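(* In the setting above, the expected number of pivot steps $\mathcal{P}(n,d,\sigma^{-1})$ of the two-phase shadow-vertex simplex method on the smoothed linear program satisfies $$ \mathcal{P}(n,d,\sigma^{-1}) \le O(\log^7 n \,(d^9 + d^3 \sigma^{-4})). $$
   Context: Consider a linear program: maximize $\langle z, x\rangle$ subject to $Ax \le b$, where $A$ is an $n\times d$ matrix with rows $a_1,\ldots,a_n$, $d>3$ and $n>d$. A smoothed linear program is one where the rows $a_i$ and $b$ are independent Gaussian random vectors with arbitrary centers $\bar a_i$ and $\bar b$, whose coordinates are independent normal random variables with standard deviations $\sigma \max_i \|(\bar a_i,\bar b_i)\|$. The algorithm is a two-phase shadow-vertex simplex method: the program is reduced (by interpolation) to unit linear programs ($b=\mathbf 1$); in phase I, $d$ randomly generated constraints (the vertices of a small randomly rotated, dilated and Gaussian-perturbed regular simplex) are added, and the procedure is repeated with fresh random constraints until the computed solution is correct; phase II uses the polar shadow-vertex pivot rule, which rotates an initial objective vector toward the actual one and walks along the facets of the convex hull of $0$ and the constraint vectors pierced by the rotating direction. The Spielman–Teng theorem (Theorem 1.1) states that the expected number of pivot steps of such a method on the smoothed program is bounded by a polynomial $\mathcal{P}(n,d,\sigma^{-1})$. *)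

theory Defs
  imports "HOL-Probability.Probability"
begin

text \<open>
  The constant in the main bound is uniform in the dimension, so the dimension cannot be a type.
  A vector of \<open>\<real>\<^sup>d\<close> is a function \<open>nat \<Rightarrow> real\<close> of which only the coordinates \<open>k < d\<close> are ever used;
  a family of constraint vectors is \<open>c :: nat \<Rightarrow> nat \<Rightarrow> real\<close> (constraint index, then coordinate);
  a matrix drawn from a product measure is a function on \<open>nat \<times> nat\<close>.
\<close>

definition dot :: "nat \<Rightarrow> (nat \<Rightarrow> real) \<Rightarrow> (nat \<Rightarrow> real) \<Rightarrow> real" where
  "dot d x y = (\<Sum>k<d. x k * y k)"

definition enorm :: "nat \<Rightarrow> (nat \<Rightarrow> real) \<Rightarrow> real" where
  "enorm d x = L2_set x {..<d}"

definition in_cone :: "nat \<Rightarrow> (nat \<Rightarrow> nat \<Rightarrow> real) \<Rightarrow> nat set \<Rightarrow> (nat \<Rightarrow> real) \<Rightarrow> bool" where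
  "in_cone d c I x \<longleftrightarrow>
     (\<exists>l. (\<forall>i\<in>I. 0 \<le> l i) \<and> (\<forall>k<d. x k = (\<Sum>i\<in>I. l i * c i k)))"

definition lin_indep :: "nat \<Rightarrow> (nat \<Rightarrow> nat \<Rightarrow> real) \<Rightarrow> nat set \<Rightarrow> bool" where
  "lin_indep d c I \<longleftrightarrow>
     (\<forall>l. (\<forall>k<d. (\<Sum>i\<in>I. l i * c i k) = 0) \<longrightarrow> (\<forall>i\<in>I. l i = 0))"


section \<open>The polar shadow-vertex walk\<close>

text \<open>
  Feasible bases of the constraints \<open>\<langle>c\<^sub>j, y\<rangle> \<le> \<beta>\<^sub>j\<close> (\<open>j \<in> S\<close>). If all \<open>\<beta>\<^sub>j = 1\<close> (a unit program), then
  \<open>y\<close> is the normal of a hyperplane \<open>\<langle>\<cdot>, y\<rangle> = 1\<close> that supports \<open>conv(0, c\<^sub>j)\<close> and contains the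
  \<open>d\<close> independent points \<open>c\<^sub>i\<close> (\<open>i \<in> I\<close>): up to degeneracies, which have probability zero below,
  \<open>I\<close> is a facet of \<open>conv(0, c\<^sub>j)\<close> that misses the origin. The direction \<open>x\<close> pierces this facet
  iff \<open>x\<close> lies in the cone over it. General \<open>\<beta>\<close> are only needed for the constraint \<open>-t \<le> 0\<close> of the
  interpolation program.
\<close>

definition feasible_basis ::
  "nat \<Rightarrow> (nat \<Rightarrow> nat \<Rightarrow> real) \<Rightarrow> (nat \<Rightarrow> real) \<Rightarrow> nat set \<Rightarrow> nat set \<Rightarrow> bool" where
  "feasible_basis d c \<beta> S I \<longleftrightarrow>
     I \<subseteq> S \<and> finite I \<and> card I = d \<and> lin_indep d c I \<and>
     (\<exists>y. (\<forall>i\<in>I. dot d (c i) y = \<beta> i) \<and> (\<forall>j\<in>S. dot d (c j) y \<le> \<beta> j))"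

text \<open>
  The objective is moved along \<open>q\<close>, whose parameter runs upwards through the interval \<open>T\<close>.
  From the facet \<open>I\<close> a pivot is made at the last parameter \<open>s\<close> at which \<open>I\<close> is pierced,
  to an adjacent facet pierced immediately after \<open>s\<close>.
\<close>

definition shadow_pivot ::
  "nat \<Rightarrow> (nat \<Rightarrow> nat \<Rightarrow> real) \<Rightarrow> (nat \<Rightarrow> real) \<Rightarrow> nat set \<Rightarrow> (real \<Rightarrow> nat \<Rightarrow> real) \<Rightarrow> real set
     \<Rightarrow> nat set \<Rightarrow> nat set \<Rightarrow> bool" where
  "shadow_pivot d c \<beta> S q T I J \<longleftrightarrow>
     feasible_basis d c \<beta> S J \<and> card (I \<inter> J) = d - 1 \<and> J \<noteq> I \<and>
     (\<exists>s\<in>T. in_cone d c I (q s) \<and> (\<forall>t\<in>T. s < t \<longrightarrow> \<not> in_cone d c I (q t)) \<and>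
        (\<exists>u\<in>T. s < u \<and> (\<forall>t. s \<le> t \<and> t \<le> u \<longrightarrow> in_cone d c J (q t))))"

text \<open>The \<open>SOME\<close> below is a unique choice outside a null set of inputs.\<close>

primrec shadow_walk ::
  "nat \<Rightarrow> (nat \<Rightarrow> nat \<Rightarrow> real) \<Rightarrow> (nat \<Rightarrow> real) \<Rightarrow> nat set \<Rightarrow> (real \<Rightarrow> nat \<Rightarrow> real) \<Rightarrow> real set
     \<Rightarrow> nat set \<Rightarrow> nat \<Rightarrow> nat set option" where
  "shadow_walk d c \<beta> S q T I\<^sub>0 0 = Some I\<^sub>0"
| "shadow_walk d c \<beta> S q T I\<^sub>0 (Suc m) =
     (case shadow_walk d c \<beta> S q T I\<^sub>0 m of
        None \<Rightarrow> None
      | Some I \<Rightarrow>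
          if \<exists>J. shadow_pivot d c \<beta> S q T I J
          then Some (SOME J. shadow_pivot d c \<beta> S q T I J) else None)"

definition walk_steps ::
  "nat \<Rightarrow> (nat \<Rightarrow> nat \<Rightarrow> real) \<Rightarrow> (nat \<Rightarrow> real) \<Rightarrow> nat set \<Rightarrow> (real \<Rightarrow> nat \<Rightarrow> real) \<Rightarrow> real set
     \<Rightarrow> nat set \<Rightarrow> ennreal" where
  "walk_steps d c \<beta> S q T I\<^sub>0 =
     (\<Sum>m. if shadow_walk d c \<beta> S q T I\<^sub>0 (Suc m) \<noteq> None then 1 else 0)"

definition walk_ends_at ::
  "nat \<Rightarrow> (nat \<Rightarrow> nat \<Rightarrow> real) \<Rightarrow> (nat \<Rightarrow> real) \<Rightarrow> nat set \<Rightarrow> (real \<Rightarrow> nat \<Rightarrow> real) \<Rightarrow> real set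
     \<Rightarrow> nat set \<Rightarrow> nat set \<Rightarrow> bool" where
  "walk_ends_at d c \<beta> S q T I\<^sub>0 J \<longleftrightarrow>
     (\<exists>m. shadow_walk d c \<beta> S q T I\<^sub>0 m = Some J \<and> shadow_walk d c \<beta> S q T I\<^sub>0 (Suc m) = None)"


section \<open>Solver for unit programs: random constraints, then the walk\<close>

definition mag :: "nat \<Rightarrow> nat \<Rightarrow> (nat \<Rightarrow> nat \<Rightarrow> real) \<Rightarrow> real" where
  "mag n d a = exp (of_int \<lceil>ln (Max ((\<lambda>i. enorm d (a i)) ` {..<n}))\<rceil>)"

definition size1 :: "real \<Rightarrow> nat \<Rightarrow> real" where
  "size1 c\<^sub>1 d = c\<^sub>1 / sqrt (ln (real d))"

definition sdev1 :: "real \<Rightarrow> nat \<Rightarrow> nat \<Rightarrow> real" where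
  "sdev1 c\<^sub>1 n d =
     min (1 / (6 * sqrt (real d * ln (real n)))) (c\<^sub>1 / (real d powr (3/2) * ln (real d)))"

definition simplex_center :: "nat \<Rightarrow> nat \<Rightarrow> real" where
  "simplex_center d k = 1 / sqrt (real d)"

text \<open>
  Vertices \<open>j < d\<close> of a regular simplex with circumradius \<open>\<rho>\<close> in the hyperplane through the unit vector
  \<open>simplex_center d\<close> orthogonal to it: the centred basis vector \<open>e\<^sub>j - 1/d\<close> has norm \<open>sqrt (1 - 1/d)\<close>.
\<close>

definition simplex_vertex :: "nat \<Rightarrow> real \<Rightarrow> nat \<Rightarrow> nat \<Rightarrow> real" where
  "simplex_vertex d \<rho> j k =
     simplex_center d k
       + \<rho> * ((if k = j then 1 else 0) - 1 / real d) / sqrt (1 - 1 / real d)"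

definition mat_app :: "nat \<Rightarrow> (nat \<times> nat \<Rightarrow> real) \<Rightarrow> (nat \<Rightarrow> real) \<Rightarrow> nat \<Rightarrow> real" where
  "mat_app d U v k = (\<Sum>l<d. U (k, l) * v l)"

text \<open>Initial objective and constraints: rotation \<open>U\<close>, dilation \<open>2M\<close>, Gaussian noise \<open>G\<close>.\<close>

definition init_objective ::
  "nat \<Rightarrow> nat \<Rightarrow> (nat \<Rightarrow> nat \<Rightarrow> real) \<Rightarrow> (nat \<times> nat \<Rightarrow> real) \<Rightarrow> nat \<Rightarrow> real" where
  "init_objective n d a U k = 2 * mag n d a * mat_app d U (simplex_center d) k"

definition new_constraint ::
  "real \<Rightarrow> nat \<Rightarrow> nat \<Rightarrow> (nat \<Rightarrow> nat \<Rightarrow> real) \<Rightarrow> (nat \<times> nat \<Rightarrow> real) \<Rightarrow> (nat \<times> nat \<Rightarrow> real)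
     \<Rightarrow> nat \<Rightarrow> nat \<Rightarrow> real" where
  "new_constraint c\<^sub>1 n d a U G j k =
     2 * mag n d a *
       (mat_app d U (simplex_vertex d (size1 c\<^sub>1 d) j) k + sdev1 c\<^sub>1 n d * G (j, k))"

definition ext_constraints ::
  "real \<Rightarrow> nat \<Rightarrow> nat \<Rightarrow> (nat \<Rightarrow> nat \<Rightarrow> real) \<Rightarrow> (nat \<times> nat \<Rightarrow> real) \<Rightarrow> (nat \<times> nat \<Rightarrow> real)
     \<Rightarrow> nat \<Rightarrow> nat \<Rightarrow> real" where
  "ext_constraints c\<^sub>1 n d a U G i = (if i < n then a i else new_constraint c\<^sub>1 n d a U G (i - n))"

text \<open>
  The new constraint vectors span a hyperplane \<open>\<langle>\<cdot>, h\<rangle> = 1\<close> at distance \<open>1 / \<parallel>h\<parallel> \<ge> M\<close> from the origin,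
  so that they form a facet of \<open>conv(0, c\<^sub>j)\<close>, and the initial objective pierces this facet.
\<close>

definition added_ok ::
  "real \<Rightarrow> nat \<Rightarrow> nat \<Rightarrow> (nat \<Rightarrow> nat \<Rightarrow> real) \<Rightarrow> (nat \<times> nat \<Rightarrow> real) \<times> (nat \<times> nat \<Rightarrow> real) \<Rightarrow> bool"
where
  "added_ok c\<^sub>1 n d a = (\<lambda>(U, G).
     let c = ext_constraints c\<^sub>1 n d a U G; I\<^sub>0 = {n..<n + d} in
       lin_indep d c I\<^sub>0 \<and> in_cone d c I\<^sub>0 (init_objective n d a U) \<and>
       (\<exists>h. (\<forall>i\<in>I\<^sub>0. dot d (c i) h = 1) \<and> mag n d a * enorm d h \<le> 1))"

definition segment_path :: "(nat \<Rightarrow> real) \<Rightarrow> (nat \<Rightarrow> real) \<Rightarrow> real \<Rightarrow> nat \<Rightarrow> real" where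
  "segment_path z\<^sub>0 z t k = (1 - t) * z\<^sub>0 k + t * z k"

definition attempt_steps ::
  "real \<Rightarrow> nat \<Rightarrow> nat \<Rightarrow> (nat \<Rightarrow> real) \<Rightarrow> (nat \<Rightarrow> nat \<Rightarrow> real)
     \<Rightarrow> (nat \<times> nat \<Rightarrow> real) \<times> (nat \<times> nat \<Rightarrow> real) \<Rightarrow> ennreal" where
  "attempt_steps c\<^sub>1 n d z a = (\<lambda>(U, G).
     if added_ok c\<^sub>1 n d a (U, G)
     then walk_steps d (ext_constraints c\<^sub>1 n d a U G) (\<lambda>_. 1) {..<n + d}
            (segment_path (init_objective n d a U) z) {0..1} {n..<n + d}
     else 0)"

definition attempt_ends_at ::
  "real \<Rightarrow> nat \<Rightarrow> nat \<Rightarrow> (nat \<Rightarrow> real) \<Rightarrow> (nat \<Rightarrow> nat \<Rightarrow> real)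
     \<Rightarrow> (nat \<times> nat \<Rightarrow> real) \<times> (nat \<times> nat \<Rightarrow> real) \<Rightarrow> nat set \<Rightarrow> bool" where
  "attempt_ends_at c\<^sub>1 n d z a = (\<lambda>(U, G) J.
     added_ok c\<^sub>1 n d a (U, G) \<and>
     walk_ends_at d (ext_constraints c\<^sub>1 n d a U G) (\<lambda>_. 1) {..<n + d}
       (segment_path (init_objective n d a U) z) {0..1} {n..<n + d} J)"

text \<open>
  If the final facet is not pierced by \<open>z\<close>, the extended unit program is unbounded, and then so is the
  original one. If it is pierced by \<open>z\<close>, it solves the original unit program when it uses none of the
  added constraints.
\<close>

definition attempt_unbounded ::
  "real \<Rightarrow> nat \<Rightarrow> nat \<Rightarrow> (nat \<Rightarrow> real) \<Rightarrow> (nat \<Rightarrow> nat \<Rightarrow> real)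
     \<Rightarrow> (nat \<times> nat \<Rightarrow> real) \<times> (nat \<times> nat \<Rightarrow> real) \<Rightarrow> bool" where
  "attempt_unbounded c\<^sub>1 n d z a \<omega> \<longleftrightarrow>
     (\<exists>J. attempt_ends_at c\<^sub>1 n d z a \<omega> J \<and>
          \<not> in_cone d (ext_constraints c\<^sub>1 n d a (fst \<omega>) (snd \<omega>)) J z)"

definition attempt_optimal ::
  "real \<Rightarrow> nat \<Rightarrow> nat \<Rightarrow> (nat \<Rightarrow> real) \<Rightarrow> (nat \<Rightarrow> nat \<Rightarrow> real)
     \<Rightarrow> (nat \<times> nat \<Rightarrow> real) \<times> (nat \<times> nat \<Rightarrow> real) \<Rightarrow> nat set \<Rightarrow> bool" where
  "attempt_optimal c\<^sub>1 n d z a \<omega> J \<longleftrightarrow>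
     attempt_ends_at c\<^sub>1 n d z a \<omega> J \<and> in_cone d a J z \<and> J \<subseteq> {..<n}"

definition attempt_correct ::
  "real \<Rightarrow> nat \<Rightarrow> nat \<Rightarrow> (nat \<Rightarrow> real) \<Rightarrow> (nat \<Rightarrow> nat \<Rightarrow> real)
     \<Rightarrow> (nat \<times> nat \<Rightarrow> real) \<times> (nat \<times> nat \<Rightarrow> real) \<Rightarrow> bool" where
  "attempt_correct c\<^sub>1 n d z a \<omega> \<longleftrightarrow>
     attempt_unbounded c\<^sub>1 n d z a \<omega> \<or> (\<exists>J. attempt_optimal c\<^sub>1 n d z a \<omega> J)"

text \<open>Attempt \<open>m\<close> uses the randomness \<open>\<omega> m\<close> and is made iff all earlier attempts were incorrect.\<close>

definition unit_steps ::
  "real \<Rightarrow> nat \<Rightarrow> nat \<Rightarrow> (nat \<Rightarrow> real) \<Rightarrow> (nat \<Rightarrow> nat \<Rightarrow> real)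
     \<Rightarrow> (nat \<Rightarrow> (nat \<times> nat \<Rightarrow> real) \<times> (nat \<times> nat \<Rightarrow> real)) \<Rightarrow> ennreal" where
  "unit_steps c\<^sub>1 n d z a \<omega> =
     (\<Sum>m. if \<forall>j<m. \<not> attempt_correct c\<^sub>1 n d z a (\<omega> j)
          then attempt_steps c\<^sub>1 n d z a (\<omega> m) else 0)"

definition unit_solution ::
  "real \<Rightarrow> nat \<Rightarrow> nat \<Rightarrow> (nat \<Rightarrow> real) \<Rightarrow> (nat \<Rightarrow> nat \<Rightarrow> real)
     \<Rightarrow> (nat \<Rightarrow> (nat \<times> nat \<Rightarrow> real) \<times> (nat \<times> nat \<Rightarrow> real)) \<Rightarrow> nat set \<Rightarrow> bool" where
  "unit_solution c\<^sub>1 n d z a \<omega> J \<longleftrightarrow>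
     (\<exists>m. (\<forall>j<m. \<not> attempt_correct c\<^sub>1 n d z a (\<omega> j)) \<and> attempt_optimal c\<^sub>1 n d z a (\<omega> m) J)"


section \<open>Interpolation between the unit program and the given one\<close>

text \<open>
  Maximize \<open>\<langle>z, x\<rangle> + \<lambda> t\<close> subject to \<open>A x \<le> t b + (1 - t) 1\<close> and \<open>0 \<le> t \<le> 1\<close>, where coordinate \<open>d\<close>
  is \<open>t\<close>. Rows \<open>i < n\<close> read \<open>\<langle>a\<^sub>i, x\<rangle> + (1 - b\<^sub>i) t \<le> 1\<close>, row \<open>n\<close> is \<open>-t \<le> 0\<close> and row \<open>n + 1\<close> is \<open>t \<le> 1\<close>.
  A solution \<open>J\<close> of the unit program gives the basis \<open>J \<union> {n}\<close> that is optimal as \<open>\<lambda> \<rightarrow> -\<infinity>\<close>; the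
  basis that is optimal as \<open>\<lambda> \<rightarrow> \<infinity>\<close> solves the given program if it contains \<open>n + 1\<close>, and otherwise shows
  that it is infeasible. If the unit program is unbounded, then the given program is unbounded or
  infeasible and no further pivots are made.
\<close>

definition int_constraints ::
  "nat \<Rightarrow> nat \<Rightarrow> (nat \<Rightarrow> nat \<Rightarrow> real) \<Rightarrow> (nat \<Rightarrow> real) \<Rightarrow> nat \<Rightarrow> nat \<Rightarrow> real" where
  "int_constraints n d a b i k =
     (if i < n then (if k < d then a i k else 1 - b i)
      else if k < d then 0 else if i = n then -1 else 1)"

definition int_rhs :: "nat \<Rightarrow> nat \<Rightarrow> real" where
  "int_rhs n i = (if i = n then 0 else 1)"

definition int_path :: "nat \<Rightarrow> (nat \<Rightarrow> real) \<Rightarrow> real \<Rightarrow> nat \<Rightarrow> real" where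
  "int_path d z t k = (if k < d then z k else t)"

definition int_steps ::
  "nat \<Rightarrow> nat \<Rightarrow> (nat \<Rightarrow> real) \<Rightarrow> (nat \<Rightarrow> nat \<Rightarrow> real) \<Rightarrow> (nat \<Rightarrow> real) \<Rightarrow> nat set \<Rightarrow> ennreal" where
  "int_steps n d z a b J =
     walk_steps (Suc d) (int_constraints n d a b) (int_rhs n) {..<n + 2}
       (int_path d z) UNIV (insert n J)"

definition simplex_steps ::
  "real \<Rightarrow> nat \<Rightarrow> nat \<Rightarrow> (nat \<Rightarrow> real) \<Rightarrow> (nat \<Rightarrow> nat \<Rightarrow> real) \<Rightarrow> (nat \<Rightarrow> real)
     \<Rightarrow> (nat \<Rightarrow> (nat \<times> nat \<Rightarrow> real) \<times> (nat \<times> nat \<Rightarrow> real)) \<Rightarrow> ennreal" where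
  "simplex_steps c\<^sub>1 n d z a b \<omega> =
     unit_steps c\<^sub>1 n d z a \<omega> +
     (if \<exists>J. unit_solution c\<^sub>1 n d z a \<omega> J
      then int_steps n d z a b (THE J. unit_solution c\<^sub>1 n d z a \<omega> J) else 0)"


section \<open>Randomness\<close>

definition std_gauss :: "nat \<Rightarrow> nat \<Rightarrow> (nat \<times> nat \<Rightarrow> real) measure" where
  "std_gauss m k =
     (\<Pi>\<^sub>M p\<in>{..<m} \<times> {..<k}. density lborel (\<lambda>x. ennreal (std_normal_density x)))"

definition orthogonal_mat :: "nat \<Rightarrow> (nat \<times> nat \<Rightarrow> real) \<Rightarrow> bool" where
  "orthogonal_mat d U \<longleftrightarrow>
     (\<forall>i<d. \<forall>j<d. (\<Sum>l<d. U (i, l) * U (j, l)) = (if i = j then 1 else 0))"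

definition mat_mult_ext ::
  "nat \<Rightarrow> (nat \<times> nat \<Rightarrow> real) \<Rightarrow> (nat \<times> nat \<Rightarrow> real) \<Rightarrow> nat \<times> nat \<Rightarrow> real" where
  "mat_mult_ext d V U = (\<lambda>(i, k)\<in>{..<d} \<times> {..<d}. \<Sum>l<d. V (i, l) * U (l, k))"

text \<open>\<open>H\<close> is the normalized Haar measure of the orthogonal group \<open>O(d)\<close>.\<close>

definition haar_orthogonal :: "nat \<Rightarrow> (nat \<times> nat \<Rightarrow> real) measure \<Rightarrow> bool" where
  "haar_orthogonal d H \<longleftrightarrow>
     prob_space H \<and> sets H = sets (\<Pi>\<^sub>M p\<in>{..<d} \<times> {..<d}. borel) \<and>
     (AE U in H. orthogonal_mat d U) \<and>
     (\<forall>V. orthogonal_mat d V \<longrightarrow> distr H H (mat_mult_ext d V) = H)"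

definition max_row_norm :: "nat \<Rightarrow> nat \<Rightarrow> (nat \<Rightarrow> nat \<Rightarrow> real) \<Rightarrow> (nat \<Rightarrow> real) \<Rightarrow> real" where
  "max_row_norm n d a b = Max ((\<lambda>i. sqrt ((enorm d (a i))\<^sup>2 + (b i)\<^sup>2)) ` {..<n})"

definition smoothed_a :: "real \<Rightarrow> (nat \<Rightarrow> nat \<Rightarrow> real) \<Rightarrow> (nat \<times> nat \<Rightarrow> real) \<Rightarrow> nat \<Rightarrow> nat \<Rightarrow> real" where
  "smoothed_a s a\<^sub>0 g i k = a\<^sub>0 i k + s * g (i, k)"

definition smoothed_b :: "nat \<Rightarrow> real \<Rightarrow> (nat \<Rightarrow> real) \<Rightarrow> (nat \<times> nat \<Rightarrow> real) \<Rightarrow> nat \<Rightarrow> real" where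
  "smoothed_b d s b\<^sub>0 g i = b\<^sub>0 i + s * g (i, d)"

text \<open>
  Column \<open>d\<close> of the \<open>n \<times> (d + 1)\<close> Gaussian matrix \<open>g\<close> perturbs the right-hand side. The
  expectation is over the program and over the independent random choices of the solver; the
  latter are a sequence of independent pairs (rotation, noise matrix).
\<close>

definition expected_pivot_steps ::
  "real \<Rightarrow> (nat \<times> nat \<Rightarrow> real) measure \<Rightarrow> nat \<Rightarrow> nat \<Rightarrow> real
     \<Rightarrow> (nat \<Rightarrow> real) \<Rightarrow> (nat \<Rightarrow> nat \<Rightarrow> real) \<Rightarrow> (nat \<Rightarrow> real) \<Rightarrow> ennreal" where
  "expected_pivot_steps c\<^sub>1 H n d \<sigma> z a\<^sub>0 b\<^sub>0 =
     (let s = \<sigma> * max_row_norm n d a\<^sub>0 b\<^sub>0 in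
      \<integral>\<^sup>+ (g, \<omega>). simplex_steps c\<^sub>1 n d z (smoothed_a s a\<^sub>0 g) (smoothed_b d s b\<^sub>0 g) \<omega>
        \<partial>(std_gauss n (Suc d) \<Otimes>\<^sub>M (\<Pi>\<^sub>M m\<in>(UNIV :: nat set). H \<Otimes>\<^sub>M std_gauss d d)))"

end

theory Submission
  imports Defs "Jordan_Normal_Form.Determinant"
begin

text \<open>
  Every pivot of a polar shadow-vertex walk in a plane \<open>W\<close> enters a new facet of \<open>conv(0, c\<^sub>j)\<close> that meets
  \<open>W\<close> in an edge of the shadow polygon, so the number of edges bounds the walk. For Gaussian \<open>c\<^sub>j\<close> it is
  bounded by comparing probabilities under maps of the configuration: dilating a facet about its centroid
  and then stretching its edge within \<open>W\<close> changes the Gaussian density by a bounded factor only, so short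
  edges are not much more likely than long ones, while the total length of the edges is bounded by the
  perimeter of the polygon.

  The interpolation program is a shadow in the plane of \<open>z\<close> and the coordinate \<open>t\<close>. An attempt on the
  unit program is treated for a fixed rotation and one value of the rounded magnitude of the rows at a
  time. An attempt is correct with probability bounded below: for given \<open>y\<close>, the small random simplex lies
  behind the hyperplane orthogonal to \<open>y\<close> with constant probability, and if \<open>y\<close> runs through a maximizing
  sequence, then the added constraints cannot be tight at the optimum. The number of attempts is
  therefore dominated by a geometric variable.
\<close>

text \<open>Stretching an edge by 2^n multiplies volume by 4^n, since the edge vector has two
  coordinates in \<open>W\<close>, while the density stays comparable as long as the vertex moves
  only a little. Summing 4^(-n) compares all edges with long ones. The dilation comes first because
  long edges are counted through projections, which need a whole interval of each edge in the
  relative interior of its facet. If \<open>M\<close> bounds the rows and \<open>K\<close> dominates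
  the squared ratio of \<open>M\<close> to the deviations, then edges of length M / K and
  barycentric margins 1 / (d^2 K) are affordable; a perimeter of order M leaves d^2 K^2 edges, and
  the choice of a dominant vertex costs another d. In phase I, K is of order \<sigma>^(-2) + d^3
  log^2 n because of the small noise of the added constraints: d^3 K^2 is the origin of both d^9 and
  d^3 \<sigma>^(-4). The obstacle of phase I is that the added constraints are scaled by the random
  magnitude of the given rows, so the extended configuration is not Gaussian. With the rounded
  magnitude frozen it is, and since the maps change it by at most one step, each program is charged
  to three levels only.\<close>

type_synonym rvec = "nat \<Rightarrow> real"
type_synonym rows = "nat \<Rightarrow> nat \<Rightarrow> real"
type_synonym cvec = "nat \<times> nat \<Rightarrow> real"

section \<open>Square linear systems\<close>

text \<open>The dimension is a variable and not a type, so determinants are taken over matrices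
  whose size is a term.\<close>

definition dt :: "nat => rows => real" where
 "dt N A = Determinant.det (mat N N (\<lambda>(i, j). A i j))"

lemma permutes_lt: "p permutes {0..<N} ==> i < N ==> p i < (N::nat)"
 using permutes_in_image[of p "{0..<N}" i] by auto

lemma dt_explicit:
 "dt N A = (\<Sum>p | p permutes {0..<N}. signof p * (\<Prod>i = 0..<N. A i (p i)))"
proof -
 have "dt N A = (\<Sum>p\<in>{p. p permutes {0..<N}}. signof p *
   (\<Prod>i = 0..<N. mat N N (\<lambda>(i, j). A i j) $$ (i, p i)))"
  unfolding dt_def by (subst det_def'[of _ N]) auto
 also have "\<dots> = (\<Sum>p | p permutes {0..<N}. signof p * (\<Prod>i = 0..<N. A i (p i)))"
  by (intro sum.cong refl arg_cong2[where f=times] prod.cong)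
   (auto simp: permutes_lt)
 finally show ?thesis .
qed

lemma dt_cong:
 assumes "\<And>i j. i < N ==> j < N ==> A i j = B i j"
 shows "dt N A = dt N B"
 unfolding dt_def using assms by (auto intro!: arg_cong[where f=Determinant.det])

lemma mat_mult_vec_fun:
 assumes "r < N"
 shows "(mat N N (\<lambda>(i, j). A i j) *\<^sub>v vec N x) $ r = (\<Sum>q<N. A r q * (x q :: real))"
 using assms by (simp add: scalar_prod_def atLeast0LessThan row_def)

lemma dt_eq_0_iff:
 "dt N A = 0 \<longleftrightarrow> (\<exists>x. (\<exists>q<N. x q \<noteq> 0) \<and> (\<forall>r<N. (\<Sum>q<N. A r q * x q) = 0))"
proof -
 let ?A = "mat N N (\<lambda>(i, j). A i j)"
 have "dt N A = 0 \<longleftrightarrow> (\<exists>v. v \<in> carrier_vec N \<and> v \<noteq> 0\<^sub>v N \<and> ?A *\<^sub>v v = 0\<^sub>v N)"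
  unfolding dt_def by (rule det_0_iff_vec_prod_zero) auto
 also have "\<dots> \<longleftrightarrow> (\<exists>x. (\<exists>q<N. x q \<noteq> 0) \<and> (\<forall>r<N. (\<Sum>q<N. A r q * x q) = 0))"
 proof safe
  fix v :: "real Matrix.vec" assume v: "v \<in> carrier_vec N" "v \<noteq> 0\<^sub>v N" "?A *\<^sub>v v = 0\<^sub>v N"
  have vv: "v = vec N (\<lambda>i. v $ i)" using v(1) by auto
  have "\<exists>q<N. v $ q \<noteq> 0" using v(1,2) by (metis carrier_vecD eq_vecI index_zero_vec(1,2))
  moreover have "(\<Sum>q<N. A r q * v $ q) = 0" if "r < N" for r
   using mat_mult_vec_fun[OF that, of A "\<lambda>i. v $ i"] vv v(3) that by auto
  ultimately show "\<exists>x. (\<exists>q<N. x q \<noteq> 0) \<and> (\<forall>r<N. (\<Sum>q<N. A r q * x q) = 0)" by blast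
 next
  fix x :: rvec and q assume x: "q < N" "x q \<noteq> 0" "\<forall>r<N. (\<Sum>q<N. A r q * x q) = 0"
  show "\<exists>v. v \<in> carrier_vec N \<and> v \<noteq> 0\<^sub>v N \<and> ?A *\<^sub>v v = 0\<^sub>v N"
  proof (intro exI conjI)
   show "vec N x \<noteq> 0\<^sub>v N" using x by (metis index_vec index_zero_vec(1))
   show "?A *\<^sub>v vec N x = 0\<^sub>v N"
    using x(3) mat_mult_vec_fun by (intro eq_vecI) auto
  qed auto
 qed
 finally show ?thesis .
qed

text \<open>Cramer's rule. The explicit quotient is measurable in the entries of the system and
  stays defined, with a meaningless value, where the determinant vanishes.\<close>

definition slv :: "nat => rows => rvec => nat => real" where
 "slv N A b q = dt N (\<lambda>i j. if j = q then b i else A i j) / dt N A"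

lemma slv_unique:
 assumes "dt N A \<noteq> 0" "\<And>r. r < N ==> (\<Sum>q<N. A r q * x q) = b r" "q < N"
 shows "x q = slv N A b q"
proof -
 let ?A = "mat N N (\<lambda>(i, j). A i j)"
 have "Determinant.det (replace_col ?A (?A *\<^sub>v vec N x) q) = vec N x $ q * Determinant.det ?A"
  by (rule cramer_lemma_mat) (use assms in auto)
 moreover have "replace_col ?A (?A *\<^sub>v vec N x) q = mat N N (\<lambda>(i, j). if j = q then b i else A i j)"
  unfolding replace_col_def using mat_mult_vec_fun assms(2) by (intro eq_matI) auto
 ultimately show ?thesis using assms(1,3) by (simp add: slv_def dt_def)
qed

lemma ex_solution:
 assumes "dt N A \<noteq> 0"
 shows "\<exists>x. \<forall>r<N. (\<Sum>q<N. A r q * x q) = b r"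
proof -
 let ?A = "mat N N (\<lambda>(i, j). A i j)"
 have "?A \<in> Units (ring_mat TYPE(real) N ())"
  by (rule det_non_zero_imp_unit) (use assms in \<open>auto simp: dt_def\<close>)
 then obtain B where B: "B \<in> carrier_mat N N" "?A * B = 1\<^sub>m N"
  unfolding Units_def by (auto simp: ring_mat_def)
 have AB: "?A *\<^sub>v (B *\<^sub>v vec N b) = vec N b"
  using B by (subst assoc_mult_mat_vec[symmetric, of _ N N _ N]) auto
 have vv: "B *\<^sub>v vec N b = vec N (\<lambda>i. (B *\<^sub>v vec N b) $ i)"
  using B by auto
 show ?thesis
 proof (intro exI allI impI)
  fix r assume "r < N"
  then show "(\<Sum>q<N. A r q * (B *\<^sub>v vec N b) $ q) = b r"
   using mat_mult_vec_fun[of r N A "\<lambda>i. (B *\<^sub>v vec N b) $ i"] vv AB by auto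
 qed
qed

lemma slv_solves:
 assumes "dt N A \<noteq> 0" "r < N"
 shows "(\<Sum>q<N. A r q * slv N A b q) = b r"
proof -
 obtain x where x: "\<forall>r<N. (\<Sum>q<N. A r q * x q) = b r" using ex_solution[OF assms(1)] by blast
 then have "\<And>q. q < N ==> x q = slv N A b q" using slv_unique[OF assms(1)] by blast
 then show ?thesis using x assms(2) by auto
qed

lemma measurable_dt [measurable (raw)]:
 assumes "\<And>i j. i < N ==> j < N ==> (\<lambda>\<omega>. A \<omega> i j) \<in> borel_measurable M"
 shows "(\<lambda>\<omega>. dt N (A \<omega>)) \<in> borel_measurable M"
proof -
 have "(\<lambda>\<omega>. A \<omega> i (p i)) \<in> borel_measurable M" if "p permutes {0..<N}" "i \<in> {0..<N}" for p i
  using assms that permutes_lt[OF that(1)] by auto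
 then show ?thesis
  unfolding dt_explicit by (intro borel_measurable_sum borel_measurable_times borel_measurable_prod) auto
qed

lemma measurable_slv:
 assumes "\<And>i j. i < N ==> j < N ==> (\<lambda>\<omega>. A \<omega> i j) \<in> borel_measurable M"
  and "\<And>i. i < N ==> (\<lambda>\<omega>. b \<omega> i) \<in> borel_measurable M"
 shows "(\<lambda>\<omega>. slv N (A \<omega>) (b \<omega>) q) \<in> borel_measurable M"
proof -
 have "(\<lambda>\<omega>. if j = q then b \<omega> i else A \<omega> i j) \<in> borel_measurable M" if "i < N" "j < N" for i j
  using assms that by auto
 then show ?thesis unfolding slv_def using assms by (intro borel_measurable_divide measurable_dt) auto
qed

text \<open>Every term of the Leibniz formula contains exactly one factor from row
  \<open>i0\<close>, so it is affine in the single entry at \<open>(i0, j0)\<close>.\<close>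

lemma dt_entry_affine:
 assumes "i0 < N" "\<And>i j. (i, j) \<noteq> (i0, j0) ==> A i j = B i j" "\<And>i j. (i, j) \<noteq> (i0, j0) ==> C i j = B i j"
  and "A i0 j0 = (1 - t) * B i0 j0 + t * C i0 j0"
 shows "dt N A = (1 - t) * dt N B + t * dt N C"
proof -
 have "(\<Prod>i = 0..<N. A i (p i)) = (1 - t) * (\<Prod>i = 0..<N. B i (p i)) + t * (\<Prod>i = 0..<N. C i (p i))" for p
 proof -
  have *: "(\<Prod>i = 0..<N. X i (p i)) = X i0 (p i0) * (\<Prod>i\<in>{0..<N} - {i0}. X i (p i))" for X :: rows
   using assms(1) by (intro prod.remove) auto
  have 1: "(\<Prod>i\<in>{0..<N} - {i0}. A i (p i)) = (\<Prod>i\<in>{0..<N} - {i0}. B i (p i))"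
   using assms(2) by (intro prod.cong) auto
  have 2: "(\<Prod>i\<in>{0..<N} - {i0}. C i (p i)) = (\<Prod>i\<in>{0..<N} - {i0}. B i (p i))"
   using assms(3) by (intro prod.cong) auto
  have 3: "A i0 (p i0) = (1 - t) * B i0 (p i0) + t * C i0 (p i0)"
   using assms by (cases "p i0 = j0") (auto simp: algebra_simps)
  show ?thesis unfolding *[of A] *[of B] *[of C] 1 2 3 by (simp add: algebra_simps)
 qed
 then show ?thesis
  unfolding dt_explicit
  by (simp only: distrib_left sum.distrib sum_distrib_left mult.left_commute)
qed

section \<open>Zero sets of multiaffine functions\<close>

definition multiaffine :: "'a set => (('a => real) => real) => bool" where
 "multiaffine P f \<longleftrightarrow>
   (\<forall>p\<in>P. \<forall>x t. f (x(p := t)) = (1 - t) * f (x(p := 0)) + t * f (x(p := 1)))"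

lemma product_sigma_finite_lborel: "product_sigma_finite (\<lambda>_::'a. lborel :: real measure)"
 by standard

text \<open>Induction on the coordinates. Along coordinate \<open>p\<close> the function is affine,
  and a nonzero value at \<open>a\<close> forces a nonzero value at \<open>p := 0\<close> or at
  \<open>p := 1\<close>; by the induction hypothesis almost every line in direction \<open>p\<close>
  then carries at most one zero.\<close>

lemma AE_multiaffine_nonzero:
 assumes "finite P" "multiaffine P f" "\<And>x y. (\<And>p. p \<in> P ==> x p = y p) ==> f x = f y"
  and "f \<in> borel_measurable (Pi\<^sub>M P (\<lambda>_. lborel))" "f a \<noteq> 0"
 shows "AE x in Pi\<^sub>M P (\<lambda>_. lborel). f x \<noteq> 0"
 using assms
proof (induction P arbitrary: f a rule: finite_induct)
 case empty
 then have "f x \<noteq> 0" for x by (metis empty_iff)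
 then show ?case by simp
next
 case (insert p P)
 interpret product_sigma_finite "\<lambda>_::'a. lborel :: real measure" by (rule product_sigma_finite_lborel)
 have meas: "(\<lambda>x. f (x(p := u))) \<in> borel_measurable (Pi\<^sub>M P (\<lambda>_. lborel))" for u
 proof -
  have "(\<lambda>x. x(p := u)) \<in> Pi\<^sub>M P (\<lambda>_. lborel) \<rightarrow>\<^sub>M Pi\<^sub>M (insert p P) (\<lambda>_. lborel :: real measure)"
   using insert.hyps by (intro measurable_fun_upd[where J=P]) auto
  then show ?thesis using insert.prems(3) by (rule measurable_compose)
 qed
 have IH: "AE x in Pi\<^sub>M P (\<lambda>_. lborel). f (x(p := u)) \<noteq> 0" if "f (a(p := u)) \<noteq> 0" for u
 proof (rule insert.IH[where a = a])
  show "multiaffine P (\<lambda>x. f (x(p := u)))"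
   unfolding multiaffine_def
  proof (intro ballI allI)
   fix q x t assume "q \<in> P"
   then have "q \<noteq> p" using insert.hyps(2) by auto
   then show "f ((x(q := t))(p := u)) = (1 - t) * f ((x(q := 0))(p := u)) + t * f ((x(q := 1))(p := u))"
    using insert.prems(1)[unfolded multiaffine_def, rule_format, of q "x(p := u)" t] \<open>q \<in> P\<close>
    by (simp only: fun_upd_twist[OF \<open>q \<noteq> p\<close>] insertI2)
  qed
  show "f (x(p := u)) = f (y(p := u))" if "\<And>p. p \<in> P ==> x p = y p" for x y
   by (rule insert.prems(2)) (use that in auto)
  show "(\<lambda>x. f (x(p := u))) \<in> borel_measurable (Pi\<^sub>M P (\<lambda>_. lborel))" by (rule meas)
  show "f (a(p := u)) \<noteq> 0" by (rule that)
 qed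
 have aff: "f (x(p := t)) = (1 - t) * f (x(p := 0)) + t * f (x(p := 1))" for x t
  using insert.prems(1) unfolding multiaffine_def by blast
 have "f a = (1 - a p) * f (a(p := 0)) + a p * f (a(p := 1))"
  using aff[of a "a p"] by simp
 with insert.prems(4) have "f (a(p := 0)) \<noteq> 0 \<or> f (a(p := 1)) \<noteq> 0" by auto
 then have AE: "AE x in Pi\<^sub>M P (\<lambda>_. lborel). f (x(p := 0)) \<noteq> 0 \<or> f (x(p := 1)) \<noteq> 0"
 proof
  assume "f (a(p := 0)) \<noteq> 0"
  from IH[OF this] show ?thesis by eventually_elim blast
 next
  assume "f (a(p := 1)) \<noteq> 0"
  from IH[OF this] show ?thesis by eventually_elim blast
 qed
 let ?Z = "{x \<in> space (Pi\<^sub>M (insert p P) (\<lambda>_. lborel)). f x = 0}"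
 have Z: "?Z \<in> sets (Pi\<^sub>M (insert p P) (\<lambda>_. lborel))" using insert.prems(3) by measurable
 have "emeasure (Pi\<^sub>M (insert p P) (\<lambda>_. lborel)) ?Z
   = (\<integral>\<^sup>+x. indicator ?Z x \<partial>Pi\<^sub>M (insert p P) (\<lambda>_. lborel))" using Z by simp
 also have "\<dots> = (\<integral>\<^sup>+x. \<integral>\<^sup>+t. indicator ?Z (x(p := t)) \<partial>lborel \<partial>Pi\<^sub>M P (\<lambda>_. lborel))"
  by (rule product_nn_integral_insert) (use insert.hyps Z in auto)
 also have "\<dots> = (\<integral>\<^sup>+x. 0 \<partial>Pi\<^sub>M P (\<lambda>_. lborel :: real measure))"
 proof (rule nn_integral_cong_AE, use AE in eventually_elim)
  case (elim x)
  let ?u = "f (x(p := 0))" and ?v = "f (x(p := 1))"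
  have "f (x(p := t)) = ?u + t * (?v - ?u)" for t by (subst aff) (simp add: algebra_simps)
  \<comment> \<open>An affine function of \<open>t\<close> that is nonzero at 0 or at 1 vanishes at
    most at this point. If the slope is 0, there is no zero at all and the value of the quotient is
    irrelevant.\<close>
  then have sub: "{t. f (x(p := t)) = 0} \<subseteq> {- ?u / (?v - ?u)}"
  proof (intro subsetI)
   fix t assume "t \<in> {t. f (x(p := t)) = 0}"
   then have "f (x(p := t)) = 0" by simp
   then have eq: "t * (?v - ?u) = - ?u" using \<open>\<And>t. f (x(p := t)) = ?u + t * (?v - ?u)\<close>[of t] by linarith
   have "?v - ?u \<noteq> 0" using elim eq by auto
   then have "t = - ?u / (?v - ?u)" using eq by (metis nonzero_eq_divide_eq)
   then show "t \<in> {- ?u / (?v - ?u)}" by simp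
  qed
  have "AE t in lborel. f (x(p := t)) \<noteq> 0"
   using AE_lborel_singleton[of "- ?u / (?v - ?u)"] by eventually_elim (use sub in blast)
  then have "AE t in lborel. indicator ?Z (x(p := t)) = (0 :: ennreal)"
   by eventually_elim (auto simp: indicator_def)
  then show ?case using nn_integral_cong_AE[of "\<lambda>t. indicator ?Z (x(p := t))" "\<lambda>_. 0" lborel] by simp
 qed
 finally have "emeasure (Pi\<^sub>M (insert p P) (\<lambda>_. lborel)) ?Z = 0" by simp
 then show ?case by (intro AE_I[OF _ _ Z]) auto
qed

section \<open>Measure distortion of one-parameter flows\<close>

abbreviation leb :: "'a set => ('a => real) measure" where
 "leb P \<equiv> Pi\<^sub>M P (\<lambda>_. lborel)"

lemma sigma_finite_leb: "finite P ==> sigma_finite_measure (leb P)"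
 by (rule product_sigma_finite.sigma_finite[OF product_sigma_finite_lborel])

lemma distr_leb_translate:
 assumes [simp]: "finite P"
 shows "distr (leb P) (leb P) (\<lambda>x. \<lambda>p\<in>P. x p + w p) = leb P"
proof (rule product_sigma_finite.PiM_eqI[OF product_sigma_finite_lborel])
 interpret finite_product_sigma_finite "\<lambda>_::'a. lborel :: real measure" P
  by standard auto
 have T[measurable]: "(\<lambda>x. \<lambda>p\<in>P. x p + w p) \<in> leb P \<rightarrow>\<^sub>M leb P"
  by (intro measurable_restrict) auto
 fix A :: "'a => real set" assume A: "\<And>i. i \<in> P ==> A i \<in> sets lborel"
 let ?B = "\<lambda>p. (\<lambda>t. w p + t) -` A p"
 have B: "?B p \<in> sets lborel" if "p \<in> P" for p
  using measurable_sets[of "\<lambda>t. w p + t" lborel lborel "A p"] A[OF that] by simp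
 have pre: "(\<lambda>x. \<lambda>p\<in>P. x p + w p) -` Pi\<^sub>E P A \<inter> space (leb P) = Pi\<^sub>E P ?B"
  by (auto simp: space_PiM PiE_iff add.commute)
 have "emeasure (distr (leb P) (leb P) (\<lambda>x. \<lambda>p\<in>P. x p + w p)) (Pi\<^sub>E P A) = emeasure (leb P) (Pi\<^sub>E P ?B)"
  using A by (subst emeasure_distr[OF T]) (auto simp: pre)
 also have "\<dots> = (\<Prod>p\<in>P. emeasure lborel (?B p))" using B by (rule measure_times)
 also have "\<dots> = (\<Prod>p\<in>P. emeasure lborel (A p))"
 proof (rule prod.cong[OF refl])
  fix p assume p: "p \<in> P"
  have "emeasure lborel (A p) = emeasure (distr lborel borel ((+) (w p))) (A p)"
   by (simp add: lborel_distr_plus)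
  also have "\<dots> = emeasure lborel (?B p)" using A[OF p] by (subst emeasure_distr) auto
  finally show "emeasure lborel (?B p) = emeasure lborel (A p)" by simp
 qed
 finally show "emeasure (distr (leb P) (leb P) (\<lambda>x. \<lambda>p\<in>P. x p + w p)) (Pi\<^sub>E P A)
   = (\<Prod>p\<in>P. emeasure lborel (A p))" .
qed auto

lemma nn_integral_leb_translate:
 assumes "finite P" "F \<in> borel_measurable (leb P)"
 shows "(\<integral>\<^sup>+x. F (\<lambda>p\<in>P. x p + w p) \<partial>leb P) = (\<integral>\<^sup>+x. F x \<partial>leb P)"
proof -
 have T: "(\<lambda>x. \<lambda>p\<in>P. x p + w p) \<in> leb P \<rightarrow>\<^sub>M leb P"
  by (intro measurable_restrict) auto
 have "(\<integral>\<^sup>+x. F x \<partial>leb P) = (\<integral>\<^sup>+x. F x \<partial>distr (leb P) (leb P) (\<lambda>x. \<lambda>p\<in>P. x p + w p))"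
  by (simp add: distr_leb_translate[OF assms(1)])
 also have "\<dots> = (\<integral>\<^sup>+x. F (\<lambda>p\<in>P. x p + w p) \<partial>leb P)"
  by (rule nn_integral_distr[OF T]) (simp add: assms(2))
 finally show ?thesis ..
qed

text \<open>If \<open>s\<close> is a coordinate along \<open>w\<close>, that is, translation by
  \<open>r * w\<close> increases \<open>s\<close> by \<open>r\<close>, then this map dilates every
  line in direction \<open>w\<close> by the factor \<open>1 + t\<close>. All maps of configurations
  below are composed of such steps.\<close>

definition flow :: "'a set => real => (('a => real) => real) => ('a => real) => ('a => real) => 'a => real" where
 "flow P t s w x = (\<lambda>p\<in>P. x p + t * s x * w p)"

lemma measurable_flow:
 assumes [measurable]: "s \<in> borel_measurable (leb P)"
 shows "flow P t s w \<in> leb P \<rightarrow>\<^sub>M leb P"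
 unfolding flow_def[abs_def] by (intro measurable_restrict) measurable

text \<open>Averages over the lines in direction \<open>w\<close>, weighted by a unit window of \<open>s\<close>.\<close>

lemma nn_integral_leb_disintegrate:
 assumes fin: "finite P" and s[measurable]: "s \<in> borel_measurable (leb P)"
  and F[measurable]: "F \<in> borel_measurable (leb P)"
  and eq: "\<And>x r. x \<in> space (leb P) ==> s (\<lambda>p\<in>P. x p + r * w p) = s x + r"
 shows "(\<integral>\<^sup>+x. F x \<partial>leb P) =
  (\<integral>\<^sup>+x. indicator {0..1} (s x) * (\<integral>\<^sup>+r. F (\<lambda>p\<in>P. x p + r * w p) \<partial>lborel) \<partial>leb P)"
proof -
 interpret L: sigma_finite_measure "leb P" by (rule sigma_finite_leb[OF fin])
 interpret pair_sigma_finite "leb P" "lborel :: real measure" ..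
 have M[measurable]: "(\<lambda>(x, r). \<lambda>p\<in>P. x p + r * w p) \<in> leb P \<Otimes>\<^sub>M lborel \<rightarrow>\<^sub>M leb P"
  unfolding case_prod_unfold by (intro measurable_restrict) measurable
 have M2[measurable]: "(\<lambda>x. \<lambda>p\<in>P. x p + r * w p) \<in> leb P \<rightarrow>\<^sub>M leb P" for r
  by (intro measurable_restrict) measurable
 \<comment> \<open>The window at offset \<open>r\<close> has integral 1 over all \<open>r\<close>,
   so it may be inserted freely. Exchanging the integrals and translating by \<open>r * w\<close>
   then moves \<open>r\<close> from the window into \<open>F\<close>.\<close>
 have one: "(\<integral>\<^sup>+r. indicator {0..1} (a - r) \<partial>lborel) = (1::ennreal)" for a :: real
 proof -
  have "(\<integral>\<^sup>+r. indicator {0..1} (a - r) \<partial>lborel) = (\<integral>\<^sup>+r. indicator {a - 1..a} r \<partial>lborel)"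
   by (intro nn_integral_cong) (auto simp: indicator_def)
  then show ?thesis by simp
 qed
 have "(\<integral>\<^sup>+x. F x \<partial>leb P) = (\<integral>\<^sup>+x. \<integral>\<^sup>+r. F x * indicator {0..1} (s x - r) \<partial>lborel \<partial>leb P)"
  by (intro nn_integral_cong) (simp add: nn_integral_cmult one)
 also have "\<dots> = (\<integral>\<^sup>+r. \<integral>\<^sup>+x. F x * indicator {0..1} (s x - r) \<partial>leb P \<partial>lborel)"
  by (rule Fubini'[symmetric]) measurable
 also have "\<dots> = (\<integral>\<^sup>+r. \<integral>\<^sup>+x. F (\<lambda>p\<in>P. x p + r * w p) * indicator {0..1} (s x) \<partial>leb P \<partial>lborel)"
 proof (rule nn_integral_cong)
  fix r :: real
  have "(\<integral>\<^sup>+x. F x * indicator {0..1} (s x - r) \<partial>leb P)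
   = (\<integral>\<^sup>+x. F (\<lambda>p\<in>P. x p + r * w p) * indicator {0..1} (s (\<lambda>p\<in>P. x p + r * w p) - r) \<partial>leb P)"
   by (rule nn_integral_leb_translate[OF fin, symmetric]) measurable
  also have "\<dots> = (\<integral>\<^sup>+x. F (\<lambda>p\<in>P. x p + r * w p) * indicator {0..1} (s x) \<partial>leb P)"
   by (intro nn_integral_cong) (simp add: eq)
  finally show "(\<integral>\<^sup>+x. F x * indicator {0..1} (s x - r) \<partial>leb P)
   = (\<integral>\<^sup>+x. F (\<lambda>p\<in>P. x p + r * w p) * indicator {0..1} (s x) \<partial>leb P)" .
 qed
 also have "\<dots> = (\<integral>\<^sup>+x. \<integral>\<^sup>+r. F (\<lambda>p\<in>P. x p + r * w p) * indicator {0..1} (s x) \<partial>lborel \<partial>leb P)"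
  by (rule Fubini') measurable
 also have "\<dots> = (\<integral>\<^sup>+x. indicator {0..1} (s x) * (\<integral>\<^sup>+r. F (\<lambda>p\<in>P. x p + r * w p) \<partial>lborel) \<partial>leb P)"
 proof (rule nn_integral_cong)
  fix x assume x: "x \<in> space (leb P)"
  have "(\<lambda>r. (x, r)) \<in> lborel \<rightarrow>\<^sub>M leb P \<Otimes>\<^sub>M lborel" using x by measurable
  from measurable_compose[OF this M]
  have [measurable]: "(\<lambda>r. \<lambda>p\<in>P. x p + r * w p) \<in> lborel \<rightarrow>\<^sub>M leb P" by simp
  have m: "(\<lambda>r. F (\<lambda>p\<in>P. x p + r * w p)) \<in> borel_measurable lborel"
   by (rule measurable_compose[OF _ F]) fact
  show "(\<integral>\<^sup>+r. F (\<lambda>p\<in>P. x p + r * w p) * indicator {0..1} (s x) \<partial>lborel)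
   = indicator {0..1} (s x) * (\<integral>\<^sup>+r. F (\<lambda>p\<in>P. x p + r * w p) \<partial>lborel)"
   using nn_integral_multc[OF m, of "indicator {0..1} (s x)"] by (simp add: mult.commute)
 qed
 finally show ?thesis .
qed

text \<open>The change-of-variables formula with constant Jacobian \<open>J\<close> is taken as the
  definition: \<open>T\<close> multiplies volume by \<open>J\<close>. In this form it composes
  without any argument on smoothness or injectivity.\<close>

definition jac :: "'a set => (('a => real) => 'a => real) => real => bool" where
 "jac P T J \<longleftrightarrow> T \<in> leb P \<rightarrow>\<^sub>M leb P \<and> 0 \<le> J \<and>
   (\<forall>F\<in>borel_measurable (leb P). (\<integral>\<^sup>+x. F x \<partial>leb P) = ennreal J * (\<integral>\<^sup>+x. F (T x) \<partial>leb P))"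

lemma jac_comp:
 assumes "jac P T J" "jac P T' J'"
 shows "jac P (\<lambda>x. T' (T x)) (J' * J)"
 unfolding jac_def
proof (intro conjI ballI)
 have TT: "T \<in> leb P \<rightarrow>\<^sub>M leb P" "T' \<in> leb P \<rightarrow>\<^sub>M leb P" using assms unfolding jac_def by blast+
 show "(\<lambda>x. T' (T x)) \<in> leb P \<rightarrow>\<^sub>M leb P" using TT by (rule measurable_compose)
 show "0 \<le> J' * J" using assms unfolding jac_def by auto
 fix F :: "('a => real) => ennreal" assume F: "F \<in> borel_measurable (leb P)"
 have "(\<lambda>x. F (T' x)) \<in> borel_measurable (leb P)"
  using TT(2) F by (rule measurable_compose)
 then have "(\<integral>\<^sup>+x. F (T' x) \<partial>leb P) = ennreal J * (\<integral>\<^sup>+x. F (T' (T x)) \<partial>leb P)"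
  using assms(1) unfolding jac_def by blast
 moreover have "(\<integral>\<^sup>+x. F x \<partial>leb P) = ennreal J' * (\<integral>\<^sup>+x. F (T' x) \<partial>leb P)"
  using assms(2) F unfolding jac_def by blast
 moreover have "0 \<le> J" "0 \<le> J'" using assms unfolding jac_def by blast+
 ultimately show "(\<integral>\<^sup>+x. F x \<partial>leb P) = ennreal (J' * J) * (\<integral>\<^sup>+x. F (T' (T x)) \<partial>leb P)"
  by (simp add: ennreal_mult mult.assoc)
qed

lemma jac_cong:
 assumes "jac P T J" "\<And>x. x \<in> space (leb P) ==> T' x = T x"
 shows "jac P T' J"
proof -
 have "(\<integral>\<^sup>+x. F (T' x) \<partial>leb P) = (\<integral>\<^sup>+x. F (T x) \<partial>leb P)" for F :: "('a => real) => ennreal"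
  by (intro nn_integral_cong) (simp add: assms(2))
 then show ?thesis
  using assms measurable_cong[of "leb P" T' T "leb P"] unfolding jac_def by auto
qed

lemma jac_id: "jac P (\<lambda>x. x) 1"
 unfolding jac_def by auto

text \<open>On a line with coordinate \<open>r\<close> the map is the affine substitution
  \<open>t * s x + (1 + t) * r\<close>; the disintegration over lines reduces the claim to the
  one-dimensional rule.\<close>

lemma jac_flow:
 assumes fin: "finite P" and s[measurable]: "s \<in> borel_measurable (leb P)"
  and eq: "\<And>x r. x \<in> space (leb P) ==> s (\<lambda>p\<in>P. x p + r * w p) = s x + r"
  and t: "0 < 1 + t"
 shows "jac P (flow P t s w) (1 + t)"
 unfolding jac_def
proof (intro conjI ballI)
 show M: "flow P t s w \<in> leb P \<rightarrow>\<^sub>M leb P" by (rule measurable_flow[OF s])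
 show "0 \<le> 1 + t" using t by simp
 fix F :: "('a => real) => ennreal" assume F[measurable]: "F \<in> borel_measurable (leb P)"
 have [measurable]: "(\<lambda>x. F (flow P t s w x)) \<in> borel_measurable (leb P)"
  using M F by (rule measurable_compose)
 have M3: "(\<lambda>(x, r). \<lambda>p\<in>P. x p + r * w p) \<in> leb P \<Otimes>\<^sub>M lborel \<rightarrow>\<^sub>M leb P"
  unfolding case_prod_unfold by (intro measurable_restrict) measurable
 have inner: "(\<integral>\<^sup>+r. F (\<lambda>p\<in>P. x p + r * w p) \<partial>lborel)
   = ennreal (1 + t) * (\<integral>\<^sup>+r. F (flow P t s w (\<lambda>p\<in>P. x p + r * w p)) \<partial>lborel)"
  if x: "x \<in> space (leb P)" for x
 proof -
  have "(\<lambda>r. (x, r)) \<in> lborel \<rightarrow>\<^sub>M leb P \<Otimes>\<^sub>M lborel" using x by measurable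
  from measurable_compose[OF this M3]
  have "(\<lambda>r. \<lambda>p\<in>P. x p + r * w p) \<in> lborel \<rightarrow>\<^sub>M leb P" by simp
  from measurable_compose[OF this F]
  have G: "(\<lambda>r. F (\<lambda>p\<in>P. x p + r * w p)) \<in> borel_measurable borel" by simp
  have "(\<integral>\<^sup>+r. F (\<lambda>p\<in>P. x p + r * w p) \<partial>lborel)
    = ennreal \<bar>1 + t\<bar> * (\<integral>\<^sup>+r. F (\<lambda>p\<in>P. x p + (t * s x + (1 + t) * r) * w p) \<partial>lborel)"
   by (rule nn_integral_real_affine[OF G]) (use t in auto)
  also have "(\<integral>\<^sup>+r. F (\<lambda>p\<in>P. x p + (t * s x + (1 + t) * r) * w p) \<partial>lborel) =
   (\<integral>\<^sup>+r. F (flow P t s w (\<lambda>p\<in>P. x p + r * w p)) \<partial>lborel)"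
  proof (intro nn_integral_cong arg_cong[where f = F] ext)
   fix r p
   show "(\<lambda>p\<in>P. x p + (t * s x + (1 + t) * r) * w p) p = flow P t s w (\<lambda>p\<in>P. x p + r * w p) p"
    unfolding flow_def eq[OF x] by (simp add: algebra_simps restrict_def)
  qed
  finally show ?thesis using t by (simp only: abs_of_pos)
 qed
 let ?G = "\<lambda>x. indicator {0..1} (s x) * (\<integral>\<^sup>+r. F (flow P t s w (\<lambda>p\<in>P. x p + r * w p)) \<partial>lborel)"
 have Gm: "?G \<in> borel_measurable (leb P)"
 proof -
  have "(\<lambda>z. F (flow P t s w ((\<lambda>(x, r). \<lambda>p\<in>P. x p + r * w p) z))) \<in> borel_measurable (leb P \<Otimes>\<^sub>M lborel)"
   using M3 \<open>(\<lambda>x. F (flow P t s w x)) \<in> borel_measurable (leb P)\<close> by (rule measurable_compose)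
  then have "(\<lambda>x. \<integral>\<^sup>+r. F (flow P t s w (\<lambda>p\<in>P. x p + r * w p)) \<partial>lborel) \<in> borel_measurable (leb P)"
   by (intro lborel.borel_measurable_nn_integral) (simp add: case_prod_unfold)
  then show ?thesis by measurable
 qed
 have "(\<integral>\<^sup>+x. F x \<partial>leb P) = (\<integral>\<^sup>+x. indicator {0..1} (s x) * (\<integral>\<^sup>+r. F (\<lambda>p\<in>P. x p + r * w p) \<partial>lborel) \<partial>leb P)"
  by (rule nn_integral_leb_disintegrate[OF fin s F eq])
 also have "\<dots> = (\<integral>\<^sup>+x. ennreal (1 + t) * ?G x \<partial>leb P)"
  by (intro nn_integral_cong) (simp add: inner mult_ac)
 also have "\<dots> = ennreal (1 + t) * (\<integral>\<^sup>+x. ?G x \<partial>leb P)" by (rule nn_integral_cmult[OF Gm])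
 also have "(\<integral>\<^sup>+x. ?G x \<partial>leb P) = (\<integral>\<^sup>+x. F (flow P t s w x) \<partial>leb P)"
  by (rule nn_integral_leb_disintegrate[OF fin s _ eq, symmetric]) measurable
 finally show "(\<integral>\<^sup>+x. F x \<partial>leb P) = ennreal (1 + t) * (\<integral>\<^sup>+x. F (flow P t s w x) \<partial>leb P)" .
qed

section \<open>Gaussian product measures\<close>

abbreviation std_normal :: "real measure" where
 "std_normal \<equiv> density lborel (\<lambda>x. ennreal (std_normal_density x))"

abbreviation gauss :: "'a set => ('a => real) measure" where
 "gauss P \<equiv> Pi\<^sub>M P (\<lambda>_. std_normal)"

lemma prob_space_std_normal: "prob_space std_normal"
 by (rule prob_space_normal_density) simp

lemma prob_space_gauss: "prob_space (gauss P)"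
 by (intro prob_space_PiM prob_space_std_normal)

lemma sets_gauss_leb: "sets (gauss P) = sets (leb P)"
 by (intro sets_PiM_cong) auto

lemma gauss_eq_density:
 assumes fin: "finite P"
 shows "gauss P = density (leb P) (\<lambda>x. ennreal ((1 / sqrt (2 * pi)) ^ card P * exp (- (\<Sum>p\<in>P. (x p)\<^sup>2) / 2)))"
  (is "_ = density _ ?f")
proof -
 interpret S: product_sigma_finite "\<lambda>_::'a. std_normal"
  by (intro product_sigma_finite.intro prob_space_imp_sigma_finite prob_space_std_normal)
 interpret L: product_sigma_finite "\<lambda>_::'a. lborel :: real measure" by (rule product_sigma_finite_lborel)
 have f: "?f x = (\<Prod>p\<in>P. ennreal (std_normal_density (x p)))" for x
 proof -
  have "(\<Prod>p\<in>P. ennreal (std_normal_density (x p))) = ennreal (\<Prod>p\<in>P. std_normal_density (x p))"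
   by (rule prod_ennreal) simp
  also have "(\<Prod>p\<in>P. std_normal_density (x p)) = (1 / sqrt (2 * pi)) ^ card P * exp (- (\<Sum>p\<in>P. (x p)\<^sup>2) / 2)"
   unfolding std_normal_density_def prod.distrib by (simp add: exp_sum[OF fin, symmetric] sum_negf sum_divide_distrib)
  finally show ?thesis by simp
 qed
 have "density (leb P) ?f = gauss P"
 proof (rule S.PiM_eqI[OF fin])
  show "sets (density (leb P) ?f) = sets (gauss P)" by (simp add: sets_gauss_leb)
  fix A :: "'a => real set" assume A: "\<And>i. i \<in> P ==> A i \<in> sets std_normal"
  have A': "Pi\<^sub>E P A \<in> sets (leb P)" using A fin by (intro sets_PiM_I_finite) auto
  have "emeasure (density (leb P) ?f) (Pi\<^sub>E P A) = (\<integral>\<^sup>+x. ?f x * indicator (Pi\<^sub>E P A) x \<partial>leb P)"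
   by (rule emeasure_density[OF _ A']) measurable
  also have "\<dots> = (\<integral>\<^sup>+x. (\<Prod>p\<in>P. ennreal (std_normal_density (x p)) * indicator (A p) (x p)) \<partial>leb P)"
  proof (intro nn_integral_cong)
   fix x assume "x \<in> space (leb P)"
   then have "indicator (Pi\<^sub>E P A) x = (\<Prod>p\<in>P. indicator (A p) (x p) :: ennreal)"
    using fin by (auto simp: indicator_def space_PiM PiE_iff prod_zero_iff)
   then show "?f x * indicator (Pi\<^sub>E P A) x = (\<Prod>p\<in>P. ennreal (std_normal_density (x p)) * indicator (A p) (x p))"
    unfolding f by (simp add: prod.distrib)
  qed
  also have "\<dots> = (\<Prod>p\<in>P. \<integral>\<^sup>+t. ennreal (std_normal_density t) * indicator (A p) t \<partial>lborel)"
   by (rule L.product_nn_integral_prod[OF fin]) (use A in auto)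
  also have "\<dots> = (\<Prod>p\<in>P. emeasure std_normal (A p))"
   using A by (intro prod.cong refl) (simp add: emeasure_density)
  finally show "emeasure (density (leb P) ?f) (Pi\<^sub>E P A) = (\<Prod>p\<in>P. emeasure std_normal (A p))" .
 qed
 then show ?thesis by simp
qed

lemma AE_gauss_if_AE_leb:
 assumes "finite P" "AE x in leb P. Q x"
 shows "AE x in gauss P. Q x"
 unfolding gauss_eq_density[OF assms(1)] by (subst AE_density) (use assms(2) in auto)

text \<open>\<open>T\<close> carries \<open>A\<close> into \<open>B\<close>, multiplies volume by
  \<open>J\<close> and lowers the Gaussian density by at most the factor
  \<open>exp \<kappa>\<close>, so \<open>B\<close> has at least \<open>J * exp (- \<kappa>)\<close>
  times the mass of \<open>A\<close>. A large \<open>J\<close> therefore makes \<open>A\<close>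
  unlikely.\<close>

lemma gauss_emeasure_jac_le:
 assumes fin: "finite P" and T: "jac P T J"
  and A: "A \<in> sets (gauss P)" and B: "B \<in> sets (gauss P)"
  and AB: "\<And>x. x \<in> A ==> T x \<in> B"
  and le: "\<And>x. x \<in> A ==> (\<Sum>p\<in>P. (T x p)\<^sup>2) \<le> (\<Sum>p\<in>P. (x p)\<^sup>2) + 2 * \<kappa>"
 shows "ennreal J * emeasure (gauss P) A \<le> ennreal (exp \<kappa>) * emeasure (gauss P) B"
proof -
 let ?f = "\<lambda>x. ennreal ((1 / sqrt (2 * pi)) ^ card P * exp (- (\<Sum>p\<in>P. (x p)\<^sup>2) / 2))"
 have [measurable]: "A \<in> sets (leb P)" "B \<in> sets (leb P)" using A B by (auto simp: sets_gauss_leb)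
 have Tm[measurable]: "T \<in> leb P \<rightarrow>\<^sub>M leb P" using T unfolding jac_def by simp
 have fm[measurable]: "?f \<in> borel_measurable (leb P)" by measurable
 have bm: "(\<lambda>x. ?f x * indicator B x) \<in> borel_measurable (leb P)" by measurable
 have pt: "?f x * indicator A x \<le> ennreal (exp \<kappa>) * (?f (T x) * indicator B (T x))" for x
 proof (cases "x \<in> A")
  case True
  have "exp (- (\<Sum>p\<in>P. (x p)\<^sup>2) / 2) \<le> exp \<kappa> * exp (- (\<Sum>p\<in>P. (T x p)\<^sup>2) / 2)"
   using le[OF True] by (simp add: exp_add[symmetric])
  then have "(1 / sqrt (2 * pi)) ^ card P * exp (- (\<Sum>p\<in>P. (x p)\<^sup>2) / 2)
   \<le> exp \<kappa> * ((1 / sqrt (2 * pi)) ^ card P * exp (- (\<Sum>p\<in>P. (T x p)\<^sup>2) / 2))"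
   using mult_left_mono[of _ _ "(1 / sqrt (2 * pi)) ^ card P"] by (simp add: mult_ac)
  then show ?thesis using True AB[OF True] by (simp add: ennreal_mult[symmetric] ennreal_leI)
 qed simp
 have "emeasure (gauss P) A = (\<integral>\<^sup>+x. ?f x * indicator A x \<partial>leb P)"
  unfolding gauss_eq_density[OF fin] by (rule emeasure_density) measurable
 also have "\<dots> \<le> (\<integral>\<^sup>+x. ennreal (exp \<kappa>) * (?f (T x) * indicator B (T x)) \<partial>leb P)"
  by (intro nn_integral_mono pt)
 also have "\<dots> = ennreal (exp \<kappa>) * (\<integral>\<^sup>+x. ?f (T x) * indicator B (T x) \<partial>leb P)"
  by (rule nn_integral_cmult) (rule measurable_compose[OF Tm bm])
 finally have "ennreal J * emeasure (gauss P) A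
   \<le> ennreal J * (ennreal (exp \<kappa>) * (\<integral>\<^sup>+x. ?f (T x) * indicator B (T x) \<partial>leb P))"
  by (rule mult_left_mono) simp
 also have "\<dots> = ennreal (exp \<kappa>) * (ennreal J * (\<integral>\<^sup>+x. ?f (T x) * indicator B (T x) \<partial>leb P))"
  by (simp add: mult_ac)
 also have "ennreal J * (\<integral>\<^sup>+x. ?f (T x) * indicator B (T x) \<partial>leb P) = (\<integral>\<^sup>+x. ?f x * indicator B x \<partial>leb P)"
  using T bm unfolding jac_def by simp
 also have "\<dots> = emeasure (gauss P) B"
  unfolding gauss_eq_density[OF fin] by (rule emeasure_density[symmetric]) measurable
 finally show ?thesis .
qed

section \<open>Lengths of shadow-vertex walks\<close>

text \<open>A pivot enters \<open>J\<close> only if the path stays in the cone of \<open>J\<close>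
  for an interval of parameters; a single parameter would also admit bases that the path merely
  touches.\<close>

definition pierced_bases ::
 "nat => rows => rvec => nat set => (real => nat => real) => real set => nat set set" where
 "pierced_bases d c \<beta> S q T =
   {J. feasible_basis d c \<beta> S J \<and> (\<exists>s u. s < u \<and> s \<in> T \<and> u \<in> T \<and> (\<forall>t. s \<le> t \<and> t \<le> u \<longrightarrow> in_cone d c J (q t)))}"

lemma finite_pierced_bases: "finite S ==> finite (pierced_bases d c \<beta> S q T)"
 by (rule finite_subset[of _ "Pow S"]) (auto simp: pierced_bases_def feasible_basis_def)

lemma shadow_pivot_pierced: "shadow_pivot d c \<beta> S q T I J ==> J \<in> pierced_bases d c \<beta> S q T"
 unfolding shadow_pivot_def pierced_bases_def by blast

lemma shadow_walk_SucE:
 assumes "shadow_walk d c \<beta> S q T I0 (Suc m) = Some J"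
 obtains I where "shadow_walk d c \<beta> S q T I0 m = Some I" "shadow_pivot d c \<beta> S q T I J"
 using assms by (auto split: option.splits if_splits intro: someI)

text \<open>The last parameter at which the current basis is pierced strictly increases, so no basis recurs.\<close>

lemma shadow_walk_separated:
 assumes "shadow_walk d c \<beta> S q T I0 m = Some J" "0 < m"
 shows "\<exists>u\<in>T. in_cone d c J (q u) \<and>
  (\<forall>i<m. \<forall>I. shadow_walk d c \<beta> S q T I0 i = Some I \<longrightarrow> (\<forall>t\<in>T. u \<le> t \<longrightarrow> \<not> in_cone d c I (q t)))"
 using assms
proof (induction m arbitrary: J)
 case (Suc m)
 from Suc.prems(1) obtain I where I: "shadow_walk d c \<beta> S q T I0 m = Some I"
  and piv: "shadow_pivot d c \<beta> S q T I J" by (rule shadow_walk_SucE)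
 from piv obtain s u where su: "s \<in> T" "\<forall>t\<in>T. s < t \<longrightarrow> \<not> in_cone d c I (q t)"
  "u \<in> T" "s < u" "in_cone d c J (q u)"
  unfolding shadow_pivot_def by force
 show ?case
 proof (cases "m = 0")
  case True
  then show ?thesis using su I by (intro bexI[of _ u]) auto
 next
  case False
  then obtain v where v: "v \<in> T" "in_cone d c I (q v)"
   "\<And>i I t. i < m ==> shadow_walk d c \<beta> S q T I0 i = Some I ==> t \<in> T ==> v \<le> t ==> \<not> in_cone d c I (q t)"
   using Suc.IH[OF I] by blast
  \<comment> \<open>\<open>I\<close> is pierced at \<open>v\<close>, and \<open>s\<close> is the
    last parameter at which it is pierced.\<close>
  have "v \<le> s" using su v by (meson not_le)
  show ?thesis
  proof (intro bexI[of _ u] conjI allI impI ballI)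
   fix i I' t assume h: "i < Suc m" "shadow_walk d c \<beta> S q T I0 i = Some I'" "t \<in> T" "u \<le> t"
   show "\<not> in_cone d c I' (q t)"
   proof (cases "i = m")
    case True
    then show ?thesis using h I su by auto
   next
    case False
    then show ?thesis using h v(3)[of i I' t] \<open>v \<le> s\<close> su by auto
   qed
  qed (use su in auto)
 qed
qed simp

lemma shadow_walk_distinct:
 assumes "shadow_walk d c \<beta> S q T I0 m = Some J" "shadow_walk d c \<beta> S q T I0 i = Some J'" "i < m"
 shows "J' \<noteq> J"
 using shadow_walk_separated[OF assms(1)] assms(2,3) by force

lemma shadow_walk_in_pierced:
 assumes "shadow_walk d c \<beta> S q T I0 (Suc m) = Some J"
 shows "J \<in> pierced_bases d c \<beta> S q T"
 using assms by (elim shadow_walk_SucE shadow_pivot_pierced)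

lemma shadow_walk_inj:
 "inj_on (\<lambda>m. the (shadow_walk d c \<beta> S q T I0 (Suc m))) {m. shadow_walk d c \<beta> S q T I0 (Suc m) \<noteq> None}"
proof (rule linorder_inj_onI)
 fix i m assume "i < m" "i \<in> {m. shadow_walk d c \<beta> S q T I0 (Suc m) \<noteq> None}"
  "m \<in> {m. shadow_walk d c \<beta> S q T I0 (Suc m) \<noteq> None}"
 then show "the (shadow_walk d c \<beta> S q T I0 (Suc i)) \<noteq> the (shadow_walk d c \<beta> S q T I0 (Suc m))"
  using shadow_walk_distinct[of d c \<beta> S q T I0 "Suc m" _ "Suc i"] by (auto simp del: shadow_walk.simps)
qed auto

text \<open>Each step enters a basis that no other step enters. \<open>Suc m\<close> skips the start
  basis, which need not be pierced along an interval.\<close>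

lemma walk_steps_le_card:
 assumes "finite S"
 shows "walk_steps d c \<beta> S q T I0 \<le> of_nat (card (pierced_bases d c \<beta> S q T))"
proof -
 let ?W = "\<lambda>m. shadow_walk d c \<beta> S q T I0 (Suc m)"
 have "(\<Sum>m<K. if ?W m \<noteq> None then 1 else 0) \<le> (of_nat (card (pierced_bases d c \<beta> S q T)) :: ennreal)" for K
 proof -
  have "(\<Sum>m<K. if ?W m \<noteq> None then 1 else 0) = (of_nat (card {m. m < K \<and> ?W m \<noteq> None}) :: ennreal)"
   by (subst sum.If_cases) (auto simp del: shadow_walk.simps simp: Int_def)
  also have "card {m. m < K \<and> ?W m \<noteq> None} \<le> card (pierced_bases d c \<beta> S q T)"
  proof (rule card_inj_on_le[where f = "\<lambda>m. the (?W m)"])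
   show "inj_on (\<lambda>m. the (?W m)) {m. m < K \<and> ?W m \<noteq> None}"
    using shadow_walk_inj by (rule inj_on_subset) auto
   show "(\<lambda>m. the (?W m)) ` {m. m < K \<and> ?W m \<noteq> None} \<subseteq> pierced_bases d c \<beta> S q T"
    using shadow_walk_in_pierced by (fastforce simp del: shadow_walk.simps)
  qed (rule finite_pierced_bases[OF assms])
  finally show ?thesis by (simp del: shadow_walk.simps)
 qed
 then show ?thesis
  unfolding walk_steps_def suminf_eq_SUP by (intro SUP_least) auto
qed

lemma walk_terminates:
 assumes "finite S"
 obtains J where "walk_ends_at d c \<beta> S q T I0 J" "J = I0 \<or> J \<in> pierced_bases d c \<beta> S q T"
proof -
 let ?W = "\<lambda>m. shadow_walk d c \<beta> S q T I0 m"
 have "\<exists>m. ?W m = None"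
 proof (rule ccontr)
  assume *: "\<not> ?thesis"
  then have inj: "inj (\<lambda>m. the (?W (Suc m)))" using shadow_walk_inj[of d c \<beta> S q T I0] by (simp del: shadow_walk.simps)
  have "range (\<lambda>m. the (?W (Suc m))) \<subseteq> pierced_bases d c \<beta> S q T"
   using * shadow_walk_in_pierced by (fastforce simp del: shadow_walk.simps)
  then have "finite (range (\<lambda>m. the (?W (Suc m))))"
   using finite_pierced_bases[OF assms] by (rule finite_subset)
  then show False using inj by (simp add: finite_image_iff)
 qed
 then obtain m where m: "?W m = None" "\<And>i. i < m ==> ?W i \<noteq> None"
  using exists_least_iff[of "\<lambda>m. ?W m = None"] by blast
 then obtain k where k: "m = Suc k" by (cases m) auto
 then obtain J where J: "?W k = Some J" using m(2)[of k] by auto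
 have "J = I0 \<or> J \<in> pierced_bases d c \<beta> S q T"
  using J shadow_walk_in_pierced by (cases k) (auto simp del: shadow_walk.simps(2))
 moreover have "walk_ends_at d c \<beta> S q T I0 J" unfolding walk_ends_at_def using J m(1) k by blast
 ultimately show thesis by (rule that[rotated])
qed

text \<open>Serves the degenerate programs at the end, where no pivot leads away from the added
  facet.\<close>

lemma walk_ends_at_start:
 assumes "\<And>J. \<not> shadow_pivot d c \<beta> S q T I0 J"
 shows "walk_steps d c \<beta> S q T I0 = 0" "walk_ends_at d c \<beta> S q T I0 J \<longleftrightarrow> J = I0"
proof -
 have *: "shadow_walk d c \<beta> S q T I0 (Suc m) = None" for m
  using assms by (induction m) auto
 then show "walk_steps d c \<beta> S q T I0 = 0" unfolding walk_steps_def by simp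
 show "walk_ends_at d c \<beta> S q T I0 J \<longleftrightarrow> J = I0"
 proof
  assume "walk_ends_at d c \<beta> S q T I0 J"
  then obtain m where "shadow_walk d c \<beta> S q T I0 m = Some J" unfolding walk_ends_at_def by blast
  then show "J = I0" using * by (cases m) (auto simp del: shadow_walk.simps(2))
 next
  assume "J = I0"
  then show "walk_ends_at d c \<beta> S q T I0 J"
   unfolding walk_ends_at_def using *[of 0] by (intro exI[of _ 0]) auto
 qed
qed

section \<open>Edges of the shadow on a plane\<close>

text \<open>Index sets become columns of a matrix in increasing order; \<open>pos\<close> is the
  inverse numbering.\<close>

definition en :: "nat set => nat => nat" where
 "en I q = sorted_list_of_set I ! q"

definition pos :: "nat set => nat => nat" where
 "pos I = the_inv_into {..<card I} (en I)"

lemma bij_en: "finite I ==> bij_betw (en I) {..<card I} I"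
 unfolding en_def[abs_def] using bij_betw_nth[of "sorted_list_of_set I" "{..<card I}" I] by auto

lemma en_in: "finite I ==> q < card I ==> en I q \<in> I"
 using bij_en bij_betwE by blast

lemma pos_lt: "finite I ==> j \<in> I ==> pos I j < card I"
 unfolding pos_def using bij_betw_the_inv_into[OF bij_en] bij_betwE by blast

lemma en_pos: "finite I ==> j \<in> I ==> en I (pos I j) = j"
 unfolding pos_def using bij_en f_the_inv_into_f_bij_betw by metis

lemma pos_en: "finite I ==> q < card I ==> pos I (en I q) = q"
 unfolding pos_def using bij_en[of I] by (simp add: bij_betw_def the_inv_into_f_f)

lemma sum_en: "finite I ==> (\<Sum>j\<in>I. f j) = (\<Sum>q<card I. f (en I q))"
 using sum.reindex_bij_betw[OF bij_en] by metis

definition comb :: "rows => nat set => rvec => nat => real" where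
 "comb c I v l = (\<Sum>j\<in>I. v j * c j l)"

definition inW :: "nat => rvec => rvec => rvec => bool" where
 "inW d w1 w2 u \<longleftrightarrow> (\<exists>s1 s2. \<forall>l<d. u l = s1 * w1 l + s2 * w2 l)"

definition orthonormal2 :: "nat => rvec => rvec => bool" where
 "orthonormal2 d w1 w2 \<longleftrightarrow> dot d w1 w1 = 1 \<and> dot d w2 w2 = 1 \<and> dot d w1 w2 = 0"

text \<open>Transversality: the face without \<open>k\<close> has a direction space of dimension
  \<open>d - 2\<close> that is complementary to the plane. The facet then cuts the plane in a line
  whose barycentric direction has a nonzero coefficient at \<open>k\<close>.\<close>

definition regk :: "nat => rvec => rvec => rows => nat set => nat => bool" where
 "regk d w1 w2 c I k \<longleftrightarrow>
   (\<forall>v. (\<Sum>j\<in>I - {k}. v j) = 0 \<and> inW d w1 w2 (comb c (I - {k}) v) \<longrightarrow> (\<forall>j\<in>I - {k}. v j = 0))"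

text \<open>The barycentric direction of that line, normalized to coefficient 1 at \<open>k\<close>;
  \<open>comb c I v\<close> is the edge vector that is measured and stretched below.\<close>

definition kerv :: "nat => rvec => rvec => rows => nat set => nat => rvec => bool" where
 "kerv d w1 w2 c I k v \<longleftrightarrow> v k = 1 \<and> (\<Sum>j\<in>I. v j) = 0 \<and> inW d w1 w2 (comb c I v)"

definition supp :: "nat => rows => nat set => nat set => bool" where
 "supp d c S I \<longleftrightarrow> lin_indep d c I \<and> (\<exists>y. (\<forall>i\<in>I. dot d (c i) y = 1) \<and> (\<forall>j\<in>S. dot d (c j) y \<le> 1))"

text \<open>
 The facet \<open>I\<close> meets the plane \<open>W\<close> spanned by \<open>w1, w2\<close> in a segment whose barycentric direction \<open>v\<close> is
 largest at the vertex \<open>k\<close>, and that contains a point with all barycentric coordinates at least \<open>\<eta>\<close>.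
\<close>

definition edge ::
 "nat => rvec => rvec => rows => nat set => real => nat set => nat => bool" where
 "edge d w1 w2 c S \<eta> I k \<longleftrightarrow> supp d c S I \<and> regk d w1 w2 c I k \<and>
   (\<exists>v. kerv d w1 w2 c I k v \<and> (\<forall>j\<in>I. \<bar>v j\<bar> \<le> 1)) \<and>
   (\<exists>\<mu>. (\<forall>j\<in>I. \<eta> \<le> \<mu> j) \<and> (\<Sum>j\<in>I. \<mu> j) = 1 \<and> inW d w1 w2 (comb c I \<mu>))"

lemma dot_commute: "dot d x y = dot d y x"
 unfolding dot_def by (simp add: mult.commute)

lemma dot_add: "dot d (\<lambda>l. x l + y l) z = dot d x z + dot d y z"
 unfolding dot_def by (simp add: algebra_simps sum.distrib)

lemma dot_scale: "dot d (\<lambda>l. r * x l) z = r * dot d x z"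
 unfolding dot_def by (simp add: sum_distrib_left algebra_simps)

lemma dot_comb: "finite I ==> dot d (comb c I v) y = (\<Sum>j\<in>I. v j * dot d (c j) y)"
 unfolding dot_def comb_def sum_distrib_right sum_distrib_left
 by (subst sum.swap) (simp add: algebra_simps)

lemma dot_cong: "(\<And>l. l < d ==> x l = x' l) ==> (\<And>l. l < d ==> y l = y' l) ==> dot d x y = dot d x' y'"
 unfolding dot_def by (intro sum.cong) auto

lemma inW_lincomb:
 assumes "inW d w1 w2 u" "inW d w1 w2 u'" "\<And>l. l < d ==> x l = a * u l + b * u' l"
 shows "inW d w1 w2 x"
proof -
 obtain s1 s2 s1' s2' where "\<forall>l<d. u l = s1 * w1 l + s2 * w2 l" "\<forall>l<d. u' l = s1' * w1 l + s2' * w2 l"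
  using assms(1,2) unfolding inW_def by blast
 then have "\<forall>l<d. x l = (a * s1 + b * s1') * w1 l + (a * s2 + b * s2') * w2 l"
  using assms(3) by (simp add: algebra_simps)
 then show ?thesis unfolding inW_def by blast
qed

lemma inW_dot:
 assumes "orthonormal2 d w1 w2" "inW d w1 w2 u" "l < d"
 shows "u l = dot d w1 u * w1 l + dot d w2 u * w2 l"
proof -
 obtain s1 s2 where s: "\<forall>l<d. u l = s1 * w1 l + s2 * w2 l" using assms(2) unfolding inW_def by blast
 have "dot d w1 u = dot d (\<lambda>l. s1 * w1 l + s2 * w2 l) w1"
  using s by (subst dot_commute) (auto intro: dot_cong)
 also have "\<dots> = s1" using assms(1) by (simp add: dot_add dot_scale orthonormal2_def dot_commute[of d w2 w1])
 finally have 1: "dot d w1 u = s1" .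
 have "dot d w2 u = dot d (\<lambda>l. s1 * w1 l + s2 * w2 l) w2"
  using s by (subst dot_commute) (auto intro: dot_cong)
 also have "\<dots> = s2" using assms(1) by (simp add: dot_add dot_scale orthonormal2_def)
 finally show ?thesis using 1 s assms(3) by simp
qed

text \<open>The columns are the \<open>d - 1\<close> vertices other than \<open>k\<close> and the
  two vectors of the plane; the last row sums barycentric coefficients. Row \<open>k\<close> of
  \<open>c\<close> appears only on right-hand sides, so moving vertex \<open>k\<close> leaves the
  matrix alone.\<close>

definition Bm :: "nat => rvec => rvec => rows => nat set => nat => nat => nat => real" where
 "Bm d w1 w2 c I k r q =
   (if r < d then (if q < d - 1 then c (en (I - {k}) q) r else if q = d - 1 then w1 r else w2 r)
   else if q < d - 1 then 1 else 0)"

locale basis_index =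
 fixes d :: nat and I :: "nat set" and k :: nat
 assumes finI: "finite I" and cardI: "card I = d" and kI: "k \<in> I"
begin

lemma d_pos: "0 < d"
 using finI cardI kI card_gt_0_iff by blast

lemma card_Ik: "card (I - {k}) = d - 1"
 using finI cardI kI by simp

lemma sum_Ik: "(\<Sum>j\<in>I - {k}. f j) = (\<Sum>q<d - 1. f (en (I - {k}) q))" for f :: rvec
 using sum_en[of "I - {k}" f] finI card_Ik by simp

lemma sum_I: "(\<Sum>j\<in>I. f j) = f k + (\<Sum>j\<in>I - {k}. f j)" for f :: rvec
 using sum.remove[OF finI kI] by simp

lemma Bm_row:
 assumes "r < d" "\<And>q. q < d - 1 ==> x q = v (en (I - {k}) q)"
 shows "(\<Sum>q<d + 1. Bm d w1 w2 c I k r q * x q) = comb c (I - {k}) v r + x (d - 1) * w1 r + x d * w2 r"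
proof -
 obtain e where e: "d = Suc e" using d_pos gr0_implies_Suc by blast
 have "(\<Sum>q<d + 1. Bm d w1 w2 c I k r q * x q) = (\<Sum>q<e. c (en (I - {k}) q) r * x q) + w1 r * x e + w2 r * x (Suc e)"
  using assms(1) by (simp add: e Bm_def)
 also have "(\<Sum>q<e. c (en (I - {k}) q) r * x q) = comb c (I - {k}) v r"
  unfolding comb_def sum_Ik using assms(2) by (intro sum.cong) (auto simp: e)
 finally show ?thesis by (simp add: e)
qed

lemma Bm_last:
 assumes "\<And>q. q < d - 1 ==> x q = v (en (I - {k}) q)"
 shows "(\<Sum>q<d + 1. Bm d w1 w2 c I k d q * x q) = (\<Sum>j\<in>I - {k}. v j)"
proof -
 obtain e where e: "d = Suc e" using d_pos gr0_implies_Suc by blast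
 show ?thesis unfolding sum_Ik using assms by (simp add: e Bm_def)
qed

text \<open>A violation of \<open>regk\<close> is the same as a kernel vector of \<open>Bm\<close>;
  independence of \<open>w1\<close> and \<open>w2\<close> excludes kernel vectors supported on the
  last two columns.\<close>

lemma regk_iff_dt:
 assumes on: "orthonormal2 d w1 w2"
 shows "regk d w1 w2 c I k \<longleftrightarrow> dt (d + 1) (Bm d w1 w2 c I k) \<noteq> 0"
proof
 assume reg: "regk d w1 w2 c I k"
 show "dt (d + 1) (Bm d w1 w2 c I k) \<noteq> 0"
 proof
  assume "dt (d + 1) (Bm d w1 w2 c I k) = 0"
  then obtain x q0 where q: "q0 < d + 1" "x q0 \<noteq> 0"
   and x: "\<forall>r<d + 1. (\<Sum>q<d + 1. Bm d w1 w2 c I k r q * x q) = 0"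
   unfolding dt_eq_0_iff by blast
  define v where "v j = x (pos (I - {k}) j)" for j
  have v: "x q = v (en (I - {k}) q)" if "q < d - 1" for q
   using that card_Ik finI by (simp add: v_def pos_en)
  have s0: "(\<Sum>j\<in>I - {k}. v j) = 0" using x Bm_last[of x v w1 w2 c, OF v] by (simp del: sum.lessThan_Suc)
  have rw: "comb c (I - {k}) v r + x (d - 1) * w1 r + x d * w2 r = 0" if "r < d" for r
   using x Bm_row[of r x v w1 w2 c, OF that v] that by (simp del: sum.lessThan_Suc)
  have "inW d w1 w2 (comb c (I - {k}) v)"
   unfolding inW_def by (intro exI[of _ "- x (d - 1)"] exI[of _ "- x d"]) (use rw in \<open>auto simp: eq_neg_iff_add_eq_0 algebra_simps\<close>)
  then have v0: "\<forall>j\<in>I - {k}. v j = 0" using reg s0 unfolding regk_def by blast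
  then have c0: "comb c (I - {k}) v r = 0" for r unfolding comb_def by simp
  have W0: "\<forall>l<d. (0::real) = x (d - 1) * w1 l + x d * w2 l" using rw c0 by auto
  have "dot d (\<lambda>l. x (d - 1) * w1 l + x d * w2 l) u = 0" for u
   unfolding dot_def using W0 by (intro sum.neutral) auto
  then have "x (d - 1) = 0" "x d = 0" using on
   by (auto simp: dot_add dot_scale orthonormal2_def dot_commute[of d w2 w1])
    (metis (full_types) add.commute add_0 dot_commute mult.right_neutral mult_zero_right)+
  moreover have "x q = 0" if "q < d - 1" for q
   using v[OF that] v0 en_in[of "I - {k}" q] finI card_Ik that by simp
  moreover have "q0 < d - 1 \<or> q0 = d - 1 \<or> q0 = d" using q(1) by linarith
  ultimately show False using q(2) by auto
 qed
next
 assume dt: "dt (d + 1) (Bm d w1 w2 c I k) \<noteq> 0"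
 show "regk d w1 w2 c I k"
  unfolding regk_def
 proof (intro allI impI ballI)
  fix v j assume h: "(\<Sum>j\<in>I - {k}. v j) = 0 \<and> inW d w1 w2 (comb c (I - {k}) v)" and j: "j \<in> I - {k}"
  then obtain s1 s2 where s: "\<forall>l<d. comb c (I - {k}) v l = s1 * w1 l + s2 * w2 l" unfolding inW_def by blast
  define x where "x q = (if q < d - 1 then v (en (I - {k}) q) else if q = d - 1 then - s1 else - s2)" for q
  have v: "x q = v (en (I - {k}) q)" if "q < d - 1" for q using that by (simp add: x_def)
  have "(\<Sum>q<d + 1. Bm d w1 w2 c I k r q * x q) = 0" if "r < d + 1" for r
  proof (cases "r = d")
   case True
   then show ?thesis using Bm_last[of x v w1 w2 c, OF v] h by (simp del: sum.lessThan_Suc)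
  next
   case False
   moreover have "x (d - 1) = - s1" "x d = - s2" using d_pos by (auto simp: x_def)
   ultimately show ?thesis using Bm_row[of r x v w1 w2 c, OF _ v] s that by (simp del: sum.lessThan_Suc)
  qed
  then have "\<forall>q<d + 1. x q = 0" using dt unfolding dt_eq_0_iff by blast
  moreover have "pos (I - {k}) j < d - 1" using pos_lt[of "I - {k}" j] finI card_Ik j by simp
  ultimately have "x (pos (I - {k}) j) = 0" by simp
  then show "v j = 0" using \<open>pos (I - {k}) j < d - 1\<close> v en_pos[of "I - {k}" j] finI j by simp
 qed
qed

definition rhs_k :: "rows => nat => real" where
 "rhs_k c r = (if r < d then c k r else 1)"

definition rhs_0 :: rvec where
 "rhs_0 r = (if r < d then 0 else 1)"

text \<open>Writing \<open>c k\<close> as an affine combination of the other vertices plus a vector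
  of the plane is a linear system for \<open>- v\<close> and the two plane coordinates of the edge
  vector. This gives measurable formulas for all of them.\<close>

lemma solve_k:
 assumes on: "orthonormal2 d w1 w2" and reg: "regk d w1 w2 c I k" and v: "kerv d w1 w2 c I k v"
 shows "\<And>j. j \<in> I - {k} ==> v j = - slv (d + 1) (Bm d w1 w2 c I k) (rhs_k c) (pos (I - {k}) j)"
  and "dot d w1 (comb c I v) = slv (d + 1) (Bm d w1 w2 c I k) (rhs_k c) (d - 1)"
  and "dot d w2 (comb c I v) = slv (d + 1) (Bm d w1 w2 c I k) (rhs_k c) d"
proof -
 have dt: "dt (d + 1) (Bm d w1 w2 c I k) \<noteq> 0" using regk_iff_dt[OF on] reg by blast
 define x where "x q = (if q < d - 1 then - v (en (I - {k}) q) else if q = d - 1 then dot d w1 (comb c I v) else dot d w2 (comb c I v))" for q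
 have vx: "x q = - v (en (I - {k}) q)" if "q < d - 1" for q using that by (simp add: x_def)
 have W: "inW d w1 w2 (comb c I v)" using v unfolding kerv_def by blast
 have cI: "comb c I v r = c k r + comb c (I - {k}) v r" for r
  unfolding comb_def using v by (simp add: sum_I kerv_def)
 have neg: "comb c (I - {k}) (\<lambda>j. - v j) r = - comb c (I - {k}) v r" for r
  unfolding comb_def by (simp add: sum_negf)
 have sys: "(\<Sum>q<d + 1. Bm d w1 w2 c I k r q * x q) = rhs_k c r" if "r < d + 1" for r
 proof (cases "r < d")
  case True
  moreover have "x (d - 1) = dot d w1 (comb c I v)" "x d = dot d w2 (comb c I v)" using d_pos by (auto simp: x_def)
  ultimately show ?thesis
   using Bm_row[of r x "\<lambda>j. - v j" w1 w2 c, OF _ vx] inW_dot[OF on W True] cI[of r] neg[of r]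
   by (simp add: rhs_k_def del: sum.lessThan_Suc)
 next
  case False
  then have "r = d" using that by simp
  moreover have "(\<Sum>j\<in>I - {k}. - v j) = 1"
   using v sum_I[of v] unfolding kerv_def by (simp add: sum_negf)
  ultimately show ?thesis using Bm_last[of x "\<lambda>j. - v j" w1 w2 c, OF vx] by (simp add: rhs_k_def del: sum.lessThan_Suc)
 qed
 have x: "x q = slv (d + 1) (Bm d w1 w2 c I k) (rhs_k c) q" if "q < d + 1" for q
  by (rule slv_unique[OF dt sys that])
 show "v j = - slv (d + 1) (Bm d w1 w2 c I k) (rhs_k c) (pos (I - {k}) j)" if "j \<in> I - {k}" for j
 proof -
  have "pos (I - {k}) j < d - 1" using pos_lt[of "I - {k}" j] finI card_Ik that by simp
  then have "x (pos (I - {k}) j) = slv (d + 1) (Bm d w1 w2 c I k) (rhs_k c) (pos (I - {k}) j)"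
   "x (pos (I - {k}) j) = - v (en (I - {k}) (pos (I - {k}) j))"
   by (intro x vx; linarith)+
  then show ?thesis using en_pos[of "I - {k}" j] finI that by simp
 qed
 show "dot d w1 (comb c I v) = slv (d + 1) (Bm d w1 w2 c I k) (rhs_k c) (d - 1)"
  using x[of "d - 1"] by (simp add: x_def)
 show "dot d w2 (comb c I v) = slv (d + 1) (Bm d w1 w2 c I k) (rhs_k c) d"
 proof -
  have "x d = dot d w2 (comb c I v)" using d_pos by (auto simp: x_def)
  then show ?thesis using x[of d] by simp
 qed
qed

lemma ex_kerv:
 assumes on: "orthonormal2 d w1 w2" and reg: "regk d w1 w2 c I k"
 shows "\<exists>v. kerv d w1 w2 c I k v"
proof -
 have dt: "dt (d + 1) (Bm d w1 w2 c I k) \<noteq> 0" using regk_iff_dt[OF on] reg by blast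
 define x where "x = slv (d + 1) (Bm d w1 w2 c I k) (rhs_k c)"
 define v where "v j = (if j = k then 1 else - x (pos (I - {k}) j))" for j
 have vx: "x q = - v (en (I - {k}) q)" if "q < d - 1" for q
  using that card_Ik finI en_in[of "I - {k}" q] by (auto simp add: v_def pos_en)
 have cI: "comb c I v r = c k r + comb c (I - {k}) v r" for r
  unfolding comb_def by (simp add: sum_I v_def)
 have neg: "comb c (I - {k}) (\<lambda>j. - v j) r = - comb c (I - {k}) v r" for r
  unfolding comb_def by (simp add: sum_negf)
 have sys: "(\<Sum>q<d + 1. Bm d w1 w2 c I k r q * x q) = rhs_k c r" if "r < d + 1" for r
  unfolding x_def by (rule slv_solves[OF dt that])
 have "inW d w1 w2 (comb c I v)"
  unfolding inW_def
 proof (intro exI allI impI)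
  fix l assume "l < d"
  then show "comb c I v l = x (d - 1) * w1 l + x d * w2 l"
   using sys[of l] Bm_row[of l x "\<lambda>j. - v j" w1 w2 c, OF _ vx] cI[of l] neg[of l] by (simp add: rhs_k_def del: sum.lessThan_Suc)
 qed
 moreover have "(\<Sum>j\<in>I. v j) = 0"
  using sys[of d] Bm_last[of x "\<lambda>j. - v j" w1 w2 c, OF vx] sum_I[of v]
  by (simp add: rhs_k_def sum_negf del: sum.lessThan_Suc) (simp add: v_def)
 ultimately show ?thesis unfolding kerv_def by (intro exI[of _ v]) (simp add: v_def)
qed

text \<open>In barycentric coordinates the points of the plane on the affine hull of the facet are
  \<open>u + r * v\<close>, where \<open>u\<close> has coefficient 0 at \<open>k\<close> and
  \<open>r\<close> is the coefficient at \<open>k\<close>. An existential over vectors thus becomes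
  one over a single number in the unit interval, whose measurability can be handled.\<close>

lemma ex_bary_iff:
 assumes on: "orthonormal2 d w1 w2" and reg: "regk d w1 w2 c I k" and \<eta>: "0 \<le> \<eta>"
 shows "(\<exists>\<mu>. (\<forall>j\<in>I. \<eta> \<le> \<mu> j) \<and> (\<Sum>j\<in>I. \<mu> j) = 1 \<and> inW d w1 w2 (comb c I \<mu>)) \<longleftrightarrow>
  (\<exists>r\<in>{0..1}. \<eta> \<le> r \<and> (\<forall>j\<in>I - {k}. \<eta> \<le>
    slv (d + 1) (Bm d w1 w2 c I k) rhs_0 (pos (I - {k}) j) - r * slv (d + 1) (Bm d w1 w2 c I k) (rhs_k c) (pos (I - {k}) j)))"
  (is "?L \<longleftrightarrow> ?R")
proof -
 have dt: "dt (d + 1) (Bm d w1 w2 c I k) \<noteq> 0" using regk_iff_dt[OF on] reg by blast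
 obtain v where v: "kerv d w1 w2 c I k v" using ex_kerv[OF on reg] by blast
 define x where "x = slv (d + 1) (Bm d w1 w2 c I k) rhs_0"
 define u where "u j = (if j = k then 0 else x (pos (I - {k}) j))" for j
 have ux: "x q = u (en (I - {k}) q)" if "q < d - 1" for q
  using that card_Ik finI en_in[of "I - {k}" q] by (auto simp add: u_def pos_en)
 have cI: "comb c I u r = comb c (I - {k}) u r" for r
  unfolding comb_def by (simp add: sum_I u_def)
 have sys: "(\<Sum>q<d + 1. Bm d w1 w2 c I k r q * x q) = rhs_0 r" if "r < d + 1" for r
  unfolding x_def by (rule slv_solves[OF dt that])
 have uW: "inW d w1 w2 (comb c I u)"
  unfolding inW_def
 proof (intro exI allI impI)
  fix l assume "l < d"
  then show "comb c I u l = - x (d - 1) * w1 l + - x d * w2 l"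
   using sys[of l] Bm_row[of l x u w1 w2 c, OF _ ux] cI[of l] by (simp add: rhs_0_def del: sum.lessThan_Suc)
 qed
 have us: "(\<Sum>j\<in>I. u j) = 1"
  using sys[of d] Bm_last[of x u w1 w2 c, OF ux] sum_I[of u]
  by (simp add: rhs_0_def del: sum.lessThan_Suc) (simp add: u_def)
 have lin: "comb c I (\<lambda>j. u j + r * v j) l = comb c I u l + r * comb c I v l" for r l
  unfolding comb_def by (simp add: algebra_simps sum.distrib sum_distrib_left)
 have vk: "v k = 1" "(\<Sum>j\<in>I. v j) = 0" and vW: "inW d w1 w2 (comb c I v)" using v unfolding kerv_def by auto
 have vs: "v j = - slv (d + 1) (Bm d w1 w2 c I k) (rhs_k c) (pos (I - {k}) j)" if "j \<in> I - {k}" for j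
  using solve_k(1)[OF on reg v that] .
 show ?thesis
 proof
  assume ?L
  then obtain \<mu> where m: "\<forall>j\<in>I. \<eta> \<le> \<mu> j" "(\<Sum>j\<in>I. \<mu> j) = 1" "inW d w1 w2 (comb c I \<mu>)" by blast
  define r where "r = \<mu> k"
  define z where "z j = \<mu> j - u j - r * v j" for j
  have "z k = 0" by (simp add: z_def r_def u_def vk)
  have "(\<Sum>j\<in>I. z j) = 0"
   unfolding z_def by (simp add: sum_subtractf m us vk(2) sum_distrib_left[symmetric])
  then have z0: "(\<Sum>j\<in>I - {k}. z j) = 0" using sum_I[of z] \<open>z k = 0\<close> by simp
  have zc: "comb c (I - {k}) z l = comb c I \<mu> l - (comb c I u l + r * comb c I v l)" for l
   using \<open>z k = 0\<close> sum_I[of "\<lambda>j. z j * c j l"] unfolding comb_def z_def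
   by (simp add: algebra_simps sum.distrib sum_subtractf sum_distrib_left)
  have "inW d w1 w2 (\<lambda>l. comb c I u l + r * comb c I v l)"
   by (rule inW_lincomb[OF uW vW, where a = 1 and b = r]) simp
  from inW_lincomb[OF m(3) this, where a = 1 and b = "-1"]
  have "inW d w1 w2 (comb c (I - {k}) z)" using zc by simp
  then have "\<forall>j\<in>I - {k}. z j = 0" using reg z0 unfolding regk_def by blast
  then have mu: "\<mu> j = u j + r * v j" if "j \<in> I - {k}" for j
   using bspec[OF _ that, of "\<lambda>j. z j = 0"] unfolding z_def by linarith
  have "(\<Sum>j\<in>I - {k}. \<mu> j) \<ge> 0" using m(1) \<eta> by (intro sum_nonneg) force
  then have "r \<le> 1" using m(2) sum_I[of \<mu>] by (simp add: r_def)
  moreover have "\<eta> \<le> r" "0 \<le> r" using m(1) kI \<eta> by (auto simp: r_def)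
  moreover have "\<eta> \<le> slv (d + 1) (Bm d w1 w2 c I k) rhs_0 (pos (I - {k}) j)
    - r * slv (d + 1) (Bm d w1 w2 c I k) (rhs_k c) (pos (I - {k}) j)" if "j \<in> I - {k}" for j
  proof -
   have "\<eta> \<le> u j + r * v j" using mu[OF that] m(1) that by (metis DiffD1)
   moreover have "u j = slv (d + 1) (Bm d w1 w2 c I k) rhs_0 (pos (I - {k}) j)"
    using that by (simp add: u_def x_def)
   ultimately show ?thesis using vs[OF that] by simp
  qed
  ultimately show ?R by (intro bexI[of _ r]) auto
 next
  assume ?R
  then obtain r where r': "\<eta> \<le> r" "\<forall>j\<in>I - {k}. \<eta> \<le>
    slv (d + 1) (Bm d w1 w2 c I k) rhs_0 (pos (I - {k}) j) - r * slv (d + 1) (Bm d w1 w2 c I k) (rhs_k c) (pos (I - {k}) j)"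
   by blast
  have r: "\<eta> \<le> r" "\<forall>j\<in>I - {k}. \<eta> \<le> u j + r * v j"
  proof -
   show "\<forall>j\<in>I - {k}. \<eta> \<le> u j + r * v j"
   proof
    fix j assume j: "j \<in> I - {k}"
    then have "u j = slv (d + 1) (Bm d w1 w2 c I k) rhs_0 (pos (I - {k}) j)" by (simp add: u_def x_def)
    then show "\<eta> \<le> u j + r * v j" using r'(2) vs[OF j] j by (metis add_uminus_conv_diff mult_minus_right)
   qed
  qed (rule r'(1))
  show ?L
  proof (intro exI[of _ "\<lambda>j. u j + r * v j"] conjI)
   show "\<forall>j\<in>I. \<eta> \<le> u j + r * v j" using r vk by (auto simp: u_def)
   show "(\<Sum>j\<in>I. u j + r * v j) = 1" using us vk by (simp add: sum.distrib sum_distrib_left[symmetric])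
   show "inW d w1 w2 (comb c I (\<lambda>j. u j + r * v j))"
    by (rule inW_lincomb[OF uW vW, where a = 1 and b = r]) (simp add: lin)
  qed
 qed
qed

end

section \<open>Measurability of the edge conditions\<close>

lemma dt_transpose: "dt N (\<lambda>i j. A j i) = dt N A"
proof -
 have "mat N N (\<lambda>(i, j). A j i) = transpose_mat (mat N N (\<lambda>(i, j). A i j))"
  by (intro eq_matI) auto
 then show ?thesis unfolding dt_def by (metis det_transpose mat_carrier)
qed

lemma lin_indep_iff_dt:
 assumes "finite I" "card I = d"
 shows "lin_indep d c I \<longleftrightarrow> dt d (\<lambda>r l. c (en I r) l) \<noteq> 0"
proof -
 have "dt d (\<lambda>r l. c (en I r) l) = dt d (\<lambda>l q. c (en I q) l)"
  using dt_transpose[of d "\<lambda>l q. c (en I q) l"] by simp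
 also have "\<dots> = 0 \<longleftrightarrow> (\<exists>x. (\<exists>q<d. x q \<noteq> 0) \<and> (\<forall>l<d. (\<Sum>q<d. c (en I q) l * x q) = 0))"
  by (rule dt_eq_0_iff)
 also have "\<dots> \<longleftrightarrow> \<not> lin_indep d c I"
 proof
  assume "\<exists>x. (\<exists>q<d. x q \<noteq> 0) \<and> (\<forall>l<d. (\<Sum>q<d. c (en I q) l * x q) = 0)"
  then obtain x q where x: "q < d" "x q \<noteq> 0" "\<forall>l<d. (\<Sum>q<d. c (en I q) l * x q) = 0" by blast
  have "(\<Sum>i\<in>I. x (pos I i) * c i l) = 0" if "l < d" for l
   using x(3) that unfolding sum_en[OF assms(1)] assms(2) by (simp add: pos_en[OF assms(1)] assms(2) mult.commute)
  then have *: "\<forall>l<d. (\<Sum>i\<in>I. x (pos I i) * c i l) = 0" by blast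
  show "\<not> lin_indep d c I"
  proof
   assume "lin_indep d c I"
   from this[unfolded lin_indep_def, THEN spec, of "\<lambda>i. x (pos I i)", THEN mp, OF *]
   have "x (pos I (en I q)) = 0" using en_in[of I q] x(1) assms by blast
   then show False using x assms by (simp add: pos_en)
  qed
 next
  assume "\<not> lin_indep d c I"
  then obtain l i where l: "\<forall>k<d. (\<Sum>i\<in>I. l i * c i k) = 0" "i \<in> I" "l i \<noteq> 0"
   unfolding lin_indep_def by auto
  show "\<exists>x. (\<exists>q<d. x q \<noteq> 0) \<and> (\<forall>l<d. (\<Sum>q<d. c (en I q) l * x q) = 0)"
  proof (intro exI[of _ "\<lambda>q. l (en I q)"] conjI)
   show "\<exists>q<d. l (en I q) \<noteq> 0"
    using l assms pos_lt[of I i] en_pos[of I i] by (intro exI[of _ "pos I i"]) auto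
   show "\<forall>k<d. (\<Sum>q<d. c (en I q) k * l (en I q)) = 0"
    using l(1) unfolding sum_en[OF assms(1)] assms(2) by (simp add: mult.commute)
  qed
 qed
 finally show ?thesis by blast
qed

text \<open>Independence determines the normal \<open>y\<close> uniquely, so Cramer's rule
  eliminates the quantifier over \<open>y\<close>.\<close>

lemma supp_iff_slv:
 assumes "finite I" "card I = d"
 shows "supp d c S I \<longleftrightarrow> dt d (\<lambda>r l. c (en I r) l) \<noteq> 0 \<and>
  (\<forall>j\<in>S. dot d (c j) (slv d (\<lambda>r l. c (en I r) l) (\<lambda>_. 1)) \<le> 1)"
proof (cases "dt d (\<lambda>r l. c (en I r) l) = 0")
 case False
 let ?y = "slv d (\<lambda>r l. c (en I r) l) (\<lambda>_. 1)"
 have y1: "dot d (c i) ?y = 1" if "i \<in> I" for i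
  using slv_solves[OF False, of "pos I i" "\<lambda>_. 1"] pos_lt[of I i] en_pos[of I i] assms that
  by (simp add: dot_def)
 have "dot d (c j) y = dot d (c j) ?y" if "\<forall>i\<in>I. dot d (c i) y = 1" for y j
 proof -
  have "y q = ?y q" if "q < d" for q
   by (rule slv_unique[OF False _ that]) (use \<open>\<forall>i\<in>I. dot d (c i) y = 1\<close> en_in[of I] assms in \<open>auto simp: dot_def\<close>)
  then show ?thesis by (auto intro: dot_cong)
 qed
 then show ?thesis using False y1 unfolding supp_def lin_indep_iff_dt[OF assms] by metis
qed (simp add: supp_def lin_indep_iff_dt[OF assms])

text \<open>Compactness of the interval: the closed conditions are solvable iff they are solvable up
  to slack \<open>1 / Suc n\<close> for every \<open>n\<close>, and with slack a rational
  \<open>r\<close> suffices. Only countable operations remain.\<close>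

lemma sets_ex_unit_interval:
 assumes fin: "finite F"
  and [measurable]: "\<And>i. i \<in> F ==> A i \<in> borel_measurable M" "\<And>i. i \<in> F ==> B i \<in> borel_measurable M"
 shows "{\<omega> \<in> space M. \<exists>r\<in>{0..1::real}. \<forall>i\<in>F. 0 \<le> A i \<omega> + r * B i \<omega>} \<in> sets M"
proof -
 let ?Q = "\<rat> \<inter> {0..1::real}"
 have eq: "(\<exists>r\<in>{0..1}. \<forall>i\<in>F. 0 \<le> a i + r * b i) \<longleftrightarrow> (\<forall>n::nat. \<exists>r\<in>?Q. \<forall>i\<in>F. - (1 / Suc n) < a i + r * b i)"
  for a b :: "'a => real"
 proof
  assume "\<exists>r\<in>{0..1}. \<forall>i\<in>F. 0 \<le> a i + r * b i"
  then obtain r where r: "0 \<le> r" "r \<le> 1" "\<forall>i\<in>F. 0 \<le> a i + r * b i" by auto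
  show "\<forall>n::nat. \<exists>r\<in>?Q. \<forall>i\<in>F. - (1 / Suc n) < a i + r * b i"
  proof
   fix n :: nat
   \<comment> \<open>Moving \<open>r\<close> by less than this changes every
     \<open>a i + r * b i\<close> by less than the slack; the 1 in the denominator covers the case
     that all \<open>b i\<close> vanish.\<close>
   define \<delta> where "\<delta> = 1 / (real (Suc n) * (1 + (\<Sum>i\<in>F. \<bar>b i\<bar>)))"
   have sb: "0 \<le> (\<Sum>i\<in>F. \<bar>b i\<bar>)" by (intro sum_nonneg) auto
   then have \<delta>: "0 < \<delta>" unfolding \<delta>_def by (intro divide_pos_pos mult_pos_pos) (auto simp: add_pos_nonneg)
   obtain r' where r': "r' \<in> ?Q" "\<bar>r' - r\<bar> < \<delta>"
   proof (cases "r = 1")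
    case True
    then show ?thesis using that[of 1] \<delta> by auto
   next
    case False
    then have "r < min 1 (r + \<delta>)" using r \<delta> by auto
    then obtain q where "q \<in> \<rat>" "r < q" "q < min 1 (r + \<delta>)" using Rats_dense_in_real by blast
    then show ?thesis using that[of q] r by auto
   qed
   have "- (1 / Suc n) < a i + r' * b i" if i: "i \<in> F" for i
   proof -
    have "\<bar>b i\<bar> \<le> (\<Sum>i\<in>F. \<bar>b i\<bar>)" using fin i by (intro member_le_sum) auto
    then have "\<bar>r' - r\<bar> * \<bar>b i\<bar> \<le> \<delta> * (\<Sum>i\<in>F. \<bar>b i\<bar>)"
     using r'(2) \<delta> by (intro mult_mono) auto
    also have "\<dots> < \<delta> * (1 + (\<Sum>i\<in>F. \<bar>b i\<bar>))" using \<delta> by simp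
    also have "\<dots> = 1 / Suc n"
    proof -
     have "1 + (\<Sum>i\<in>F. \<bar>b i\<bar>) \<noteq> 0" using sb by linarith
     then show ?thesis by (simp add: \<delta>_def del: of_nat_Suc)
    qed
    finally have "\<bar>(r' - r) * b i\<bar> < 1 / Suc n" by (simp add: abs_mult)
    moreover have "a i + r' * b i = a i + r * b i + (r' - r) * b i" by (simp add: algebra_simps)
    ultimately show ?thesis using r(3) i by (smt (verit))
   qed
   then show "\<exists>r\<in>?Q. \<forall>i\<in>F. - (1 / Suc n) < a i + r * b i" using r'(1) by blast
  qed
 next
  assume "\<forall>n::nat. \<exists>r\<in>?Q. \<forall>i\<in>F. - (1 / Suc n) < a i + r * b i"
  then have "\<forall>n. \<exists>r. r \<in> {0..1} \<and> (\<forall>i\<in>F. - (1 / Suc n) < a i + r * b i)" by fast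
  then obtain r :: rvec where r: "\<And>n. r n \<in> {0..1}" "\<And>n i. i \<in> F ==> - (1 / Suc n) < a i + r n * b i"
   by metis
  obtain l f where l: "l \<in> {0..1}" "strict_mono f" "(r \<circ> f) \<longlonglongrightarrow> l"
   using compact_Icc[of "0::real" 1] r(1) unfolding compact_def by metis
  have "0 \<le> a i + l * b i" if "i \<in> F" for i
  proof (rule LIMSEQ_le)
   have "(\<lambda>n. - (1 / real (Suc n))) \<longlonglongrightarrow> - 0"
    by (intro tendsto_minus) (rule LIMSEQ_Suc[OF lim_1_over_n])
   from LIMSEQ_subseq_LIMSEQ[OF this l(2)]
   show "(\<lambda>n. - (1 / real (Suc (f n)))) \<longlonglongrightarrow> 0" by (simp add: comp_def)
   show "(\<lambda>n. a i + (r \<circ> f) n * b i) \<longlonglongrightarrow> a i + l * b i" by (intro tendsto_intros l)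
   show "\<exists>N. \<forall>n\<ge>N. - (1 / real (Suc (f n))) \<le> a i + (r \<circ> f) n * b i"
    using r(2)[OF that] by (auto simp: less_imp_le)
  qed
  then show "\<exists>r\<in>{0..1}. \<forall>i\<in>F. 0 \<le> a i + r * b i" using l(1) by blast
 qed
 have cQ: "countable ?Q" using countable_rat by blast
 have "{\<omega> \<in> space M. \<forall>n::nat. \<exists>r\<in>?Q. \<forall>i\<in>F. - (1 / Suc n) < A i \<omega> + r * B i \<omega>} \<in> sets M"
  by (intro sets.sets_Collect_countable_All sets.sets_Collect_countable_Ex' sets.sets_Collect_finite_All cQ fin) measurable
 then show ?thesis unfolding eq .
qed

text \<open>The plane may vary with the sample point because it contains the randomly rotated
  initial objective; joint measurability is required when the order of integration is changed
  later.\<close>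

locale shadow_meas =
 fixes M :: "'a measure" and d :: nat and w1 w2 :: "'a => nat => real" and c :: "'a => nat => nat => real" and S :: "nat set"
 assumes finS: "finite S"
  and mw1: "\<And>l. l < d ==> (\<lambda>\<omega>. w1 \<omega> l) \<in> borel_measurable M"
  and mw2: "\<And>l. l < d ==> (\<lambda>\<omega>. w2 \<omega> l) \<in> borel_measurable M"
  and mc: "\<And>i l. i \<in> S ==> l < d ==> (\<lambda>\<omega>. c \<omega> i l) \<in> borel_measurable M"
begin

lemma measurable_Bm:
 assumes "basis_index d I k" "I \<subseteq> S" "r < d + 1" "q < d + 1"
 shows "(\<lambda>\<omega>. Bm d (w1 \<omega>) (w2 \<omega>) (c \<omega>) I k r q) \<in> borel_measurable M"
proof -
 interpret basis_index d I k by fact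
 have "en (I - {k}) q \<in> S" if "q < d - 1" using en_in[of "I - {k}" q] that card_Ik finI assms(2) by auto
 then show ?thesis unfolding Bm_def using mc mw1 mw2
  by (cases "r < d"; cases "q < d - 1"; cases "q = d - 1") simp_all
qed

lemma measurable_slv_Bm:
 assumes "basis_index d I k" "I \<subseteq> S"
 shows "(\<lambda>\<omega>. slv (d + 1) (Bm d (w1 \<omega>) (w2 \<omega>) (c \<omega>) I k) (basis_index.rhs_k d k (c \<omega>)) q) \<in> borel_measurable M"
  "(\<lambda>\<omega>. slv (d + 1) (Bm d (w1 \<omega>) (w2 \<omega>) (c \<omega>) I k) (basis_index.rhs_0 d) q) \<in> borel_measurable M"
  "(\<lambda>\<omega>. dt (d + 1) (Bm d (w1 \<omega>) (w2 \<omega>) (c \<omega>) I k)) \<in> borel_measurable M"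
proof -
 interpret basis_index d I k by fact
 have "k \<in> S" using kI assms by blast
 then have "(\<lambda>\<omega>. rhs_k (c \<omega>) i) \<in> borel_measurable M" for i
  unfolding rhs_k_def using mc by (cases "i < d") simp_all
 then show "(\<lambda>\<omega>. slv (d + 1) (Bm d (w1 \<omega>) (w2 \<omega>) (c \<omega>) I k) (rhs_k (c \<omega>)) q) \<in> borel_measurable M"
  using measurable_Bm[OF assms] by (intro measurable_slv) auto
 show "(\<lambda>\<omega>. slv (d + 1) (Bm d (w1 \<omega>) (w2 \<omega>) (c \<omega>) I k) rhs_0 q) \<in> borel_measurable M"
  using measurable_Bm[OF assms] by (intro measurable_slv) auto
 show "(\<lambda>\<omega>. dt (d + 1) (Bm d (w1 \<omega>) (w2 \<omega>) (c \<omega>) I k)) \<in> borel_measurable M"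
  using measurable_Bm[OF assms] by (intro measurable_dt) auto
qed

lemma sets_supp:
 assumes "finite I" "card I = d" "I \<subseteq> S"
 shows "{\<omega> \<in> space M. supp d (c \<omega>) S I} \<in> sets M"
proof -
 have e: "(\<lambda>\<omega>. c \<omega> (en I r) l) \<in> borel_measurable M" if "r < d" "l < d" for r l
  using that en_in[of I r] assms mc by auto
 have [measurable]: "(\<lambda>\<omega>. dt d (\<lambda>r l. c \<omega> (en I r) l)) \<in> borel_measurable M"
  using e by (intro measurable_dt) auto
 have y: "(\<lambda>\<omega>. slv d (\<lambda>r l. c \<omega> (en I r) l) (\<lambda>_. 1) q) \<in> borel_measurable M" for q
  using e by (intro measurable_slv) auto
 have [measurable]: "(\<lambda>\<omega>. dot d (c \<omega> j) (slv d (\<lambda>r l. c \<omega> (en I r) l) (\<lambda>_. 1))) \<in> borel_measurable M" if "j \<in> S" for j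
  unfolding dot_def using that mc y by (intro borel_measurable_sum borel_measurable_times) auto
 show ?thesis unfolding supp_iff_slv[OF assms(1,2)]
  by (intro sets.sets_Collect_conj sets.sets_Collect_finite_All finS) measurable
qed

lemma sets_edge:
 assumes bi: "basis_index d I k" and I: "I \<subseteq> S" and \<eta>: "0 \<le> \<eta>"
  and on: "\<And>\<omega>. \<omega> \<in> space M ==> orthonormal2 d (w1 \<omega>) (w2 \<omega>)"
 shows "{\<omega> \<in> space M. edge d (w1 \<omega>) (w2 \<omega>) (c \<omega>) S \<eta> I k} \<in> sets M"
proof -
 interpret basis_index d I k by fact
 let ?sk = "\<lambda>\<omega>. slv (d + 1) (Bm d (w1 \<omega>) (w2 \<omega>) (c \<omega>) I k) (rhs_k (c \<omega>))"
 let ?s0 = "\<lambda>\<omega>. slv (d + 1) (Bm d (w1 \<omega>) (w2 \<omega>) (c \<omega>) I k) rhs_0"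
 \<comment> \<open>At \<open>j = k\<close> the two coefficients encode the condition
   \<open>\<eta> \<le> r\<close>.\<close>
 let ?E = "\<lambda>\<omega>. \<exists>r\<in>{0..1::real}. \<forall>j\<in>insert k (I - {k}). 0 \<le> (if j = k then - \<eta> else ?s0 \<omega> (pos (I - {k}) j) - \<eta>) +
   r * (if j = k then 1 else - ?sk \<omega> (pos (I - {k}) j))"
 have E: "{\<omega> \<in> space M. ?E \<omega>} \<in> sets M"
 proof (rule sets_ex_unit_interval)
  fix j
  show "(\<lambda>\<omega>. if j = k then - \<eta> else ?s0 \<omega> (pos (I - {k}) j) - \<eta>) \<in> borel_measurable M"
   using measurable_slv_Bm(2)[OF bi I, of "pos (I - {k}) j"] by (cases "j = k") simp_all
  show "(\<lambda>\<omega>. if j = k then 1 else - ?sk \<omega> (pos (I - {k}) j)) \<in> borel_measurable M"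
   using measurable_slv_Bm(1)[OF bi I, of "pos (I - {k}) j"] by (cases "j = k") simp_all
 qed (use finI in simp)
 have iff: "edge d (w1 \<omega>) (w2 \<omega>) (c \<omega>) S \<eta> I k \<longleftrightarrow> supp d (c \<omega>) S I \<and>
   dt (d + 1) (Bm d (w1 \<omega>) (w2 \<omega>) (c \<omega>) I k) \<noteq> 0 \<and> (\<forall>j\<in>I - {k}. \<bar>?sk \<omega> (pos (I - {k}) j)\<bar> \<le> 1) \<and> ?E \<omega>"
  if w: "\<omega> \<in> space M" for \<omega>
 proof -
  note on' = on[OF w]
  show ?thesis
  proof (cases "regk d (w1 \<omega>) (w2 \<omega>) (c \<omega>) I k")
   case True
   obtain v0 where v0: "kerv d (w1 \<omega>) (w2 \<omega>) (c \<omega>) I k v0" using ex_kerv[OF on' True] by blast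
   have k1: "(\<exists>v. kerv d (w1 \<omega>) (w2 \<omega>) (c \<omega>) I k v \<and> (\<forall>j\<in>I. \<bar>v j\<bar> \<le> 1)) \<longleftrightarrow>
     (\<forall>j\<in>I - {k}. \<bar>?sk \<omega> (pos (I - {k}) j)\<bar> \<le> 1)"
   proof
    assume "\<exists>v. kerv d (w1 \<omega>) (w2 \<omega>) (c \<omega>) I k v \<and> (\<forall>j\<in>I. \<bar>v j\<bar> \<le> 1)"
    then obtain v where v: "kerv d (w1 \<omega>) (w2 \<omega>) (c \<omega>) I k v" "\<forall>j\<in>I. \<bar>v j\<bar> \<le> 1" by blast
    show "\<forall>j\<in>I - {k}. \<bar>?sk \<omega> (pos (I - {k}) j)\<bar> \<le> 1"
     using solve_k(1)[OF on' True v(1)] v(2) by (metis DiffD1 abs_minus_cancel)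
   next
    assume h: "\<forall>j\<in>I - {k}. \<bar>?sk \<omega> (pos (I - {k}) j)\<bar> \<le> 1"
    have "\<bar>v0 j\<bar> \<le> 1" if "j \<in> I" for j
    proof (cases "j = k")
     case True
     then show ?thesis using v0 by (simp add: kerv_def)
    next
     case False
     then have "j \<in> I - {k}" using that by simp
     then show ?thesis using h solve_k(1)[OF on' True v0, of j] by (metis abs_minus_cancel)
    qed
    then show "\<exists>v. kerv d (w1 \<omega>) (w2 \<omega>) (c \<omega>) I k v \<and> (\<forall>j\<in>I. \<bar>v j\<bar> \<le> 1)" using v0 by blast
   qed
   have "?E \<omega> \<longleftrightarrow> (\<exists>r\<in>{0..1}. \<eta> \<le> r \<and> (\<forall>j\<in>I - {k}. \<eta> \<le> ?s0 \<omega> (pos (I - {k}) j) - r * ?sk \<omega> (pos (I - {k}) j)))"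
    by (intro bex_cong refl) (auto simp: algebra_simps)
   then show ?thesis
    unfolding edge_def k1 ex_bary_iff[OF on' True \<eta>] using True regk_iff_dt[OF on'] by blast
  next
   case False
   then show ?thesis unfolding edge_def using regk_iff_dt[OF on'] by blast
  qed
 qed
 have "{\<omega> \<in> space M. supp d (c \<omega>) S I \<and>
   dt (d + 1) (Bm d (w1 \<omega>) (w2 \<omega>) (c \<omega>) I k) \<noteq> 0 \<and> (\<forall>j\<in>I - {k}. \<bar>?sk \<omega> (pos (I - {k}) j)\<bar> \<le> 1) \<and> ?E \<omega>} \<in> sets M"
 proof (intro sets.sets_Collect_conj sets_supp E finI cardI I sets.sets_Collect_finite_All finite_Diff)
  show "{\<omega> \<in> space M. dt (d + 1) (Bm d (w1 \<omega>) (w2 \<omega>) (c \<omega>) I k) \<noteq> 0} \<in> sets M"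
   using measurable_slv_Bm(3)[OF bi I] by measurable
  show "{\<omega> \<in> space M. \<bar>?sk \<omega> (pos (I - {k}) j)\<bar> \<le> 1} \<in> sets M" for j
   using measurable_slv_Bm(1)[OF bi I, of "pos (I - {k}) j"] by measurable
 qed
 also have "{\<omega> \<in> space M. supp d (c \<omega>) S I \<and>
   dt (d + 1) (Bm d (w1 \<omega>) (w2 \<omega>) (c \<omega>) I k) \<noteq> 0 \<and> (\<forall>j\<in>I - {k}. \<bar>?sk \<omega> (pos (I - {k}) j)\<bar> \<le> 1) \<and> ?E \<omega>}
   = {\<omega> \<in> space M. edge d (w1 \<omega>) (w2 \<omega>) (c \<omega>) S \<eta> I k}"
  by (rule Collect_cong) (use iff in blast)
 finally show ?thesis .
qed

end

section \<open>Two maps that preserve edges: dilation and stretching\<close>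

lemma comb_cong: "(\<And>j. j \<in> I ==> v j = v' j) ==> (\<And>j. j \<in> I ==> c j l = c' j l) ==> comb c I v l = comb c' I v' l"
 unfolding comb_def by (intro sum.cong) auto

lemma inW_scaleI:
 assumes "inW d w1 w2 u" "\<And>l. l < d ==> x l = a * u l"
 shows "inW d w1 w2 x"
 using inW_lincomb[OF assms(1,1), of x a 0] assms(2) by simp

text \<open>Dilation of a facet about its centroid moves every point of it away from the relative boundary.\<close>

lemma edge_dilate:
 assumes bi: "basis_index d I k" and e: "edge d w1 w2 c S 0 I k" and \<tau>: "0 < \<tau>"
  and c'I: "\<And>i l. i \<in> I ==> l < d ==> c' i l = c i l + \<tau> * (c i l - (\<Sum>j\<in>I. c j l) / d)"
  and c'o: "\<And>i l. i \<notin> I ==> l < d ==> c' i l = c i l"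
 shows "edge d w1 w2 c' S (\<tau> / (real d * (1 + \<tau>))) I k"
proof -
 interpret basis_index d I k by fact
 define cen where "cen l = (\<Sum>j\<in>I. c j l) / d" for l
 have d0: "real d \<noteq> 0" using d_pos by simp
 have cmb: "comb c' J v l = (1 + \<tau>) * comb c J v l - \<tau> * (\<Sum>j\<in>J. v j) * cen l" if "J \<subseteq> I" "l < d" for J v l
 proof -
  have "comb c' J v l = (\<Sum>j\<in>J. (1 + \<tau>) * (v j * c j l) - \<tau> * v j * cen l)"
   unfolding comb_def
  proof (intro sum.cong refl)
   fix j assume "j \<in> J"
   then have "c' j l = c j l + \<tau> * (c j l - cen l)" using c'I that unfolding cen_def by blast
   then show "v j * c' j l = (1 + \<tau>) * (v j * c j l) - \<tau> * v j * cen l" by (simp only:) (simp add: algebra_simps)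
  qed
  then show ?thesis
   unfolding comb_def by (simp add: sum_subtractf sum_distrib_left[symmetric] sum_distrib_right[symmetric])
 qed
 have cen_comb: "cen l = comb c I (\<lambda>_. 1 / d) l" for l
  unfolding cen_def comb_def by (simp add: sum_divide_distrib)
 have li: "lin_indep d c I" using e unfolding edge_def supp_def by blast
 obtain y where y: "\<forall>i\<in>I. dot d (c i) y = 1" "\<forall>j\<in>S. dot d (c j) y \<le> 1"
  using e unfolding edge_def supp_def by blast
 have li': "lin_indep d c' I"
  unfolding lin_indep_def
 proof (intro allI impI)
  fix v assume h: "\<forall>l<d. (\<Sum>i\<in>I. v i * c' i l) = 0"
  define L where "L = (\<Sum>j\<in>I. v j)"
  have "(\<Sum>i\<in>I. ((1 + \<tau>) * v i - \<tau> * L / d) * c i l) = 0" if "l < d" for l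
  proof -
   have "(\<Sum>i\<in>I. ((1 + \<tau>) * v i - \<tau> * L / d) * c i l) = (1 + \<tau>) * comb c I v l - \<tau> * L * cen l"
    unfolding comb_def cen_def sum_distrib_left sum_divide_distrib sum_subtractf[symmetric]
    by (intro sum.cong) (auto simp: algebra_simps)
   also have "\<dots> = comb c' I v l" using cmb[of I l v] that by (simp add: L_def)
   also have "\<dots> = 0" using h that by (simp add: comb_def)
   finally show ?thesis .
  qed
  then have z: "\<forall>i\<in>I. (1 + \<tau>) * v i - \<tau> * L / d = 0"
   using li[unfolded lin_indep_def, THEN spec, of "\<lambda>i. (1 + \<tau>) * v i - \<tau> * L / d"] by blast
  then have "(\<Sum>i\<in>I. (1 + \<tau>) * v i - \<tau> * L / d) = 0" by simp
  then have "(1 + \<tau>) * L - \<tau> * L = 0"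
   using d0 cardI by (simp add: sum_subtractf sum_distrib_left[symmetric] L_def[symmetric])
  then have "L = 0" by (simp add: algebra_simps)
  then show "\<forall>i\<in>I. v i = 0" using z \<tau> by auto
 qed
 have yc: "dot d (c' i) y = dot d (c i) y" if "i \<in> I \<or> i \<notin> I" for i
 proof (cases "i \<in> I")
  case True
  have "dot d cen y = 1"
   using dot_comb[OF finI, of d c "\<lambda>_. 1 / d" y] y(1) cardI d0 by (simp add: cen_comb[abs_def])
  moreover have "dot d (c' i) y = dot d (\<lambda>l. (1 + \<tau>) * c i l + (- \<tau>) * cen l) y"
   by (intro dot_cong) (auto simp: c'I[OF True] cen_def algebra_simps)
  ultimately have "dot d (c' i) y = (1 + \<tau>) * dot d (c i) y + (- \<tau>) * dot d cen y"
   by (simp only: dot_add dot_scale)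
  then show ?thesis using \<open>dot d cen y = 1\<close> y(1) True by simp
 next
  case False
  then show ?thesis by (intro dot_cong) (auto simp: c'o)
 qed
 have supp': "supp d c' S I" unfolding supp_def using li' y yc by (auto intro!: exI[of _ y])
 have reg: "regk d w1 w2 c I k" using e unfolding edge_def by blast
 have reg': "regk d w1 w2 c' I k"
  unfolding regk_def
 proof (intro allI impI)
  fix v assume h: "(\<Sum>j\<in>I - {k}. v j) = 0 \<and> inW d w1 w2 (comb c' (I - {k}) v)"
  have "inW d w1 w2 (comb c (I - {k}) v)"
   by (rule inW_scaleI[OF conjunct2[OF h], where a = "1 / (1 + \<tau>)"])
    (use cmb[of "I - {k}" _ v] h \<tau> in auto)
  then show "\<forall>j\<in>I - {k}. v j = 0" using h reg unfolding regk_def by blast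
 qed
 obtain v where v: "kerv d w1 w2 c I k v" "\<forall>j\<in>I. \<bar>v j\<bar> \<le> 1" using e unfolding edge_def by blast
 have "inW d w1 w2 (comb c' I v)"
  by (rule inW_scaleI[of _ _ _ "comb c I v" _ "1 + \<tau>"]) (use v cmb[of I _ v] in \<open>auto simp: kerv_def\<close>)
 then have kv: "kerv d w1 w2 c' I k v" using v unfolding kerv_def by blast
 obtain \<mu> where m: "\<forall>j\<in>I. 0 \<le> \<mu> j" "(\<Sum>j\<in>I. \<mu> j) = 1" "inW d w1 w2 (comb c I \<mu>)" using e unfolding edge_def by blast
 \<comment> \<open>These are the weights of the same point with respect to the dilated vertices:
   weights \<open>\<mu>'\<close> there correspond to weights
   \<open>(1 + \<tau>) * \<mu>' j - \<tau> / d\<close> before the dilation.\<close>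
 define \<mu>' where "\<mu>' j = (\<mu> j + \<tau> / d) / (1 + \<tau>)" for j
 have m1: "\<tau> / (real d * (1 + \<tau>)) \<le> \<mu>' j" if "j \<in> I" for j
  using m(1) that \<tau> d_pos by (auto simp: \<mu>'_def divide_simps)
 have m2: "(\<Sum>j\<in>I. \<mu>' j) = 1"
  unfolding \<mu>'_def using m(2) cardI d0 \<tau> by (simp add: sum_divide_distrib[symmetric] sum.distrib)
 have m3: "comb c' I \<mu>' l = comb c I \<mu> l" if "l < d" for l
 proof -
  have "(1 + \<tau>) * comb c I \<mu>' l = comb c I (\<lambda>j. \<mu> j + \<tau> / d) l"
   unfolding comb_def \<mu>'_def sum_distrib_left using \<tau> by (intro sum.cong) auto
  also have "\<dots> = comb c I \<mu> l + \<tau> * cen l"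
   unfolding comb_def cen_def by (simp add: algebra_simps sum.distrib sum_distrib_left sum_divide_distrib)
  finally show ?thesis using cmb[of I l \<mu>'] that m2 by simp
 qed
 have "inW d w1 w2 (comb c' I \<mu>')" by (rule inW_scaleI[OF m(3), where a = 1]) (use m3 in auto)
 then show ?thesis unfolding edge_def using supp' reg' kv v(2) m1 m2 by blast
qed

text \<open>Vertex \<open>k\<close> moves along the edge vector, which lies in the plane and is
  parallel to the hyperplane of the facet. The supporting hyperplane therefore persists, every
  combination of the vertices changes by a vector of the plane, and the coefficients
  \<open>v\<close> and \<open>\<mu>\<close> remain valid.\<close>

lemma edge_stretch:
 assumes bi: "basis_index d I k" and e: "edge d w1 w2 c S \<eta> I k" and v: "kerv d w1 w2 c I k v" and t: "0 < 1 + t"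
  and c'k: "\<And>l. l < d ==> c' k l = c k l + t * comb c I v l"
  and c'o: "\<And>i l. i \<noteq> k ==> l < d ==> c' i l = c i l"
 shows "edge d w1 w2 c' S \<eta> I k" "kerv d w1 w2 c' I k v" "\<And>l. l < d ==> comb c' I v l = (1 + t) * comb c I v l"
proof -
 interpret basis_index d I k by fact
 define D where "D = comb c I v"
 have W: "inW d w1 w2 D" and vk: "v k = 1" and vs: "(\<Sum>j\<in>I. v j) = 0" using v unfolding kerv_def D_def by auto
 have cmb: "comb c' I u l = comb c I u l + t * u k * D l" if "l < d" for u l
 proof -
  have "comb c' I u l = u k * c' k l + (\<Sum>j\<in>I - {k}. u j * c j l)"
   unfolding comb_def sum_I using c'o that by simp
  also have "\<dots> = comb c I u l + t * u k * D l"
   unfolding comb_def[of c I u] sum_I using c'k that by (simp add: D_def algebra_simps)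
  finally show ?thesis .
 qed
 show D': "comb c' I v l = (1 + t) * comb c I v l" if "l < d" for l
  using cmb[OF that, of v] vk by (simp add: D_def algebra_simps)
 have "inW d w1 w2 (comb c' I v)"
  by (rule inW_scaleI[OF W, where a = "1 + t"]) (use D' in \<open>auto simp: D_def\<close>)
 then show kv: "kerv d w1 w2 c' I k v" using v unfolding kerv_def by blast
 have li: "lin_indep d c I" using e unfolding edge_def supp_def by blast
 obtain y where y: "\<forall>i\<in>I. dot d (c i) y = 1" "\<forall>j\<in>S. dot d (c j) y \<le> 1"
  using e unfolding edge_def supp_def by blast
 have li': "lin_indep d c' I"
  unfolding lin_indep_def
 proof (intro allI impI)
  fix u assume h: "\<forall>l<d. (\<Sum>i\<in>I. u i * c' i l) = 0"
  have "(\<Sum>i\<in>I. (u i + t * u k * v i) * c i l) = 0" if "l < d" for l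
  proof -
   have "(\<Sum>i\<in>I. (u i + t * u k * v i) * c i l) = comb c I u l + t * u k * D l"
    unfolding comb_def D_def by (simp add: algebra_simps sum.distrib sum_distrib_left)
   then show ?thesis using cmb[OF that, of u] h that by (simp add: comb_def)
  qed
  then have z: "\<forall>i\<in>I. u i + t * u k * v i = 0"
   using li[unfolded lin_indep_def, THEN spec, of "\<lambda>i. u i + t * u k * v i"] by blast
  then have "u k * (1 + t) = 0" using kI vk by (auto simp: algebra_simps)
  then have "u k = 0" using t by simp
  then show "\<forall>i\<in>I. u i = 0" using z by simp
 qed
 have yD: "dot d D y = 0" unfolding D_def dot_comb[OF finI] using y(1) vs by simp
 have yc: "dot d (c' i) y = dot d (c i) y" for i
 proof (cases "i = k")
  case True
  have "dot d (c' k) y = dot d (\<lambda>l. c k l + t * D l) y" by (intro dot_cong) (auto simp: c'k D_def)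
  then show ?thesis using True yD by (simp add: dot_add dot_scale)
 next
  case False
  then show ?thesis by (intro dot_cong) (auto simp: c'o)
 qed
 have supp': "supp d c' S I" unfolding supp_def using li' y yc by (auto intro!: exI[of _ y])
 have reg': "regk d w1 w2 c' I k"
 proof -
  have "inW d w1 w2 (comb c' (I - {k}) u) \<longleftrightarrow> inW d w1 w2 (comb c (I - {k}) u)" for u
   unfolding inW_def comb_def using c'o by simp
  then show ?thesis using e unfolding edge_def regk_def by simp
 qed
 obtain u where u: "kerv d w1 w2 c I k u" "\<forall>j\<in>I. \<bar>u j\<bar> \<le> 1" using e unfolding edge_def by blast
 have "inW d w1 w2 (comb c' I u)"
  by (rule inW_lincomb[OF _ W, of "comb c I u" _ 1 "t * u k"]) (use u cmb in \<open>auto simp: kerv_def\<close>)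
 then have ku: "kerv d w1 w2 c' I k u" using u unfolding kerv_def by blast
 obtain \<mu> where m: "\<forall>j\<in>I. \<eta> \<le> \<mu> j" "(\<Sum>j\<in>I. \<mu> j) = 1" "inW d w1 w2 (comb c I \<mu>)" using e unfolding edge_def by blast
 have "inW d w1 w2 (comb c' I \<mu>)"
  by (rule inW_lincomb[OF m(3) W, of _ 1 "t * \<mu> k"]) (use cmb in auto)
 then show "edge d w1 w2 c' S \<eta> I k" unfolding edge_def using supp' reg' ku u(2) m by blast
qed

section \<open>Gaussian configurations\<close>

text \<open>The sample \<open>x\<close> is standard Gaussian noise and \<open>cf x\<close> the
  configuration. The deviation varies with the row because the added constraints have noise of their
  own size.\<close>

locale gconf =
 fixes m d :: nat and cb :: rows and sd :: rvec and w1 w2 :: rvec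
 assumes sd: "\<And>i. i < m ==> 0 < sd i" and on: "orthonormal2 d w1 w2"
begin

abbreviation "P \<equiv> {..<m} \<times> {..<d}"
abbreviation "S \<equiv> {..<m}"

definition cf :: "cvec => nat => nat => real" where
 "cf x i l = cb i l + sd i * x (i, l)"

definition rn :: "cvec => nat => real" where
 "rn x i = enorm d (\<lambda>l. x (i, l))"

lemma measurable_cf [measurable]: "i < m ==> l < d ==> (\<lambda>x. cf x i l) \<in> borel_measurable (leb P)"
 unfolding cf_def by measurable

sublocale shadow_meas "leb P" d "\<lambda>_. w1" "\<lambda>_. w2" cf S
 by standard auto

text \<open>\<open>cf x i l / sd i\<close> equals the noise plus \<open>cb i l / sd i\<close>, so
  the configuration entries in \<open>Q\<close> are scaled by \<open>1 + \<tau>\<close>. This is the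
  first half of a dilation about the centroid; \<open>dil_shift\<close> moves the centroid
  back.\<close>

definition dil_scale :: "real => (nat \<times> nat) set => cvec => cvec" where
 "dil_scale \<tau> Q x = (\<lambda>p\<in>P. if p \<in> Q then x p + \<tau> * (x p + cb (fst p) (snd p) / sd (fst p)) else x p)"

lemma jac_dil_scale:
 assumes "finite Q" "Q \<subseteq> P" "0 < 1 + \<tau>"
 shows "jac P (dil_scale \<tau> Q) ((1 + \<tau>) ^ card Q)"
 using assms(1,2)
proof (induction Q rule: finite_induct)
 case empty
 show ?case by (rule jac_cong[of _ "\<lambda>x. x"]) (use jac_id in \<open>auto simp: dil_scale_def space_PiM PiE_restrict\<close>)
next
 case (insert p Q)
 let ?s = "\<lambda>x::cvec. x p + cb (fst p) (snd p) / sd (fst p)" and ?w = "\<lambda>q. if q = p then 1 else (0::real)"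
 have p: "p \<in> P" using insert.prems by simp
 have 1: "jac P (flow P \<tau> ?s ?w) (1 + \<tau>)"
  by (rule jac_flow) (use assms(3) p in auto)
 have 2: "jac P (dil_scale \<tau> Q) ((1 + \<tau>) ^ card Q)" using insert by blast
 have "jac P (\<lambda>x. flow P \<tau> ?s ?w (dil_scale \<tau> Q x)) ((1 + \<tau>) * (1 + \<tau>) ^ card Q)"
  by (rule jac_comp[OF 2 1])
 moreover have "dil_scale \<tau> (insert p Q) x = flow P \<tau> ?s ?w (dil_scale \<tau> Q x)" for x
  using insert.hyps p by (intro ext) (auto simp: dil_scale_def flow_def restrict_def)
 ultimately show ?case using insert.hyps by (simp add: jac_cong)
qed

definition cen :: "nat set => cvec => nat => real" where
 "cen I x l = (\<Sum>i\<in>I. cf x i l) / real d"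

definition dil_shift :: "real => nat set => nat set => cvec => cvec" where
 "dil_shift \<kappa> I L x = (\<lambda>p\<in>P. if fst p \<in> I \<and> snd p \<in> L then x p - \<kappa> * cen I x (snd p) / sd (fst p) else x p)"

text \<open>Moving coordinate \<open>l\<close> of all rows of \<open>I\<close> together advances
  coordinate \<open>l\<close> of the centroid at unit speed, so each coordinate contributes one flow
  with \<open>s\<close> the centroid coordinate, and different coordinates do not disturb each
  other.\<close>

lemma jac_dil_shift:
 assumes "finite L" "L \<subseteq> {..<d}" "\<kappa> < 1" and I: "I \<subseteq> S" "card I = d" "0 < d"
 shows "jac P (dil_shift \<kappa> I L) ((1 - \<kappa>) ^ card L)"
 using assms(1,2)
proof (induction L rule: finite_induct)
 case empty
 show ?case by (rule jac_cong[of _ "\<lambda>x. x"]) (use jac_id in \<open>auto simp: dil_shift_def space_PiM PiE_restrict\<close>)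
next
 case (insert l L)
 let ?s = "\<lambda>x. cen I x l" and ?w = "\<lambda>q. if fst q \<in> I \<and> snd q = l then 1 / sd (fst q) else (0::real)"
 have l: "l < d" using insert.prems by simp
 have Ii: "i < m" if "i \<in> I" for i using I that by auto
 have sdI: "sd i \<noteq> 0" if "i \<in> I" for i using sd[OF Ii[OF that]] by simp
 have 1: "jac P (flow P (- \<kappa>) ?s ?w) (1 + - \<kappa>)"
 proof (rule jac_flow)
  show "?s \<in> borel_measurable (leb P)"
   unfolding cen_def using measurable_cf Ii l by (intro borel_measurable_divide borel_measurable_sum) auto
  fix x :: "cvec" and r :: real
  have "(\<Sum>i\<in>I. cf (\<lambda>p\<in>P. x p + r * ?w p) i l) = (\<Sum>i\<in>I. cf x i l + r)"
   using Ii l sdI by (intro sum.cong) (auto simp: cf_def algebra_simps)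
  also have "\<dots> = (\<Sum>i\<in>I. cf x i l) + real d * r" by (simp add: sum.distrib I)
  finally show "cen I (\<lambda>p\<in>P. x p + r * ?w p) l = cen I x l + r"
   using I(3) by (simp add: cen_def add_divide_distrib)
 qed (use assms(3) in auto)
 have 2: "jac P (dil_shift \<kappa> I L) ((1 - \<kappa>) ^ card L)" using insert by blast
 have "jac P (\<lambda>x. flow P (- \<kappa>) ?s ?w (dil_shift \<kappa> I L x)) ((1 + - \<kappa>) * (1 - \<kappa>) ^ card L)"
  by (rule jac_comp[OF 2 1])
 moreover have "dil_shift \<kappa> I (insert l L) x = flow P (- \<kappa>) ?s ?w (dil_shift \<kappa> I L x)" for x
 proof -
  have "cen I (dil_shift \<kappa> I L x) l = cen I x l"
   unfolding cen_def cf_def using Ii l insert.hyps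
   by (intro arg_cong2[where f = "(/)"] sum.cong) (auto simp: dil_shift_def)
  then show ?thesis using insert.hyps by (intro ext) (auto simp: dil_shift_def flow_def restrict_def)
 qed
 ultimately show ?case using insert.hyps by (simp add: jac_cong)
qed

text \<open>After the scaling the centroid sits at \<open>(1 + \<tau>) * cen\<close>; its fraction
  \<open>\<tau> / (1 + \<tau>)\<close> is the excess \<open>\<tau> * cen\<close>.\<close>

definition dilate :: "real => nat set => cvec => cvec" where
 "dilate \<tau> I x = dil_shift (\<tau> / (1 + \<tau>)) I {..<d} (dil_scale \<tau> (I \<times> {..<d}) x)"

text \<open>The scaling contributes \<open>d * d\<close> factors \<open>1 + \<tau>\<close> and the
  shift only \<open>d\<close> factors \<open>1 / (1 + \<tau>)\<close>, so volume does not
  shrink.\<close>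

lemma dilate_jac:
 assumes "I \<subseteq> S" "card I = d" "0 < d" "0 < \<tau>"
 shows "\<exists>J\<ge>1. jac P (dilate \<tau> I) J"
proof -
 have fI: "finite I" using assms(1) finite_subset by blast
 have 1: "jac P (dil_scale \<tau> (I \<times> {..<d})) ((1 + \<tau>) ^ (d * d))"
  using jac_dil_scale[of "I \<times> {..<d}" \<tau>] assms fI by (auto simp: card_cartesian_product)
 have 2: "jac P (dil_shift (\<tau> / (1 + \<tau>)) I {..<d}) ((1 - \<tau> / (1 + \<tau>)) ^ d)"
  using jac_dil_shift[of "{..<d}" "\<tau> / (1 + \<tau>)" I] assms by auto
 have eq: "1 - \<tau> / (1 + \<tau>) = 1 / (1 + \<tau>)" using assms(4) by (simp add: field_simps)
 have "(1 + \<tau>) ^ d \<le> (1 + \<tau>) ^ (d * d)" using assms by (intro power_increasing) auto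
 then have "1 \<le> (1 - \<tau> / (1 + \<tau>)) ^ d * (1 + \<tau>) ^ (d * d)"
  unfolding eq using assms(4) by (simp add: power_one_over divide_simps)
 then show ?thesis using jac_comp[OF 1 2] unfolding dilate_def[abs_def] by blast
qed

lemma cf_dilate:
 assumes "I \<subseteq> S" "0 < \<tau>" "l < d"
 shows "i \<in> I ==> cf (dilate \<tau> I x) i l = cf x i l + \<tau> * (cf x i l - cen I x l)"
  and "i < m ==> i \<notin> I ==> cf (dilate \<tau> I x) i l = cf x i l"
proof -
 have sc: "cf (dil_scale \<tau> (I \<times> {..<d}) x) i l = (1 + \<tau>) * cf x i l" if "i \<in> I" for i
 proof -
  have "i < m" using assms(1) that by auto
  then show ?thesis using sd[of i] assms(3) that by (simp add: cf_def dil_scale_def field_simps)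
 qed
 then have cn: "cen I (dil_scale \<tau> (I \<times> {..<d}) x) l = (1 + \<tau>) * cen I x l"
  unfolding cen_def by (simp add: sum_distrib_left)
 show "cf (dilate \<tau> I x) i l = cf x i l + \<tau> * (cf x i l - cen I x l)" if i: "i \<in> I"
 proof -
  have im: "i < m" using assms(1) that by auto
  have "cf (dilate \<tau> I x) i l = cf (dil_scale \<tau> (I \<times> {..<d}) x) i l
    - \<tau> / (1 + \<tau>) * cen I (dil_scale \<tau> (I \<times> {..<d}) x) l"
   using sd[OF im] im i assms(3) unfolding dilate_def by (simp add: cf_def dil_shift_def right_diff_distrib)
  moreover have "\<tau> / (1 + \<tau>) * ((1 + \<tau>) * cen I x l) = \<tau> * cen I x l" using assms(2) by simp
  ultimately show ?thesis unfolding sc[OF i] cn by (simp only:) (simp add: algebra_simps)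
 qed
 show "i < m ==> i \<notin> I ==> cf (dilate \<tau> I x) i l = cf x i l"
  using assms(3) unfolding dilate_def by (simp add: cf_def dil_shift_def dil_scale_def)
qed

text \<open>\<open>sD1\<close> and \<open>sD2\<close> are the plane coordinates of the edge vector.
  In the singular case the value has no geometric meaning; it is chosen so that moving row
  \<open>k\<close> within the plane still changes it at unit speed, which \<open>jac_flow\<close>
  demands at every \<open>x\<close>.\<close>

definition sD1 :: "nat set => nat => cvec => real" where
 "sD1 I k x = (if dt (d + 1) (Bm d w1 w2 (cf x) I k) \<noteq> 0
   then slv (d + 1) (Bm d w1 w2 (cf x) I k) (basis_index.rhs_k d k (cf x)) (d - 1) else dot d w1 (cf x k))"

definition sD2 :: "nat set => nat => cvec => real" where
 "sD2 I k x = (if dt (d + 1) (Bm d w1 w2 (cf x) I k) \<noteq> 0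
   then slv (d + 1) (Bm d w1 w2 (cf x) I k) (basis_index.rhs_k d k (cf x)) d else dot d w2 (cf x k))"

definition rowdir :: "nat => rvec => cvec" where
 "rowdir k w p = (if fst p = k then w (snd p) / sd k else 0)"

lemma measurable_sD:
 assumes "basis_index d I k" "I \<subseteq> S"
 shows "sD1 I k \<in> borel_measurable (leb P)" "sD2 I k \<in> borel_measurable (leb P)"
proof -
 interpret basis_index d I k by fact
 have km: "k < m" using kI assms(2) by auto
 have "(\<lambda>x. dot d w (cf x k)) \<in> borel_measurable (leb P)" for w
  unfolding dot_def using measurable_cf km by (intro borel_measurable_sum borel_measurable_times) auto
 then show "sD1 I k \<in> borel_measurable (leb P)" "sD2 I k \<in> borel_measurable (leb P)"
  unfolding sD1_def[abs_def] sD2_def[abs_def]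
  using measurable_slv_Bm(1,3)[OF assms]
  by (auto intro!: measurable_If simp del: One_nat_def)
qed

text \<open>\<open>Bm\<close> omits row \<open>k\<close>, so regularity and the coefficients survive
  the move, and the edge vector takes over the displacement because \<open>v k = 1\<close>.\<close>

lemma sD_move:
 assumes bi: "basis_index d I k" and I: "I \<subseteq> S"
  and c'k: "\<And>l. l < d ==> cf x' k l = cf x k l + r1 * w1 l + r2 * w2 l"
  and c'o: "\<And>i l. i < m ==> i \<noteq> k ==> l < d ==> cf x' i l = cf x i l"
 shows "sD1 I k x' = sD1 I k x + r1" "sD2 I k x' = sD2 I k x + r2"
proof -
 interpret basis_index d I k by fact
 have o: "dot d w1 w1 = 1" "dot d w2 w2 = 1" "dot d w1 w2 = 0" "dot d w2 w1 = 0"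
  using on dot_commute[of d w2 w1] by (auto simp: orthonormal2_def)
 have B: "Bm d w1 w2 (cf x') I k r q = Bm d w1 w2 (cf x) I k r q" if "q < d + 1" for r q
  using c'o en_in[of "I - {k}" q] finI card_Ik I by (auto simp: Bm_def)
 have dtB: "dt (d + 1) (Bm d w1 w2 (cf x') I k) = dt (d + 1) (Bm d w1 w2 (cf x) I k)"
  by (intro dt_cong) (use B in auto)
 have "sD1 I k x' = sD1 I k x + r1 \<and> sD2 I k x' = sD2 I k x + r2"
 proof (cases "dt (d + 1) (Bm d w1 w2 (cf x) I k) = 0")
  case True
  have "dot d (cf x' k) w = dot d (\<lambda>l. cf x k l + (r1 * w1 l + r2 * w2 l)) w" for w
   by (intro dot_cong) (auto simp: c'k)
  then have "dot d (cf x' k) w = dot d (cf x k) w + (r1 * dot d w1 w + r2 * dot d w2 w)" for w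
   by (simp add: dot_add dot_scale)
  then have "dot d w1 (cf x' k) = dot d w1 (cf x k) + r1" "dot d w2 (cf x' k) = dot d w2 (cf x k) + r2"
   unfolding dot_commute[of d w1 "cf x' k"] dot_commute[of d w1 "cf x k"]
    dot_commute[of d w2 "cf x' k"] dot_commute[of d w2 "cf x k"] using o by simp_all
  then show ?thesis using True dtB by (simp add: sD1_def sD2_def)
 next
  case False
  have reg: "regk d w1 w2 (cf x) I k" using False regk_iff_dt[OF on] by blast
  have reg': "regk d w1 w2 (cf x') I k" using False dtB regk_iff_dt[OF on] by simp
  obtain v where v: "kerv d w1 w2 (cf x) I k v" using ex_kerv[OF on reg] by blast
  have cm: "comb (cf x') I v l = comb (cf x) I v l + (r1 * w1 l + r2 * w2 l)" if "l < d" for l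
  proof -
   have "(\<Sum>j\<in>I - {k}. v j * cf x' j l) = (\<Sum>j\<in>I - {k}. v j * cf x j l)"
    using c'o that I by (intro sum.cong) auto
   then show ?thesis unfolding comb_def sum_I using v c'k[OF that] by (simp add: kerv_def)
  qed
  have W0: "inW d w1 w2 (\<lambda>l. r1 * w1 l + r2 * w2 l)" unfolding inW_def by blast
  have vW: "inW d w1 w2 (comb (cf x) I v)" using v by (simp add: kerv_def)
  have "inW d w1 w2 (comb (cf x') I v)"
   by (rule inW_lincomb[OF vW W0, of _ 1 1]) (simp add: cm)
  then have v': "kerv d w1 w2 (cf x') I k v" using v by (auto simp: kerv_def)
  have "dot d (comb (cf x') I v) w = dot d (\<lambda>l. comb (cf x) I v l + (r1 * w1 l + r2 * w2 l)) w" for w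
   by (intro dot_cong) (auto simp: cm)
  then have "dot d (comb (cf x') I v) w = dot d (comb (cf x) I v) w + (r1 * dot d w1 w + r2 * dot d w2 w)" for w
   by (simp add: dot_add dot_scale)
  then have "dot d w1 (comb (cf x') I v) = dot d w1 (comb (cf x) I v) + r1"
   "dot d w2 (comb (cf x') I v) = dot d w2 (comb (cf x) I v) + r2"
   unfolding dot_commute[of d w1 "comb (cf x') I v"] dot_commute[of d w1 "comb (cf x) I v"]
    dot_commute[of d w2 "comb (cf x') I v"] dot_commute[of d w2 "comb (cf x) I v"] using o by simp_all
  then show ?thesis
   using solve_k(2,3)[OF on reg v] solve_k(2,3)[OF on reg' v'] False dtB by (simp add: sD1_def sD2_def)
 qed
 then show "sD1 I k x' = sD1 I k x + r1" "sD2 I k x' = sD2 I k x + r2" by auto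
qed

definition stretch :: "real => nat set => nat => cvec => cvec" where
 "stretch t I k x = flow P t (sD2 I k) (rowdir k w2) (flow P t (sD1 I k) (rowdir k w1) x)"

lemma cf_rowdir:
 assumes "k < m" "l < d" "i < m"
 shows "cf (\<lambda>p\<in>P. x p + r * rowdir k w p) i l = (if i = k then cf x k l + r * w l else cf x i l)"
 using sd[OF assms(1)] assms by (auto simp: cf_def rowdir_def field_simps)

lemma jac_stretch:
 assumes bi: "basis_index d I k" and I: "I \<subseteq> S" and t: "0 < 1 + t"
 shows "jac P (stretch t I k) ((1 + t) * (1 + t))"
proof -
 interpret basis_index d I k by fact
 have km: "k < m" using kI I by auto
 have 1: "jac P (flow P t (sD1 I k) (rowdir k w1)) (1 + t)"
 proof (rule jac_flow)
  show "sD1 I k (\<lambda>p\<in>P. x p + r * rowdir k w1 p) = sD1 I k x + r" for x r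
   by (rule sD_move(1)[OF bi I, where ?r2.0 = 0]) (use km in \<open>simp_all add: cf_rowdir\<close>)
 qed (use measurable_sD[OF bi I] t in auto)
 have 2: "jac P (flow P t (sD2 I k) (rowdir k w2)) (1 + t)"
 proof (rule jac_flow)
  show "sD2 I k (\<lambda>p\<in>P. x p + r * rowdir k w2 p) = sD2 I k x + r" for x r
   by (rule sD_move(2)[OF bi I, where ?r1.0 = 0]) (use km in \<open>simp_all add: cf_rowdir\<close>)
 qed (use measurable_sD[OF bi I] t in auto)
 show ?thesis unfolding stretch_def[abs_def] by (rule jac_comp[OF 1 2])
qed

text \<open>Moving row \<open>k\<close> along \<open>w1\<close> does not change the coordinate along
  \<open>w2\<close>, so the second flow may use its value at the original point.\<close>

lemma stretch_eq:
 assumes bi: "basis_index d I k" and I: "I \<subseteq> S"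
 shows "stretch t I k x = (\<lambda>p\<in>P. x p + (t * sD1 I k x * rowdir k w1 p + t * sD2 I k x * rowdir k w2 p))"
proof -
 interpret basis_index d I k by fact
 have km: "k < m" using kI I by auto
 have "sD2 I k (flow P t (sD1 I k) (rowdir k w1) x) = sD2 I k x + 0"
  unfolding flow_def
  by (rule sD_move(2)[OF bi I, where ?r1.0 = "t * sD1 I k x"]) (use km in \<open>simp_all add: cf_rowdir\<close>)
 then show ?thesis unfolding stretch_def by (intro ext) (simp add: flow_def restrict_def)
qed

lemma cf_stretch:
 assumes bi: "basis_index d I k" and I: "I \<subseteq> S" and l: "l < d"
 shows "cf (stretch t I k x) k l = cf x k l + t * (sD1 I k x * w1 l + sD2 I k x * w2 l)"
  and "i < m ==> i \<noteq> k ==> cf (stretch t I k x) i l = cf x i l"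
proof -
 interpret basis_index d I k by fact
 have km: "k < m" using kI I by auto
 show "cf (stretch t I k x) k l = cf x k l + t * (sD1 I k x * w1 l + sD2 I k x * w2 l)"
  using sd[OF km] km l unfolding stretch_eq[OF bi I] by (simp add: cf_def rowdir_def field_simps)
 show "i < m ==> i \<noteq> k ==> cf (stretch t I k x) i l = cf x i l"
  using l unfolding stretch_eq[OF bi I] by (simp add: cf_def rowdir_def)
qed

lemma comb_eq_sD:
 assumes bi: "basis_index d I k" and v: "kerv d w1 w2 (cf x) I k v" and reg: "regk d w1 w2 (cf x) I k" and l: "l < d"
 shows "comb (cf x) I v l = sD1 I k x * w1 l + sD2 I k x * w2 l"
proof -
 interpret basis_index d I k by fact
 have "inW d w1 w2 (comb (cf x) I v)" using v by (simp add: kerv_def)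
 from inW_dot[OF on this l] show ?thesis
  using solve_k(2,3)[OF on reg v] reg regk_iff_dt[OF on] by (simp add: sD1_def sD2_def)
qed

end

section \<open>Few long edges\<close>

lemma enorm_sq: "(enorm d x)\<^sup>2 = dot d x x"
 unfolding enorm_def L2_set_def dot_def by (simp add: sum_nonneg power2_eq_square)

lemma enorm_nonneg [simp]: "0 \<le> enorm d x"
 unfolding enorm_def by simp

lemma abs_dot_le: "\<bar>dot d x y\<bar> \<le> enorm d x * enorm d y"
proof -
 have "\<bar>dot d x y\<bar> \<le> (\<Sum>k<d. \<bar>x k\<bar> * \<bar>y k\<bar>)"
  unfolding dot_def using sum_abs[of "\<lambda>k. x k * y k" "{..<d}"] by (simp add: abs_mult)
 also have "\<dots> \<le> L2_set x {..<d} * L2_set y {..<d}" by (rule L2_set_mult_ineq)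
 finally show ?thesis unfolding enorm_def .
qed

lemma enorm_add: "enorm d (\<lambda>l. x l + y l) \<le> enorm d x + enorm d y"
 unfolding enorm_def by (rule L2_set_triangle_ineq)

lemma enorm_scale: "enorm d (\<lambda>l. r * x l) = \<bar>r\<bar> * enorm d x"
proof -
 have "L2_set (\<lambda>l. r * x l) {..<d} = sqrt (r\<^sup>2 * (\<Sum>i<d. (x i)\<^sup>2))"
  unfolding L2_set_def by (simp add: power_mult_distrib sum_distrib_left)
 then show ?thesis unfolding enorm_def by (simp add: real_sqrt_mult L2_set_def)
qed

lemma enorm_cong: "(\<And>l. l < d ==> x l = y l) ==> enorm d x = enorm d y"
 unfolding enorm_def by (intro L2_set_cong) auto

lemma enorm_diff: "enorm d (\<lambda>l. x l - y l) \<le> enorm d x + enorm d y"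
 using enorm_add[of d x "\<lambda>l. (-1) * y l"] enorm_scale[of d "-1" y] by simp

lemma enorm_sum_le: "finite I ==> enorm d (\<lambda>l. \<Sum>j\<in>I. f j l) \<le> (\<Sum>j\<in>I. enorm d (f j))"
proof (induction I rule: finite_induct)
 case empty
 show ?case by (simp add: enorm_def L2_set_def)
next
 case (insert j I)
 have "enorm d (\<lambda>l. \<Sum>j\<in>insert j I. f j l) = enorm d (\<lambda>l. f j l + (\<Sum>j\<in>I. f j l))" using insert.hyps by simp
 also have "\<dots> \<le> enorm d (f j) + enorm d (\<lambda>l. \<Sum>j\<in>I. f j l)" by (rule enorm_add)
 finally show ?case using insert by simp
qed

lemma enorm_convex_le:
 assumes "finite I" "\<forall>j\<in>I. 0 \<le> \<mu> j" "(\<Sum>j\<in>I. \<mu> j) = 1" "\<And>j. j \<in> I ==> enorm d (c j) \<le> M"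
 shows "enorm d (comb c I \<mu>) \<le> M"
proof -
 have "enorm d (comb c I \<mu>) \<le> (\<Sum>j\<in>I. enorm d (\<lambda>l. \<mu> j * c j l))"
  unfolding comb_def[abs_def] by (rule enorm_sum_le[OF assms(1)])
 also have "\<dots> = (\<Sum>j\<in>I. \<mu> j * enorm d (c j))" using assms(2) by (simp add: enorm_scale)
 also have "\<dots> \<le> (\<Sum>j\<in>I. \<mu> j * M)" using assms(2,4) by (intro sum_mono mult_left_mono) auto
 finally show ?thesis using assms(3) by (simp add: sum_distrib_right[symmetric])
qed

text \<open>Equivalently, no hyperplane off the origin contains more than \<open>d\<close> of the
  points, so that a facet is determined by any of its index sets.\<close>

definition gp :: "nat => rows => nat set => bool" where
 "gp d c S \<longleftrightarrow> (\<forall>I J. I \<subseteq> S \<and> J \<subseteq> S \<and> card I = d \<and> card J = d \<and> I \<noteq> J \<longrightarrow>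
   \<not> (\<exists>y. \<forall>i\<in>I \<union> J. dot d (c i) y = 1))"

text \<open>
 A line in the plane meets the relative interiors of at most two edges: the supporting line at the
 middle one of three collinear boundary points would contain another facet.
\<close>

lemma collinear_edges:
 assumes gp: "gp d c S" and fin: "finite S"
  and I: "\<And>i. i \<in> {1, 2, 3::nat} ==> I i \<subseteq> S \<and> card (I i) = d \<and> supp d c S (I i)"
  and dist: "I 1 \<noteq> I 2" "I 3 \<noteq> I 2"
  and pos: "\<And>i j. i \<in> {1, 2, 3::nat} ==> j \<in> I i ==> 0 < \<mu> i j"
  and one: "\<And>i. i \<in> {1, 2, 3::nat} ==> (\<Sum>j\<in>I i. \<mu> i j) = 1"
  and line: "\<And>i l. i \<in> {1, 2, 3::nat} ==> l < d ==> comb c (I i) (\<mu> i) l = u l + b i * w l"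
  and ord: "b 1 \<le> b 2" "b 2 \<le> b (3::nat)"
 shows False
proof -
 obtain y where y: "\<forall>i\<in>I 2. dot d (c i) y = 1" "\<forall>j\<in>S. dot d (c j) y \<le> 1"
  using I[of 2] unfolding supp_def by auto
 define g where "g i = dot d (comb c (I i) (\<mu> i)) y" for i
 have fI: "finite (I i)" if "i \<in> {1, 2, 3}" for i using I[OF that] fin finite_subset by blast
 have gs: "g i = (\<Sum>j\<in>I i. \<mu> i j * dot d (c j) y)" if "i \<in> {1, 2, 3}" for i
  unfolding g_def by (rule dot_comb[OF fI[OF that]])
 have le: "g i \<le> 1" if "i \<in> {1, 2, 3}" for i
 proof -
  have "g i \<le> (\<Sum>j\<in>I i. \<mu> i j * 1)"
   unfolding gs[OF that] using y(2) I[OF that] pos[OF that] by (intro sum_mono mult_left_mono) (auto simp: less_imp_le)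
  then show ?thesis using one[OF that] by simp
 qed
 have lt: "g i < 1" if i: "i \<in> {1, 3}" for i
 proof (rule ccontr)
  have i3: "i \<in> {1, 2, 3}" using i by auto
  assume "\<not> g i < 1"
  then have "g i = 1" using le[OF i3] by simp
  then have "(\<Sum>j\<in>I i. \<mu> i j * (1 - dot d (c j) y)) = 0"
   using gs[OF i3] one[OF i3] by (simp add: right_diff_distrib sum_subtractf)
  moreover have "0 \<le> \<mu> i j * (1 - dot d (c j) y)" if "j \<in> I i" for j
   using pos[OF i3 that] y(2) I[OF i3] that by (intro mult_nonneg_nonneg) (auto simp: less_imp_le)
  ultimately have "\<forall>j\<in>I i. \<mu> i j * (1 - dot d (c j) y) = 0"
   using sum_nonneg_eq_0_iff[OF fI[OF i3], of "\<lambda>j. \<mu> i j * (1 - dot d (c j) y)"] by auto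
  then have "\<forall>j\<in>I i \<union> I 2. dot d (c j) y = 1" using y(1) pos[OF i3] by force
  moreover have "I i \<noteq> I 2" using i dist by auto
  ultimately show False using gp I[OF i3] I[of 2] unfolding gp_def by blast
 qed
 have g2: "g 2 = 1" using gs[of 2] y(1) one[of 2] by simp
 \<comment> \<open>Along the line \<open>y\<close> is affine; it equals 1 at the middle point but is
   smaller at both outer points, which is impossible for an affine function.\<close>
 have lin: "g i = dot d u y + b i * dot d w y" if "i \<in> {1, 2, 3}" for i
 proof -
  have "g i = dot d (\<lambda>l. u l + b i * w l) y" unfolding g_def by (intro dot_cong) (auto simp: line[OF that])
  then show ?thesis by (simp add: dot_add dot_scale)
 qed
 have "b 1 * dot d w y < b 2 * dot d w y" "b 3 * dot d w y < b 2 * dot d w y"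
  using lt[of 1] lt[of 3] g2 lin[of 1] lin[of 2] lin[of 3] by auto
 then show False using ord by (smt (verit) mult_right_mono mult_right_mono_neg)
qed

lemma sort3:
 fixes b :: "'a => real"
 assumes "distinct [x, y, z]"
 obtains p q r where "{p, q, r} = {x, y, z}" "distinct [p, q, r]" "b p \<le> b q" "b q \<le> b r"
proof -
 consider "b x \<le> b y \<and> b y \<le> b z" | "b x \<le> b z \<and> b z \<le> b y" | "b y \<le> b x \<and> b x \<le> b z"
  | "b y \<le> b z \<and> b z \<le> b x" | "b z \<le> b x \<and> b x \<le> b y" | "b z \<le> b y \<and> b y \<le> b x" by linarith
 then show thesis
  by cases (use assms that[of x y z] that[of x z y] that[of y x z] that[of y z x] that[of z x y] that[of z y x] in auto)
qed

text \<open>Project the edges to the axis \<open>w\<close>. Around the image of the point with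
  weights \<open>\<mu> I\<close> every edge covers, by relative interior points, an open interval
  whose radius is the summand. All intervals lie in \<open>{- M..M}\<close>, and no value is covered
  three times, because the three points would lie on one line of the plane orthogonal to
  \<open>w\<close>.\<close>

lemma sum_edge_widths_le:
 assumes on: "orthonormal2 d w w'" and gp: "gp d c S" and fin: "finite S"
  and M: "\<And>i. i \<in> S ==> enorm d (c i) \<le> M"
  and F: "finite F" "\<And>I. I \<in> F ==> I \<subseteq> S \<and> card I = d \<and> supp d c S I"
  and \<mu>: "\<And>I j. I \<in> F ==> j \<in> I ==> \<eta> \<le> \<mu> I j" "\<And>I. I \<in> F ==> (\<Sum>j\<in>I. \<mu> I j) = 1" "\<And>I. I \<in> F ==> inW d w w' (comb c I (\<mu> I))"
  and v: "\<And>I j. I \<in> F ==> j \<in> I ==> \<bar>v I j\<bar> \<le> 1" "\<And>I. I \<in> F ==> (\<Sum>j\<in>I. v I j) = 0" "\<And>I. I \<in> F ==> inW d w w' (comb c I (v I))"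
  and \<eta>: "0 < \<eta>" and M0: "0 \<le> M"
 shows "(\<Sum>I\<in>F. \<eta> * \<bar>dot d w (comb c I (v I))\<bar>) \<le> 2 * M"
proof -
 define A where "A I = dot d w (comb c I (\<mu> I))" for I
 define B where "B I = dot d w (comb c I (v I))" for I
 define r where "r I = \<eta> * \<bar>B I\<bar>" for I
 define O' where "O' I = {A I - r I<..<A I + r I}" for I
 have fI: "finite I" if "I \<in> F" for I using F(2)[OF that] fin finite_subset by blast
 have w1: "enorm d w = 1"
  using on enorm_sq[of d w] enorm_nonneg[of d w] by (simp add: orthonormal2_def power2_eq_1_iff)
 have pt: "\<exists>\<nu>. (\<forall>j\<in>I. 0 < \<nu> j) \<and> (\<Sum>j\<in>I. \<nu> j) = 1 \<and> inW d w w' (comb c I \<nu>) \<and> dot d w (comb c I \<nu>) = a"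
  if I: "I \<in> F" and a: "a \<in> O' I" for I a
 proof -
  have "B I \<noteq> 0" using a by (auto simp: O'_def r_def)
  define t where "t = (a - A I) / B I"
  have "\<bar>a - A I\<bar> < \<eta> * \<bar>B I\<bar>" using a by (auto simp: O'_def r_def)
  then have t: "\<bar>t\<bar> < \<eta>" using \<open>B I \<noteq> 0\<close> by (simp add: t_def abs_divide pos_divide_less_eq)
  have cm: "comb c I (\<lambda>j. \<mu> I j + t * v I j) l = comb c I (\<mu> I) l + t * comb c I (v I) l" for l
   unfolding comb_def by (simp add: algebra_simps sum.distrib sum_distrib_left)
  show ?thesis
  proof (intro exI[of _ "\<lambda>j. \<mu> I j + t * v I j"] conjI ballI)
   fix j assume j: "j \<in> I"
   have "\<bar>t * v I j\<bar> \<le> \<bar>t\<bar>" using v(1)[OF I j] by (simp add: abs_mult mult_left_le)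
   then show "0 < \<mu> I j + t * v I j" using \<mu>(1)[OF I j] t by linarith
  next
   show "(\<Sum>j\<in>I. \<mu> I j + t * v I j) = 1"
    using \<mu>(2)[OF I] v(2)[OF I] by (simp add: sum.distrib sum_distrib_left[symmetric])
   show "inW d w w' (comb c I (\<lambda>j. \<mu> I j + t * v I j))"
    by (rule inW_lincomb[OF \<mu>(3)[OF I] v(3)[OF I], of _ 1 t]) (simp add: cm)
   have "dot d w (comb c I (\<lambda>j. \<mu> I j + t * v I j)) = A I + t * B I"
    unfolding A_def B_def by (simp add: cm[abs_def] dot_commute[of d w] dot_add dot_scale)
   then show "dot d w (comb c I (\<lambda>j. \<mu> I j + t * v I j)) = a" using \<open>B I \<noteq> 0\<close> by (simp add: t_def)
  qed
 qed
 have bnd: "\<bar>a\<bar> \<le> M" if I: "I \<in> F" and a: "a \<in> O' I" for I a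
 proof -
  obtain \<nu> where n: "\<forall>j\<in>I. 0 < \<nu> j" "(\<Sum>j\<in>I. \<nu> j) = 1" "dot d w (comb c I \<nu>) = a" using pt[OF I a] by blast
  have "enorm d (comb c I \<nu>) \<le> M"
   by (rule enorm_convex_le[OF fI[OF I] _ n(2)]) (use n(1) F(2)[OF I] M in \<open>auto simp: less_imp_le\<close>)
  then show ?thesis using abs_dot_le[of d w "comb c I \<nu>"] w1 n(3) by simp
 qed
 have two: "card {I \<in> F. a \<in> O' I} \<le> 2" for a
 proof (rule ccontr)
  assume "\<not> card {I \<in> F. a \<in> O' I} \<le> 2"
  then have "3 \<le> card {I \<in> F. a \<in> O' I}" by simp
  then obtain X where X: "X \<subseteq> {I \<in> F. a \<in> O' I}" "card X = 3" using obtain_subset_with_card_n by metis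
  then obtain x y z where xyz: "X = {x, y, z}" "distinct [x, y, z]"
   by (auto simp: card_3_iff)
  define \<nu> where "\<nu> I = (SOME \<nu>. (\<forall>j\<in>I. 0 < \<nu> j) \<and> (\<Sum>j\<in>I. \<nu> j) = 1 \<and> inW d w w' (comb c I \<nu>) \<and> dot d w (comb c I \<nu>) = a)" for I
  have n: "(\<forall>j\<in>I. 0 < \<nu> I j) \<and> (\<Sum>j\<in>I. \<nu> I j) = 1 \<and> inW d w w' (comb c I (\<nu> I)) \<and> dot d w (comb c I (\<nu> I)) = a"
   if "I \<in> X" for I
  proof -
   have "\<exists>\<nu>. (\<forall>j\<in>I. 0 < \<nu> j) \<and> (\<Sum>j\<in>I. \<nu> j) = 1 \<and> inW d w w' (comb c I \<nu>) \<and> dot d w (comb c I \<nu>) = a"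
    by (rule pt) (use X that in auto)
   from someI_ex[OF this] show ?thesis unfolding \<nu>_def .
  qed
  obtain p q s where pqs: "{p, q, s} = {x, y, z}" "distinct [p, q, s]"
   "dot d w' (comb c p (\<nu> p)) \<le> dot d w' (comb c q (\<nu> q))" "dot d w' (comb c q (\<nu> q)) \<le> dot d w' (comb c s (\<nu> s))"
   using sort3[OF xyz(2), of "\<lambda>I. dot d w' (comb c I (\<nu> I))"] by blast
  define II where "II i = (if i = 1 then p else if i = 2 then q else s)" for i :: nat
  have II: "II i \<in> X" for i using pqs(1) xyz(1) by (auto simp: II_def)
  show False
  proof (rule collinear_edges[OF gp fin, of II "\<lambda>i. \<nu> (II i)" "\<lambda>l. a * w l" "\<lambda>i. dot d w' (comb c (II i) (\<nu> (II i)))" w'])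
   show "II i \<subseteq> S \<and> card (II i) = d \<and> supp d c S (II i)" for i using F(2) II X(1) by blast
   show "II 1 \<noteq> II 2" "II 3 \<noteq> II 2" using pqs(2) by (auto simp: II_def)
   show "0 < \<nu> (II i) j" if "j \<in> II i" for i j using n[OF II] that by blast
   show "(\<Sum>j\<in>II i. \<nu> (II i) j) = 1" for i using n[OF II] by blast
   show "comb c (II i) (\<nu> (II i)) l = a * w l + dot d w' (comb c (II i) (\<nu> (II i))) * w' l" if "l < d" for i l
    using inW_dot[OF on _ that, of "comb c (II i) (\<nu> (II i))"] n[OF II, of i] by simp
  qed (use pqs in \<open>auto simp: II_def\<close>)
 qed
 \<comment> \<open>Each interval has length \<open>2 * r I\<close>; integrating the multiplicity,
   which is at most 2 and vanishes outside \<open>{- M..M}\<close>, bounds the sum by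
   \<open>4 * M\<close>.\<close>
 have "ennreal (\<Sum>I\<in>F. 2 * r I) = (\<Sum>I\<in>F. emeasure lborel (O' I))"
  using \<eta> by (simp add: O'_def r_def sum_ennreal)
 also have "\<dots> = (\<integral>\<^sup>+a. (\<Sum>I\<in>F. indicator (O' I) a) \<partial>lborel)"
  by (subst nn_integral_sum) (auto simp: O'_def)
 also have "\<dots> \<le> (\<integral>\<^sup>+a. 2 * indicator {-M..M} a \<partial>lborel)"
 proof (rule nn_integral_mono)
  fix a :: real
  show "(\<Sum>I\<in>F. indicator (O' I) a) \<le> (2 * indicator {-M..M} a :: ennreal)"
  proof (cases "\<exists>I\<in>F. a \<in> O' I")
   case True
   then have "a \<in> {-M..M}" using bnd by fastforce
   moreover have "(\<Sum>I\<in>F. indicator (O' I) a) = (of_nat (card {I \<in> F. a \<in> O' I}) :: ennreal)"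
    using F(1) by (simp add: indicator_def sum.If_cases Int_def)
   moreover have "(of_nat (card {I \<in> F. a \<in> O' I}) :: ennreal) \<le> 2"
    using two[of a] of_nat_mono[of _ 2, where 'a = ennreal] by simp
   ultimately show ?thesis by simp
  next
   case False
   then have "(\<Sum>I\<in>F. indicator (O' I) a) = (0::ennreal)" by (intro sum.neutral) auto
   then show ?thesis by simp
  qed
 qed
 also have "\<dots> = 2 * emeasure lborel {-M..M}" by (simp add: nn_integral_cmult)
 finally have le: "ennreal (\<Sum>I\<in>F. 2 * r I) \<le> 2 * emeasure lborel {-M..M}" .
 have "2 * emeasure lborel {-M..M} = ennreal (4 * M)"
  using M0 by (simp add: ennreal_mult[symmetric] ennreal_numeral[symmetric] del: ennreal_numeral)
 with le have "ennreal (\<Sum>I\<in>F. 2 * r I) \<le> ennreal (4 * M)" by simp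
 then have "(\<Sum>I\<in>F. 2 * r I) \<le> 4 * M" using M0 by (subst (asm) ennreal_le_iff) auto
 then show ?thesis unfolding r_def B_def by (simp add: sum_distrib_left[symmetric])
qed

text \<open>The coordinates of a vector of length at least \<open>\<epsilon>\<close> have absolute
  sum at least \<open>\<epsilon>\<close>, and the widths along each of the two axes, scaled by
  \<open>\<eta>\<close>, add up to at most \<open>2 * M\<close>.\<close>

lemma card_long_edges:
 assumes on: "orthonormal2 d w1 w2" and gp: "gp d c S" and fin: "finite S"
  and M: "\<And>i. i \<in> S ==> enorm d (c i) \<le> M" and M0: "0 \<le> M" and \<eta>: "0 < \<eta>" and \<epsilon>: "0 < \<epsilon>"
  and F: "\<And>I. I \<in> F ==> I \<subseteq> S \<and> card I = d"
  and long: "\<And>I. I \<in> F ==> \<exists>k\<in>I. \<exists>v. edge d w1 w2 c S \<eta> I k \<and> kerv d w1 w2 c I k v \<and> (\<forall>j\<in>I. \<bar>v j\<bar> \<le> 1) \<and>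
    \<epsilon>\<^sup>2 \<le> (dot d w1 (comb c I v))\<^sup>2 + (dot d w2 (comb c I v))\<^sup>2"
 shows "real (card F) * (\<eta> * \<epsilon>) \<le> 4 * M"
proof -
 have finF: "finite F" using F fin by (intro finite_subset[of F "Pow S"]) auto
 define R where "R I v \<mu> \<longleftrightarrow> supp d c S I \<and> (\<forall>j\<in>I. \<bar>v j\<bar> \<le> 1) \<and> (\<Sum>j\<in>I. v j) = 0 \<and> inW d w1 w2 (comb c I v) \<and>
   \<epsilon>\<^sup>2 \<le> (dot d w1 (comb c I v))\<^sup>2 + (dot d w2 (comb c I v))\<^sup>2 \<and>
   (\<forall>j\<in>I. \<eta> \<le> \<mu> j) \<and> (\<Sum>j\<in>I. \<mu> j) = 1 \<and> inW d w1 w2 (comb c I \<mu>)" for I v \<mu>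
 have "\<forall>I\<in>F. \<exists>v \<mu>. R I v \<mu>"
 proof
  fix I assume "I \<in> F"
  from long[OF this] obtain k v where kv: "edge d w1 w2 c S \<eta> I k" "kerv d w1 w2 c I k v" "\<forall>j\<in>I. \<bar>v j\<bar> \<le> 1"
    "\<epsilon>\<^sup>2 \<le> (dot d w1 (comb c I v))\<^sup>2 + (dot d w2 (comb c I v))\<^sup>2" by blast
  from kv(1) obtain \<mu> where "\<forall>j\<in>I. \<eta> \<le> \<mu> j" "(\<Sum>j\<in>I. \<mu> j) = 1" "inW d w1 w2 (comb c I \<mu>)"
   unfolding edge_def by blast
  then have "R I v \<mu>" using kv unfolding R_def edge_def kerv_def by blast
  then show "\<exists>v \<mu>. R I v \<mu>" by blast
 qed
 from bchoice[OF this] obtain v where "\<forall>I\<in>F. \<exists>\<mu>. R I (v I) \<mu>" by blast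
 from bchoice[OF this] obtain \<mu> where R: "\<forall>I\<in>F. R I (v I) (\<mu> I)" by blast
 have *: "supp d c S I \<and> (\<forall>j\<in>I. \<bar>v I j\<bar> \<le> 1) \<and> (\<Sum>j\<in>I. v I j) = 0 \<and> inW d w1 w2 (comb c I (v I)) \<and>
   \<epsilon>\<^sup>2 \<le> (dot d w1 (comb c I (v I)))\<^sup>2 + (dot d w2 (comb c I (v I)))\<^sup>2 \<and>
   (\<forall>j\<in>I. \<eta> \<le> \<mu> I j) \<and> (\<Sum>j\<in>I. \<mu> I j) = 1 \<and> inW d w1 w2 (comb c I (\<mu> I))" if "I \<in> F" for I
  using R that unfolding R_def by blast
 have vm: "\<And>I j. I \<in> F ==> j \<in> I ==> \<bar>v I j\<bar> \<le> 1" "\<And>I. I \<in> F ==> (\<Sum>j\<in>I. v I j) = 0"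
  "\<And>I. I \<in> F ==> inW d w1 w2 (comb c I (v I))" "\<And>I j. I \<in> F ==> j \<in> I ==> \<eta> \<le> \<mu> I j"
  "\<And>I. I \<in> F ==> (\<Sum>j\<in>I. \<mu> I j) = 1" "\<And>I. I \<in> F ==> inW d w1 w2 (comb c I (\<mu> I))"
  by (insert *, blast+)
 have sw: "inW d w2 w1 u" if uW: "inW d w1 w2 u" for u
 proof -
  obtain s1 s2 where "\<forall>l<d. u l = s1 * w1 l + s2 * w2 l" using uW unfolding inW_def by blast
  then have "\<forall>l<d. u l = s2 * w2 l + s1 * w1 l" by simp
  then show ?thesis unfolding inW_def by blast
 qed
 have on2: "orthonormal2 d w2 w1" using on dot_commute[of d w1 w2] by (simp add: orthonormal2_def)
 have 1: "(\<Sum>I\<in>F. \<eta> * \<bar>dot d w1 (comb c I (v I))\<bar>) \<le> 2 * M"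
  by (rule sum_edge_widths_le[OF on gp fin M finF, of \<eta> \<mu> v]) (simp_all add: *[THEN conjunct1] F vm \<eta> M0)
 have 2: "(\<Sum>I\<in>F. \<eta> * \<bar>dot d w2 (comb c I (v I))\<bar>) \<le> 2 * M"
  by (rule sum_edge_widths_le[OF on2 gp fin M finF, of \<eta> \<mu> v]) (simp_all add: *[THEN conjunct1] F vm \<eta> M0 sw)
 have ge: "\<epsilon> \<le> \<bar>dot d w1 (comb c I (v I))\<bar> + \<bar>dot d w2 (comb c I (v I))\<bar>" if "I \<in> F" for I
 proof -
  let ?a = "\<bar>dot d w1 (comb c I (v I))\<bar>" and ?b = "\<bar>dot d w2 (comb c I (v I))\<bar>"
  have "\<epsilon>\<^sup>2 \<le> ?a\<^sup>2 + ?b\<^sup>2" using *[OF that] by simp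
  also have "\<dots> \<le> (?a + ?b)\<^sup>2" by (simp add: power2_sum)
  finally show ?thesis by (rule power2_le_imp_le) simp
 qed
 have "real (card F) * (\<eta> * \<epsilon>) = (\<Sum>I\<in>F. \<eta> * \<epsilon>)" by simp
 also have "\<dots> \<le> (\<Sum>I\<in>F. \<eta> * (\<bar>dot d w1 (comb c I (v I))\<bar> + \<bar>dot d w2 (comb c I (v I))\<bar>))"
  using ge \<eta> by (intro sum_mono mult_left_mono) auto
 also have "\<dots> = (\<Sum>I\<in>F. \<eta> * \<bar>dot d w1 (comb c I (v I))\<bar>) + (\<Sum>I\<in>F. \<eta> * \<bar>dot d w2 (comb c I (v I))\<bar>)"
  by (simp add: distrib_left sum.distrib)
 finally show ?thesis using 1 2 by simp
qed

section \<open>Smoothed shadows have few edges\<close>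

context gconf
begin

lemma finP [simp]: "finite P" by simp

lemma kerv_bound_unique:
 assumes bi: "basis_index d I k" and e: "edge d w1 w2 (cf x) S \<eta> I k"
 shows "\<exists>v. kerv d w1 w2 (cf x) I k v \<and> (\<forall>j\<in>I. \<bar>v j\<bar> \<le> 1) \<and>
   dot d w1 (comb (cf x) I v) = sD1 I k x \<and> dot d w2 (comb (cf x) I v) = sD2 I k x"
proof -
 interpret basis_index d I k by fact
 obtain v where v: "kerv d w1 w2 (cf x) I k v" "\<forall>j\<in>I. \<bar>v j\<bar> \<le> 1" using e unfolding edge_def by blast
 have reg: "regk d w1 w2 (cf x) I k" using e unfolding edge_def by blast
 then have "dt (d + 1) (Bm d w1 w2 (cf x) I k) \<noteq> 0" using regk_iff_dt[OF on] by blast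
 then show ?thesis using v solve_k(2,3)[OF on reg v(1)] by (intro exI[of _ v]) (simp add: sD1_def sD2_def)
qed

lemma edge_cf_dilate:
 assumes bi: "basis_index d I k" and I: "I \<subseteq> S" and e: "edge d w1 w2 (cf x) S 0 I k" and \<tau>: "0 < \<tau>"
 shows "edge d w1 w2 (cf (dilate \<tau> I x)) S (\<tau> / (real d * (1 + \<tau>))) I k"
proof -
 \<comment> \<open>\<open>edge_dilate\<close> asks for agreement at every index outside
   \<open>I\<close>, but the dilation controls only rows below \<open>m\<close>. \<open>?c'\<close>
   agrees with the dilated configuration on all rows that matter.\<close>
 let ?c' = "\<lambda>i. if i < m then cf (dilate \<tau> I x) i else cf x i"
 have "edge d w1 w2 ?c' S (\<tau> / (real d * (1 + \<tau>))) I k"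
  by (rule edge_dilate[OF bi e \<tau>]) (use I cf_dilate[OF I \<tau>] in \<open>auto simp: cen_def\<close>)
 moreover have "supp d ?c' S I = supp d (cf (dilate \<tau> I x)) S I"
 proof -
  have "lin_indep d ?c' I = lin_indep d (cf (dilate \<tau> I x)) I"
  proof -
   have "(\<Sum>i\<in>I. l i * ?c' i k) = (\<Sum>i\<in>I. l i * cf (dilate \<tau> I x) i k)" for l k
    using I by (intro sum.cong) auto
   then show ?thesis unfolding lin_indep_def by simp
  qed
  then show ?thesis unfolding supp_def using I by auto
 qed
 moreover have "comb ?c' J v l = comb (cf (dilate \<tau> I x)) J v l" if "J \<subseteq> I" for J v l
  using that I by (intro comb_cong) auto
 then have "comb ?c' I v = comb (cf (dilate \<tau> I x)) I v" "comb ?c' (I - {k}) v = comb (cf (dilate \<tau> I x)) (I - {k}) v" for v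
  by auto
 ultimately show ?thesis unfolding edge_def regk_def kerv_def by simp
qed

lemma edge_cf_stretch:
 assumes bi: "basis_index d I k" and I: "I \<subseteq> S" and e: "edge d w1 w2 (cf x) S \<eta> I k" and t: "0 < 1 + t"
 shows "edge d w1 w2 (cf (stretch t I k x)) S \<eta> I k"
  "sD1 I k (stretch t I k x) = (1 + t) * sD1 I k x" "sD2 I k (stretch t I k x) = (1 + t) * sD2 I k x"
proof -
 interpret basis_index d I k by fact
 let ?x' = "stretch t I k x"
 have km: "k < m" using kI I by auto
 let ?c' = "\<lambda>i. if i < m then cf ?x' i else cf x i"
 obtain v where v: "kerv d w1 w2 (cf x) I k v" using e unfolding edge_def by blast
 have reg: "regk d w1 w2 (cf x) I k" using e unfolding edge_def by blast
 have "edge d w1 w2 ?c' S \<eta> I k"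
  by (rule edge_stretch(1)[OF bi e v t]) (use km cf_stretch[OF bi I] comb_eq_sD[OF bi v reg] in auto)
 moreover have "supp d ?c' S I = supp d (cf ?x') S I"
 proof -
  have "lin_indep d ?c' I = lin_indep d (cf ?x') I"
  proof -
   have "(\<Sum>i\<in>I. l i * ?c' i k) = (\<Sum>i\<in>I. l i * cf ?x' i k)" for l k
    using I by (intro sum.cong) auto
   then show ?thesis unfolding lin_indep_def by simp
  qed
  then show ?thesis unfolding supp_def using I by auto
 qed
 moreover have "comb ?c' J v l = comb (cf ?x') J v l" if "J \<subseteq> I" for J v l
  using that I by (intro comb_cong) auto
 then have "comb ?c' I v = comb (cf ?x') I v" "comb ?c' (I - {k}) v = comb (cf ?x') (I - {k}) v" for v
  by auto
 ultimately show "edge d w1 w2 (cf ?x') S \<eta> I k" unfolding edge_def regk_def kerv_def by simp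
 have "cf ?x' k l = cf x k l + (t * sD1 I k x) * w1 l + (t * sD2 I k x) * w2 l" if "l < d" for l
  using cf_stretch(1)[OF bi I that] by (simp add: algebra_simps)
 from sD_move[OF bi I this] cf_stretch(2)[OF bi I]
 show "sD1 I k ?x' = (1 + t) * sD1 I k x" "sD2 I k ?x' = (1 + t) * sD2 I k x"
  by (simp_all add: algebra_simps)
qed

text \<open>A displacement \<delta> of a row \<open>x\<close> of the noise adds twice the inner
  product of \<open>x\<close> and \<delta> plus the squared norm of \<delta>. \<open>K\<close>
  dominates \<open>M / sd i\<close> times the norm of the noise and also the square of
  \<open>M / sd i\<close>, so a displacement \<open>a i\<close> in units of \<open>M\<close> costs
  about \<open>K * a i\<close> in the exponent.\<close>

lemma norm_change:
 assumes a: "\<And>i. i < m ==> enorm d (\<lambda>l. cf x' i l - cf x i l) \<le> a i * M" "\<And>i. i < m ==> 0 \<le> a i"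
  and K: "\<And>i. i < m ==> (M / sd i) * rn x i \<le> K" "\<And>i. i < m ==> (M / sd i)\<^sup>2 \<le> K" and M: "0 < M"
 shows "(\<Sum>p\<in>P. (x' p)\<^sup>2) \<le> (\<Sum>p\<in>P. (x p)\<^sup>2) + 2 * (\<Sum>i<m. K * (a i + (a i)\<^sup>2 / 2))"
proof -
 have row: "(\<Sum>l<d. (x' (i, l))\<^sup>2) \<le> (\<Sum>l<d. (x (i, l))\<^sup>2) + 2 * (K * (a i + (a i)\<^sup>2 / 2))" if i: "i < m" for i
 proof -
  define \<delta> where "\<delta> l = x' (i, l) - x (i, l)" for l
  have s: "0 < sd i" using sd[OF i] .
  have "(\<lambda>l. cf x' i l - cf x i l) = (\<lambda>l. sd i * \<delta> l)" by (auto simp: cf_def \<delta>_def algebra_simps)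
  then have "sd i * enorm d \<delta> \<le> a i * M" using a(1)[OF i] s by (simp add: enorm_scale)
  then have \<delta>: "enorm d \<delta> \<le> a i * (M / sd i)" using s by (simp add: field_simps)
  have "dot d (\<lambda>l. x (i, l)) \<delta> \<le> rn x i * enorm d \<delta>"
   using abs_dot_le[of d "\<lambda>l. x (i, l)" \<delta>] by (simp add: rn_def)
  also have "\<dots> \<le> rn x i * (a i * (M / sd i))" using \<delta> by (intro mult_left_mono) (auto simp: rn_def)
  also have "\<dots> = a i * ((M / sd i) * rn x i)" by simp
  also have "\<dots> \<le> a i * K" using K(1)[OF i] a(2)[OF i] by (intro mult_left_mono)
  finally have 1: "dot d (\<lambda>l. x (i, l)) \<delta> \<le> a i * K" .
  have "dot d \<delta> \<delta> = (enorm d \<delta>)\<^sup>2" by (simp add: enorm_sq)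
  also have "\<dots> \<le> (a i * (M / sd i))\<^sup>2" using \<delta> by (intro power_mono) auto
  also have "\<dots> \<le> (a i)\<^sup>2 * K" unfolding power_mult_distrib using K(2)[OF i] by (intro mult_left_mono) auto
  finally have 2: "dot d \<delta> \<delta> \<le> (a i)\<^sup>2 * K" .
  have "(\<Sum>l<d. (x' (i, l))\<^sup>2) = (\<Sum>l<d. (x (i, l))\<^sup>2) + 2 * dot d (\<lambda>l. x (i, l)) \<delta> + dot d \<delta> \<delta>"
   unfolding dot_def \<delta>_def sum_distrib_left sum.distrib[symmetric]
   by (intro sum.cong) (auto simp: power2_eq_square algebra_simps)
  then show ?thesis using 1 2 by (simp add: algebra_simps)
 qed
 have "(\<Sum>p\<in>P. (x' p)\<^sup>2) = (\<Sum>i<m. \<Sum>l<d. (x' (i, l))\<^sup>2)" by (simp add: sum.cartesian_product)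
 also have "\<dots> \<le> (\<Sum>i<m. (\<Sum>l<d. (x (i, l))\<^sup>2) + 2 * (K * (a i + (a i)\<^sup>2 / 2)))"
  using row by (intro sum_mono) auto
 also have "\<dots> = (\<Sum>p\<in>P. (x p)\<^sup>2) + 2 * (\<Sum>i<m. K * (a i + (a i)\<^sup>2 / 2))"
  by (simp add: sum.distrib sum_distrib_left sum.cartesian_product)
 finally show ?thesis .
qed

end

text \<open>Edges are counted on \<open>Q0\<close>; \<open>Q1\<close> is a slightly larger set into
  which the maps of configurations lead. Keeping the mass of \<open>Q1\<close> in the final
  estimate, in place of 1, permits a sum over infinitely many magnitudes later.\<close>

locale gconf_bounds = gconf +
 fixes M K :: real and Q0 Q1 :: "cvec set"
 assumes d0: "0 < d" and M0: "0 < M" and K1: "1 \<le> K"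
  and Q0: "Q0 \<in> sets (leb P)" and Q1: "Q1 \<in> sets (leb P)"
  and Q0c: "\<And>x i. x \<in> Q0 ==> i < m ==> enorm d (cf x i) \<le> M"
  and Q0x: "\<And>x i. x \<in> Q0 ==> i < m ==> (M / sd i) * rn x i \<le> K"
  and sdK: "\<And>i. i < m ==> (M / sd i)\<^sup>2 \<le> K"
  and Q01: "\<And>x x'. x \<in> Q0 ==> x' \<in> space (leb P) ==> (\<And>i. i < m ==> enorm d (\<lambda>l. cf x' i l - cf x i l) \<le> M / 100) ==> x' \<in> Q1"
  and Q1c: "\<And>x i. x \<in> Q1 ==> i < m ==> enorm d (cf x i) \<le> 2 * M"
begin

text \<open>The constants let every row move by at most \<open>M / 100\<close> and the exponent of
  the density change by at most 1. Both shrink with the cost factor \<open>K\<close>, and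
  \<open>\<tau>\<close> also with \<open>d\<close> because all \<open>d\<close> vertices move.
  \<open>\<eta>\<close> is the margin that \<open>edge_dilate\<close> produces.\<close>

definition "\<tau> = 1 / (400 * real d * K)"
definition "\<epsilon> = M / (400 * K)"
definition "\<eta> = \<tau> / (real d * (1 + \<tau>))"

lemma \<tau>_pos: "0 < \<tau>" and \<epsilon>_pos: "0 < \<epsilon>" and \<eta>_pos: "0 < \<eta>"
 using d0 K1 M0 by (auto simp: \<tau>_def \<epsilon>_def \<eta>_def intro!: divide_pos_pos mult_pos_pos add_pos_pos)

lemma \<tau>_le: "\<tau> \<le> 1 / 400"
proof -
 have "1 * 1 \<le> real d * K" using d0 K1 by (intro mult_mono) auto
 then show ?thesis unfolding \<tau>_def by (intro divide_left_mono) auto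
qed

definition Dn :: "nat set => nat => cvec => real" where
 "Dn I k x = sqrt ((sD1 I k x)\<^sup>2 + (sD2 I k x)\<^sup>2)"

text \<open>Contains edges of every length; those that are long already are covered by the map with
  \<open>n = 0\<close>.\<close>

definition shortE :: "nat set => nat => cvec set" where
 "shortE I k = {x \<in> Q0. edge d w1 w2 (cf x) S 0 I k}"

definition longE :: "nat set => nat => cvec set" where
 "longE I k = {x \<in> Q1. edge d w1 w2 (cf x) S \<eta> I k \<and> \<epsilon> \<le> Dn I k x}"

lemma sets_edge': "basis_index d I k ==> I \<subseteq> S ==> 0 \<le> e ==> {x \<in> space (leb P). edge d w1 w2 (cf x) S e I k} \<in> sets (leb P)"
 using sets_edge on by blast

lemma measurable_Dn: "basis_index d I k ==> I \<subseteq> S ==> Dn I k \<in> borel_measurable (leb P)"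
 unfolding Dn_def[abs_def] using measurable_sD[of I k]
 by (intro borel_measurable_sqrt[THEN measurable_compose[rotated]] borel_measurable_add borel_measurable_power) auto

lemma sets_shortE: "basis_index d I k ==> I \<subseteq> S ==> shortE I k \<in> sets (gauss P)"
proof -
 assume a: "basis_index d I k" "I \<subseteq> S"
 have "shortE I k = Q0 \<inter> {x \<in> space (leb P). edge d w1 w2 (cf x) S 0 I k}"
  unfolding shortE_def using sets.sets_into_space[OF Q0] by auto
 then show ?thesis using Q0 sets_edge'[OF a, of 0] by (simp add: sets_gauss_leb)
qed

lemma sets_longE: "basis_index d I k ==> I \<subseteq> S ==> longE I k \<in> sets (gauss P)"
proof -
 assume a: "basis_index d I k" "I \<subseteq> S"
 have "longE I k = Q1 \<inter> {x \<in> space (leb P). edge d w1 w2 (cf x) S \<eta> I k} \<inter> {x \<in> space (leb P). \<epsilon> \<le> Dn I k x}"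
  unfolding longE_def using sets.sets_into_space[OF Q1] by auto
 moreover have "{x \<in> space (leb P). \<epsilon> \<le> Dn I k x} \<in> sets (leb P)"
  using measurable_Dn[OF a] by measurable
 ultimately show ?thesis using Q1 sets_edge'[OF a, of \<eta>] \<eta>_pos by (simp add: sets_gauss_leb)
qed

definition Tn :: "nat set => nat => nat => cvec => cvec" where
 "Tn I k n x = stretch (2 ^ n - 1) I k (dilate \<tau> I x)"

text \<open>By \<open>small\<close> the stretch moves vertex \<open>k\<close> by at most
  \<open>2 * \<epsilon>\<close>; together with the motion of the dilation all displacements stay
  within the limits of \<open>norm_change\<close> and \<open>Q01\<close>.\<close>

lemma Tn_props:
 assumes bi: "basis_index d I k" and I: "I \<subseteq> S" and x: "x \<in> shortE I k"
  and small: "(2 ^ n - 1) * Dn I k (dilate \<tau> I x) \<le> 2 * \<epsilon>"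
 shows "Tn I k n x \<in> Q1" "edge d w1 w2 (cf (Tn I k n x)) S \<eta> I k"
  "Dn I k (Tn I k n x) = 2 ^ n * Dn I k (dilate \<tau> I x)"
  "(\<Sum>p\<in>P. (Tn I k n x p)\<^sup>2) \<le> (\<Sum>p\<in>P. (x p)\<^sup>2) + 2 * 1"
proof -
 interpret basis_index d I k by fact
 let ?x1 = "dilate \<tau> I x" and ?x2 = "Tn I k n x" and ?t = "2 ^ n - 1 :: real"
 have xQ: "x \<in> Q0" and e0: "edge d w1 w2 (cf x) S 0 I k" using x unfolding shortE_def by auto
 have t: "0 < 1 + ?t" "0 \<le> ?t" by auto
 have e1: "edge d w1 w2 (cf ?x1) S \<eta> I k" unfolding \<eta>_def by (rule edge_cf_dilate[OF bi I e0 \<tau>_pos])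
 show e2: "edge d w1 w2 (cf ?x2) S \<eta> I k" unfolding Tn_def by (rule edge_cf_stretch(1)[OF bi I e1 t(1)])
 have "sD1 I k ?x2 = 2 ^ n * sD1 I k ?x1" "sD2 I k ?x2 = 2 ^ n * sD2 I k ?x1"
  unfolding Tn_def using edge_cf_stretch(2,3)[OF bi I e1 t(1)] by auto
 then have "Dn I k ?x2 = sqrt ((2 ^ n)\<^sup>2 * ((sD1 I k ?x1)\<^sup>2 + (sD2 I k ?x1)\<^sup>2))"
  unfolding Dn_def by (simp add: power_mult_distrib distrib_left)
 then show "Dn I k ?x2 = 2 ^ n * Dn I k ?x1" unfolding Dn_def by (simp add: real_sqrt_mult)
 \<comment> \<open>Displacements in units of \<open>M\<close>: a vertex has distance at most
   \<open>2 * M\<close> from the centroid, and vertex \<open>k\<close> moves by another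
   \<open>2 * \<epsilon>\<close>.\<close>
 define a where "a i = (if i \<in> I then 2 * \<tau> else 0) + (if i = k then 2 * \<epsilon> / M else 0)" for i
 have a0: "0 \<le> a i" for i using \<tau>_pos \<epsilon>_pos M0 by (auto simp: a_def)
 have d1: "enorm d (\<lambda>l. cf ?x1 i l - cf x i l) \<le> (if i \<in> I then 2 * \<tau> else 0) * M" if i: "i < m" for i
 proof (cases "i \<in> I")
  case True
  have "enorm d (\<lambda>l. cf ?x1 i l - cf x i l) = enorm d (\<lambda>l. \<tau> * (cf x i l - cen I x l))"
   by (intro enorm_cong) (simp add: cf_dilate(1)[OF I \<tau>_pos _ True])
  also have "\<dots> = \<tau> * enorm d (\<lambda>l. cf x i l - cen I x l)" using \<tau>_pos by (simp add: enorm_scale)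
  also have "\<dots> \<le> \<tau> * (enorm d (cf x i) + enorm d (cen I x))" using \<tau>_pos enorm_diff by (intro mult_left_mono) auto
  also have "\<dots> \<le> \<tau> * (M + M)"
  proof -
   have "cen I x = comb (cf x) I (\<lambda>_. 1 / d)" unfolding cen_def comb_def by (auto simp: sum_divide_distrib)
   then have "enorm d (cen I x) \<le> M"
    using enorm_convex_le[OF finI, of "\<lambda>_. 1 / d" d "cf x" M] cardI d_pos Q0c[OF xQ] I by auto
   then show ?thesis using \<tau>_pos Q0c[OF xQ i] by (intro mult_left_mono add_mono) auto
  qed
  finally show ?thesis using True by simp
 next
  case False
  have "enorm d (\<lambda>l. cf ?x1 i l - cf x i l) = enorm d (\<lambda>l. 0)"
   by (intro enorm_cong) (simp add: cf_dilate(2)[OF I \<tau>_pos _ i False])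
  then show ?thesis using False by (simp add: enorm_def L2_set_def)
 qed
 have d2: "enorm d (\<lambda>l. cf ?x2 i l - cf ?x1 i l) \<le> (if i = k then 2 * \<epsilon> / M else 0) * M" if i: "i < m" for i
 proof (cases "i = k")
  case True
  have o: "dot d w1 w1 = 1" "dot d w2 w2 = 1" "dot d w1 w2 = 0" "dot d w2 w1 = 0"
   using on dot_commute[of d w2 w1] by (auto simp: orthonormal2_def)
  let ?u = "\<lambda>l. sD1 I k ?x1 * w1 l + sD2 I k ?x1 * w2 l"
  have "dot d w1 ?u = sD1 I k ?x1" "dot d w2 ?u = sD2 I k ?x1"
   unfolding dot_commute[of d w1 ?u] dot_commute[of d w2 ?u] using o by (simp_all add: dot_add dot_scale)
  then have "(enorm d ?u)\<^sup>2 = (sD1 I k ?x1)\<^sup>2 + (sD2 I k ?x1)\<^sup>2"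
   unfolding enorm_sq by (simp add: dot_add dot_scale power2_eq_square)
  then have "enorm d ?u = Dn I k ?x1"
   unfolding Dn_def by (rule real_sqrt_unique[OF _ enorm_nonneg, symmetric])
  moreover have "enorm d (\<lambda>l. cf ?x2 i l - cf ?x1 i l) = enorm d (\<lambda>l. ?t * ?u l)"
   unfolding Tn_def True by (intro enorm_cong) (simp add: cf_stretch(1)[OF bi I])
  ultimately show ?thesis using small t M0 True by (simp add: enorm_scale)
 next
  case False
  have "enorm d (\<lambda>l. cf ?x2 i l - cf ?x1 i l) = enorm d (\<lambda>l. 0)"
   unfolding Tn_def by (intro enorm_cong) (simp add: cf_stretch(2)[OF bi I _ i False])
  then show ?thesis using False by (simp add: enorm_def L2_set_def)
 qed
 have dd: "enorm d (\<lambda>l. cf ?x2 i l - cf x i l) \<le> a i * M" if i: "i < m" for i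
 proof -
  have "enorm d (\<lambda>l. cf ?x2 i l - cf x i l) = enorm d (\<lambda>l. (cf ?x2 i l - cf ?x1 i l) + (cf ?x1 i l - cf x i l))" by simp
  also have "\<dots> \<le> enorm d (\<lambda>l. cf ?x2 i l - cf ?x1 i l) + enorm d (\<lambda>l. cf ?x1 i l - cf x i l)" by (rule enorm_add)
  finally show ?thesis using d1[OF i] d2[OF i] by (simp add: a_def distrib_right)
 qed
 have eM: "2 * \<epsilon> / M = 1 / (200 * K)" using M0 by (simp add: \<epsilon>_def)
 have a_le: "a i \<le> 1 / 100" for i
 proof -
  have "1 / (200 * K) \<le> 1 / 200" using K1 by (simp add: divide_simps)
  then have "2 * \<epsilon> / M \<le> 1 / 200" using eM by simp
  then show ?thesis using \<tau>_le \<tau>_pos unfolding a_def by (cases "i \<in> I"; cases "i = k") auto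
 qed
 have jac_dil: "dilate \<tau> I \<in> leb P \<rightarrow>\<^sub>M leb P" "stretch ?t I k \<in> leb P \<rightarrow>\<^sub>M leb P"
  using dilate_jac[OF I cardI d_pos \<tau>_pos] jac_stretch[OF bi I t(1)] unfolding jac_def by blast+
 have "x \<in> space (leb P)" using sets.sets_into_space[OF Q0] xQ by auto
 then have "?x2 \<in> space (leb P)" unfolding Tn_def using jac_dil measurable_space by metis
 then show "?x2 \<in> Q1"
 proof (rule Q01[OF xQ])
  fix i assume i: "i < m"
  have "a i * M \<le> 1 / 100 * M" using a_le M0 by (intro mult_right_mono) auto
  then show "enorm d (\<lambda>l. cf ?x2 i l - cf x i l) \<le> M / 100" using dd[OF i] by linarith
 qed
 have "(\<Sum>i<m. K * (a i + (a i)\<^sup>2 / 2)) \<le> (\<Sum>i<m. 2 * K * a i)"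
 proof (intro sum_mono)
  fix i
  have "a i * a i \<le> a i * 1" using a0[of i] a_le[of i] by (intro mult_left_mono) auto
  then have "(a i)\<^sup>2 / 2 \<le> a i" using a0[of i] unfolding power2_eq_square by simp
  then have "K * (a i + (a i)\<^sup>2 / 2) \<le> K * (2 * a i)" using K1 by (intro mult_left_mono) auto
  then show "K * (a i + (a i)\<^sup>2 / 2) \<le> 2 * K * a i" by simp
 qed
 also have "\<dots> = 2 * K * ((\<Sum>i<m. if i \<in> I then 2 * \<tau> else 0) + (\<Sum>i<m. if i = k then 2 * \<epsilon> / M else 0))"
  by (simp only: a_def sum_distrib_left[symmetric] sum.distrib)
 also have "(\<Sum>i<m. if i \<in> I then 2 * \<tau> else 0) = real d * (2 * \<tau>)"
  using I cardI by (simp add: sum.If_cases Int_absorb1)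
 also have "(\<Sum>i<m. if i = k then 2 * \<epsilon> / M else 0) = 2 * \<epsilon> / M" using kI I by auto
 also have "2 * K * (real d * (2 * \<tau>) + 2 * \<epsilon> / M) \<le> 1"
  unfolding eM \<tau>_def using K1 d0 by (simp add: field_simps)
 finally have "(\<Sum>i<m. K * (a i + (a i)\<^sup>2 / 2)) \<le> 1" .
 then show "(\<Sum>p\<in>P. (?x2 p)\<^sup>2) \<le> (\<Sum>p\<in>P. (x p)\<^sup>2) + 2 * 1"
  using norm_change[of ?x2 x a M K, OF dd a0 Q0x[OF xQ] sdK M0] by linarith
qed

text \<open>Sort the edges by the number \<open>n\<close> of doublings that make them long. On class
  \<open>n\<close> the map multiplies volume by at least 4^n and lowers the density by at most the
  factor e, so the class has at most e / 4^n times the mass of \<open>longE\<close>. The geometric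
  series gives 4 e / 3, which is at most 4 because e is at most 3.\<close>

lemma emeasure_shortE_le:
 assumes bi: "basis_index d I k" and I: "I \<subseteq> S"
 shows "emeasure (gauss P) (shortE I k) \<le> ennreal 4 * emeasure (gauss P) (longE I k)"
proof -
 interpret basis_index d I k by fact
 interpret G: prob_space "gauss P" by (rule prob_space_gauss)
 obtain J where J: "1 \<le> J" "jac P (dilate \<tau> I) J" using dilate_jac[OF I cardI d_pos \<tau>_pos] by blast
 have jT: "jac P (Tn I k n) (2 ^ n * 2 ^ n * J)" for n
  using jac_comp[OF J(2) jac_stretch[OF bi I, of "2 ^ n - 1"]] unfolding Tn_def[abs_def] by simp
 let ?D = "\<lambda>x. Dn I k (dilate \<tau> I x)"
 have mD: "?D \<in> borel_measurable (gauss P)"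
 proof -
  have "dilate \<tau> I \<in> leb P \<rightarrow>\<^sub>M leb P" using J(2) unfolding jac_def by blast
  from measurable_compose[OF this measurable_Dn[OF bi I]] show ?thesis
   using measurable_cong_sets[OF sets_gauss_leb refl] by blast
 qed
 define A where "A n = {x \<in> shortE I k. \<epsilon> \<le> 2 ^ n * ?D x \<and> (2 ^ n - 1) * ?D x \<le> 2 * \<epsilon>}" for n :: nat
 \<comment> \<open>Edges that the dilation leaves with length 0 never become long, but the map
   applies to them for every \<open>n\<close>, so their mass is below all
   \<open>exp 1 / 4 ^ n\<close>.\<close>
 define Z where "Z = {x \<in> shortE I k. ?D x = 0}"
 have sub: "shortE I k \<subseteq> space (gauss P)" using sets.sets_into_space[OF sets_shortE[OF bi I]] .
 have Am: "A n \<in> sets (gauss P)" for n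
 proof -
  have "A n = shortE I k \<inter> {x \<in> space (gauss P). \<epsilon> \<le> 2 ^ n * ?D x \<and> (2 ^ n - 1) * ?D x \<le> 2 * \<epsilon>}"
   unfolding A_def using sub by auto
  moreover have "{x \<in> space (gauss P). \<epsilon> \<le> 2 ^ n * ?D x \<and> (2 ^ n - 1) * ?D x \<le> 2 * \<epsilon>} \<in> sets (gauss P)"
   using mD by measurable
  ultimately show ?thesis using sets_shortE[OF bi I] by simp
 qed
 have Zm: "Z \<in> sets (gauss P)"
 proof -
  have "Z = shortE I k \<inter> {x \<in> space (gauss P). ?D x = 0}" unfolding Z_def using sub by auto
  moreover have "{x \<in> space (gauss P). ?D x = 0} \<in> sets (gauss P)" using mD by measurable
  ultimately show ?thesis using sets_shortE[OF bi I] by simp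
 qed
 have fromJ: "measure (gauss P) X \<le> exp 1 * (1 / 4) ^ n * measure (gauss P) Y"
  if "ennreal (2 ^ n * 2 ^ n * J) * emeasure (gauss P) X \<le> ennreal (exp 1) * emeasure (gauss P) Y" for X Y n
 proof -
  have "ennreal (2 ^ n * 2 ^ n * J * measure (gauss P) X) \<le> ennreal (exp 1 * measure (gauss P) Y)"
   using that J(1) by (simp add: G.emeasure_eq_measure ennreal_mult)
  then have "2 ^ n * 2 ^ n * J * measure (gauss P) X \<le> exp 1 * measure (gauss P) Y"
   by (subst (asm) ennreal_le_iff) auto
  moreover have "4 ^ n * measure (gauss P) X \<le> 2 ^ n * 2 ^ n * J * measure (gauss P) X"
   using J(1) by (intro mult_right_mono) (auto simp: power_mult_distrib[symmetric])
  ultimately have "4 ^ n * measure (gauss P) X \<le> exp 1 * measure (gauss P) Y" by linarith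
  then show ?thesis by (simp add: field_simps power_one_over)
 qed
 have An: "measure (gauss P) (A n) \<le> exp 1 * (1 / 4) ^ n * measure (gauss P) (longE I k)" for n
 proof (rule fromJ, rule gauss_emeasure_jac_le[OF finP jT Am sets_longE[OF bi I]])
  fix x assume "x \<in> A n"
  then have x: "x \<in> shortE I k" "\<epsilon> \<le> 2 ^ n * ?D x" "(2 ^ n - 1) * ?D x \<le> 2 * \<epsilon>" unfolding A_def by auto
  note T = Tn_props[OF bi I x(1,3)]
  show "Tn I k n x \<in> longE I k" unfolding longE_def using T x(2) by simp
  show "(\<Sum>p\<in>P. (Tn I k n x p)\<^sup>2) \<le> (\<Sum>p\<in>P. (x p)\<^sup>2) + 2 * 1" by (rule T(4))
 qed
 have Zn: "measure (gauss P) Z \<le> exp 1 * (1 / 4) ^ n * measure (gauss P) (space (gauss P))" for n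
 proof (rule fromJ, rule gauss_emeasure_jac_le[OF finP jT Zm sets.top])
  fix x assume "x \<in> Z"
  then have x: "x \<in> shortE I k" "(2 ^ n - 1) * ?D x \<le> 2 * \<epsilon>" unfolding Z_def using \<epsilon>_pos by auto
  note T = Tn_props[OF bi I x(1,2)]
  show "Tn I k n x \<in> space (gauss P)"
   using T(1) sets.sets_into_space[OF Q1] sets_eq_imp_space_eq[OF sets_gauss_leb] by blast
  show "(\<Sum>p\<in>P. (Tn I k n x p)\<^sup>2) \<le> (\<Sum>p\<in>P. (x p)\<^sup>2) + 2 * 1" by (rule T(4))
 qed
 have "measure (gauss P) Z \<le> 0"
 proof (rule LIMSEQ_le_const)
  show "(\<lambda>n. exp 1 * (1 / 4) ^ n * measure (gauss P) (space (gauss P))) \<longlonglongrightarrow> 0"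
   by (rule tendsto_eq_intros LIMSEQ_realpow_zero | simp)+
 qed (use Zn in blast)
 then have Z0: "emeasure (gauss P) Z = 0"
  using measure_nonneg[of "gauss P" Z] by (simp add: G.emeasure_eq_measure)
 have cover: "shortE I k \<subseteq> (\<Union>n. A n) \<union> Z"
 proof
  fix x assume x: "x \<in> shortE I k"
  have D0: "0 \<le> ?D x" by (simp add: Dn_def)
  show "x \<in> (\<Union>n. A n) \<union> Z"
  proof (cases "?D x = 0")
   case True
   then show ?thesis using x unfolding Z_def by simp
  next
   case False
   then have Dp: "0 < ?D x" using D0 by simp
   obtain n0 where "\<epsilon> / ?D x < 2 ^ n0" using real_arch_pow[of 2 "\<epsilon> / ?D x"] by auto
   then have ex: "\<exists>n. \<epsilon> \<le> 2 ^ n * ?D x" using Dp by (auto simp: field_simps intro!: less_imp_le exI[of _ n0])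
   define n where "n = (LEAST n. \<epsilon> \<le> 2 ^ n * ?D x)"
   have n: "\<epsilon> \<le> 2 ^ n * ?D x" unfolding n_def using ex by (rule LeastI_ex)
   \<comment> \<open>Minimality of \<open>n\<close> limits the displacement: one doubling earlier
     the length was still below \<open>\<epsilon>\<close>.\<close>
   have "(2 ^ n - 1) * ?D x \<le> 2 * \<epsilon>"
   proof (cases n)
    case 0
    then show ?thesis using \<epsilon>_pos by simp
   next
    case (Suc k')
    then have "\<not> \<epsilon> \<le> 2 ^ k' * ?D x" using not_less_Least[of k' "\<lambda>n. \<epsilon> \<le> 2 ^ n * ?D x"] unfolding n_def by simp
    then show ?thesis using Suc Dp by (simp add: algebra_simps)
   qed
   then show ?thesis using n x unfolding A_def by blast
  qed
 qed
 have UA: "(\<Union>n. A n) \<in> sets (gauss P)" using Am by auto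
 have "emeasure (gauss P) (shortE I k) \<le> emeasure (gauss P) ((\<Union>n. A n) \<union> Z)"
  by (rule emeasure_mono[OF cover]) (use UA Zm in auto)
 also have "\<dots> \<le> emeasure (gauss P) (\<Union>n. A n) + emeasure (gauss P) Z"
  by (rule emeasure_subadditive[OF UA Zm])
 also have "\<dots> = emeasure (gauss P) (\<Union>n. A n)" by (simp add: Z0)
 also have "\<dots> \<le> (\<Sum>n. emeasure (gauss P) (A n))"
  by (rule emeasure_subadditive_countably) (use Am in auto)
 also have "\<dots> \<le> (\<Sum>n. ennreal (exp 1 * (1 / 4) ^ n * measure (gauss P) (longE I k)))"
  using An by (intro suminf_le) (auto simp: G.emeasure_eq_measure intro!: ennreal_leI)
 also have "\<dots> = ennreal (exp 1 * (4 / 3) * measure (gauss P) (longE I k))"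
 proof (rule suminf_ennreal_eq)
  have "(\<lambda>n. (1 / 4) ^ n) sums (1 / (1 - 1 / 4 :: real))" by (rule geometric_sums) simp
  from sums_mult[OF this, of "exp 1 * measure (gauss P) (longE I k)"]
  show "(\<lambda>n. exp 1 * (1 / 4) ^ n * measure (gauss P) (longE I k)) sums (exp 1 * (4 / 3) * measure (gauss P) (longE I k))"
   by (simp add: mult_ac)
 qed simp
 also have "\<dots> \<le> ennreal (4 * measure (gauss P) (longE I k))"
  using exp_le by (intro ennreal_leI mult_right_mono) auto
 also have "\<dots> = ennreal 4 * emeasure (gauss P) (longE I k)" by (simp add: G.emeasure_eq_measure ennreal_mult)
 finally show ?thesis .
qed

end

definition shadow_sets :: "nat => rvec => rvec => nat => rows => nat set set" where
 "shadow_sets d w1 w2 m c = {I. I \<subseteq> {..<m} \<and> card I = d \<and> (\<exists>k\<in>I. edge d w1 w2 c {..<m} 0 I k)}"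

abbreviation nshadow :: "nat => rvec => rvec => nat => rows => 'a :: semiring_1" where
 "nshadow d w1 w2 m c \<equiv> of_nat (card (shadow_sets d w1 w2 m c))"

lemma basis_index_lessThan: "I \<subseteq> {..<m} ==> card I = d ==> k \<in> I ==> basis_index d I k"
 using finite_subset[of I "{..<m}"] by (auto simp: basis_index_def)

context gconf_bounds
begin

text \<open>Sum and expectation are exchanged twice: the expected number of edges is at most 4 times
  the expected number of long ones, and the latter number is bounded pointwise on \<open>Q1\<close>,
  with a factor \<open>d\<close> for the choice of \<open>k\<close>.\<close>

lemma nn_integral_shadow_le:
 assumes gp: "AE x in gauss P. gp d (cf x) S"
 shows "(\<integral>\<^sup>+x. indicator Q0 x * nshadow d w1 w2 m (cf x) \<partial>gauss P)
  \<le> ennreal (6000000 * real d ^ 3 * K\<^sup>2) * emeasure (gauss P) Q1"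
proof -
 interpret G: prob_space "gauss P" by (rule prob_space_gauss)
 let ?I = "{I. I \<subseteq> S \<and> card I = d}"
 have finI: "finite ?I" by (rule finite_subset[of _ "Pow S"]) auto
 have finI': "finite I" if "I \<in> ?I" for I using that finite_subset[of I S] by auto
 have bi: "basis_index d I k" if "I \<in> ?I" "k \<in> I" for I k using basis_index_lessThan that by blast
 have spQ: "Q0 \<subseteq> space (gauss P)" "Q1 \<subseteq> space (gauss P)"
  using sets.sets_into_space[OF Q0] sets.sets_into_space[OF Q1] sets_eq_imp_space_eq[OF sets_gauss_leb] by blast+
 have pt1: "indicator Q0 x * nshadow d w1 w2 m (cf x) \<le> (\<Sum>I\<in>?I. \<Sum>k\<in>I. indicator (shortE I k) x :: ennreal)" for x
 proof (cases "x \<in> Q0")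
  case True
  let ?F = "shadow_sets d w1 w2 m (cf x)"
  have F: "?F \<subseteq> ?I" unfolding shadow_sets_def by auto
  have "of_nat (card ?F) = (\<Sum>I\<in>?F. 1 :: ennreal)" by simp
  also have "\<dots> \<le> (\<Sum>I\<in>?F. \<Sum>k\<in>I. indicator (shortE I k) x)"
  proof (rule sum_mono)
   fix I assume I: "I \<in> ?F"
   then obtain k where k: "k \<in> I" "edge d w1 w2 (cf x) S 0 I k" unfolding shadow_sets_def by blast
   then have "indicator (shortE I k) x = (1::ennreal)" using True unfolding shortE_def by simp
   then show "1 \<le> (\<Sum>k\<in>I. indicator (shortE I k) x :: ennreal)"
    using member_le_sum[OF k(1) _ finI'[OF subsetD[OF F I]], of "\<lambda>k. indicator (shortE I k) x :: ennreal"] by simp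
  qed
  also have "\<dots> \<le> (\<Sum>I\<in>?I. \<Sum>k\<in>I. indicator (shortE I k) x)" by (rule sum_mono2[OF finI F]) simp
  finally show ?thesis using True by simp
 qed simp
 \<comment> \<open>The bound of \<open>card_long_edges\<close> for points of norm at most
   \<open>2 * M\<close>.\<close>
 define B where "B = 8 * M / (\<eta> * \<epsilon>)"
 have B0: "0 \<le> B" unfolding B_def using M0 \<eta>_pos \<epsilon>_pos by simp
 have pt2: "(\<Sum>I\<in>?I. \<Sum>k\<in>I. indicator (longE I k) x :: ennreal) \<le> ennreal (real d * B) * indicator Q1 x"
  if gpx: "gp d (cf x) S" for x
 proof (cases "x \<in> Q1")
  case False
  then have "indicator (longE I k) x = (0::ennreal)" for I k unfolding longE_def by simp
  then show ?thesis by simp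
 next
  case True
  define F where "F = {I \<in> ?I. \<exists>k\<in>I. x \<in> longE I k}"
  have "real (card F) * (\<eta> * \<epsilon>) \<le> 4 * (2 * M)"
  proof (rule card_long_edges[OF on gpx])
   show "enorm d (cf x i) \<le> 2 * M" if "i \<in> S" for i using Q1c[OF True] that by simp
   fix I assume "I \<in> F"
   then obtain k where k: "k \<in> I" "x \<in> longE I k" "I \<in> ?I" unfolding F_def by blast
   show "I \<subseteq> S \<and> card I = d" using k(3) by simp
   have e: "edge d w1 w2 (cf x) S \<eta> I k" and D: "\<epsilon> \<le> Dn I k x" using k(2) unfolding longE_def by auto
   obtain v where v: "kerv d w1 w2 (cf x) I k v" "\<forall>j\<in>I. \<bar>v j\<bar> \<le> 1"
    "dot d w1 (comb (cf x) I v) = sD1 I k x" "dot d w2 (comb (cf x) I v) = sD2 I k x"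
    using kerv_bound_unique[OF bi[OF k(3,1)] e] by blast
   have "\<epsilon>\<^sup>2 \<le> (Dn I k x)\<^sup>2" using D \<epsilon>_pos by (intro power_mono) auto
   also have "\<dots> = (sD1 I k x)\<^sup>2 + (sD2 I k x)\<^sup>2" unfolding Dn_def by simp
   finally show "\<exists>k\<in>I. \<exists>v. edge d w1 w2 (cf x) S \<eta> I k \<and> kerv d w1 w2 (cf x) I k v \<and> (\<forall>j\<in>I. \<bar>v j\<bar> \<le> 1) \<and>
     \<epsilon>\<^sup>2 \<le> (dot d w1 (comb (cf x) I v))\<^sup>2 + (dot d w2 (comb (cf x) I v))\<^sup>2"
    using k(1) e v by (intro bexI[of _ k] exI[of _ v]) auto
  qed (use M0 \<eta>_pos \<epsilon>_pos in auto)
  then have cF: "real (card F) \<le> B" using \<eta>_pos \<epsilon>_pos unfolding B_def by (simp add: field_simps)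
  have "(\<Sum>k\<in>I. indicator (longE I k) x :: ennreal) \<le> (if I \<in> F then of_nat d else 0)" if "I \<in> ?I" for I
  proof (cases "I \<in> F")
   case True
   have "(\<Sum>k\<in>I. indicator (longE I k) x :: ennreal) \<le> (\<Sum>k\<in>I. 1)" by (intro sum_mono) (auto simp: indicator_def)
   then show ?thesis using True that by simp
  next
   case False
   then have "(\<Sum>k\<in>I. indicator (longE I k) x :: ennreal) = 0"
    using that unfolding F_def by (intro sum.neutral) auto
   then show ?thesis using False by simp
  qed
  then have "(\<Sum>I\<in>?I. \<Sum>k\<in>I. indicator (longE I k) x :: ennreal) \<le> (\<Sum>I\<in>?I. if I \<in> F then of_nat d else 0)"
   by (rule sum_mono)
  also have "\<dots> = of_nat (card F * d)"
  proof -
   have "?I \<inter> {I. I \<in> F} = F" unfolding F_def by auto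
   then show ?thesis using finI by (simp add: sum.If_cases)
  qed
  also have "\<dots> = ennreal (real (card F * d))" by (rule ennreal_of_nat_eq_real_of_nat)
  also have "\<dots> = ennreal (real (card F) * real d)" by simp
  also have "\<dots> \<le> ennreal (real d * B)" using mult_left_mono[OF cF, of "real d"] by (intro ennreal_leI) (simp add: mult.commute)
  finally show ?thesis using True by simp
 qed
 have mS: "shortE I k \<in> sets (gauss P)" "longE I k \<in> sets (gauss P)" if "I \<in> ?I" "k \<in> I" for I k
  using sets_shortE[OF bi[OF that]] sets_longE[OF bi[OF that]] that by auto
 have swap: "(\<integral>\<^sup>+x. (\<Sum>I\<in>?I. \<Sum>k\<in>I. indicator (E I k) x) \<partial>gauss P) = (\<Sum>I\<in>?I. \<Sum>k\<in>I. emeasure (gauss P) (E I k))"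
  if E: "\<And>I k. I \<in> ?I ==> k \<in> I ==> E I k \<in> sets (gauss P)" for E
 proof -
  have "(\<integral>\<^sup>+x. (\<Sum>I\<in>?I. \<Sum>k\<in>I. indicator (E I k) x) \<partial>gauss P) = (\<Sum>I\<in>?I. \<integral>\<^sup>+x. (\<Sum>k\<in>I. indicator (E I k) x) \<partial>gauss P)"
   using E by (intro nn_integral_sum borel_measurable_sum borel_measurable_indicator)
  also have "\<dots> = (\<Sum>I\<in>?I. \<Sum>k\<in>I. \<integral>\<^sup>+x. indicator (E I k) x \<partial>gauss P)"
   using E by (intro sum.cong refl nn_integral_sum borel_measurable_indicator)
  also have "\<dots> = (\<Sum>I\<in>?I. \<Sum>k\<in>I. emeasure (gauss P) (E I k))"
   using E by (intro sum.cong refl nn_integral_indicator)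
  finally show ?thesis .
 qed
 have "(\<integral>\<^sup>+x. indicator Q0 x * nshadow d w1 w2 m (cf x) \<partial>gauss P)
   \<le> (\<integral>\<^sup>+x. (\<Sum>I\<in>?I. \<Sum>k\<in>I. indicator (shortE I k) x) \<partial>gauss P)"
  by (intro nn_integral_mono pt1)
 also have "\<dots> = (\<Sum>I\<in>?I. \<Sum>k\<in>I. emeasure (gauss P) (shortE I k))"
  using mS(1) by (rule swap)
 also have "\<dots> \<le> (\<Sum>I\<in>?I. \<Sum>k\<in>I. ennreal 4 * emeasure (gauss P) (longE I k))"
  using emeasure_shortE_le[OF bi] by (intro sum_mono) auto
 also have "\<dots> = ennreal 4 * (\<integral>\<^sup>+x. (\<Sum>I\<in>?I. \<Sum>k\<in>I. indicator (longE I k) x) \<partial>gauss P)"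
  by (subst swap[of longE]) (use mS(2) in \<open>simp_all add: sum_distrib_left\<close>)
 also have "\<dots> \<le> ennreal 4 * (\<integral>\<^sup>+x. ennreal (real d * B) * indicator Q1 x \<partial>gauss P)"
 proof (intro mult_left_mono nn_integral_mono_AE)
  show "AE x in gauss P. (\<Sum>I\<in>?I. \<Sum>k\<in>I. indicator (longE I k) x) \<le> ennreal (real d * B) * indicator Q1 x"
   using gp by eventually_elim (rule pt2)
 qed simp
 also have "\<dots> = ennreal 4 * (ennreal (real d * B) * emeasure (gauss P) Q1)"
  using Q1 by (simp add: nn_integral_cmult sets_gauss_leb)
 also have "\<dots> = ennreal (4 * (real d * B)) * emeasure (gauss P) Q1"
  using B0 by (simp add: ennreal_mult mult.assoc)
 also have "\<dots> \<le> ennreal (6000000 * real d ^ 3 * K\<^sup>2) * emeasure (gauss P) Q1"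
 proof (intro mult_right_mono ennreal_leI)
  \<comment> \<open>\<open>1 + \<tau> \<le> 401 / 400\<close> bounds \<open>1 / \<eta>\<close> by a
    multiple of d^2 K; multiplied by \<open>8 * M / \<epsilon> = 3200 * K\<close> this has order d^2
    K^2.\<close>
  have "\<tau> / (real d * (401 / 400)) \<le> \<eta>"
   unfolding \<eta>_def using \<tau>_pos \<tau>_le d0 by (intro divide_left_mono mult_left_mono mult_pos_pos) auto
  moreover have "\<tau> / (real d * (401 / 400)) = 1 / (401 * (real d)\<^sup>2 * K)"
   unfolding \<tau>_def using d0 K1 by (simp add: field_simps power2_eq_square)
  ultimately have "1 / (401 * (real d)\<^sup>2 * K) \<le> \<eta>" by simp
  then have "1 / \<eta> \<le> 401 * (real d)\<^sup>2 * K"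
   using \<eta>_pos d0 K1 by (simp add: field_simps)
  then have "3200 * K * (1 / \<eta>) \<le> 3200 * K * (401 * (real d)\<^sup>2 * K)"
   using K1 by (intro mult_left_mono) auto
  moreover have "B = 8 * M / \<epsilon> * (1 / \<eta>)" unfolding B_def by simp
  moreover have "8 * M / \<epsilon> = 3200 * K" unfolding \<epsilon>_def using M0 K1 by (simp add: field_simps)
  ultimately have "B \<le> 3200 * K * (401 * (real d)\<^sup>2 * K)" by simp
  also have "\<dots> = 1283200 * (real d)\<^sup>2 * K\<^sup>2" by (simp add: power2_eq_square)
  finally have "B \<le> 1283200 * (real d)\<^sup>2 * K\<^sup>2" .
  then have "4 * (real d * B) \<le> 4 * (real d * (1283200 * (real d)\<^sup>2 * K\<^sup>2))" by (intro mult_left_mono) auto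
  also have "\<dots> = 5132800 * (real d ^ 3 * K\<^sup>2)" by (simp add: power3_eq_cube power2_eq_square)
  also have "\<dots> \<le> 6000000 * (real d ^ 3 * K\<^sup>2)" by (intro mult_right_mono) auto
  finally show "4 * (real d * B) \<le> 6000000 * real d ^ 3 * K\<^sup>2" by (simp add: mult.assoc)
 qed simp
 finally show ?thesis .
qed

end

section \<open>General position\<close>

text \<open>Renormalizing the edge direction at a coefficient of largest modulus makes all
  coefficients at most 1 in modulus, and this selects \<open>k\<close>. A nonzero vector of the
  cone, divided by the sum of its coefficients, is a point of the facet in the plane.\<close>

lemma pierced_imp_edge:
 assumes on: "orthonormal2 d w1 w2" and I: "finite I" "card I = d" "0 < d"
  and s: "supp d c S I" and reg: "\<And>k. k \<in> I ==> regk d w1 w2 c I k"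
  and x: "\<forall>j\<in>I. 0 \<le> x j" "inW d w1 w2 (comb c I x)" "l < d" "comb c I x l \<noteq> 0"
 shows "\<exists>k\<in>I. edge d w1 w2 c S 0 I k"
proof -
 have ne: "I \<noteq> {}" using I by auto
 then obtain k0 where k0: "k0 \<in> I" by blast
 interpret b: basis_index d I k0 by standard (use I k0 in auto)
 obtain v0 where v0: "kerv d w1 w2 c I k0 v0" using b.ex_kerv[OF on reg[OF k0]] by blast
 have "Max ((\<lambda>j. \<bar>v0 j\<bar>) ` I) \<in> (\<lambda>j. \<bar>v0 j\<bar>) ` I" using I ne by (intro Max_in) auto
 then obtain k where k: "k \<in> I" "\<bar>v0 k\<bar> = Max ((\<lambda>j. \<bar>v0 j\<bar>) ` I)" by auto
 have mx: "\<bar>v0 j\<bar> \<le> \<bar>v0 k\<bar>" if "j \<in> I" for j unfolding k(2) using I that by (intro Max_ge) auto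
 have "\<bar>v0 k0\<bar> = 1" using v0 by (simp add: kerv_def)
 then have vk: "v0 k \<noteq> 0" using mx[OF k0] by auto
 define v where "v j = v0 j / v0 k" for j
 have cv: "comb c I v l = (1 / v0 k) * comb c I v0 l" for l
  unfolding comb_def v_def by (simp add: sum_divide_distrib)
 have "inW d w1 w2 (comb c I v)"
  by (rule inW_scaleI[of _ _ _ "comb c I v0" _ "1 / v0 k"]) (use v0 cv in \<open>auto simp: kerv_def\<close>)
 moreover have "(\<Sum>j\<in>I. v j) = 0" using v0 by (simp add: kerv_def v_def sum_divide_distrib[symmetric])
 ultimately have kv: "kerv d w1 w2 c I k v" using vk by (simp add: kerv_def v_def)
 have v1: "\<forall>j\<in>I. \<bar>v j\<bar> \<le> 1" using mx vk by (auto simp: v_def abs_divide divide_le_eq_1)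
 define s' where "s' = (\<Sum>j\<in>I. x j)"
 have "s' \<noteq> 0"
 proof
  assume "s' = 0"
  then have "\<forall>j\<in>I. x j = 0" using x(1) I sum_nonneg_eq_0_iff[of I x] unfolding s'_def by auto
  then show False using x(4) by (simp add: comb_def)
 qed
 moreover have "0 \<le> s'" unfolding s'_def using x(1) by (intro sum_nonneg) auto
 ultimately have s': "0 < s'" by simp
 have "inW d w1 w2 (comb c I (\<lambda>j. x j / s'))"
  by (rule inW_scaleI[OF x(2), of _ "1 / s'"]) (simp add: comb_def sum_divide_distrib)
 moreover have "(\<Sum>j\<in>I. x j / s') = 1" using s' by (simp add: sum_divide_distrib[symmetric] s'_def[symmetric])
 moreover have "\<forall>j\<in>I. 0 \<le> x j / s'" using x(1) s' by simp
 ultimately have "edge d w1 w2 c S 0 I k"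
  unfolding edge_def using s reg[OF k(1)] kv v1 by (intro conjI exI[of _ v] exI[of _ "\<lambda>j. x j / s'"]) auto
 then show ?thesis using k(1) by blast
qed

text \<open>If all 2-by-2 minors vanished, equality would hold in the Cauchy-Schwarz inequality,
  against orthonormality.\<close>

lemma ex_nonzero_minor:
 assumes "orthonormal2 d w1 w2"
 shows "\<exists>l1<d. \<exists>l2<d. w1 l1 * w2 l2 \<noteq> w1 l2 * w2 l1"
proof (rule ccontr)
 assume "\<not> ?thesis"
 then have eq: "w1 l * w2 l' = w1 l' * w2 l" if "l < d" "l' < d" for l l' using that by blast
 have "1 = dot d w1 w1 * dot d w2 w2" using assms by (simp add: orthonormal2_def)
 also have "\<dots> = (\<Sum>l<d. \<Sum>l'<d. (w1 l * w2 l') * (w1 l * w2 l'))"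
  unfolding dot_def sum_product by (intro sum.cong refl) (simp add: mult_ac)
 also have "\<dots> = (\<Sum>l<d. \<Sum>l'<d. (w1 l * w2 l) * (w1 l' * w2 l'))"
 proof (intro sum.cong refl)
  fix l l' assume "l \<in> {..<d}" "l' \<in> {..<d}"
  then have "(w1 l * w2 l') * (w1 l * w2 l') = (w1 l * w2 l') * (w1 l' * w2 l)" using eq[of l l'] by simp
  then show "(w1 l * w2 l') * (w1 l * w2 l') = (w1 l * w2 l) * (w1 l' * w2 l')" by (simp add: mult_ac)
 qed
 also have "\<dots> = dot d w1 w2 * dot d w1 w2" unfolding dot_def sum_product by simp
 also have "\<dots> = 0" using assms by (simp add: orthonormal2_def)
 finally show False by simp
qed

context gconf
begin

lemma ex_conf:
 "\<exists>x. \<forall>i<m. \<forall>l<d. cf x i l = a i l"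
proof -
 have "\<forall>i<m. \<forall>l<d. cf (\<lambda>p. (a (fst p) (snd p) - cb (fst p) (snd p)) / sd (fst p)) i l = a i l"
  using sd by (force simp: cf_def)
 then show ?thesis by blast
qed

text \<open>Because \<open>e\<close> is injective, each noise coordinate enters at most one matrix
  entry. The determinant is thus multiaffine in the noise, and a single nonsingular configuration
  excludes all but a null set.\<close>

lemma AE_dt_rows_nonzero:
 assumes e: "inj_on e {..<N}" "\<And>q. q < N ==> e q < m"
  and A: "\<And>x r q. r < n ==> q < n ==> A x r q = (if r < d' \<and> q < N then cf x (e q) r else F r q)"
  and nz: "dt n (A x\<^sub>0) \<noteq> 0" and Nn: "N \<le> n" "d' \<le> n" "d' \<le> d"
 shows "AE x in gauss P. dt n (A x) \<noteq> 0"
proof (rule AE_gauss_if_AE_leb[OF finP], rule AE_multiaffine_nonzero[OF finP, of "\<lambda>x. dt n (A x)" x\<^sub>0])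
 show "multiaffine P (\<lambda>x. dt n (A x))"
  unfolding multiaffine_def
 proof (intro ballI allI)
  fix p x t assume p: "p \<in> P"
  obtain i l where il: "p = (i, l)" "i < m" "l < d" using p by auto
  define A' where "A' x r q = (if r < n \<and> q < n then A x r q else 0)" for x r q
  have dA: "dt n (A x) = dt n (A' x)" for x by (intro dt_cong) (auto simp: A'_def)
  show "dt n (A (x(p := t))) = (1 - t) * dt n (A (x(p := 0))) + t * dt n (A (x(p := 1)))"
  proof (cases "(\<exists>q<N. e q = i) \<and> l < d'")
   case True
   then obtain q0 where q0: "q0 < N" "e q0 = i" "l < d'" by blast
   have other: "A' (x(p := s)) r q = A' (x(p := 0)) r q" if "(r, q) \<noteq> (l, q0)" for s r q
   proof -
    have "cf (x(p := s)) (e q) r = cf (x(p := 0)) (e q) r" if "q < N" "r < d'"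
    proof (cases "r = l")
     case True
     then have "q \<noteq> q0" using \<open>(r, q) \<noteq> (l, q0)\<close> by auto
     then have "e q \<noteq> i" using e(1) that q0 by (auto dest: inj_onD)
     then show ?thesis by (simp add: cf_def il)
    next
     case False
     then show ?thesis by (simp add: cf_def il)
    qed
    then show ?thesis by (auto simp: A'_def A)
   qed
   have "l < n" "q0 < n" using il q0 Nn by auto
   then have ent: "A' (x(p := s)) l q0 = cb i l + sd i * s" for s
    using il q0 by (simp add: A'_def A cf_def)
   show ?thesis unfolding dA
   proof (rule dt_entry_affine[OF \<open>l < n\<close>, of q0])
    show "A' (x(p := t)) l q0 = (1 - t) * A' (x(p := 0)) l q0 + t * A' (x(p := 1)) l q0"
     unfolding ent by (simp add: algebra_simps)
   qed (rule other, assumption)+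
  next
   case False
   then have "A' (x(p := s)) = A' (x(p := 0))" for s
    by (intro ext) (auto simp: A'_def A cf_def il)
   then show ?thesis unfolding dA by (metis (no_types, opaque_lifting) add.commute diff_add_cancel distrib_right mult_1)
  qed
 qed
 show "dt n (A x) = dt n (A y)" if "\<And>p. p \<in> P ==> x p = y p" for x y
  by (intro dt_cong) (use that e Nn(3) in \<open>auto simp: A cf_def\<close>)
 show "(\<lambda>x. dt n (A x)) \<in> borel_measurable (leb P)"
 proof (rule measurable_dt)
  fix r q assume rq: "r < n" "q < n"
  show "(\<lambda>x. A x r q) \<in> borel_measurable (leb P)"
  proof (cases "r < d' \<and> q < N")
   case True
   then show ?thesis using measurable_cf[of "e q" r] e(2)[of q] Nn(3) by (simp add: A[OF rq])
  next
   case False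
   then have "(\<lambda>x. A x r q) = (\<lambda>_. F r q)" by (auto simp: A[OF rq])
   then show ?thesis by simp
  qed
 qed
qed (rule nz)

lemma AE_regk:
 assumes I: "I \<subseteq> S" "card I = d" "k \<in> I"
 shows "AE x in gauss P. regk d w1 w2 (cf x) I k"
proof -
 have fI: "finite I" using I finite_subset by blast
 interpret basis_index d I k by standard (use I fI in auto)
 let ?e = "en (I - {k})"
 have bij: "bij_betw ?e {..<d - 1} (I - {k})" using bij_en[of "I - {k}"] fI card_Ik by simp
 have em: "?e q < m" if "q < d - 1" for q using en_in[of "I - {k}" q] fI card_Ik I that by auto
 obtain l1 l2 where l: "l1 < d" "l2 < d" "w1 l1 * w2 l2 \<noteq> w1 l2 * w2 l1" using ex_nonzero_minor[OF on] by blast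
 then have l12: "l1 \<noteq> l2" by auto
 let ?L = "{..<d} - {l1, l2}"
 have cL: "card ?L = d - 2" using l l12 by (simp add: card_Diff_subset)
 \<comment> \<open>The vertex at position 0 is the origin, and the others are the unit vectors with
   index different from \<open>l1\<close> and \<open>l2\<close>. The plane is transversal to their
   span because its minor at \<open>l1\<close>, \<open>l2\<close> is nonzero.\<close>
 define a where "a i j = (if pos (I - {k}) i = 0 then 0 else if j = en ?L (pos (I - {k}) i - 1) then 1 else (0::real))" for i j
 obtain x\<^sub>0 where x0: "\<forall>i<m. \<forall>l<d. cf x\<^sub>0 i l = a i l" using ex_conf[of a] by blast
 have reg: "regk d w1 w2 (cf x\<^sub>0) I k"
  unfolding regk_def
 proof (intro allI impI)
  fix v assume h: "(\<Sum>j\<in>I - {k}. v j) = 0 \<and> inW d w1 w2 (comb (cf x\<^sub>0) (I - {k}) v)"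
  then obtain s1 s2 where s: "\<forall>l<d. comb (cf x\<^sub>0) (I - {k}) v l = s1 * w1 l + s2 * w2 l" unfolding inW_def by blast
  have cmb: "comb (cf x\<^sub>0) (I - {k}) v l = (\<Sum>q<d - 1. if q = 0 then 0 else if l = en ?L (q - 1) then v (?e q) else 0)" if "l < d" for l
  proof -
   have "comb (cf x\<^sub>0) (I - {k}) v l = (\<Sum>q<d - 1. v (?e q) * a (?e q) l)"
    unfolding comb_def sum_Ik using x0 em that by (intro sum.cong) auto
   then show ?thesis using fI card_Ik by (simp add: a_def pos_en) (intro sum.cong refl, auto simp: pos_en)
  qed
  have enL: "en ?L (q - 1) \<in> ?L" if "q < d - 1" "q \<noteq> 0" for q using en_in[of ?L "q - 1"] cL that by auto
  have z: "s1 * w1 l1 + s2 * w2 l1 = 0" "s1 * w1 l2 + s2 * w2 l2 = 0"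
  proof -
   have "comb (cf x\<^sub>0) (I - {k}) v l1 = 0" "comb (cf x\<^sub>0) (I - {k}) v l2 = 0"
   proof -
    have "l1 \<noteq> en ?L (q - 1)" "l2 \<noteq> en ?L (q - 1)" if "q < d - 1" "q \<noteq> 0" for q using enL[OF that] by auto
    then show "comb (cf x\<^sub>0) (I - {k}) v l1 = 0" "comb (cf x\<^sub>0) (I - {k}) v l2 = 0"
     unfolding cmb[OF l(1)] cmb[OF l(2)] by (intro sum.neutral; simp)+
   qed
   then show "s1 * w1 l1 + s2 * w2 l1 = 0" "s1 * w1 l2 + s2 * w2 l2 = 0" using s l by auto
  qed
  have "s1 * (w1 l1 * w2 l2 - w1 l2 * w2 l1) = (s1 * w1 l1 + s2 * w2 l1) * w2 l2 - (s1 * w1 l2 + s2 * w2 l2) * w2 l1"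
   by (simp add: algebra_simps)
  then have "s1 * (w1 l1 * w2 l2 - w1 l2 * w2 l1) = 0" unfolding z by simp
  then have s1: "s1 = 0" using l(3) by simp
  then have "s2 * w2 l1 = 0" "s2 * w2 l2 = 0" using z by auto
  then have s2: "s2 = 0" using l(3) by auto
  have vq: "v (?e q) = 0" if q: "q < d - 1" "q \<noteq> 0" for q
  proof -
   have lq: "en ?L (q - 1) < d" using enL[OF q] by auto
   have inj: "en ?L (q' - 1) = en ?L (q - 1) \<longleftrightarrow> q' = q" if "q' < d - 1" "q' \<noteq> 0" for q'
   proof -
    have "pos ?L (en ?L (q' - 1)) = q' - 1" "pos ?L (en ?L (q - 1)) = q - 1"
     by (rule pos_en; use cL that q in simp)+
    then have "en ?L (q' - 1) = en ?L (q - 1) ==> q' - 1 = q - 1" by metis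
    then show ?thesis using that(2) q(2) by force
   qed
   have "(\<Sum>q'<d - 1. if q' = 0 then 0 else if en ?L (q - 1) = en ?L (q' - 1) then v (?e q') else 0)
    = (\<Sum>q'<d - 1. if q' = q then v (?e q') else 0)"
   proof (intro sum.cong refl)
    fix q' assume "q' \<in> {..<d - 1}"
    then show "(if q' = 0 then 0 else if en ?L (q - 1) = en ?L (q' - 1) then v (?e q') else 0) = (if q' = q then v (?e q') else 0)"
     using inj[of q'] q(2) by (metis lessThan_iff)
   qed
   also have "\<dots> = v (?e q)" using q by simp
   finally show ?thesis using cmb[OF lq] s lq s1 s2 by simp
  qed
  have "v (?e 0) = 0" if "0 < d - 1"
  proof -
   have "(\<Sum>j\<in>I - {k}. v j) = (\<Sum>q<d - 1. v (?e q))" by (rule sum_Ik)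
   also have "\<dots> = v (?e 0) + (\<Sum>q\<in>{..<d - 1} - {0}. v (?e q))" using that by (intro sum.remove) auto
   also have "(\<Sum>q\<in>{..<d - 1} - {0}. v (?e q)) = 0" using vq by (intro sum.neutral) auto
   finally show ?thesis using h by simp
  qed
  then have "v (?e q) = 0" if "q < d - 1" for q using vq that by (cases "q = 0") auto
  then have "\<forall>j\<in>?e ` {..<d - 1}. v j = 0" by simp
  then show "\<forall>j\<in>I - {k}. v j = 0" by (simp only: bij_betw_imp_surj_on[OF bij])
 qed
 have "AE x in gauss P. dt (d + 1) (Bm d w1 w2 (cf x) I k) \<noteq> 0"
 proof (rule AE_dt_rows_nonzero[where e = ?e and N = "d - 1" and d' = d and x\<^sub>0 = x\<^sub>0])
  show "inj_on ?e {..<d - 1}" using bij unfolding bij_betw_def by blast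
  show "Bm d w1 w2 (cf x) I k r q = (if r < d \<and> q < d - 1 then cf x (?e q) r else Bm d w1 w2 (\<lambda>_ _. 0) I k r q)" for x r q
   by (simp add: Bm_def)
  show "dt (d + 1) (Bm d w1 w2 (cf x\<^sub>0) I k) \<noteq> 0" using reg regk_iff_dt[OF on] by blast
 qed (use em in auto)
 then show ?thesis using regk_iff_dt[OF on] by simp
qed

lemma AE_regk_all: "AE x in gauss P. \<forall>I. I \<subseteq> S \<longrightarrow> card I = d \<longrightarrow> (\<forall>k\<in>I. regk d w1 w2 (cf x) I k)"
proof -
 have "AE x in gauss P. \<forall>I\<in>{I. I \<subseteq> S \<and> card I = d}. \<forall>k\<in>I. regk d w1 w2 (cf x) I k"
 proof (intro AE_finite_allI)
  show "finite {I. I \<subseteq> S \<and> card I = d}" by (rule finite_subset[of _ "Pow S"]) auto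
  show "finite I" if "I \<in> {I. I \<subseteq> S \<and> card I = d}" for I using that finite_subset[of I S] by auto
 qed (use AE_regk in auto)
 then show ?thesis by eventually_elim auto
qed

text \<open>The test configuration consists of unit vectors and, at position \<open>d'\<close>, a
  row whose first \<open>d'\<close> coordinates are 0. Dimensions \<open>d'\<close> below
  \<open>d\<close> occur because the rows of the given matrix are initial parts of rows that include
  the right-hand side.\<close>

lemma AE_affine_indep:
 assumes I: "I \<subseteq> S" "card I = d' + 1" and d': "d' \<le> d"
 shows "AE x in gauss P. dt (d' + 1) (\<lambda>q r. if q < d' then cf x (en I r) q else 1) \<noteq> 0"
proof -
 have fI: "finite I" using I finite_subset by blast
 have em: "en I q < m" if "q < d' + 1" for q using en_in[of I q] fI I that by auto
 obtain x\<^sub>0 where x0: "\<forall>i<m. \<forall>l<d. cf x\<^sub>0 i l = (if l = pos I i then 1 else 0)"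
  using ex_conf[of "\<lambda>i l. if l = pos I i then 1 else 0"] by blast
 show ?thesis
 proof (rule AE_dt_rows_nonzero[where e = "en I" and N = "d' + 1" and d' = d' and x\<^sub>0 = x\<^sub>0])
  show "inj_on (en I) {..<d' + 1}" using bij_en[OF fI] I unfolding bij_betw_def by simp
  show "dt (d' + 1) (\<lambda>q r. if q < d' then cf x\<^sub>0 (en I r) q else 1) \<noteq> 0"
  proof
   assume "dt (d' + 1) (\<lambda>q r. if q < d' then cf x\<^sub>0 (en I r) q else 1) = 0"
   then obtain y q0 where y: "q0 < d' + 1" "y q0 \<noteq> 0"
    "\<forall>q<d' + 1. (\<Sum>r<d' + 1. (if q < d' then cf x\<^sub>0 (en I r) q else 1) * y r) = 0"
    unfolding dt_eq_0_iff by blast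
   have y1: "y q = 0" if "q < d'" for q
   proof -
    have "(\<Sum>r<d' + 1. (if q < d' then cf x\<^sub>0 (en I r) q else 1) * y r) = (\<Sum>r<d' + 1. if r = q then y r else 0)"
     using that x0 em fI I d' by (intro sum.cong refl) (auto simp: pos_en)
    also have "\<dots> = y q" using that by simp
    finally show ?thesis using y(3)[rule_format, of q] that by simp
   qed
   have "(\<Sum>r<d' + 1. y r) = 0" using y(3)[rule_format, of d'] by simp
   then have "y d' = 0" using y1 by simp
   then show False using y1 y(1,2) by (cases "q0 = d'") auto
  qed
 qed (use em d' in auto)
qed

text \<open>Two different index sets of size \<open>d'\<close> contain together at least
  \<open>d' + 1\<close> rows, and affine independence forbids a common hyperplane.\<close>

lemma AE_gp:
 assumes d': "d' \<le> d"
 shows "AE x in gauss P. gp d' (cf x) S"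
proof -
 have "AE x in gauss P. \<forall>I\<in>{I. I \<subseteq> S \<and> card I = d' + 1}. dt (d' + 1) (\<lambda>q r. if q < d' then cf x (en I r) q else 1) \<noteq> 0"
 proof (intro AE_finite_allI)
  show "finite {I. I \<subseteq> S \<and> card I = d' + 1}" by (rule finite_subset[of _ "Pow S"]) auto
 qed (use AE_affine_indep d' in auto)
 then show ?thesis
 proof eventually_elim
  case (elim x)
  show ?case unfolding gp_def
  proof (intro allI impI notI)
   fix I J assume IJ: "I \<subseteq> S \<and> J \<subseteq> S \<and> card I = d' \<and> card J = d' \<and> I \<noteq> J" and "\<exists>y. \<forall>i\<in>I \<union> J. dot d' (cf x i) y = 1"
   then obtain y where y: "\<forall>i\<in>I \<union> J. dot d' (cf x i) y = 1" by blast
   have fin: "finite I" "finite J" using IJ finite_subset by auto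
   have "\<not> J \<subseteq> I" using IJ card_subset_eq[OF fin(1), of J] by auto
   then obtain j where j: "j \<in> J" "j \<notin> I" by blast
   let ?I = "insert j I"
   have I': "?I \<subseteq> S" "card ?I = d' + 1" "finite ?I" using IJ j fin by auto
   have "dt (d' + 1) (\<lambda>q r. if r < d' then cf x (en ?I q) r else 1) = dt (d' + 1) (\<lambda>q r. if q < d' then cf x (en ?I r) q else 1)"
    using dt_transpose[of "d' + 1" "\<lambda>q r. if q < d' then cf x (en ?I r) q else 1"] by simp
   moreover have "dt (d' + 1) (\<lambda>q r. if r < d' then cf x (en ?I q) r else 1) = 0"
    unfolding dt_eq_0_iff
   proof (intro exI[of _ "\<lambda>r. if r < d' then y r else - 1"] conjI allI impI)
    show "\<exists>q<d' + 1. (if q < d' then y q else - 1) \<noteq> 0" by (intro exI[of _ d']) auto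
    fix q assume q: "q < d' + 1"
    have "en ?I q \<in> ?I" using en_in[OF I'(3)] I'(2) q by simp
    then have "dot d' (cf x (en ?I q)) y = 1" using y j by auto
    then show "(\<Sum>r<d' + 1. (if r < d' then cf x (en ?I q) r else 1) * (if r < d' then y r else - 1)) = 0"
     by (simp add: dot_def)
   qed
   ultimately show False using elim I' by auto
  qed
 qed
qed

lemma AE_lin_indep:
 assumes I: "I \<subseteq> S" "card I = d"
 shows "AE x in gauss P. lin_indep d (cf x) I"
proof -
 have fI: "finite I" using I finite_subset by blast
 have em: "en I q < m" if "q < d" for q using en_in[of I q] fI I that by auto
 obtain x\<^sub>0 where x0: "\<forall>i<m. \<forall>l<d. cf x\<^sub>0 i l = (if l = pos I i then 1 else 0)"
  using ex_conf[of "\<lambda>i l. if l = pos I i then 1 else 0"] by blast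
 have "AE x in gauss P. dt d (\<lambda>q r. cf x (en I r) q) \<noteq> 0"
 proof (rule AE_dt_rows_nonzero[where e = "en I" and N = d and d' = d and x\<^sub>0 = x\<^sub>0 and F = "\<lambda>_ _. 0"])
  show "inj_on (en I) {..<d}" using bij_en[OF fI] I unfolding bij_betw_def by simp
  show "dt d (\<lambda>q r. cf x\<^sub>0 (en I r) q) \<noteq> 0"
  proof
   assume "dt d (\<lambda>q r. cf x\<^sub>0 (en I r) q) = 0"
   then obtain y q0 where y: "q0 < d" "y q0 \<noteq> 0" "\<forall>q<d. (\<Sum>r<d. cf x\<^sub>0 (en I r) q * y r) = 0"
    unfolding dt_eq_0_iff by blast
   have "(\<Sum>r<d. cf x\<^sub>0 (en I r) q0 * y r) = (\<Sum>r<d. if r = q0 then y r else 0)"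
    using y(1) x0 em fI I by (intro sum.cong refl) (auto simp: pos_en)
   then show False using y by simp
  qed
 qed (use em in auto)
 then show ?thesis
  unfolding lin_indep_iff_dt[OF fI I(2)] using dt_transpose[of d "\<lambda>q r. cf _ (en I r) q"] by simp
qed

lemma AE_lin_indep_all: "AE x in gauss P. \<forall>I. I \<subseteq> S \<longrightarrow> card I = d \<longrightarrow> lin_indep d (cf x) I"
proof -
 have "AE x in gauss P. \<forall>I\<in>{I. I \<subseteq> S \<and> card I = d}. lin_indep d (cf x) I"
 proof (intro AE_finite_allI)
  show "finite {I. I \<subseteq> S \<and> card I = d}" by (rule finite_subset[of _ "Pow S"]) auto
 qed (use AE_lin_indep in auto)
 then show ?thesis by eventually_elim auto
qed

text \<open>Applied to the objective, this makes the multipliers of an optimal basis strictly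
  positive and excludes optima supported by fewer than \<open>d\<close> constraints.\<close>

lemma AE_vec_notin_span:
 assumes z: "l0 < d'" "z l0 \<noteq> 0" and d': "d' \<le> d" and I: "I \<subseteq> S" "card I = d' - 1"
 shows "AE x in gauss P. \<not> (\<exists>v. \<forall>l<d'. z l = comb (cf x) I v l)"
proof -
 have fI: "finite I" using I finite_subset by blast
 have em: "en I q < m" if "q < d' - 1" for q using en_in[of I q] fI I that by auto
 let ?L = "{..<d'} - {l0}"
 have cL: "card ?L = d' - 1" using z by simp
 obtain x\<^sub>0 where x0: "\<forall>i<m. \<forall>l<d. cf x\<^sub>0 i l = (if l = en ?L (pos I i) then 1 else 0)"
  using ex_conf[of "\<lambda>i l. if l = en ?L (pos I i) then 1 else 0"] by blast
 let ?A = "\<lambda>x r q. if q < d' - 1 then cf x (en I q) r else z r"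
 have rowsum: "(\<Sum>q<d'. ?A x r q * y q) = (\<Sum>q<d' - 1. cf x (en I q) r * y q) + z r * y (d' - 1)" for x r y
 proof -
  obtain e where e: "d' = Suc e" using z(1) by (cases d') auto
  show ?thesis by (simp add: e)
 qed
 have "AE x in gauss P. dt d' (?A x) \<noteq> 0"
 proof (rule AE_dt_rows_nonzero[where e = "en I" and N = "d' - 1" and d' = d' and x\<^sub>0 = x\<^sub>0 and F = "\<lambda>r q. z r"])
  show "inj_on (en I) {..<d' - 1}" using bij_en[OF fI] I unfolding bij_betw_def by simp
  show "dt d' (?A x\<^sub>0) \<noteq> 0"
  proof
   assume "dt d' (?A x\<^sub>0) = 0"
   then obtain y q0 where y: "q0 < d'" "y q0 \<noteq> 0" "\<forall>r<d'. (\<Sum>q<d'. ?A x\<^sub>0 r q * y q) = 0"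
    unfolding dt_eq_0_iff by blast
   have eq: "(\<Sum>q<d' - 1. if r = en ?L q then y q else 0) + z r * y (d' - 1) = 0" if "r < d'" for r
   proof -
    have "(\<Sum>q<d' - 1. cf x\<^sub>0 (en I q) r * y q) = (\<Sum>q<d' - 1. if r = en ?L q then y q else 0)"
     using x0 em fI I d' that by (intro sum.cong refl) (auto simp: pos_en)
    then show ?thesis using y(3) that rowsum[of x\<^sub>0 r y] by simp
   qed
   have enL: "en ?L q \<in> ?L" if "q < d' - 1" for q using en_in[of ?L q] cL that by auto
   have "(\<Sum>q<d' - 1. if l0 = en ?L q then y q else 0) = 0"
   proof (intro sum.neutral ballI)
    fix q assume "q \<in> {..<d' - 1}"
    then have "l0 \<noteq> en ?L q" using enL[of q] by auto
    then show "(if l0 = en ?L q then y q else 0) = 0" by simp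
   qed
   then have yd: "y (d' - 1) = 0" using eq[OF z(1)] z(2) by simp
   have "y q = 0" if q: "q < d' - 1" for q
   proof -
    have "(\<Sum>q'<d' - 1. if en ?L q = en ?L q' then y q' else 0) = (\<Sum>q'<d' - 1. if q' = q then y q' else 0)"
    proof (intro sum.cong refl)
     fix q' assume "q' \<in> {..<d' - 1}"
     then have "pos ?L (en ?L q') = q'" "pos ?L (en ?L q) = q" using cL q by (auto intro!: pos_en)
     then have "en ?L q = en ?L q' \<longleftrightarrow> q' = q" by metis
     then show "(if en ?L q = en ?L q' then y q' else 0) = (if q' = q then y q' else 0)" by simp
    qed
    also have "\<dots> = y q" using q by simp
    finally show ?thesis using eq[of "en ?L q"] enL[OF q] yd by auto
   qed
   then show False using yd y(1,2) by (cases "q0 = d' - 1") auto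
  qed
 qed (use em d' in auto)
 then show ?thesis
 proof eventually_elim
  case (elim x)
  show ?case
  proof
   assume "\<exists>v. \<forall>l<d'. z l = comb (cf x) I v l"
   then obtain v where v: "\<forall>l<d'. z l = comb (cf x) I v l" by blast
   have "dt d' (?A x) = 0"
    unfolding dt_eq_0_iff
   proof (intro exI[of _ "\<lambda>q. if q < d' - 1 then v (en I q) else - 1"] conjI allI impI)
    show "\<exists>q<d'. (if q < d' - 1 then v (en I q) else - 1) \<noteq> 0" using z(1) by (intro exI[of _ "d' - 1"]) auto
    fix r assume r: "r < d'"
    have "comb (cf x) I v r = (\<Sum>q<d' - 1. cf x (en I q) r * v (en I q))"
     unfolding comb_def sum_en[OF fI] I(2) by (simp add: mult.commute)
    then show "(\<Sum>q<d'. ?A x r q * (if q < d' - 1 then v (en I q) else - 1)) = 0"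
     using v r rowsum[of x r "\<lambda>q. if q < d' - 1 then v (en I q) else - 1"] by simp
   qed
   then show False using elim by simp
  qed
 qed
qed

lemma AE_vec_notin_span_all:
 assumes "l0 < d'" "z l0 \<noteq> 0" "d' \<le> d"
 shows "AE x in gauss P. \<forall>I. I \<subseteq> S \<longrightarrow> card I = d' - 1 \<longrightarrow> \<not> (\<exists>v. \<forall>l<d'. z l = comb (cf x) I v l)"
proof -
 have "AE x in gauss P. \<forall>I\<in>{I. I \<subseteq> S \<and> card I = d' - 1}. \<not> (\<exists>v. \<forall>l<d'. z l = comb (cf x) I v l)"
 proof (intro AE_finite_allI)
  show "finite {I. I \<subseteq> S \<and> card I = d' - 1}" by (rule finite_subset[of _ "Pow S"]) auto
 qed (use AE_vec_notin_span[of l0 d' z, OF assms] in auto)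
 then show ?thesis by eventually_elim auto
qed

end

section \<open>Gaussian tails\<close>

text \<open>Completing the square turns the integrand into \<open>sqrt 2\<close> times a normal
  density of variance 2.\<close>

lemma nn_integral_exp_sq: "(\<integral>\<^sup>+t. ennreal (exp (t\<^sup>2 / 4)) \<partial>std_normal) = ennreal (sqrt 2)"
proof -
 have "(\<integral>\<^sup>+t. ennreal (exp (t\<^sup>2 / 4)) \<partial>std_normal) = (\<integral>\<^sup>+t. ennreal (std_normal_density t) * ennreal (exp (t\<^sup>2 / 4)) \<partial>lborel)"
  by (rule nn_integral_density) auto
 also have "\<dots> = (\<integral>\<^sup>+t. ennreal (sqrt 2) * ennreal (normal_density 0 (sqrt 2) t) \<partial>lborel)"
 proof (rule nn_integral_cong)
  fix t :: real
  have e: "exp (- t\<^sup>2 / 2) * exp (t\<^sup>2 / 4) = exp (- t\<^sup>2 / 4)"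
   unfolding exp_add[symmetric] by simp
  have q: "sqrt (4 * pi) = sqrt 2 * sqrt (2 * pi)"
   by (simp add: real_sqrt_mult[symmetric])
  have "std_normal_density t * exp (t\<^sup>2 / 4) = 1 / sqrt (2 * pi) * exp (- t\<^sup>2 / 4)"
   by (simp only: std_normal_density_def mult.assoc e)
  also have "\<dots> = sqrt 2 * normal_density 0 (sqrt 2) t"
   unfolding normal_density_def by (simp add: q)
  finally show "ennreal (std_normal_density t) * ennreal (exp (t\<^sup>2 / 4)) = ennreal (sqrt 2) * ennreal (normal_density 0 (sqrt 2) t)"
   by (simp add: ennreal_mult[symmetric])
 qed
 also have "\<dots> = ennreal (sqrt 2) * emeasure (density lborel (\<lambda>t. ennreal (normal_density 0 (sqrt 2) t))) UNIV"
  by (simp add: nn_integral_cmult emeasure_density)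
 also have "\<dots> = ennreal (sqrt 2)"
  using prob_space.emeasure_space_1[OF prob_space_normal_density[of "sqrt 2" 0]] by simp
 finally show ?thesis .
qed

text \<open>Markov's inequality for the exponential of a quarter of the sum of squares, whose
  expectation factorizes over the coordinates.\<close>

lemma gauss_tail:
 assumes fin: "finite P" and Q: "Q \<subseteq> P"
 shows "emeasure (gauss P) {x \<in> space (gauss P). r < (\<Sum>p\<in>Q. (x p)\<^sup>2)} \<le> ennreal (sqrt 2 ^ card Q * exp (- r / 4))"
proof -
 interpret S: product_sigma_finite "\<lambda>_::'a. std_normal"
  by (intro product_sigma_finite.intro prob_space_imp_sigma_finite prob_space_std_normal)
 have finQ: "finite Q" using fin Q finite_subset by blast
 let ?f = "\<lambda>p t. if p \<in> Q then ennreal (exp (t\<^sup>2 / 4)) else 1"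
 have int: "(\<integral>\<^sup>+x. (\<Prod>p\<in>P. ?f p (x p)) \<partial>gauss P) = ennreal (sqrt 2 ^ card Q)"
 proof -
  have "(\<integral>\<^sup>+x. (\<Prod>p\<in>P. ?f p (x p)) \<partial>gauss P) = (\<Prod>p\<in>P. \<integral>\<^sup>+t. ?f p t \<partial>std_normal)"
   by (rule S.product_nn_integral_prod[OF fin]) auto
  also have "\<dots> = (\<Prod>p\<in>P. if p \<in> Q then ennreal (sqrt 2) else 1)"
   using prob_space.emeasure_space_1[OF prob_space_std_normal] nn_integral_exp_sq by (intro prod.cong) auto
  also have "\<dots> = ennreal (sqrt 2) ^ card Q"
   using Q fin by (simp add: prod.If_cases Int_absorb1)
  finally show ?thesis by (simp add: ennreal_power)
 qed
 let ?A = "{x \<in> space (gauss P). r < (\<Sum>p\<in>Q. (x p)\<^sup>2)}"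
 have pm: "(\<lambda>x. x p) \<in> borel_measurable (gauss P)" if "p \<in> P" for p
  using measurable_component_singleton[OF that, of "\<lambda>_. std_normal"] by simp
 have A: "?A \<in> sets (gauss P)"
 proof -
  have "(\<lambda>x. \<Sum>p\<in>Q. (x p)\<^sup>2) \<in> borel_measurable (gauss P)"
   using Q pm by (intro borel_measurable_sum borel_measurable_power) auto
  then show ?thesis by measurable
 qed
 have mp: "(\<lambda>x. \<Prod>p\<in>P. ?f p (x p)) \<in> borel_measurable (gauss P)"
 proof (rule borel_measurable_prod_ennreal)
  fix p assume p: "p \<in> P"
  have "?f p \<in> borel_measurable borel" by simp
  from measurable_compose[OF pm[OF p] this] show "(\<lambda>x. ?f p (x p)) \<in> borel_measurable (gauss P)" .
 qed
 have "emeasure (gauss P) ?A = (\<integral>\<^sup>+x. indicator ?A x \<partial>gauss P)" using A by simp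
 also have "\<dots> \<le> (\<integral>\<^sup>+x. ennreal (exp (- r / 4)) * (\<Prod>p\<in>P. ?f p (x p)) \<partial>gauss P)"
 proof (rule nn_integral_mono)
  fix x
  have eq: "(\<Prod>p\<in>P. ?f p (x p)) = ennreal (exp ((\<Sum>p\<in>Q. (x p)\<^sup>2) / 4))"
  proof -
   have "(\<Prod>p\<in>P. ?f p (x p)) = (\<Prod>p\<in>Q. ennreal (exp ((x p)\<^sup>2 / 4)))"
    using Q fin by (simp add: prod.If_cases Int_absorb1)
   also have "\<dots> = ennreal (\<Prod>p\<in>Q. exp ((x p)\<^sup>2 / 4))" by (rule prod_ennreal) simp
   also have "(\<Prod>p\<in>Q. exp ((x p)\<^sup>2 / 4)) = exp ((\<Sum>p\<in>Q. (x p)\<^sup>2) / 4)"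
    by (simp add: exp_sum[OF finQ, symmetric] sum_divide_distrib)
   finally show ?thesis .
  qed
  show "indicator ?A x \<le> ennreal (exp (- r / 4)) * (\<Prod>p\<in>P. ?f p (x p))"
  proof (cases "x \<in> ?A")
   case True
   then have "1 \<le> exp (- r / 4) * exp ((\<Sum>p\<in>Q. (x p)\<^sup>2) / 4)" by (simp add: exp_add[symmetric])
   then show ?thesis unfolding eq using True by (simp add: ennreal_mult[symmetric])
  qed simp
 qed
 also have "\<dots> = ennreal (exp (- r / 4)) * ennreal (sqrt 2 ^ card Q)"
  using mp by (simp add: nn_integral_cmult int)
 finally show ?thesis by (simp add: ennreal_mult[symmetric] mult.commute)
qed

lemma gauss_row_tail:
 assumes fin: "finite P" and R: "\<And>i. i < m ==> {i} \<times> {..<d} \<subseteq> P" and L: "0 \<le> L"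
 shows "emeasure (gauss P) {x \<in> space (gauss P). \<exists>i<m. L < enorm d (\<lambda>l. x (i, l))}
  \<le> ennreal (real m * sqrt 2 ^ d * exp (- L\<^sup>2 / 4))"
proof -
 let ?A = "\<lambda>i. {x \<in> space (gauss P). L\<^sup>2 < (\<Sum>p\<in>{i} \<times> {..<d}. (x p)\<^sup>2)}"
 have pm: "(\<lambda>x. x p) \<in> borel_measurable (gauss P)" if "p \<in> P" for p
  using measurable_component_singleton[OF that, of "\<lambda>_. std_normal"] by simp
 have A: "?A i \<in> sets (gauss P)" if "i < m" for i
 proof -
  have "(\<lambda>x. \<Sum>p\<in>{i} \<times> {..<d}. (x p)\<^sup>2) \<in> borel_measurable (gauss P)"
   using R[OF that] pm by (intro borel_measurable_sum borel_measurable_power) auto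
  then show ?thesis by measurable
 qed
 have eq: "(enorm d (\<lambda>l. x (i, l)))\<^sup>2 = (\<Sum>p\<in>{i} \<times> {..<d}. (x p)\<^sup>2)" for x :: "cvec" and i
 proof -
  have "(\<Sum>p\<in>{i} \<times> {..<d}. (x p)\<^sup>2) = (\<Sum>l<d. (x (i, l))\<^sup>2)"
   by (rule sum.reindex_bij_witness[of _ "\<lambda>l. (i, l)" snd]) auto
  then show ?thesis unfolding enorm_sq dot_def by (simp add: power2_eq_square)
 qed
 have "{x \<in> space (gauss P). \<exists>i<m. L < enorm d (\<lambda>l. x (i, l))} \<subseteq> (\<Union>i<m. ?A i)"
 proof clarify
  fix x i assume "x \<in> space (gauss P)" "i < m" "L < enorm d (\<lambda>l. x (i, l))"
  then show "x \<in> (\<Union>i<m. ?A i)" using power_strict_mono[of L "enorm d (\<lambda>l. x (i, l))" 2] L eq[of x i] by auto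
 qed
 then have "emeasure (gauss P) {x \<in> space (gauss P). \<exists>i<m. L < enorm d (\<lambda>l. x (i, l))} \<le> emeasure (gauss P) (\<Union>i<m. ?A i)"
  using A by (intro emeasure_mono) auto
 also have "\<dots> \<le> (\<Sum>i<m. emeasure (gauss P) (?A i))"
  using A by (intro emeasure_subadditive_finite) auto
 also have "\<dots> \<le> (\<Sum>i<m. ennreal (sqrt 2 ^ d * exp (- L\<^sup>2 / 4)))"
 proof (intro sum_mono)
  fix i assume "i \<in> {..<m}"
  then have Ri: "{i} \<times> {..<d} \<subseteq> P" using R by simp
  have c: "card ({i} \<times> {..<d}) = d" by (simp add: card_cartesian_product)
  show "emeasure (gauss P) (?A i) \<le> ennreal (sqrt 2 ^ d * exp (- L\<^sup>2 / 4))"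
   using gauss_tail[OF fin Ri, of "L\<^sup>2"] unfolding c .
 qed
 also have "\<dots> = ennreal (real m * sqrt 2 ^ d * exp (- L\<^sup>2 / 4))"
  by (simp add: ennreal_of_nat_eq_real_of_nat ennreal_mult mult.assoc)
 finally show ?thesis .
qed

text \<open>A trivial count, affordable only on events of tiny probability.\<close>

lemma card_shadow_sets_le: "card (shadow_sets d w1 w2 m c) \<le> m ^ d"
proof -
 have "card (shadow_sets d w1 w2 m c) \<le> card {I. I \<subseteq> {..<m} \<and> card I = d}"
 proof (rule card_mono)
  show "finite {I. I \<subseteq> {..<m} \<and> card I = d}" by (rule finite_subset[of _ "Pow {..<m}"]) auto
 qed (auto simp: shadow_sets_def)
 also have "\<dots> = m choose d" by (simp add: n_subsets)
 also have "\<dots> \<le> m ^ d"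
  by (cases "d \<le> m") (simp_all add: binomial_le_pow binomial_eq_0)
 finally show ?thesis .
qed

lemma (in shadow_meas) measurable_card_shadow:
 assumes "S = {..<m}" and on: "\<And>\<omega>. \<omega> \<in> space M ==> orthonormal2 d (w1 \<omega>) (w2 \<omega>)"
 shows "(\<lambda>\<omega>. nshadow d (w1 \<omega>) (w2 \<omega>) m (c \<omega>) :: ennreal) \<in> borel_measurable M"
proof -
 let ?I = "{I. I \<subseteq> S \<and> card I = d}"
 let ?E = "\<lambda>I. {\<omega> \<in> space M. \<exists>k\<in>I. edge d (w1 \<omega>) (w2 \<omega>) (c \<omega>) S 0 I k}"
 have finI: "finite ?I" using finS by (intro finite_subset[of ?I "Pow S"]) auto
 have E: "?E I \<in> sets M" if "I \<in> ?I" for I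
 proof -
  have "finite I" using that finS finite_subset by blast
  moreover have "{\<omega> \<in> space M. edge d (w1 \<omega>) (w2 \<omega>) (c \<omega>) S 0 I k} \<in> sets M" if "k \<in> I" for k
  proof (rule sets_edge)
   show "basis_index d I k" using \<open>I \<in> ?I\<close> that assms(1) by (intro basis_index_lessThan[of I m]) auto
  qed (use \<open>I \<in> ?I\<close> on in auto)
  ultimately show ?thesis by (intro sets.sets_Collect_finite_Ex)
 qed
 have "(\<lambda>\<omega>. \<Sum>I\<in>?I. indicator (?E I) \<omega> :: ennreal) \<in> borel_measurable M"
  using E by (intro borel_measurable_sum borel_measurable_indicator)
 moreover have "nshadow d (w1 \<omega>) (w2 \<omega>) m (c \<omega>) = (\<Sum>I\<in>?I. indicator (?E I) \<omega> :: ennreal)"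
  if "\<omega> \<in> space M" for \<omega>
 proof -
  have "shadow_sets d (w1 \<omega>) (w2 \<omega>) m (c \<omega>) = ?I \<inter> {I. \<omega> \<in> ?E I}"
   unfolding shadow_sets_def using that assms(1) by auto
  then show ?thesis using finI by (simp add: indicator_def sum.If_cases)
 qed
 ultimately show ?thesis by (subst measurable_cong) auto
qed

section \<open>The interpolation walk\<close>

lemma lin_indep_dual:
 assumes "finite I" "card I = d" "lin_indep d c I" "\<forall>i\<in>I. dot d (c i) y = 0" "l < d"
 shows "y l = 0"
proof (rule ccontr)
 assume "y l \<noteq> 0"
 moreover have "(\<Sum>q<d. c (en I r) q * y q) = 0" if "r < d" for r
  using assms(4) en_in[of I r] assms(1,2) that by (auto simp: dot_def)
 ultimately have "dt d (\<lambda>r l. c (en I r) l) = 0" unfolding dt_eq_0_iff using assms(5) by blast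
 then show False using assms(3) lin_indep_iff_dt[OF assms(1,2)] by blast
qed

text \<open>Complementary slackness: \<open>x1\<close> and \<open>x2\<close> both maximize
  \<open>z\<close>, and a strictly positive multiplier forces its constraint to be tight at every
  maximizer.\<close>

lemma optimal_bases_tight:
 assumes fin: "finite J1" "finite J2" and J: "J1 \<subseteq> S" "J2 \<subseteq> S"
  and x1: "\<forall>i\<in>J1. dot d (a i) x1 = \<beta> i" "\<forall>j\<in>S. dot d (a j) x1 \<le> \<beta> j"
  and x2: "\<forall>i\<in>J2. dot d (a i) x2 = \<beta> i" "\<forall>j\<in>S. dot d (a j) x2 \<le> \<beta> j"
  and l1: "\<forall>i\<in>J1. 0 < l1 i" "\<forall>k<d. z k = comb a J1 l1 k"
  and l2: "\<forall>i\<in>J2. 0 \<le> l2 i" "\<forall>k<d. z k = comb a J2 l2 k"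
 shows "\<forall>i\<in>J1 \<union> J2. dot d (a i) x2 = \<beta> i"
proof -
 have z1: "dot d z x = (\<Sum>i\<in>J1. l1 i * dot d (a i) x)" for x
  using dot_cong[of d z "comb a J1 l1" x x] l1(2) dot_comb[OF fin(1), of d a l1 x] by simp
 have z2: "dot d z x = (\<Sum>i\<in>J2. l2 i * dot d (a i) x)" for x
  using dot_cong[of d z "comb a J2 l2" x x] l2(2) dot_comb[OF fin(2), of d a l2 x] by simp
 have "dot d z x1 \<le> (\<Sum>i\<in>J2. l2 i * \<beta> i)"
  unfolding z2 using l2(1) x1(2) J(2) by (intro sum_mono mult_left_mono) auto
 also have "\<dots> = dot d z x2" unfolding z2 using x2(1) by simp
 finally have ge: "dot d z x1 \<le> dot d z x2" .
 have "(\<Sum>i\<in>J1. l1 i * (\<beta> i - dot d (a i) x2)) = dot d z x1 - dot d z x2"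
  unfolding z1 using x1(1) by (simp add: right_diff_distrib sum_subtractf)
 then have "(\<Sum>i\<in>J1. l1 i * (\<beta> i - dot d (a i) x2)) \<le> 0" using ge by simp
 moreover have nn: "0 \<le> l1 i * (\<beta> i - dot d (a i) x2)" if "i \<in> J1" for i
  using l1(1) x2(2) J(1) that by (intro mult_nonneg_nonneg) (auto simp: less_imp_le)
 moreover have "0 \<le> (\<Sum>i\<in>J1. l1 i * (\<beta> i - dot d (a i) x2))" using nn by (rule sum_nonneg)
 ultimately have "(\<Sum>i\<in>J1. l1 i * (\<beta> i - dot d (a i) x2)) = 0" by linarith
 then have "\<forall>i\<in>J1. l1 i * (\<beta> i - dot d (a i) x2) = 0"
  using sum_nonneg_eq_0_iff[OF fin(1), of "\<lambda>i. l1 i * (\<beta> i - dot d (a i) x2)"] nn by simp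
 then have "dot d (a i) x2 = \<beta> i" if "i \<in> J1" for i using l1(1) that by force
 then show ?thesis using x2(1) by blast
qed

locale interp =
 fixes n d :: nat and a :: rows and b z :: rvec and R :: real and k0 :: nat
 assumes R: "0 < R" and z0: "k0 < d" "z k0 \<noteq> 0"
begin

abbreviation "IC \<equiv> int_constraints n d a b"
abbreviation "PB \<equiv> pierced_bases (Suc d) IC (int_rhs n) {..<n + 2} (int_path d z) UNIV"

text \<open>A projective change of variables replaces the right-hand side 1 of the unit program by
  \<open>R\<close>; afterwards everything is divided by \<open>R\<close>. If \<open>R\<close> is the
  largest row norm, the centers have norm at most 2 and the deviation is \<sigma>, whatever the
  scale of the program. The rows \<open>(a i, 1 - b i)\<close> themselves are large relative to
  their noise when \<open>R\<close> is small.\<close>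

definition ch :: rows where
 "ch i l = (if l < d then a i l / R else b i / R - 1)"

definition u1 :: rvec where "u1 l = (if l < d then z l / enorm d z else 0)"
definition u2 :: rvec where "u2 l = (if l = d then 1 else 0)"

lemma norm_z: "0 < enorm d z"
proof -
 have "0 < (z k0)\<^sup>2" using z0 by simp
 also have "\<dots> \<le> (\<Sum>k<d. (z k)\<^sup>2)" using z0 by (intro member_le_sum) auto
 finally show ?thesis unfolding enorm_def L2_set_def by simp
qed

lemma on_u: "orthonormal2 (Suc d) u1 u2"
proof -
 have "dot (Suc d) u1 u1 = dot d z z / (enorm d z)\<^sup>2"
  by (simp add: dot_def u1_def sum_divide_distrib power2_eq_square)
 then have "dot (Suc d) u1 u1 = 1" using norm_z by (simp add: enorm_sq[symmetric])
 then show ?thesis unfolding orthonormal2_def by (simp add: dot_def u1_def u2_def)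
qed

lemma dot_IC: "i < n ==> dot (Suc d) (IC i) y = dot d (a i) y + (1 - b i) * y d"
 "dot (Suc d) (IC n) y = - y d" "dot (Suc d) (IC (Suc n)) y = y d"
 unfolding dot_def int_constraints_def by simp_all

lemma PB_D:
 assumes "J \<in> PB"
 obtains y l where "J \<subseteq> {..<n + 2}" "finite J" "card J = Suc d" "lin_indep (Suc d) IC J"
  "\<forall>i\<in>J. dot (Suc d) (IC i) y = int_rhs n i" "\<forall>j<n + 2. dot (Suc d) (IC j) y \<le> int_rhs n j"
  "\<forall>i\<in>J. 0 \<le> l i" "\<forall>k<d. z k = (\<Sum>i\<in>J. l i * IC i k)"
proof -
 from assms obtain s u :: real where "feasible_basis (Suc d) IC (int_rhs n) {..<n + 2} J"
  "s < u" "\<forall>t. s \<le> t \<and> t \<le> u \<longrightarrow> in_cone (Suc d) IC J (int_path d z t)"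
  unfolding pierced_bases_def by blast
 moreover then have "in_cone (Suc d) IC J (int_path d z s)" by simp
 ultimately show thesis
  using that unfolding feasible_basis_def in_cone_def int_path_def by (auto simp: less_Suc_eq)
qed

lemma PB_in_shadow:
 assumes J: "J \<in> PB" "J \<subseteq> {..<n}"
  and reg: "\<And>k. k \<in> J ==> regk (Suc d) u1 u2 ch J k" and li: "lin_indep (Suc d) ch J"
 shows "J \<in> shadow_sets (Suc d) u1 u2 n ch"
proof -
 obtain y l where fJ: "finite J" "card J = Suc d"
  and y: "\<forall>i\<in>J. dot (Suc d) (IC i) y = int_rhs n i" "\<forall>j<n + 2. dot (Suc d) (IC j) y \<le> int_rhs n j"
  and l: "\<forall>i\<in>J. 0 \<le> l i" "\<forall>k<d. z k = (\<Sum>i\<in>J. l i * IC i k)"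
  using J(1) by (rule PB_D) blast
 define t where "t = y d"
 have t: "0 \<le> t" "t \<le> 1"
  using y(2)[rule_format, of n] y(2)[rule_format, of "Suc n"] unfolding dot_IC t_def int_rhs_def by auto
 \<comment> \<open>The new homogenizing factor: the interpolated right-hand side
   \<open>(1 - t) + t * b i\<close> exceeds \<open>t * b i - R * t\<close> by exactly
   \<open>w\<close>, so division by \<open>w\<close> gives every row the right-hand side 1.\<close>
 define w where "w = (1 - t) + R * t"
 have w: "0 < w"
 proof (cases "t = 1")
  case True then show ?thesis using R by (simp add: w_def)
 next
  case False then have "0 < 1 - t" "0 \<le> R * t" using t R by auto
  then show ?thesis unfolding w_def by linarith
 qed
 define yh where "yh k = (if k < d then R * y k / w else - (R * t) / w)" for k
 have dyh: "dot (Suc d) (ch i) yh = (dot d (a i) y - b i * t + R * t) / w" for i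
 proof -
  have "dot (Suc d) (ch i) yh = (\<Sum>k<d. a i k * y k / w) + (b i / R - 1) * (- (R * t) / w)"
   using R by (simp add: dot_def ch_def yh_def)
  also have "(\<Sum>k<d. a i k * y k / w) = dot d (a i) y / w" by (simp add: dot_def sum_divide_distrib)
  also have "(b i / R - 1) * (- (R * t) / w) = (- b i * t + R * t) / w" using R w by (simp add: field_simps)
  finally show ?thesis by (simp add: add_divide_distrib diff_divide_distrib)
 qed
 have "supp (Suc d) ch {..<n} J"
  unfolding supp_def
 proof (intro conjI exI[of _ yh] ballI)
  fix i assume i: "i \<in> J"
  then have "i < n" using J(2) by auto
  then have "dot d (a i) y + (1 - b i) * t = 1" using y(1) i dot_IC(1)[of i y] by (simp add: int_rhs_def t_def)
  then have "dot d (a i) y - b i * t + R * t = w" by (simp add: w_def algebra_simps)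
  then show "dot (Suc d) (ch i) yh = 1" using w by (simp add: dyh)
 next
  fix j assume "j \<in> {..<n}"
  then have "j < n" by simp
  then have "dot d (a j) y + (1 - b j) * t \<le> 1" using y(2)[rule_format, of j] dot_IC(1)[of j y] by (simp add: int_rhs_def t_def)
  then have "dot d (a j) y - b j * t + R * t \<le> w" by (simp add: w_def algebra_simps)
  then show "dot (Suc d) (ch j) yh \<le> 1" using w by (simp add: dyh)
 qed (rule li)
 moreover have cl: "comb ch J l k = z k / R" if "k < d" for k
 proof -
  have "comb ch J l k = (\<Sum>i\<in>J. l i * IC i k) / R"
   unfolding comb_def sum_divide_distrib using J(2) that by (intro sum.cong) (auto simp: ch_def int_constraints_def)
  then show ?thesis using l(2) that by simp
 qed
 moreover have "inW (Suc d) u1 u2 (comb ch J l)"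
  unfolding inW_def
 proof (intro exI allI impI)
  fix k assume "k < Suc d"
  then show "comb ch J l k = enorm d z / R * u1 k + comb ch J l d * u2 k"
   using cl[of k] norm_z by (cases "k < d") (auto simp: u1_def u2_def less_Suc_eq)
 qed
 moreover have "comb ch J l k0 \<noteq> 0" using cl[OF z0(1)] z0 R by simp
 ultimately have "\<exists>k\<in>J. edge (Suc d) u1 u2 ch {..<n} 0 J k"
  using pierced_imp_edge[OF on_u fJ zero_less_Suc _ reg l(1), of "{..<n}" k0] z0(1) by auto
 then show ?thesis unfolding shadow_sets_def using J(2) fJ by blast
qed

definition genz :: bool where
 "genz \<longleftrightarrow> (\<forall>I. I \<subseteq> {..<n} \<longrightarrow> card I = d - 1 \<longrightarrow> \<not> (\<exists>v. \<forall>l<d. z l = comb a I v l))"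

lemma cone_pos:
 assumes "genz" "J \<subseteq> {..<n}" "card J = d" "\<forall>i\<in>J. 0 \<le> l i" "\<forall>k<d. z k = comb a J l k" "i \<in> J"
 shows "0 < l i"
proof (rule ccontr)
 assume "\<not> 0 < l i"
 then have li: "l i = 0" using assms(4,6) by force
 have fJ: "finite J" using assms(2) finite_subset by blast
 have "comb a J l k = comb a (J - {i}) l k" for k
  unfolding comb_def using sum.remove[OF fJ assms(6), of "\<lambda>j. l j * a j k"] li by simp
 then have "\<forall>k<d. z k = comb a (J - {i}) l k" using assms(5) by simp
 moreover have "J - {i} \<subseteq> {..<n}" "card (J - {i}) = d - 1" using assms fJ by auto
 ultimately show False using assms(1) unfolding genz_def by blast
qed

lemma not_both: "lin_indep (Suc d) IC J ==> finite J ==> n \<in> J ==> Suc n \<notin> J"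
proof
 assume h: "lin_indep (Suc d) IC J" "finite J" "n \<in> J" "Suc n \<in> J"
 let ?l = "\<lambda>i. if i = n \<or> i = Suc n then 1 else (0::real)"
 have "(\<Sum>i\<in>J. ?l i * IC i k) = 0" for k
 proof -
  have "(\<Sum>i\<in>J. ?l i * IC i k) = (\<Sum>i\<in>{n, Suc n}. ?l i * IC i k)"
   by (rule sum.mono_neutral_right) (use h in auto)
  then show ?thesis by (simp add: int_constraints_def)
 qed
 then have "?l n = 0" using h(1)[unfolded lin_indep_def, THEN spec, of ?l] h(3) by blast
 then show False by simp
qed

text \<open>Bases with \<open>t = 0\<close> or \<open>t = 1\<close> fixed are optimal bases for the right-hand sides \<open>1\<close> and \<open>b\<close>.\<close>

lemma PB_end_D:
 assumes J: "J \<in> PB" "e \<in> J" "e = n \<or> e = Suc n"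
 obtains y l where "J - {e} \<subseteq> {..<n}" "card (J - {e}) = d" "finite (J - {e})"
  "\<forall>i\<in>J - {e}. dot d (a i) y = (if e = n then 1 else b i)" "\<forall>j<n. dot d (a j) y \<le> (if e = n then 1 else b j)"
  "\<forall>i\<in>J - {e}. 0 \<le> l i" "\<forall>k<d. z k = comb a (J - {e}) l k"
proof -
 obtain y l where fJ: "J \<subseteq> {..<n + 2}" "finite J" "card J = Suc d" and li: "lin_indep (Suc d) IC J"
  and y: "\<forall>i\<in>J. dot (Suc d) (IC i) y = int_rhs n i" "\<forall>j<n + 2. dot (Suc d) (IC j) y \<le> int_rhs n j"
  and l: "\<forall>i\<in>J. 0 \<le> l i" "\<forall>k<d. z k = (\<Sum>i\<in>J. l i * IC i k)"
  using J(1) by (rule PB_D)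
 have "\<not> (n \<in> J \<and> Suc n \<in> J)" using not_both[OF li fJ(2)] by blast
 then have sub: "J - {e} \<subseteq> {..<n}" using fJ(1) J(2,3) by (auto simp: less_Suc_eq)
 have yd: "y d = (if e = n then 0 else 1)"
  using y(1)[rule_format, OF J(2)] J(3) dot_IC(2,3)[of y] by (auto simp: int_rhs_def)
 have "\<forall>i\<in>J - {e}. dot d (a i) y = (if e = n then 1 else b i)"
 proof
  fix i assume i: "i \<in> J - {e}"
  then have "i < n" using sub by auto
  then show "dot d (a i) y = (if e = n then 1 else b i)"
   using y(1) i dot_IC(1)[of i y] yd by (auto simp: int_rhs_def split: if_splits)
 qed
 moreover have "\<forall>j<n. dot d (a j) y \<le> (if e = n then 1 else b j)"
 proof (intro allI impI)
  fix j assume j: "j < n"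
  then show "dot d (a j) y \<le> (if e = n then 1 else b j)"
   using y(2)[rule_format, of j] dot_IC(1)[of j y] yd by (auto simp: int_rhs_def split: if_splits)
 qed
 moreover have "\<forall>k<d. z k = comb a (J - {e}) l k"
 proof (intro allI impI)
  fix k assume k: "k < d"
  have "z k = l e * IC e k + (\<Sum>i\<in>J - {e}. l i * IC i k)" using l(2) k sum.remove[OF fJ(2) J(2)] by simp
  also have "IC e k = 0" using J(3) k by (auto simp: int_constraints_def)
  also have "(\<Sum>i\<in>J - {e}. l i * IC i k) = comb a (J - {e}) l k"
   unfolding comb_def using sub k by (intro sum.cong) (auto simp: int_constraints_def)
  finally show "z k = comb a (J - {e}) l k" by simp
 qed
 ultimately show thesis using that[of y l] sub fJ J(2) l(1) by auto
qed

text \<open>Generic programs have a single optimal basis. Strictly positive multipliers make the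
  optimum of the second basis tight on both; for the right-hand side 1 this contradicts
  \<open>gp\<close>, and for \<open>b\<close> it gives \<open>Suc d\<close> rows
  \<open>(a i, b i)\<close> orthogonal to \<open>(y2, - 1)\<close>, against their
  independence.\<close>

lemma PB_end_unique:
 assumes J: "J1 \<in> PB" "e \<in> J1" "J2 \<in> PB" "e \<in> J2" "e = n \<or> e = Suc n"
  and gz: genz and gpa: "gp d a {..<n}"
  and gb: "\<And>I. I \<subseteq> {..<n} ==> card I = Suc d ==> lin_indep (Suc d) (\<lambda>i l. if l < d then a i l else b i) I"
 shows "J1 = J2"
proof (rule ccontr)
 assume ne: "J1 \<noteq> J2"
 obtain y1 l1 where 1: "J1 - {e} \<subseteq> {..<n}" "card (J1 - {e}) = d" "finite (J1 - {e})"
  "\<forall>i\<in>J1 - {e}. dot d (a i) y1 = (if e = n then 1 else b i)" "\<forall>j<n. dot d (a j) y1 \<le> (if e = n then 1 else b j)"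
  "\<forall>i\<in>J1 - {e}. 0 \<le> l1 i" "\<forall>k<d. z k = comb a (J1 - {e}) l1 k"
  using PB_end_D[OF J(1,2,5)] by metis
 obtain y2 l2 where 2: "J2 - {e} \<subseteq> {..<n}" "card (J2 - {e}) = d" "finite (J2 - {e})"
  "\<forall>i\<in>J2 - {e}. dot d (a i) y2 = (if e = n then 1 else b i)" "\<forall>j<n. dot d (a j) y2 \<le> (if e = n then 1 else b j)"
  "\<forall>i\<in>J2 - {e}. 0 \<le> l2 i" "\<forall>k<d. z k = comb a (J2 - {e}) l2 k"
  using PB_end_D[OF J(3,4,5)] by metis
 have pos: "\<forall>i\<in>J1 - {e}. 0 < l1 i" using cone_pos[OF gz 1(1,2,6,7)] by blast
 have tight: "\<forall>i\<in>(J1 - {e}) \<union> (J2 - {e}). dot d (a i) y2 = (if e = n then 1 else b i)"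
  by (rule optimal_bases_tight[OF 1(3) 2(3) 1(1) 2(1) 1(4) _ 2(4) _ pos 1(7) 2(6,7)]) (use 1(5) 2(5) in auto)
 have ne': "J1 - {e} \<noteq> J2 - {e}" using ne J(2,4) by blast
 show False
 proof (cases "e = n")
  case True
  then have "\<exists>y. \<forall>i\<in>(J1 - {e}) \<union> (J2 - {e}). dot d (a i) y = 1" using tight by auto
  then show False using gpa ne' 1(1,2) 2(1,2) unfolding gp_def by blast
 next
  case False
  have "\<not> J1 - {e} \<subseteq> J2 - {e}" using ne' card_subset_eq[OF 2(3), of "J1 - {e}"] 1(2) 2(2) by auto
  then obtain j where j: "j \<in> J1 - {e}" "j \<notin> J2 - {e}" by blast
  let ?I = "insert j (J2 - {e})" and ?y = "\<lambda>l. if l < d then y2 l else - 1" and ?c = "\<lambda>i l. if l < d then a i l else b i"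
  have I: "?I \<subseteq> {..<n}" "card ?I = Suc d" "finite ?I" using j 1(1) 2(1,2,3) by auto
  have "dot (Suc d) (?c i) ?y = 0" if "i \<in> ?I" for i
  proof -
   have "dot d (a i) y2 = b i" using tight that j False by auto
   then show ?thesis by (simp add: dot_def)
  qed
  then have "?y d = 0" using lin_indep_dual[OF I(3,2) gb[OF I(1,2)], of ?y d] by blast
  then show False by simp
 qed
qed

text \<open>A basis that contains neither bound on \<open>t\<close> is an edge of the shadow; the
  summand 2 accounts for one basis with \<open>t = 0\<close> and one with
  \<open>t = 1\<close>.\<close>

lemma card_PB_le:
 assumes gz: genz and gpa: "gp d a {..<n}"
  and gb: "\<And>I. I \<subseteq> {..<n} ==> card I = Suc d ==> lin_indep (Suc d) (\<lambda>i l. if l < d then a i l else b i) I"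
  and reg: "\<And>I k. I \<subseteq> {..<n} ==> card I = Suc d ==> k \<in> I ==> regk (Suc d) u1 u2 ch I k"
  and li: "\<And>I. I \<subseteq> {..<n} ==> card I = Suc d ==> lin_indep (Suc d) ch I"
 shows "card PB \<le> card (shadow_sets (Suc d) u1 u2 n ch) + 2"
proof -
 have fPB: "finite PB" by (rule finite_pierced_bases) simp
 have fS: "finite (shadow_sets (Suc d) u1 u2 n ch)"
  unfolding shadow_sets_def by (rule finite_subset[of _ "Pow {..<n}"]) auto
 have c1: "card {J \<in> PB. e \<in> J} \<le> 1" if "e = n \<or> e = Suc n" for e
 proof -
  have f: "finite {J \<in> PB. e \<in> J}" using fPB by simp
  have "card {J \<in> PB. e \<in> J} \<le> Suc 0"
   unfolding card_le_Suc0_iff_eq[OF f]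
  proof (intro ballI)
   fix J1 J2 assume "J1 \<in> {J \<in> PB. e \<in> J}" "J2 \<in> {J \<in> PB. e \<in> J}"
   then have "J1 \<in> PB" "e \<in> J1" "J2 \<in> PB" "e \<in> J2" by blast+
   then show "J1 = J2" using that gz gpa gb by (rule PB_end_unique)
  qed
  then show ?thesis by simp
 qed
 have "PB \<subseteq> shadow_sets (Suc d) u1 u2 n ch \<union> {J \<in> PB. n \<in> J} \<union> {J \<in> PB. Suc n \<in> J}"
 proof
  fix J assume J: "J \<in> PB"
  then have sub: "J \<subseteq> {..<n + 2}" "card J = Suc d" unfolding pierced_bases_def feasible_basis_def by auto
  show "J \<in> shadow_sets (Suc d) u1 u2 n ch \<union> {J \<in> PB. n \<in> J} \<union> {J \<in> PB. Suc n \<in> J}"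
  proof (cases "n \<in> J \<or> Suc n \<in> J")
   case False
   then have "J \<subseteq> {..<n}" using sub(1) by (force simp: less_Suc_eq)
   then show ?thesis using PB_in_shadow[OF J] reg li sub(2) by blast
  qed (use J in auto)
 qed
 then have "card PB \<le> card (shadow_sets (Suc d) u1 u2 n ch \<union> {J \<in> PB. n \<in> J} \<union> {J \<in> PB. Suc n \<in> J})"
  using fPB fS by (intro card_mono) auto
 also have "\<dots> \<le> card (shadow_sets (Suc d) u1 u2 n ch) + card {J \<in> PB. n \<in> J} + card {J \<in> PB. Suc n \<in> J}"
  by (meson add_le_mono card_Un_le le_refl order_trans)
 finally show ?thesis using c1[of n] c1[of "Suc n"] by simp
qed

end

section \<open>Measurability of norms, and congruence in the coordinates that matter\<close>

lemma measurable_enorm: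
 assumes "\<And>l. l < d ==> (\<lambda>x. f x l) \<in> borel_measurable M"
 shows "(\<lambda>x. enorm d (f x)) \<in> borel_measurable M"
proof -
 have "(\<lambda>x. \<Sum>l<d. (f x l)\<^sup>2) \<in> borel_measurable M"
  using assms by (intro borel_measurable_sum borel_measurable_power) auto
 from measurable_compose[OF this borel_measurable_sqrt] show ?thesis
  unfolding enorm_def L2_set_def .
qed

lemma indicator_split: "(x \<in> A \<longleftrightarrow> x \<notin> B) ==> N = indicator A x * N + indicator B x * (N :: ennreal)"
 by (cases "x \<in> A") auto

lemma comb_cong_row: "(\<And>i. i \<in> I ==> c i l = c' i l) ==> comb c I v l = comb c' I v l"
 unfolding comb_def by (intro sum.cong) auto

lemma inW_cong: "(\<And>l. l < d ==> u l = u' l) ==> inW d w1 w2 u = inW d w1 w2 u'"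
 unfolding inW_def by auto

lemma lin_indep_cong:
 assumes "\<And>i l. i \<in> I ==> l < d ==> c i l = c' i l"
 shows "lin_indep d c I = lin_indep d c' I"
proof -
 have "(\<Sum>i\<in>I. v i * c i k) = (\<Sum>i\<in>I. v i * c' i k)" if "k < d" for v k
  using assms that by (intro sum.cong) auto
 then show ?thesis unfolding lin_indep_def by simp
qed

lemma regk_cong:
 assumes "\<And>i l. i \<in> I ==> l < d ==> c i l = c' i l"
 shows "regk d w1 w2 c I k = regk d w1 w2 c' I k"
proof -
 have "inW d w1 w2 (comb c (I - {k}) v) = inW d w1 w2 (comb c' (I - {k}) v)" for v
  by (intro inW_cong comb_cong_row) (use assms in auto)
 then show ?thesis unfolding regk_def by simp
qed

lemma edge_cong:
 assumes "\<And>i l. i \<in> S ==> l < d ==> c i l = c' i l" "I \<subseteq> S"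
 shows "edge d w1 w2 c S \<eta> I k = edge d w1 w2 c' S \<eta> I k"
proof -
 have cI: "\<And>i l. i \<in> I ==> l < d ==> c i l = c' i l" using assms by blast
 have "inW d w1 w2 (comb c I v) = inW d w1 w2 (comb c' I v)" for v
  by (intro inW_cong comb_cong_row) (use cI in auto)
 moreover have "dot d (c i) y = dot d (c' i) y" if "i \<in> S" for i y
  by (intro dot_cong) (use assms(1) that in auto)
 then have "supp d c S I = supp d c' S I"
 proof -
  assume eq: "\<And>i y. i \<in> S ==> dot d (c i) y = dot d (c' i) y"
  have "(\<forall>i\<in>I. dot d (c i) y = 1) = (\<forall>i\<in>I. dot d (c' i) y = 1)" for y
   by (intro ball_cong refl) (use eq assms(2) in auto)
  moreover have "(\<forall>j\<in>S. dot d (c j) y \<le> 1) = (\<forall>j\<in>S. dot d (c' j) y \<le> 1)" for y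
   by (intro ball_cong refl) (use eq in auto)
  moreover have "lin_indep d c I = lin_indep d c' I" by (rule lin_indep_cong) (rule cI)
  ultimately show ?thesis unfolding supp_def by simp
 qed
 ultimately show ?thesis unfolding edge_def kerv_def using regk_cong[OF cI] by simp
qed

lemma shadow_sets_cong:
 assumes "\<And>i l. i < m ==> l < d ==> c i l = c' i l"
 shows "shadow_sets d w1 w2 m c = shadow_sets d w1 w2 m c'"
proof -
 have "edge d w1 w2 c {..<m} 0 I k = edge d w1 w2 c' {..<m} 0 I k" if "I \<subseteq> {..<m}" for I k
  by (rule edge_cong[OF _ that]) (use assms in auto)
 then show ?thesis unfolding shadow_sets_def by blast
qed

lemma gp_cong:
 assumes "\<And>i l. i \<in> S ==> l < d ==> c i l = c' i l"
 shows "gp d c S = gp d c' S"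
proof -
 have "dot d (c i) y = dot d (c' i) y" if "i \<in> S" for i y
  by (intro dot_cong) (use assms that in auto)
 then have "(\<forall>i\<in>I \<union> J. dot d (c i) y = 1) = (\<forall>i\<in>I \<union> J. dot d (c' i) y = 1)" if "I \<subseteq> S" "J \<subseteq> S" for I J y
  using that by (intro ball_cong refl) auto
 then show ?thesis unfolding gp_def by auto
qed

context gconf
begin

text \<open>Rows of norm more than \<open>L\<close> are so unlikely that the trivial bound on the number of edges suffices there.\<close>

lemma nn_integral_shadow_truncate:
 assumes L: "0 \<le> L" and small: "real m ^ d * (real m * sqrt 2 ^ d * exp (- L\<^sup>2 / 4)) \<le> B" and B: "0 \<le> B"
 shows "(\<integral>\<^sup>+x. indicator {x \<in> space (gauss P). \<exists>i<m. L < rn x i} x * nshadow d w1 w2 m (cf x) \<partial>gauss P)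
  \<le> ennreal B"
proof -
 let ?A = "{x \<in> space (gauss P). \<exists>i<m. L < rn x i}"
 have pm: "(\<lambda>x. x p) \<in> borel_measurable (gauss P)" if "p \<in> P" for p
  using measurable_component_singleton[OF that, of "\<lambda>_. std_normal"] by simp
 have rnm: "(\<lambda>x. rn x i) \<in> borel_measurable (gauss P)" if "i < m" for i
  unfolding rn_def by (rule measurable_enorm) (rule pm, use that in simp)
 have A: "?A \<in> sets (gauss P)"
 proof -
  have "?A = (\<Union>i<m. {x \<in> space (gauss P). L < rn x i})" by auto
  moreover have "{x \<in> space (gauss P). L < rn x i} \<in> sets (gauss P)" if "i < m" for i
   using rnm[OF that] by measurable
  ultimately show ?thesis by auto
 qed
 have "(\<integral>\<^sup>+x. indicator ?A x * nshadow d w1 w2 m (cf x) \<partial>gauss P)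
   \<le> (\<integral>\<^sup>+x. of_nat (m ^ d) * indicator ?A x \<partial>gauss P)"
 proof (rule nn_integral_mono)
  fix x
  have "nshadow d w1 w2 m (cf x) \<le> (of_nat (m ^ d) :: ennreal)"
   using card_shadow_sets_le by (rule of_nat_mono)
  then show "indicator ?A x * nshadow d w1 w2 m (cf x) \<le> (of_nat (m ^ d) * indicator ?A x :: ennreal)"
   by (cases "x \<in> ?A") simp_all
 qed
 also have "\<dots> = of_nat (m ^ d) * emeasure (gauss P) ?A" by (rule nn_integral_cmult_indicator[OF A])
 also have "\<dots> \<le> ennreal (real m ^ d) * ennreal (real m * sqrt 2 ^ d * exp (- L\<^sup>2 / 4))"
 proof (intro mult_mono)
  show "of_nat (m ^ d) \<le> ennreal (real m ^ d)" by (simp add: ennreal_of_nat_eq_real_of_nat ennreal_power)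
  show "emeasure (gauss P) ?A \<le> ennreal (real m * sqrt 2 ^ d * exp (- L\<^sup>2 / 4))"
   unfolding rn_def by (rule gauss_row_tail[OF finP _ L]) auto
 qed auto
 also have "\<dots> \<le> ennreal B" using small by (simp add: ennreal_mult[symmetric] ennreal_leI)
 finally show ?thesis .
qed

lemma measurable_shadow: "(\<lambda>x. nshadow d w1 w2 m (cf x) :: ennreal) \<in> borel_measurable (gauss P)"
 using measurable_card_shadow[of m] on measurable_cong_sets[OF sets_gauss_leb refl] by blast

end

text \<open>The factor 16 makes the exponential equal to n^(-4k), while the product of the other
  factors is at most n^(3k).\<close>

lemma truncation_small:
 fixes n k :: nat and L :: real
 assumes n: "2 \<le> n" and L: "L\<^sup>2 = 16 * real k * ln (real n)" and k: "1 \<le> k"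
 shows "real n ^ k * (real n * sqrt 2 ^ k * exp (- L\<^sup>2 / 4)) \<le> 1"
proof -
 have n0: "0 < real n" using n by simp
 have "- L\<^sup>2 / 4 = - (real (4 * k) * ln (real n))" unfolding L by simp
 moreover have "exp (real (4 * k) * ln (real n)) = real n ^ (4 * k)"
  unfolding exp_of_nat_mult using n0 by (simp only: exp_ln)
 ultimately have e: "exp (- L\<^sup>2 / 4) = 1 / real n ^ (4 * k)"
  by (simp only: exp_minus inverse_eq_divide)
 have "sqrt 2 \<le> real n" using n sqrt2_less_2 by linarith
 then have 1: "sqrt 2 ^ k \<le> real n ^ k" by (intro power_mono) auto
 have 2: "real n \<le> real n ^ k" using n k self_le_power[of "real n" k] by simp
 have "real n ^ k * (real n * sqrt 2 ^ k) \<le> real n ^ k * (real n ^ k * real n ^ k)"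
  using 1 2 by (intro mult_left_mono mult_mono) auto
 also have "\<dots> = real n ^ (k + (k + k))" by (simp only: power_add)
 also have "\<dots> = real n ^ (3 * k)" by (rule arg_cong[where f = "\<lambda>e. real n ^ e"]) simp
 also have "\<dots> \<le> real n ^ (4 * k)" using n by (intro power_increasing) auto
 finally show ?thesis unfolding e using n0 by (simp add: divide_le_eq_1)
qed

lemma max_row_norm_ge:
 assumes "i < n"
 shows "sqrt ((enorm d (a i))\<^sup>2 + (b i)\<^sup>2) \<le> max_row_norm n d a b"
 unfolding max_row_norm_def using assms by (intro Max_ge) auto

section \<open>Expected number of interpolation steps for the smoothed program\<close>

locale smoothed =
 fixes n d :: nat and \<sigma> :: real and z :: rvec and a0 :: rows and b0 :: rvec
  and R :: real and k0 :: nat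
 assumes d3: "3 < d" and dn: "d < n" and \<sigma>: "0 < \<sigma>" and R_def: "R = max_row_norm n d a0 b0" and R: "0 < R"
  and z0: "k0 < d" "z k0 \<noteq> 0"
begin

abbreviation "s \<equiv> \<sigma> * R"
abbreviation "PP \<equiv> {..<n} \<times> {..<Suc d}"
abbreviation "A g \<equiv> smoothed_a s a0 g"
abbreviation "B g \<equiv> smoothed_b d s b0 g"

lemma s0: "0 < s" using \<sigma> R by simp

text \<open>Two Gaussian configurations are built from the same noise: \<open>cbh\<close> centers
  the rescaled rows whose shadow is counted, \<open>cbb\<close> the plain rows
  \<open>(a i, b i)\<close> that supply general position.\<close>

definition cbh :: rows where
 "cbh i l = (if l < d then a0 i l / R else b0 i / R - 1)"
definition cbb :: rows where
 "cbb i l = (if l < d then a0 i l else b0 i)"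

abbreviation "v1 \<equiv> interp.u1 d z"
abbreviation "v2 \<equiv> interp.u2 d"

lemma interp_ax: "interp d z R k0" using R z0 by (simp add: interp_def)

sublocale H: gconf n "Suc d" cbh "\<lambda>_. \<sigma>" v1 v2
 using \<sigma> interp.on_u[OF interp_ax] by unfold_locales auto

sublocale BB: gconf n "Suc d" cbb "\<lambda>_. s" v1 v2
 using s0 interp.on_u[OF interp_ax] by unfold_locales auto

lemma H_cf: "i < n ==> l < Suc d ==> H.cf g i l = interp.ch d (A g) (B g) R i l"
 using R by (auto simp: H.cf_def cbh_def interp.ch_def[OF interp_ax] smoothed_a_def smoothed_b_def field_simps less_Suc_eq)

lemma BB_cf: "i < n ==> l < Suc d ==> BB.cf g i l = (if l < d then A g i l else B g i)"
 by (auto simp: BB.cf_def cbb_def smoothed_a_def smoothed_b_def less_Suc_eq)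

lemma AE_genz: "AE g in gauss PP. interp.genz n d (A g) z"
 using BB.AE_vec_notin_span_all[of k0 d z, OF z0 le_SucI[OF order_refl]]
proof (eventually_elim)
 case (elim g)
 have "comb (BB.cf g) I v l = comb (A g) I v l" if "I \<subseteq> {..<n}" "l < d" for I v l
  by (rule comb_cong_row) (use that BB_cf in auto)
 then show ?case using elim unfolding interp.genz_def[OF interp_ax] by auto
qed

lemma AE_gpa: "AE g in gauss PP. gp d (A g) {..<n}"
 using BB.AE_gp[of d, OF le_SucI[OF order_refl]]
proof (eventually_elim)
 case (elim g)
 have "gp d (BB.cf g) {..<n} = gp d (A g) {..<n}" by (rule gp_cong) (use BB_cf in auto)
 then show ?case using elim by simp
qed

lemma AE_int_steps_le:
 "AE g in gauss PP. \<forall>J. int_steps n d z (A g) (B g) J \<le> nshadow (Suc d) v1 v2 n (H.cf g) + 2"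
 using AE_genz AE_gpa BB.AE_lin_indep_all H.AE_regk_all H.AE_lin_indep_all
proof eventually_elim
 case (elim g)
 have ss: "shadow_sets (Suc d) v1 v2 n (H.cf g) = shadow_sets (Suc d) v1 v2 n (interp.ch d (A g) (B g) R)"
  by (rule shadow_sets_cong) (rule H_cf)
 have "card (pierced_bases (Suc d) (int_constraints n d (A g) (B g)) (int_rhs n) {..<n + 2} (int_path d z) UNIV)
   \<le> card (shadow_sets (Suc d) v1 v2 n (interp.ch d (A g) (B g) R)) + 2"
 proof (rule interp.card_PB_le[OF interp_ax elim(1,2)])
  fix I assume I: "I \<subseteq> {..<n}" "card I = Suc d"
  have "lin_indep (Suc d) (BB.cf g) I = lin_indep (Suc d) (\<lambda>i l. if l < d then A g i l else B g i) I"
   by (rule lin_indep_cong) (use BB_cf I in auto)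
  then show "lin_indep (Suc d) (\<lambda>i l. if l < d then A g i l else B g i) I" using elim(3) I by simp
  have "lin_indep (Suc d) (H.cf g) I = lin_indep (Suc d) (interp.ch d (A g) (B g) R) I"
   by (rule lin_indep_cong) (use H_cf I in auto)
  then show "lin_indep (Suc d) (interp.ch d (A g) (B g) R) I" using elim(5) I by simp
  fix k assume k: "k \<in> I"
  have "regk (Suc d) v1 v2 (H.cf g) I k = regk (Suc d) v1 v2 (interp.ch d (A g) (B g) R) I k"
   by (rule regk_cong) (use H_cf I in auto)
  then show "regk (Suc d) v1 v2 (interp.ch d (A g) (B g) R) I k" using elim(4) I k by simp
 qed
 then have "of_nat (card (pierced_bases (Suc d) (int_constraints n d (A g) (B g)) (int_rhs n) {..<n + 2} (int_path d z) UNIV))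
   \<le> (of_nat (card (shadow_sets (Suc d) v1 v2 n (H.cf g)) + 2) :: ennreal)"
  unfolding ss by (rule of_nat_mono)
 then have "walk_steps (Suc d) (int_constraints n d (A g) (B g)) (int_rhs n) {..<n + 2} (int_path d z) UNIV I
   \<le> of_nat (card (shadow_sets (Suc d) v1 v2 n (H.cf g)) + 2)" for I
  by (rule order_trans[OF walk_steps_le_card[OF finite_lessThan]])
 then show ?case unfolding int_steps_def by (simp only: of_nat_add of_nat_numeral) blast
qed

text \<open>Truncation radius of the noise, matched to \<open>truncation_small\<close> with
  \<open>k = Suc d\<close>.\<close>

definition LL :: real where "LL = 4 * sqrt (real (Suc d) * ln (real n))"

lemma LL_sq: "LL\<^sup>2 = 16 * real (Suc d) * ln (real n)"
proof -
 have "0 \<le> real (Suc d) * ln (real n)" using dn by simp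
 then show ?thesis unfolding LL_def by (simp add: power_mult_distrib)
qed

lemma ln_n_ge: "1 \<le> ln (real n)"
proof -
 have "exp 1 \<le> real n" using exp_le dn d3 by (intro order_trans[OF exp_le]) auto
 then show ?thesis using dn d3 by (subst ln_ge_iff) auto
qed

lemma LL_ge: "1 \<le> LL"
proof -
 have "1 \<le> real (Suc d) * ln (real n)" using ln_n_ge mult_mono[of 1 "real (Suc d)" 1 "ln (real n)"] by simp
 then show ?thesis unfolding LL_def using real_sqrt_ge_one[of "real (Suc d) * ln (real n)"] by linarith
qed

text \<open>\<open>(a0 i, b0 i)\<close> has norm at most \<open>R\<close> by the choice of
  \<open>R\<close>, and so has the vector with last coordinate \<open>R\<close> that is subtracted
  before the division by \<open>R\<close>.\<close>

lemma cbh_norm: "i < n ==> enorm (Suc d) (cbh i) \<le> 2"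
proof -
 assume i: "i < n"
 have "enorm (Suc d) (\<lambda>l. (if l < d then a0 i l else b0 i)) = sqrt ((enorm d (a0 i))\<^sup>2 + (b0 i)\<^sup>2)"
  unfolding enorm_def L2_set_def by (simp add: sum_nonneg)
 also have "\<dots> \<le> R" using max_row_norm_ge[OF i, of d a0 b0] unfolding R_def .
 finally have 1: "enorm (Suc d) (\<lambda>l. (if l < d then a0 i l else b0 i)) \<le> R" .
 have 2: "enorm (Suc d) (\<lambda>l. if l < d then 0 else R) = R"
  unfolding enorm_def L2_set_def using R by simp
 have "enorm (Suc d) (cbh i) = enorm (Suc d) (\<lambda>l. (1 / R) * ((if l < d then a0 i l else b0 i) - (if l < d then 0 else R)))"
  by (rule enorm_cong) (use R in \<open>auto simp: cbh_def field_simps\<close>)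
 also have "\<dots> = (1 / R) * enorm (Suc d) (\<lambda>l. (if l < d then a0 i l else b0 i) - (if l < d then 0 else R))"
  unfolding enorm_scale using R by simp
 also have "\<dots> \<le> (1 / R) * (R + R)"
  using enorm_diff[of "Suc d" "\<lambda>l. (if l < d then a0 i l else b0 i)" "\<lambda>l. if l < d then 0 else R"] 1 2 R
  by (intro mult_left_mono) auto
 finally show ?thesis using R by simp
qed

lemma expected_interp_shadow:
 "(\<integral>\<^sup>+g. nshadow (Suc d) v1 v2 n (H.cf g) \<partial>gauss PP)
  \<le> ennreal (6000000 * real (Suc d) ^ 3 * ((2 / \<sigma> + LL)\<^sup>2)\<^sup>2 + 1)"
proof -
 \<comment> \<open>Centers have norm at most 2 and the truncated noise adds at most
   \<open>\<sigma> * LL\<close>. Since \<open>LL \<le> M / \<sigma>\<close>, the square of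
   \<open>M / \<sigma>\<close> is an admissible \<open>K\<close>.\<close>
 define M where "M = 2 + \<sigma> * LL"
 define Q0 where "Q0 = {x \<in> space (leb PP). \<forall>i<n. H.rn x i \<le> LL}"
 define Q1 where "Q1 = {x \<in> space (leb PP). \<forall>i<n. enorm (Suc d) (H.cf x i) \<le> 2 * M}"
 have M0: "0 < M" unfolding M_def using \<sigma> LL_ge by (simp add: add_pos_nonneg)
 have MS: "M / \<sigma> = 2 / \<sigma> + LL" unfolding M_def using \<sigma> by (simp add: field_simps)
 have rnm: "(\<lambda>x. H.rn x i) \<in> borel_measurable (leb PP)" if "i < n" for i
  unfolding H.rn_def by (rule measurable_enorm) (use that in \<open>auto intro: measurable_component_singleton\<close>)
 have cfm: "(\<lambda>x. enorm (Suc d) (H.cf x i)) \<in> borel_measurable (leb PP)" if "i < n" for i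
  by (rule measurable_enorm) (rule H.measurable_cf[OF that])
 have Q0m: "Q0 \<in> sets (leb PP)"
 proof -
  have "Q0 = (\<Inter>i\<in>{..<n}. {x \<in> space (leb PP). H.rn x i \<le> LL})" unfolding Q0_def using dn by auto
  moreover have "{x \<in> space (leb PP). H.rn x i \<le> LL} \<in> sets (leb PP)" if "i < n" for i using rnm[OF that] by measurable
  ultimately show ?thesis using dn by (auto intro!: sets.finite_INT)
 qed
 have Q1m: "Q1 \<in> sets (leb PP)"
 proof -
  have "Q1 = (\<Inter>i\<in>{..<n}. {x \<in> space (leb PP). enorm (Suc d) (H.cf x i) \<le> 2 * M})" unfolding Q1_def using dn by auto
  moreover have "{x \<in> space (leb PP). enorm (Suc d) (H.cf x i) \<le> 2 * M} \<in> sets (leb PP)" if "i < n" for i using cfm[OF that] by measurable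
  ultimately show ?thesis using dn by (auto intro!: sets.finite_INT)
 qed
 have cfb: "enorm (Suc d) (H.cf x i) \<le> M" if "x \<in> Q0" "i < n" for x i
 proof -
  have "enorm (Suc d) (H.cf x i) \<le> enorm (Suc d) (cbh i) + enorm (Suc d) (\<lambda>l. \<sigma> * x (i, l))"
   unfolding H.cf_def[abs_def] by (rule enorm_add)
  also have "\<dots> \<le> 2 + \<sigma> * LL"
   using cbh_norm[OF that(2)] that \<sigma> unfolding Q0_def enorm_scale H.rn_def by (intro add_mono) auto
  finally show ?thesis unfolding M_def .
 qed
 interpret gconf_bounds n "Suc d" cbh "\<lambda>_. \<sigma>" v1 v2 M "(2 / \<sigma> + LL)\<^sup>2" Q0 Q1
 proof
  have "1 \<le> 2 / \<sigma> + LL" using \<sigma> LL_ge by (simp add: add_increasing)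
  then show "1 \<le> (2 / \<sigma> + LL)\<^sup>2" by simp
  show "M / \<sigma> * H.rn x i \<le> (2 / \<sigma> + LL)\<^sup>2" if "x \<in> Q0" "i < n" for x i
  proof -
   have "H.rn x i \<le> 2 / \<sigma> + LL" using that \<sigma> unfolding Q0_def by (simp add: add_increasing)
   then show ?thesis unfolding MS power2_eq_square using \<sigma> LL_ge by (intro mult_left_mono) (auto simp: add_nonneg_nonneg)
  qed
  show "(M / \<sigma>)\<^sup>2 \<le> (2 / \<sigma> + LL)\<^sup>2" unfolding MS by simp
  show "x' \<in> Q1" if "x \<in> Q0" "x' \<in> space (leb PP)" "\<And>i. i < n ==> enorm (Suc d) (\<lambda>l. H.cf x' i l - H.cf x i l) \<le> M / 100" for x x'
  proof -
   have "enorm (Suc d) (H.cf x' i) \<le> 2 * M" if i: "i < n" for i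
   proof -
    have "enorm (Suc d) (H.cf x' i) = enorm (Suc d) (\<lambda>l. H.cf x i l + (H.cf x' i l - H.cf x i l))" by simp
    also have "\<dots> \<le> enorm (Suc d) (H.cf x i) + enorm (Suc d) (\<lambda>l. H.cf x' i l - H.cf x i l)" by (rule enorm_add)
    finally show ?thesis using cfb[OF \<open>x \<in> Q0\<close> i] \<open>\<And>i. i < n ==> enorm (Suc d) (\<lambda>l. H.cf x' i l - H.cf x i l) \<le> M / 100\<close>[OF i] M0 by linarith
   qed
   then show ?thesis using that(2) unfolding Q1_def by simp
  qed
  show "enorm (Suc d) (H.cf x i) \<le> 2 * M" if "x \<in> Q1" "i < n" for x i using that unfolding Q1_def by blast
 qed (fact zero_less_Suc M0 Q0m Q1m cfb)+
 interpret G: prob_space "gauss PP" by (rule prob_space_gauss)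
 let ?N = "\<lambda>g. nshadow (Suc d) v1 v2 n (H.cf g) :: ennreal"
 let ?A = "{x \<in> space (gauss PP). \<exists>i<n. LL < H.rn x i}"
 have sp: "space (gauss PP) = space (leb PP)" by (rule sets_eq_imp_space_eq[OF sets_gauss_leb])
 have Am: "?A \<in> sets (gauss PP)"
 proof -
  have "?A = space (gauss PP) - Q0" unfolding Q0_def sp by auto
  then show ?thesis using Q0m sets_gauss_leb by auto
 qed
 have "(\<integral>\<^sup>+g. ?N g \<partial>gauss PP) = (\<integral>\<^sup>+g. indicator Q0 g * ?N g + indicator ?A g * ?N g \<partial>gauss PP)"
 proof (rule nn_integral_cong)
  fix g assume g: "g \<in> space (gauss PP)"
  have "g \<in> Q0 \<longleftrightarrow> g \<notin> ?A" using g unfolding Q0_def sp by (simp add: not_less) (meson not_le)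
  then show "?N g = indicator Q0 g * ?N g + indicator ?A g * ?N g" by (rule indicator_split)
 qed
 also have "\<dots> = (\<integral>\<^sup>+g. indicator Q0 g * ?N g \<partial>gauss PP) + (\<integral>\<^sup>+g. indicator ?A g * ?N g \<partial>gauss PP)"
  by (intro nn_integral_add borel_measurable_times_ennreal borel_measurable_indicator H.measurable_shadow Am)
   (simp only: sets_gauss_leb Q0m)
 also have "\<dots> \<le> ennreal (6000000 * real (Suc d) ^ 3 * ((2 / \<sigma> + LL)\<^sup>2)\<^sup>2) + ennreal 1"
 proof (rule add_mono)
  have "(\<integral>\<^sup>+g. indicator Q0 g * ?N g \<partial>gauss PP) \<le> ennreal (6000000 * real (Suc d) ^ 3 * ((2 / \<sigma> + LL)\<^sup>2)\<^sup>2) * emeasure (gauss PP) Q1"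
   by (rule nn_integral_shadow_le[OF H.AE_gp]) simp
  also have "\<dots> \<le> ennreal (6000000 * real (Suc d) ^ 3 * ((2 / \<sigma> + LL)\<^sup>2)\<^sup>2) * 1"
   using G.emeasure_le_1 by (intro mult_left_mono) auto
  finally show "(\<integral>\<^sup>+g. indicator Q0 g * ?N g \<partial>gauss PP) \<le> ennreal (6000000 * real (Suc d) ^ 3 * ((2 / \<sigma> + LL)\<^sup>2)\<^sup>2)" by simp
  show "(\<integral>\<^sup>+g. indicator ?A g * ?N g \<partial>gauss PP) \<le> ennreal 1"
   by (rule H.nn_integral_shadow_truncate[of LL]) (use LL_ge truncation_small[OF _ LL_sq] dn d3 in auto)
 qed
 also have "\<dots> = ennreal (6000000 * real (Suc d) ^ 3 * ((2 / \<sigma> + LL)\<^sup>2)\<^sup>2 + 1)" by (rule ennreal_plus[symmetric]) auto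
 finally show ?thesis .
qed

end

section \<open>Orthogonal matrices\<close>

abbreviation orth :: "nat => cvec => bool" where
 "orth \<equiv> Defs.orthogonal_mat"

text \<open>For square matrices a right inverse is a left inverse.\<close>

lemma orth_columns:
 assumes "orth d U" "k < d" "l < d"
 shows "(\<Sum>i<d. U (i, k) * U (i, l)) = (if k = l then 1 else 0)"
proof -
 let ?A = "mat d d U" and ?B = "transpose_mat (mat d d U)"
 have "?A * ?B = 1\<^sub>m d"
 proof (rule eq_matI)
  fix i j assume "i < dim_row (1\<^sub>m d :: real mat)" "j < dim_col (1\<^sub>m d :: real mat)"
  then have ij: "i < d" "j < d" by auto
  then have "(?A * ?B) $$ (i, j) = (\<Sum>l<d. U (i, l) * U (j, l))"
   by (simp add: scalar_prod_def atLeast0LessThan)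
  then show "(?A * ?B) $$ (i, j) = 1\<^sub>m d $$ (i, j)" using assms(1) ij by (simp add: Defs.orthogonal_mat_def)
 qed auto
 then have BA: "?B * ?A = 1\<^sub>m d" by (rule mat_mult_left_right_inverse[rotated 2]) auto
 have "(?B * ?A) $$ (k, l) = (\<Sum>i<d. U (i, k) * U (i, l))"
  using assms(2,3) by (simp add: scalar_prod_def atLeast0LessThan)
 then show ?thesis using BA assms(2,3) by simp
qed

lemma dot_mat_app:
 assumes "orth d U"
 shows "dot d (mat_app d U x) (mat_app d U y) = dot d x y"
proof -
 have "dot d (mat_app d U x) (mat_app d U y) = (\<Sum>i<d. \<Sum>k<d. \<Sum>l<d. U (i, k) * x k * (U (i, l) * y l))"
  unfolding dot_def mat_app_def sum_product ..
 also have "\<dots> = (\<Sum>k<d. \<Sum>i<d. \<Sum>l<d. U (i, k) * x k * (U (i, l) * y l))" by (rule sum.swap)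
 also have "\<dots> = (\<Sum>k<d. \<Sum>l<d. \<Sum>i<d. U (i, k) * x k * (U (i, l) * y l))"
  by (rule sum.cong[OF refl], rule sum.swap)
 also have "\<dots> = (\<Sum>k<d. \<Sum>l<d. x k * y l * (if k = l then 1 else 0))"
 proof (intro sum.cong refl)
  fix k l assume "k \<in> {..<d}" "l \<in> {..<d}"
  then have "(\<Sum>i<d. U (i, k) * U (i, l)) = (if k = l then 1 else 0)" using orth_columns[OF assms] by simp
  moreover have "(\<Sum>i<d. U (i, k) * x k * (U (i, l) * y l)) = x k * y l * (\<Sum>i<d. U (i, k) * U (i, l))"
   unfolding sum_distrib_left by (intro sum.cong) auto
  ultimately show "(\<Sum>i<d. U (i, k) * x k * (U (i, l) * y l)) = x k * y l * (if k = l then 1 else 0)" by simp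
 qed
 also have "\<dots> = (\<Sum>k<d. x k * y k)" by (intro sum.cong refl) (simp add: if_distrib cong: if_cong)
 finally show ?thesis unfolding dot_def .
qed

lemma enorm_mat_app: "orth d U ==> enorm d (mat_app d U x) = enorm d x"
 using dot_mat_app[of d U x x] enorm_sq[of d "mat_app d U x"] enorm_sq[of d x] enorm_nonneg power2_eq_imp_eq by metis

lemma mat_app_add: "mat_app d U (\<lambda>l. x l + y l) k = mat_app d U x k + mat_app d U y k"
 unfolding mat_app_def by (simp add: algebra_simps sum.distrib)

lemma mat_app_scale: "mat_app d U (\<lambda>l. r * x l) k = r * mat_app d U x k"
 unfolding mat_app_def by (simp add: algebra_simps sum_distrib_left)

definition simplex_dir :: "nat => nat => nat => real" where
 "simplex_dir d j k = ((if k = j then 1 else 0) - 1 / real d) / sqrt (1 - 1 / real d)"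

lemma simplex_vertex_eq: "simplex_vertex d \<rho> j = (\<lambda>k. simplex_center d k + \<rho> * simplex_dir d j k)"
 unfolding simplex_vertex_def simplex_dir_def by auto

lemma dot_center: "0 < d ==> dot d (simplex_center d) (simplex_center d) = 1"
 unfolding dot_def simplex_center_def by simp

lemma norm_center: "0 < d ==> enorm d (simplex_center d) = 1"
 using dot_center[of d] enorm_sq[of d "simplex_center d"] enorm_nonneg[of d "simplex_center d"]
 by (simp add: power2_eq_1_iff)

lemma norm_dir:
 assumes "1 < d" "j < d"
 shows "enorm d (simplex_dir d j) = 1"
proof -
 have d: "0 < 1 - 1 / real d" using assms by simp
 have "(\<Sum>k<d. ((if k = j then 1 else 0) - 1 / real d)\<^sup>2) = (\<Sum>k<d. (if k = j then 1 - 2 / real d else 0) + 1 / (real d)\<^sup>2)"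
  by (intro sum.cong refl) (auto simp: power2_eq_square field_simps)
 also have "\<dots> = 1 - 1 / real d" using assms by (simp add: sum.distrib power2_eq_square)
 finally have "dot d (simplex_dir d j) (simplex_dir d j) = 1"
  using d assms unfolding dot_def simplex_dir_def by (simp add: power2_eq_square[symmetric] power_divide sum_divide_distrib[symmetric])
 then show ?thesis
  using enorm_sq[of d "simplex_dir d j"] enorm_nonneg[of d "simplex_dir d j"] by (simp add: power2_eq_1_iff)
qed

lemma norm_vertex:
 assumes "1 < d" "j < d" "0 \<le> \<rho>" "\<rho> \<le> 1"
 shows "enorm d (simplex_vertex d \<rho> j) \<le> 2"
 using enorm_add[of d "simplex_center d" "\<lambda>k. \<rho> * simplex_dir d j k"] norm_center[of d] norm_dir[of d j] assms
 by (simp add: simplex_vertex_eq enorm_scale)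

text \<open>A unit vector orthogonal to the centre; its rotation completes the plane when the final
  objective is parallel to the initial one.\<close>

definition edge_dir :: rvec where
 "edge_dir k = (if k = 0 then 1 / sqrt 2 else if k = 1 then - 1 / sqrt 2 else 0)"

lemma edge_dir_props:
 assumes "1 < d"
 shows "dot d edge_dir edge_dir = 1" "dot d (simplex_center d) edge_dir = 0"
proof -
 have eq: "(\<Sum>k<d. f k) = f 0 + f 1" if "\<And>k. k \<noteq> 0 ==> k \<noteq> 1 ==> f k = 0" for f :: rvec
 proof -
  have "(\<Sum>k<d. f k) = (\<Sum>k\<in>{0, 1}. f k)" by (rule sum.mono_neutral_right) (use assms that in auto)
  then show ?thesis by simp
 qed
 show "dot d edge_dir edge_dir = 1" unfolding dot_def by (subst eq) (auto simp: edge_dir_def)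
 show "dot d (simplex_center d) edge_dir = 0" unfolding dot_def by (subst eq) (auto simp: edge_dir_def simplex_center_def)
qed

text \<open>With standard unit vectors as default values the basis is orthonormal for every matrix,
  as the measurability lemmas require on the whole space.\<close>

definition pl1 :: "nat => cvec => nat => real" where
 "pl1 d U l = (if orth d U then mat_app d U (simplex_center d) l else if l = 0 then 1 else 0)"

definition pl_res :: "nat => rvec => cvec => nat => real" where
 "pl_res d z U l = z l - dot d z (mat_app d U (simplex_center d)) * mat_app d U (simplex_center d) l"

text \<open>An orthonormal basis of a plane through the initial and the final objective; the last two cases only make it total.\<close>

definition pl2 :: "nat => rvec => cvec => nat => real" where
 "pl2 d z U l = (if orth d U
   then if enorm d (pl_res d z U) = 0 then mat_app d U edge_dir l else pl_res d z U l / enorm d (pl_res d z U)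
   else if l = 1 then 1 else 0)"

lemma enorm_eq_0: "enorm d x = 0 ==> l < d ==> x l = 0"
 unfolding enorm_def by (simp add: L2_set_eq_0_iff)

lemma pl_orthonormal:
 assumes "1 < d"
 shows "orthonormal2 d (pl1 d U) (pl2 d z U)"
proof (cases "orth d U")
 case True
 let ?w = "mat_app d U (simplex_center d)" and ?r = "pl_res d z U"
 have ww: "dot d ?w ?w = 1" using dot_mat_app[OF True] dot_center assms by simp
 have p1: "pl1 d U = ?w" by (auto simp: pl1_def True)
 show ?thesis
 proof (cases "enorm d ?r = 0")
  case True2: True
  have "pl2 d z U = mat_app d U edge_dir" using True True2 by (auto simp: pl2_def)
  then show ?thesis using ww dot_mat_app[OF True] edge_dir_props[OF assms] by (simp add: orthonormal2_def p1)
 next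
  case False
  have p2: "pl2 d z U = (\<lambda>l. (1 / enorm d ?r) * ?r l)" using True False by (auto simp: pl2_def)
  have "dot d ?r ?w = dot d (\<lambda>l. z l + (- dot d z ?w) * ?w l) ?w" by (intro dot_cong) (auto simp: pl_res_def)
  also have "\<dots> = dot d z ?w + (- dot d z ?w) * dot d ?w ?w" by (simp only: dot_add dot_scale)
  also have "\<dots> = 0" using ww by simp
  finally have rw: "dot d ?r ?w = 0" .
  have "dot d (pl2 d z U) (pl2 d z U) = (1 / enorm d ?r) * ((1 / enorm d ?r) * dot d ?r ?r)"
   unfolding p2 dot_scale by (subst dot_commute) (simp only: dot_scale)
  also have "\<dots> = 1" using False by (simp add: enorm_sq[symmetric] power2_eq_square)
  finally have "dot d (pl2 d z U) (pl2 d z U) = 1" .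
  moreover have "dot d (pl1 d U) (pl2 d z U) = 0"
   unfolding p1 p2 by (subst dot_commute) (simp only: dot_scale rw mult_zero_right)
  ultimately show ?thesis using ww by (simp add: orthonormal2_def p1)
 qed
next
 case False
 have e: "(\<Sum>k<d. (if k = i then 1 else 0) * (if k = j then 1 else (0::real))) = (if i = j then 1 else 0)" if "i < d" for i j
 proof -
  have "(\<Sum>k<d. (if k = i then 1 else 0) * (if k = j then 1 else (0::real))) = (\<Sum>k<d. if k = i then (if i = j then 1 else 0) else 0)"
   by (intro sum.cong) auto
  then show ?thesis using that by simp
 qed
 have "pl1 d U = (\<lambda>k. if k = 0 then 1 else 0)" "pl2 d z U = (\<lambda>k. if k = 1 then 1 else 0)"
  using False by (auto simp: pl1_def pl2_def)
 then show ?thesis using e[of 0 0] e[of 1 1] e[of 0 1] assms unfolding orthonormal2_def dot_def by simp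
qed

lemma pl_inW:
 assumes U: "orth d U"
 shows "inW d (pl1 d U) (pl2 d z U) (mat_app d U (simplex_center d))" "inW d (pl1 d U) (pl2 d z U) z"
proof -
 let ?w = "mat_app d U (simplex_center d)" and ?r = "pl_res d z U"
 have p1: "pl1 d U = ?w" by (auto simp: pl1_def U)
 show "inW d (pl1 d U) (pl2 d z U) ?w" unfolding inW_def p1 by (intro exI[of _ 1] exI[of _ 0]) simp
 have zr: "z l = dot d z ?w * ?w l + ?r l" for l by (simp add: pl_res_def)
 show "inW d (pl1 d U) (pl2 d z U) z"
 proof (cases "enorm d ?r = 0")
  case True
  then have "?r l = 0" if "l < d" for l using enorm_eq_0 that by blast
  then show ?thesis unfolding inW_def p1 using zr by (intro exI[of _ "dot d z ?w"] exI[of _ 0]) simp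
 next
  case False
  then have "?r l = enorm d ?r * pl2 d z U l" for l using U by (simp add: pl2_def)
  then show ?thesis unfolding inW_def p1 using zr by (intro exI[of _ "dot d z ?w"] exI[of _ "enorm d ?r"]) simp
 qed
qed

section \<open>Joining the program with the added constraints\<close>

text \<open>Column \<open>d\<close> of \<open>g\<close> perturbs only the right-hand side and is
  dropped; the noise of the added constraints is appended as the last \<open>d\<close> rows.\<close>

definition joinx :: "nat => nat => cvec => cvec => cvec" where
 "joinx n d g G = (\<lambda>(i, l)\<in>{..<n + d} \<times> {..<d}. if i < n then g (i, l) else G (i - n, l))"

lemma measurable_joinx:
 "(\<lambda>x. joinx n d (fst x) (snd x)) \<in> gauss ({..<n} \<times> {..<Suc d}) \<Otimes>\<^sub>M gauss ({..<d} \<times> {..<d}) \<rightarrow>\<^sub>M gauss ({..<n + d} \<times> {..<d})"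
 unfolding joinx_def
proof (rule measurable_restrict)
 fix p assume p: "p \<in> {..<n + d} \<times> {..<d}"
 obtain i l where il: "p = (i, l)" "i < n + d" "l < d" using p by auto
 let ?M1 = "gauss ({..<n} \<times> {..<Suc d})" and ?M2 = "gauss ({..<d} \<times> {..<d})"
 show "(\<lambda>x. case p of (i, l) => if i < n then fst x (i, l) else snd x (i - n, l)) \<in> ?M1 \<Otimes>\<^sub>M ?M2 \<rightarrow>\<^sub>M std_normal"
 proof (cases "i < n")
  case True
  then have "(\<lambda>g. g (i, l)) \<in> ?M1 \<rightarrow>\<^sub>M std_normal" using il by (intro measurable_component_singleton) auto
  from measurable_compose[OF measurable_fst this] show ?thesis using True il by simp
 next
  case False
  then have "(\<lambda>g. g (i - n, l)) \<in> ?M2 \<rightarrow>\<^sub>M std_normal" using il by (intro measurable_component_singleton) auto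
  from measurable_compose[OF measurable_snd this] show ?thesis using False il by simp
 qed
qed

lemma distr_joinx:
 "distr (gauss ({..<n} \<times> {..<Suc d}) \<Otimes>\<^sub>M gauss ({..<d} \<times> {..<d})) (gauss ({..<n + d} \<times> {..<d})) (\<lambda>x. joinx n d (fst x) (snd x))
  = gauss ({..<n + d} \<times> {..<d})"
proof -
 let ?P1 = "{..<n} \<times> {..<Suc d}" and ?P2 = "{..<d} \<times> {..<d}" and ?P = "{..<n + d} \<times> {..<d}"
 interpret S: product_sigma_finite "\<lambda>_::nat \<times> nat. std_normal"
  by (intro product_sigma_finite.intro prob_space_imp_sigma_finite prob_space_std_normal)
 interpret G2: prob_space "gauss ?P2" by (rule prob_space_gauss)
 show ?thesis
 proof (rule S.PiM_eqI)
  fix A :: "nat \<times> nat => real set" assume A: "\<And>i. i \<in> ?P ==> A i \<in> sets std_normal"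
  \<comment> \<open>The dropped column is unconstrained and contributes the factor 1.\<close>
  define A1 where "A1 p = (if snd p < d then A p else UNIV)" for p :: "nat \<times> nat"
  define A2 where "A2 p = A (fst p + n, snd p)" for p :: "nat \<times> nat"
  have pre: "(\<lambda>x. joinx n d (fst x) (snd x)) -` Pi\<^sub>E ?P A \<inter> space (gauss ?P1 \<Otimes>\<^sub>M gauss ?P2) = Pi\<^sub>E ?P1 A1 \<times> Pi\<^sub>E ?P2 A2"
  proof (intro equalityI subsetI)
   fix x assume x: "x \<in> (\<lambda>x. joinx n d (fst x) (snd x)) -` Pi\<^sub>E ?P A \<inter> space (gauss ?P1 \<Otimes>\<^sub>M gauss ?P2)"
   then have j: "\<And>p. p \<in> ?P ==> joinx n d (fst x) (snd x) p \<in> A p" by (auto simp: PiE_iff)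
   have sp: "fst x \<in> extensional ?P1" "snd x \<in> extensional ?P2"
    using x by (auto simp: space_pair_measure space_PiM PiE_iff)
   have "fst x p \<in> A1 p" if "p \<in> ?P1" for p
    using j[of p] that by (cases p) (auto simp: A1_def joinx_def)
   moreover have "snd x p \<in> A2 p" if "p \<in> ?P2" for p
    using j[of "(fst p + n, snd p)"] that by (cases p) (auto simp: A2_def joinx_def)
   ultimately show "x \<in> Pi\<^sub>E ?P1 A1 \<times> Pi\<^sub>E ?P2 A2" using sp by (cases x) (auto simp: PiE_iff)
  next
   fix x assume x: "x \<in> Pi\<^sub>E ?P1 A1 \<times> Pi\<^sub>E ?P2 A2"
   then have x1: "\<And>p. p \<in> ?P1 ==> fst x p \<in> A1 p" "\<And>p. p \<in> ?P2 ==> snd x p \<in> A2 p" "fst x \<in> extensional ?P1" "snd x \<in> extensional ?P2"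
    by (auto simp: PiE_iff)
   have "joinx n d (fst x) (snd x) p \<in> A p" if "p \<in> ?P" for p
    using x1(1)[of p] x1(2)[of "(fst p - n, snd p)"] that by (cases p) (auto simp: joinx_def A1_def A2_def)
   moreover have "joinx n d (fst x) (snd x) \<in> extensional ?P" by (simp add: joinx_def)
   ultimately show "x \<in> (\<lambda>x. joinx n d (fst x) (snd x)) -` Pi\<^sub>E ?P A \<inter> space (gauss ?P1 \<Otimes>\<^sub>M gauss ?P2)"
    using x1(3,4) by (cases x) (auto simp: space_pair_measure space_PiM PiE_iff)
  qed
  have m1: "A1 p \<in> sets std_normal" if "p \<in> ?P1" for p using A[of p] that by (cases p) (auto simp: A1_def)
  have m2: "A2 p \<in> sets std_normal" if "p \<in> ?P2" for p using A[of "(fst p + n, snd p)"] that by (cases p) (auto simp: A2_def)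
  have "emeasure (distr (gauss ?P1 \<Otimes>\<^sub>M gauss ?P2) (gauss ?P) (\<lambda>x. joinx n d (fst x) (snd x))) (Pi\<^sub>E ?P A)
   = emeasure (gauss ?P1 \<Otimes>\<^sub>M gauss ?P2) (Pi\<^sub>E ?P1 A1 \<times> Pi\<^sub>E ?P2 A2)"
   unfolding pre[symmetric] by (rule emeasure_distr[OF measurable_joinx]) (use A in \<open>auto intro!: sets_PiM_I_finite\<close>)
  also have "\<dots> = emeasure (gauss ?P1) (Pi\<^sub>E ?P1 A1) * emeasure (gauss ?P2) (Pi\<^sub>E ?P2 A2)"
   by (rule G2.emeasure_pair_measure_Times) (use m1 m2 in \<open>auto intro!: sets_PiM_I_finite\<close>)
  also have "emeasure (gauss ?P1) (Pi\<^sub>E ?P1 A1) = (\<Prod>p\<in>?P1. emeasure std_normal (A1 p))"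
   by (rule S.emeasure_PiM) (use m1 in auto)
  also have "emeasure (gauss ?P2) (Pi\<^sub>E ?P2 A2) = (\<Prod>p\<in>?P2. emeasure std_normal (A2 p))"
   by (rule S.emeasure_PiM) (use m2 in auto)
  also have "(\<Prod>p\<in>?P1. emeasure std_normal (A1 p)) = (\<Prod>p\<in>{..<n} \<times> {..<d}. emeasure std_normal (A p))"
  proof -
   have u: "emeasure std_normal UNIV = 1" using prob_space.emeasure_space_1[OF prob_space_std_normal] by simp
   have "(\<Prod>p\<in>?P1. emeasure std_normal (A1 p)) = (\<Prod>p\<in>{..<n} \<times> {..<d}. emeasure std_normal (A1 p))"
    by (rule prod.mono_neutral_right) (auto simp: A1_def u)
   also have "\<dots> = (\<Prod>p\<in>{..<n} \<times> {..<d}. emeasure std_normal (A p))"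
    by (intro prod.cong refl) (auto simp: A1_def)
   finally show ?thesis .
  qed
  also have "(\<Prod>p\<in>?P2. emeasure std_normal (A2 p)) = (\<Prod>p\<in>{n..<n + d} \<times> {..<d}. emeasure std_normal (A p))"
   by (rule prod.reindex_bij_witness[of _ "\<lambda>p. (fst p - n, snd p)" "\<lambda>p. (fst p + n, snd p)"]) (auto simp: A2_def)
  also have "(\<Prod>p\<in>{..<n} \<times> {..<d}. emeasure std_normal (A p)) * (\<Prod>p\<in>{n..<n + d} \<times> {..<d}. emeasure std_normal (A p))
   = (\<Prod>p\<in>{..<n} \<times> {..<d} \<union> {n..<n + d} \<times> {..<d}. emeasure std_normal (A p))"
   by (rule prod.union_disjoint[symmetric]) auto
  also have "{..<n} \<times> {..<d} \<union> {n..<n + d} \<times> {..<d} = ?P" by auto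
  finally show "emeasure (distr (gauss ?P1 \<Otimes>\<^sub>M gauss ?P2) (gauss ?P) (\<lambda>x. joinx n d (fst x) (snd x))) (Pi\<^sub>E ?P A)
   = (\<Prod>p\<in>?P. emeasure std_normal (A p))" .
 qed auto
qed

section \<open>One attempt on the unit program\<close>

text \<open>The rotation is held fixed; the average over it is taken last.\<close>

locale attempt = smoothed +
 fixes c1 :: real and U :: "cvec"
 assumes c1: "0 < c1" "c1 \<le> 1" and U: "orth d U"
begin

abbreviation "\<rho> \<equiv> size1 c1 d"
abbreviation "sg \<equiv> sdev1 c1 n d"
abbreviation "w1 \<equiv> pl1 d U"
abbreviation "w2 \<equiv> pl2 d z U"
abbreviation "PX \<equiv> {..<n + d} \<times> {..<d}"

lemma ln_d_ge: "1 \<le> ln (real d)"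
proof -
 have "exp 1 \<le> real d" using d3 by (intro order_trans[OF exp_le]) auto
 then show ?thesis using d3 by (subst ln_ge_iff) auto
qed

lemma rho: "0 < \<rho>" "\<rho> \<le> 1"
proof -
 have s1: "1 \<le> sqrt (ln (real d))" using ln_d_ge by simp
 show "0 < \<rho>" unfolding size1_def using c1 s1 by (intro divide_pos_pos) auto
 have "c1 / sqrt (ln (real d)) \<le> 1 / 1" using c1 s1 by (intro frac_le) auto
 then show "\<rho> \<le> 1" unfolding size1_def by simp
qed

text \<open>Truncation radius of the noise. It is the reciprocal of the first bound in
  \<open>sdev1\<close>, so that truncated noise moves an added vertex by at most 1 before the
  dilation.\<close>

definition Lx :: real where "Lx = 6 * sqrt (real d * ln (real n))"

lemma Lx_sq: "Lx\<^sup>2 = 36 * real d * ln (real n)"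
proof -
 have "0 \<le> real d * ln (real n)" using dn by simp
 then show ?thesis unfolding Lx_def by (simp add: power_mult_distrib)
qed

lemma Lx_ge: "1 \<le> Lx"
proof -
 have "1 \<le> real d * ln (real n)" using ln_n_ge d3 mult_mono[of 1 "real d" 1 "ln (real n)"] by simp
 then show ?thesis unfolding Lx_def using real_sqrt_ge_one[of "real d * ln (real n)"] by linarith
qed

lemma sg: "0 < sg" "sg * Lx \<le> 1"
proof -
 have "0 < c1 / (real d powr (3 / 2) * ln (real d))" using c1 ln_d_ge d3 by (intro divide_pos_pos mult_pos_pos) auto
 moreover have "0 < 1 / (6 * sqrt (real d * ln (real n)))"
  using Lx_ge unfolding Lx_def by (intro divide_pos_pos) linarith+
 ultimately show "0 < sg" unfolding sdev1_def by simp
 have "sg \<le> 1 / Lx" unfolding sdev1_def Lx_def by simp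
 then show "sg * Lx \<le> 1" using Lx_ge by (simp add: field_simps)
qed

definition mx :: "cvec => real" where
 "mx x = Max ((\<lambda>i. enorm d (A x i)) ` {..<n})"

definition lev :: "cvec => int" where
 "lev x = \<lceil>ln (mx x)\<rceil>"

lemma mag_lev: "mag n d (A x) = exp (of_int (lev x))"
 unfolding mag_def lev_def mx_def ..

lemma mx_ge: "i < n ==> enorm d (A x i) \<le> mx x"
 unfolding mx_def by (intro Max_ge) auto

lemma mx_ex: "\<exists>i<n. mx x = enorm d (A x i)"
proof -
 have "mx x \<in> (\<lambda>i. enorm d (A x i)) ` {..<n}" unfolding mx_def using dn by (intro Max_in) auto
 then show ?thesis by auto
qed

definition ex :: "cvec => nat => nat => real" where
 "ex x i l = (if i < n then A x i l
   else 2 * mag n d (A x) * (mat_app d U (simplex_vertex d \<rho> (i - n)) l + sg * x (i, l)))"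

text \<open>Freezes the rounded magnitude at \<open>k\<close>. The scale of the added rows in
  \<open>ex\<close> depends on the random given rows, whereas the configuration with centers
  \<open>cbk k\<close> is truly Gaussian and agrees with \<open>ex\<close> where
  \<open>lev x = k\<close>.\<close>

definition cbk :: "int => nat => nat => real" where
 "cbk k i l = (if i < n then a0 i l else 2 * exp (of_int k) * mat_app d U (simplex_vertex d \<rho> (i - n)) l)"

definition sdk :: "int => nat => real" where
 "sdk k i = (if i < n then s else 2 * exp (of_int k) * sg)"

lemma gc: "gconf (n + d) d (sdk k) w1 w2"
 using s0 sg(1) pl_orthonormal[of d U z] d3 by unfold_locales (auto simp: sdk_def)

abbreviation "ck k \<equiv> gconf.cf (cbk k) (sdk k)"

lemma ex_eq_ck: "lev x = k ==> ex x = ck k x"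
 by (intro ext) (simp add: ex_def gconf.cf_def[OF gc] cbk_def sdk_def mag_lev smoothed_a_def distrib_left mult.assoc)

lemma measurable_A: "i < n ==> l < d ==> (\<lambda>x. A x i l) \<in> borel_measurable (leb PX)"
 unfolding smoothed_a_def by (intro borel_measurable_add borel_measurable_times measurable_component_singleton[of "(i, l)" PX "\<lambda>_. lborel", simplified]) auto

lemma measurable_mx [measurable]: "mx \<in> borel_measurable (leb PX)"
 unfolding mx_def[abs_def] by (rule borel_measurable_Max) (auto intro!: measurable_enorm measurable_A)

lemma measurable_lev [measurable]: "lev \<in> leb PX \<rightarrow>\<^sub>M count_space UNIV"
 unfolding lev_def[abs_def]
 by (rule measurable_compose[OF _ measurable_real_ceiling]) measurable

definition KK :: real where "KK = (17 * (1 / \<sigma> + Lx))\<^sup>2 + 9 / sg\<^sup>2"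

lemma KK_ge: "1 \<le> KK"
proof -
 have "0 < 1 / \<sigma>" using \<sigma> by simp
 then have "1 \<le> 17 * (1 / \<sigma> + Lx)" using Lx_ge by argo
 then have "1 \<le> (17 * (1 / \<sigma> + Lx))\<^sup>2" by simp
 then show ?thesis unfolding KK_def by (simp add: add_increasing2)
qed

lemma a0_norm: "i < n ==> enorm d (a0 i) \<le> R"
proof -
 assume i: "i < n"
 have "enorm d (a0 i) = sqrt ((enorm d (a0 i))\<^sup>2)" by simp
 also have "\<dots> \<le> sqrt ((enorm d (a0 i))\<^sup>2 + (b0 i)\<^sup>2)" by (intro real_sqrt_le_mono) simp
 finally show ?thesis using max_row_norm_ge[OF i, of d a0 b0] unfolding R_def by linarith
qed

text \<open>\<open>0 < mx x\<close> is required because \<open>lev\<close> rounds a logarithm, which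
  says nothing about the norms at 0.\<close>

definition Q0 :: "int => cvec set" where
 "Q0 k = {x \<in> space (leb PX). lev x = k \<and> 0 < mx x \<and> (\<forall>i\<in>{..<n + d}. enorm d (\<lambda>l. x (i, l)) \<le> Lx)}"

definition Q1 :: "int => cvec set" where
 "Q1 k = {x \<in> space (leb PX). lev x \<in> {k - 1..k + 1} \<and> (\<forall>i\<in>{..<n + d}. enorm d (ck k x i) \<le> 2 * (6 * exp (of_int k)))}"

lemma sets_Q0: "Q0 k \<in> sets (leb PX)"
 unfolding Q0_def
proof (intro sets.sets_Collect_conj sets.sets_Collect_finite_All)
 show "{x \<in> space (leb PX). lev x = k} \<in> sets (leb PX)" "{x \<in> space (leb PX). 0 < mx x} \<in> sets (leb PX)" by measurable
 fix i assume i: "i \<in> {..<n + d}"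
 have "(\<lambda>x. enorm d (\<lambda>l. x (i, l))) \<in> borel_measurable (leb PX)"
  by (rule measurable_enorm) (use i measurable_component_singleton[of "(i, _)" PX "\<lambda>_. lborel"] in simp)
 then show "{x \<in> space (leb PX). enorm d (\<lambda>l. x (i, l)) \<le> Lx} \<in> sets (leb PX)" by measurable
qed simp

lemma sets_lev: "{x \<in> space (leb PX). lev x \<in> J} \<in> sets (leb PX)"
 using measurable_sets[OF measurable_lev, of J] by (simp add: vimage_def Int_def conj_commute)

lemma sets_Q1: "Q1 k \<in> sets (leb PX)"
 unfolding Q1_def
proof (intro sets.sets_Collect_conj sets.sets_Collect_finite_All sets_lev)
 fix i assume i: "i \<in> {..<n + d}"
 have "(\<lambda>x. enorm d (ck k x i)) \<in> borel_measurable (leb PX)"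
  by (rule measurable_enorm) (use i gconf.measurable_cf[OF gc] in auto)
 then show "{x \<in> space (leb PX). enorm d (ck k x i) \<le> 2 * (6 * exp (of_int k))} \<in> sets (leb PX)" by measurable
qed simp

lemma Q0_facts:
 assumes x: "x \<in> Q0 k"
 shows "mx x \<le> exp (of_int k)" "exp (of_int k) < exp 1 * mx x" "mx x \<le> R + s * Lx"
  "\<And>i. i < n + d ==> enorm d (\<lambda>l. x (i, l)) \<le> Lx"
proof -
 have l: "lev x = k" "0 < mx x" and Lb: "\<And>i. i < n + d ==> enorm d (\<lambda>l. x (i, l)) \<le> Lx" using x unfolding Q0_def by auto
 then show "\<And>i. i < n + d ==> enorm d (\<lambda>l. x (i, l)) \<le> Lx" by blast
 have "ln (mx x) \<le> of_int k" "of_int k - 1 < ln (mx x)" using l(1) unfolding lev_def by linarith+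
 then show "mx x \<le> exp (of_int k)" using l(2) by (metis exp_ln exp_le_cancel_iff)
 have "exp (of_int k - 1) < mx x" using \<open>of_int k - 1 < ln (mx x)\<close> l(2) by (metis exp_ln exp_less_cancel_iff)
 then show "exp (of_int k) < exp 1 * mx x" by (simp add: exp_diff field_simps)
 obtain i where i: "i < n" "mx x = enorm d (A x i)" using mx_ex by blast
 have "enorm d (A x i) \<le> enorm d (a0 i) + enorm d (\<lambda>l. s * x (i, l))"
  unfolding smoothed_a_def[abs_def] by (rule enorm_add)
 also have "\<dots> \<le> R + s * Lx" unfolding enorm_scale using a0_norm[OF i(1)] Lb[of i] i(1) s0
  by (intro add_mono) (auto simp del: zero_less_mult_iff intro!: mult_left_mono)
 finally show "mx x \<le> R + s * Lx" using i(2) by simp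
qed

lemma ck_norm:
 assumes x: "x \<in> Q0 k" and i: "i < n + d"
 shows "enorm d (ck k x i) \<le> 6 * exp (of_int k)"
proof (cases "i < n")
 case True
 have "ck k x i = A x i" using True by (auto simp: gconf.cf_def[OF gc] cbk_def sdk_def smoothed_a_def)
 then have "enorm d (ck k x i) \<le> exp (of_int k)" using mx_ge[OF True, of x] Q0_facts(1)[OF x] by simp
 also have "\<dots> \<le> 6 * exp (of_int k)" by simp
 finally show ?thesis .
next
 case False
 have "ck k x i = (\<lambda>l. 2 * exp (of_int k) * (mat_app d U (simplex_vertex d \<rho> (i - n)) l + sg * x (i, l)))"
  using False by (auto simp: gconf.cf_def[OF gc] cbk_def sdk_def algebra_simps)
 then have "enorm d (ck k x i) = 2 * exp (of_int k) * enorm d (\<lambda>l. mat_app d U (simplex_vertex d \<rho> (i - n)) l + sg * x (i, l))"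
  by (simp only: enorm_scale) simp
 also have "\<dots> \<le> 2 * exp (of_int k) * (2 + 1)"
 proof (intro mult_left_mono)
  have "enorm d (\<lambda>l. mat_app d U (simplex_vertex d \<rho> (i - n)) l + sg * x (i, l))
   \<le> enorm d (mat_app d U (simplex_vertex d \<rho> (i - n))) + enorm d (\<lambda>l. sg * x (i, l))" by (rule enorm_add)
  also have "\<dots> \<le> 2 + sg * Lx"
   unfolding enorm_scale enorm_mat_app[OF U]
   using norm_vertex[of d "i - n" \<rho>] d3 rho i False Q0_facts(4)[OF x i] sg(1) by (intro add_mono) auto
  finally show "enorm d (\<lambda>l. mat_app d U (simplex_vertex d \<rho> (i - n)) l + sg * x (i, l)) \<le> 2 + 1" using sg(2) by linarith
 qed simp
 finally show ?thesis by simp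
qed

text \<open>On \<open>Q0 k\<close> the largest row norm lies between e^(k-1) and e^k; changing it by
  at most 6 percent of e^k keeps it between e^(k-2) and e^(k+1).\<close>

lemma lev_nbhd:
 assumes x: "x \<in> Q0 k" and near: "\<And>i. i < n + d ==> enorm d (\<lambda>l. ck k x' i l - ck k x i l) \<le> 6 * exp (of_int k) / 100"
 shows "lev x' \<in> {k - 1..k + 1}"
proof -
 define M where "M = exp (of_int k :: real)"
 have M0: "0 < M" by (simp add: M_def)
 have ckA: "ck k y i = A y i" if "i < n" for y i using that by (auto simp: gconf.cf_def[OF gc] cbk_def sdk_def smoothed_a_def)
 have close: "\<bar>enorm d (A x' i) - enorm d (A x i)\<bar> \<le> 6 * M / 100" if i: "i < n" for i
 proof -
  have n1: "enorm d (\<lambda>l. A x' i l - A x i l) \<le> 6 * M / 100" using near[of i] i unfolding M_def ckA[OF i] by simp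
  have "enorm d (A x' i) \<le> enorm d (A x i) + enorm d (\<lambda>l. A x' i l - A x i l)"
   using enorm_add[of d "A x i" "\<lambda>l. A x' i l - A x i l"] by simp
  moreover have "enorm d (A x i) \<le> enorm d (A x' i) + enorm d (\<lambda>l. A x' i l - A x i l)"
   using enorm_diff[of d "A x' i" "\<lambda>l. A x' i l - A x i l"] by simp
  ultimately show ?thesis using n1 by linarith
 qed
 obtain i where i: "i < n" "mx x' = enorm d (A x' i)" using mx_ex by blast
 have up: "mx x' \<le> 2 * M"
  using close[OF i(1)] i(2) mx_ge[OF i(1), of x] Q0_facts(1)[OF x] M0 unfolding M_def by linarith
 obtain j where j: "j < n" "mx x = enorm d (A x j)" using mx_ex by blast
 have low1: "mx x - 6 * M / 100 \<le> mx x'" using close[OF j(1)] j(2) mx_ge[OF j(1), of x'] by linarith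
 have e2: "(2::real) \<le> exp 1" using exp_ge_add_one_self[of "1::real"] by simp
 have "M / exp 1 < mx x" using Q0_facts(2)[OF x] unfolding M_def by (simp add: field_simps)
 then have "M / exp 1 - 6 * M / 100 < mx x'" using low1 by linarith
 moreover have "M / exp 2 \<le> M / exp 1 - 6 * M / 100"
 proof -
  \<comment> \<open>In terms of \<open>t\<close> the claim is
    \<open>t * t \<le> t - 6 / 100\<close>, and \<open>t * (1 - t)\<close> is at least
    \<open>1 / 6\<close>.\<close>
  define t where "t = 1 / exp (1::real)"
  have t: "1 / 3 \<le> t" "t \<le> 1 / 2" unfolding t_def using e2 exp_le by (auto intro!: divide_left_mono)
  have "1 / exp 2 = t * t" unfolding t_def by (simp add: exp_add[symmetric])
  moreover have "(1 / 3) * (1 / 2) \<le> t * (1 - t)" using t by (intro mult_mono) auto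
  ultimately have "1 / exp 2 \<le> t - 6 / 100" by (simp add: algebra_simps)
  then have "M * (1 / exp 2) \<le> M * (t - 6 / 100)" using M0 by (intro mult_left_mono) auto
  then show ?thesis by (simp add: t_def algebra_simps)
 qed
 ultimately have lo: "M / exp 2 < mx x'" by linarith
 then have m0: "0 < mx x'" using M0 by (smt (verit) divide_pos_pos exp_gt_zero)
 have "ln (M / exp 2) < ln (mx x')" using lo M0 m0 by (subst ln_less_cancel_iff) auto
 then have a: "of_int k - 2 < ln (mx x')" using M0 by (simp add: ln_div M_def)
 have "ln (mx x') \<le> ln (exp 1 * M)" using order_trans[OF up mult_right_mono[OF e2, of M]] M0 m0 by (subst ln_le_cancel_iff) auto
 then have b: "ln (mx x') \<le> of_int k + 1" using M0 by (simp add: ln_mult M_def)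
 show ?thesis unfolding lev_def using a b by (auto intro: ceiling_le) linarith
qed

lemma bounds_level:
 assumes ne: "Q0 k \<noteq> {}"
 shows "gconf_bounds (n + d) d (cbk k) (sdk k) w1 w2 (6 * exp (of_int k)) KK (Q0 k) (Q1 k)"
proof -
 interpret G: gconf "n + d" d "cbk k" "sdk k" w1 w2 by (rule gc)
 define M where "M = exp (of_int k :: real)"
 have M0: "0 < M" by (simp add: M_def)
 obtain x\<^sub>0 where x0: "x\<^sub>0 \<in> Q0 k" using ne by blast
 have Ms: "6 * M / s \<le> 17 * (1 / \<sigma> + Lx)"
 proof -
  have "6 * M \<le> 6 * (exp 1 * mx x\<^sub>0)" using Q0_facts(2)[OF x0] unfolding M_def by simp
  also have "\<dots> \<le> 6 * (exp 1 * (R + s * Lx))" using Q0_facts(3)[OF x0] by simp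
  also have "\<dots> = (6 * exp 1) * (R + s * Lx)" by simp
  also have "\<dots> \<le> 17 * (R + s * Lx)" using e_less_272 R s0 Lx_ge by (intro mult_right_mono) auto
  finally have "6 * M / s \<le> 17 * (R + s * Lx) / s" using s0 by (intro divide_right_mono) auto
  also have "\<dots> = 17 * (1 / \<sigma> + Lx)" using \<sigma> R by (simp add: field_simps)
  finally show ?thesis .
 qed
 have "0 < 1 / \<sigma>" using \<sigma> by simp
 then have Ls: "Lx \<le> 17 * (1 / \<sigma> + Lx)" using Lx_ge by argo
 have sK: "(17 * (1 / \<sigma> + Lx))\<^sup>2 \<le> KK" "9 / sg\<^sup>2 \<le> KK" unfolding KK_def by auto
 have Lsg: "Lx \<le> 1 / sg" using sg by (simp add: field_simps)
 have M3: "6 * M / (2 * M * sg) = 3 / sg" using M0 by (simp add: field_simps)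
 show ?thesis
 proof
  show "0 < d" "0 < 6 * exp (real_of_int k)" "1 \<le> KK" using d3 KK_ge by auto
  show "Q0 k \<in> sets (leb G.P)" "Q1 k \<in> sets (leb G.P)" by (rule sets_Q0, rule sets_Q1)
  show "enorm d (G.cf x i) \<le> 6 * exp (real_of_int k)" if "x \<in> Q0 k" "i < n + d" for x i by (rule ck_norm[OF that])
  show "6 * exp (real_of_int k) / sdk k i * G.rn x i \<le> KK" if x: "x \<in> Q0 k" and i: "i < n + d" for x i
  proof (cases "i < n")
   case True
   have "6 * M / s * G.rn x i \<le> (17 * (1 / \<sigma> + Lx)) * (17 * (1 / \<sigma> + Lx))"
   proof (rule mult_mono)
    show "G.rn x i \<le> 17 * (1 / \<sigma> + Lx)" using Ls Q0_facts(4)[OF x i] unfolding G.rn_def by linarith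
    show "0 \<le> 17 * (1 / \<sigma> + Lx)" using Ls Lx_ge by linarith
   qed (use Ms in \<open>auto simp: G.rn_def\<close>)
   then show ?thesis using sK(1) True by (simp add: sdk_def M_def power2_eq_square)
  next
   case False
   have "6 * M / (2 * M * sg) * G.rn x i \<le> 3 / sg * (1 / sg)"
    unfolding M3 using Q0_facts(4)[OF x i] Lsg sg(1) unfolding G.rn_def by (intro mult_left_mono) auto
   also have "\<dots> \<le> 9 / sg\<^sup>2" using sg(1) by (simp add: power2_eq_square divide_right_mono)
   finally show ?thesis using sK(2) False by (simp add: sdk_def M_def)
  qed
  show "(6 * exp (real_of_int k) / sdk k i)\<^sup>2 \<le> KK" if i: "i < n + d" for i
  proof (cases "i < n")
   case True
   have "(6 * M / s)\<^sup>2 \<le> (17 * (1 / \<sigma> + Lx))\<^sup>2" using Ms M0 s0 by (intro power_mono) auto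
   then show ?thesis using sK(1) True by (simp add: sdk_def M_def)
  next
   case False
   have "(6 * M / (2 * M * sg))\<^sup>2 = 9 / sg\<^sup>2" unfolding M3 by (simp add: power_divide)
   then show ?thesis using sK(2) False by (simp add: sdk_def M_def)
  qed
  show "x' \<in> Q1 k" if x: "x \<in> Q0 k" and x': "x' \<in> space (leb G.P)"
   and near: "\<And>i. i < n + d ==> enorm d (\<lambda>l. G.cf x' i l - G.cf x i l) \<le> 6 * exp (real_of_int k) / 100" for x x'
  proof -
   have "enorm d (G.cf x' i) \<le> 2 * (6 * exp (of_int k))" if i: "i < n + d" for i
   proof -
    have "enorm d (G.cf x' i) \<le> enorm d (G.cf x i) + enorm d (\<lambda>l. G.cf x' i l - G.cf x i l)"
     using enorm_add[of d "G.cf x i" "\<lambda>l. G.cf x' i l - G.cf x i l"] by simp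
    then show ?thesis using ck_norm[OF x i] near[OF i] exp_gt_zero[of "real_of_int k"] by linarith
   qed
   then show ?thesis unfolding Q1_def using x' lev_nbhd[OF x near] by simp
  qed
  show "enorm d (G.cf x i) \<le> 2 * (6 * exp (real_of_int k))" if "x \<in> Q1 k" "i < n + d" for x i
   using that unfolding Q1_def by simp
 qed
qed

lemma level_integral:
 "(\<integral>\<^sup>+x. indicator (Q0 k) x * nshadow d w1 w2 (n + d) (ck k x) \<partial>gauss PX)
  \<le> ennreal (6000000 * real d ^ 3 * KK\<^sup>2) * emeasure (gauss PX) {x \<in> space (leb PX). lev x \<in> {k - 1..k + 1}}"
proof (cases "Q0 k = {}")
 case False
 interpret gconf_bounds "n + d" d "cbk k" "sdk k" w1 w2 "6 * exp (of_int k)" KK "Q0 k" "Q1 k" by (rule bounds_level[OF False])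
 have "(\<integral>\<^sup>+x. indicator (Q0 k) x * nshadow d w1 w2 (n + d) (ck k x) \<partial>gauss PX)
  \<le> ennreal (6000000 * real d ^ 3 * KK\<^sup>2) * emeasure (gauss PX) (Q1 k)"
  by (rule nn_integral_shadow_le[OF AE_gp]) simp
 also have "\<dots> \<le> ennreal (6000000 * real d ^ 3 * KK\<^sup>2) * emeasure (gauss PX) {x \<in> space (leb PX). lev x \<in> {k - 1..k + 1}}"
 proof (intro mult_left_mono emeasure_mono)
  show "Q1 k \<subseteq> {x \<in> space (leb PX). lev x \<in> {k - 1..k + 1}}" unfolding Q1_def by blast
  show "{x \<in> space (leb PX). lev x \<in> {k - 1..k + 1}} \<in> sets (gauss PX)" using sets_lev by (simp add: sets_gauss_leb)
 qed simp
 finally show ?thesis .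
qed simp

end

context attempt
begin

text \<open>The factor 36 in \<open>Lx_sq\<close> makes the tail n^(-9d), which outweighs the
  trivial count even for \<open>n + d\<close> rows.\<close>

lemma bad_small:
 "of_nat ((n + d) ^ d) * emeasure (gauss PX) {x \<in> space (gauss PX). \<exists>i<n + d. Lx < enorm d (\<lambda>l. x (i, l))} \<le> 1"
proof -
 let ?e = "exp (- Lx\<^sup>2 / 4)"
 have n0: "0 < real n" "1 \<le> real n" "2 \<le> n" using dn d3 by auto
 have "- Lx\<^sup>2 / 4 = - (real (9 * d) * ln (real n))" unfolding Lx_sq by simp
 moreover have "exp (real (9 * d) * ln (real n)) = real n ^ (9 * d)"
  unfolding exp_of_nat_mult using n0(1) by (simp only: exp_ln)
 ultimately have e: "?e = 1 / real n ^ (9 * d)" by (simp only: exp_minus inverse_eq_divide)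
 have nd: "real (n + d) \<le> real n ^ 2"
 proof -
  have "real (n + d) \<le> 2 * real n" using dn by simp
  also have "\<dots> \<le> real n * real n" using n0 by (intro mult_right_mono) auto
  finally show ?thesis by (simp add: power2_eq_square)
 qed
 have "sqrt 2 \<le> real n" using n0 sqrt2_less_2 by linarith
 then have 1: "sqrt 2 ^ d \<le> real n ^ d" by (intro power_mono) auto
 have 2: "real (n + d) ^ d \<le> real n ^ (2 * d)" unfolding power_mult using nd by (intro power_mono) auto
 have "real (n + d) ^ d * (real (n + d) * sqrt 2 ^ d) \<le> real n ^ (2 * d) * (real n ^ 2 * real n ^ d)"
  using 1 2 nd by (intro mult_mono) auto
 also have "\<dots> = real n ^ (2 * d + (2 + d))" by (simp only: power_add)
 also have "\<dots> \<le> real n ^ (9 * d)" using n0 d3 by (intro power_increasing) auto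
 finally have le: "real (n + d) ^ d * (real (n + d) * sqrt 2 ^ d * ?e) \<le> 1"
  unfolding e using n0(1) by (simp add: divide_le_eq_1)
 have "of_nat ((n + d) ^ d) * emeasure (gauss PX) {x \<in> space (gauss PX). \<exists>i<n + d. Lx < enorm d (\<lambda>l. x (i, l))}
   \<le> ennreal (real (n + d) ^ d) * ennreal (real (n + d) * sqrt 2 ^ d * ?e)"
 proof (intro mult_mono)
  show "of_nat ((n + d) ^ d) \<le> ennreal (real (n + d) ^ d)" by (simp only: ennreal_of_nat_eq_real_of_nat of_nat_power order_refl)
  show "emeasure (gauss PX) {x \<in> space (gauss PX). \<exists>i<n + d. Lx < enorm d (\<lambda>l. x (i, l))} \<le> ennreal (real (n + d) * sqrt 2 ^ d * ?e)"
   by (rule gauss_row_tail) (use Lx_ge in auto)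
 qed auto
 also have "\<dots> = ennreal (real (n + d) ^ d * (real (n + d) * sqrt 2 ^ d * ?e))" by (rule ennreal_mult[symmetric]) auto
 also have "\<dots> \<le> ennreal 1" using le by (rule ennreal_leI)
 finally show ?thesis by simp
qed

text \<open>The magnitude takes infinitely many values, so the bound of each level must carry the
  probability of neighbouring levels. Every \<open>x\<close> lies in three of these windows, hence
  18000000 is 3 times 6000000. The final 1 pays for noise beyond \<open>Lx\<close>.\<close>

lemma all_levels:
 "(\<integral>\<^sup>+x. indicator {x. 0 < mx x} x * nshadow d w1 w2 (n + d) (ex x) \<partial>gauss PX)
  \<le> ennreal (18000000 * real d ^ 3 * KK\<^sup>2 + 1)"
proof -
 interpret P: prob_space "gauss PX" by (rule prob_space_gauss)
 let ?bad = "{x \<in> space (gauss PX). \<exists>i<n + d. Lx < enorm d (\<lambda>l. x (i, l))}"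
 let ?N = "\<lambda>k x. nshadow d w1 w2 (n + d) (ck k x) :: ennreal"
 have sp: "space (gauss PX) = space (leb PX)" by (rule sets_eq_imp_space_eq[OF sets_gauss_leb])
 have Nm: "?N k \<in> borel_measurable (gauss PX)" for k using gconf.measurable_shadow[OF gc] .
 have fm: "(\<lambda>x. indicator (Q0 k) x * ?N k x) \<in> borel_measurable (gauss PX)" for k
  by (intro borel_measurable_times_ennreal borel_measurable_indicator Nm) (simp only: sets_gauss_leb sets_Q0)
 have bm: "?bad \<in> sets (gauss PX)"
 proof -
  have "?bad = (\<Union>i\<in>{..<n + d}. {x \<in> space (gauss PX). Lx < enorm d (\<lambda>l. x (i, l))})" by auto
  moreover have "{x \<in> space (gauss PX). Lx < enorm d (\<lambda>l. x (i, l))} \<in> sets (gauss PX)" if "i < n + d" for i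
  proof -
   have "(\<lambda>x. enorm d (\<lambda>l. x (i, l))) \<in> borel_measurable (gauss PX)"
    by (rule measurable_enorm) (use that measurable_component_singleton[of "(i, _)" PX "\<lambda>_. std_normal"] in simp)
   then show ?thesis by measurable
  qed
  ultimately show ?thesis by auto
 qed
 have pt: "indicator {x. 0 < mx x} x * nshadow d w1 w2 (n + d) (ex x)
   \<le> (\<integral>\<^sup>+k. indicator (Q0 k) x * ?N k x \<partial>count_space UNIV) + of_nat ((n + d) ^ d) * indicator ?bad x"
  if x: "x \<in> space (gauss PX)" for x
 proof (cases "0 < mx x")
  case True
  show ?thesis
  proof (cases "x \<in> ?bad")
   case xb: True
   have "nshadow d w1 w2 (n + d) (ex x) \<le> (of_nat ((n + d) ^ d) :: ennreal)"
    using card_shadow_sets_le by (rule of_nat_mono)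
   then show ?thesis using True xb by (simp add: add_increasing del: of_nat_power of_nat_add)
  next
   case False
   then have "\<forall>i\<in>{..<n + d}. enorm d (\<lambda>l. x (i, l)) \<le> Lx" using x by (force simp: not_less)
   then have xQ: "x \<in> Q0 (lev x)" using True x unfolding Q0_def sp by auto
   have "nshadow d w1 w2 (n + d) (ex x) = indicator (Q0 (lev x)) x * ?N (lev x) x"
    using xQ ex_eq_ck[OF refl, of x] by simp
   also have "\<dots> \<le> (\<integral>\<^sup>+k. indicator (Q0 k) x * ?N k x \<partial>count_space UNIV)"
    by (rule nn_integral_ge_point) simp
   finally show ?thesis using True False by simp
  qed
 qed simp
 have "(\<integral>\<^sup>+x. indicator {x. 0 < mx x} x * nshadow d w1 w2 (n + d) (ex x) \<partial>gauss PX)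
  \<le> (\<integral>\<^sup>+x. (\<integral>\<^sup>+k. indicator (Q0 k) x * ?N k x \<partial>count_space UNIV) + of_nat ((n + d) ^ d) * indicator ?bad x \<partial>gauss PX)"
  by (intro nn_integral_mono pt)
 also have "\<dots> = (\<integral>\<^sup>+x. (\<integral>\<^sup>+k. indicator (Q0 k) x * ?N k x \<partial>count_space UNIV) \<partial>gauss PX)
   + (\<integral>\<^sup>+x. of_nat ((n + d) ^ d) * indicator ?bad x \<partial>gauss PX)"
 proof (rule nn_integral_add)
  show "(\<lambda>x. \<integral>\<^sup>+k. indicator (Q0 k) x * ?N k x \<partial>count_space UNIV) \<in> borel_measurable (gauss PX)"
  proof -
   have c: "countable (UNIV :: int set)" by simp
   have "(\<lambda>x. \<integral>\<^sup>+k. indicator (Q0 k) x * ?N k x \<partial>count_space UNIV) = (\<lambda>x. \<Sum>i. indicator (Q0 (int_decode i)) x * ?N (int_decode i) x)"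
   proof
    fix x
    have "(\<integral>\<^sup>+k. indicator (Q0 k) x * ?N k x \<partial>count_space UNIV)
      = (\<integral>\<^sup>+i. indicator (Q0 (int_decode i)) x * ?N (int_decode i) x \<partial>count_space UNIV)"
     by (rule nn_integral_bij_count_space[symmetric]) (rule bij_int_decode)
    then show "(\<integral>\<^sup>+k. indicator (Q0 k) x * ?N k x \<partial>count_space UNIV) = (\<Sum>i. indicator (Q0 (int_decode i)) x * ?N (int_decode i) x)"
     by (simp only: nn_integral_count_space_nat)
   qed
   then show ?thesis using fm by simp
  qed
 qed (use bm in measurable)
 also have "(\<integral>\<^sup>+x. (\<integral>\<^sup>+k. indicator (Q0 k) x * ?N k x \<partial>count_space UNIV) \<partial>gauss PX)
   = (\<integral>\<^sup>+k. (\<integral>\<^sup>+x. indicator (Q0 k) x * ?N k x \<partial>gauss PX) \<partial>count_space UNIV)"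
  by (rule nn_integral_count_space_nn_integral) (use fm in auto)
 also have "\<dots> \<le> (\<integral>\<^sup>+k. ennreal (6000000 * real d ^ 3 * KK\<^sup>2) * emeasure (gauss PX) {x \<in> space (leb PX). lev x \<in> {k - 1..k + 1}} \<partial>count_space UNIV)"
  by (intro nn_integral_mono level_integral)
 also have "\<dots> = ennreal (6000000 * real d ^ 3 * KK\<^sup>2) * (\<integral>\<^sup>+k. emeasure (gauss PX) {x \<in> space (leb PX). lev x \<in> {k - 1..k + 1}} \<partial>count_space UNIV)"
  by (rule nn_integral_cmult) simp
 also have "(\<integral>\<^sup>+k. emeasure (gauss PX) {x \<in> space (leb PX). lev x \<in> {k - 1..k + 1}} \<partial>count_space UNIV)
   = (\<integral>\<^sup>+k. (\<integral>\<^sup>+x. indicator {x \<in> space (leb PX). lev x \<in> {k - 1..k + 1}} x \<partial>gauss PX) \<partial>count_space UNIV)"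
  by (intro nn_integral_cong nn_integral_indicator[symmetric]) (simp only: sets_gauss_leb sets_lev)
 also have "\<dots> = (\<integral>\<^sup>+x. (\<integral>\<^sup>+k. indicator {x \<in> space (leb PX). lev x \<in> {k - 1..k + 1}} x \<partial>count_space UNIV) \<partial>gauss PX)"
  by (rule nn_integral_count_space_nn_integral[symmetric]) (auto intro!: borel_measurable_indicator simp only: sets_gauss_leb sets_lev)
 also have "\<dots> = (\<integral>\<^sup>+x. 3 \<partial>gauss PX)"
 proof (rule nn_integral_cong)
  fix x assume x: "x \<in> space (gauss PX)"
  have "(\<integral>\<^sup>+k. indicator {x \<in> space (leb PX). lev x \<in> {k - 1..k + 1}} x \<partial>count_space UNIV)
    = (\<integral>\<^sup>+k. indicator {lev x - 1..lev x + 1} k \<partial>count_space UNIV)"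
   by (intro nn_integral_cong) (use x sp in \<open>auto simp: indicator_def\<close>)
  also have "\<dots> = emeasure (count_space UNIV) {lev x - 1..lev x + 1}" by (rule nn_integral_indicator) simp
  also have "\<dots> = 3" by (subst emeasure_count_space) auto
  finally show "(\<integral>\<^sup>+k. indicator {x \<in> space (leb PX). lev x \<in> {k - 1..k + 1}} x \<partial>count_space UNIV) = (3::ennreal)" .
 qed
 also have "\<dots> = 3" by (simp add: P.emeasure_space_1)
 also have "(\<integral>\<^sup>+x. of_nat ((n + d) ^ d) * indicator ?bad x \<partial>gauss PX) = of_nat ((n + d) ^ d) * emeasure (gauss PX) ?bad"
  by (rule nn_integral_cmult_indicator[OF bm])
 finally have "(\<integral>\<^sup>+x. indicator {x. 0 < mx x} x * nshadow d w1 w2 (n + d) (ex x) \<partial>gauss PX)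
   \<le> ennreal (6000000 * real d ^ 3 * KK\<^sup>2) * 3 + of_nat ((n + d) ^ d) * emeasure (gauss PX) ?bad" by (simp only: add_right_mono)
 also have "\<dots> \<le> ennreal (6000000 * real d ^ 3 * KK\<^sup>2) * ennreal 3 + ennreal 1" using bad_small by (intro add_mono) auto
 also have "\<dots> = ennreal (18000000 * real d ^ 3 * KK\<^sup>2 + 1)"
  by (subst ennreal_mult[symmetric], simp, simp, subst ennreal_plus[symmetric]) (auto simp: mult_ac)
 finally show ?thesis .
qed

lemma AE_regk_ex: "AE x in gauss PX. \<forall>I. I \<subseteq> {..<n + d} \<longrightarrow> card I = d \<longrightarrow> (\<forall>k\<in>I. regk d w1 w2 (ex x) I k)"
proof -
 have "AE x in gauss PX. \<forall>q::int. \<forall>I. I \<subseteq> {..<n + d} \<longrightarrow> card I = d \<longrightarrow> (\<forall>k\<in>I. regk d w1 w2 (ck q x) I k)"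
  unfolding AE_all_countable using gconf.AE_regk_all[OF gc] by blast
 then show ?thesis
 proof eventually_elim
  case (elim x)
  then show ?case using ex_eq_ck[OF refl, of x] by metis
 qed
qed

lemma ext_eq_ex:
 assumes "i < n + d" "l < d"
 shows "ext_constraints c1 n d (A g) U G i l = ex (joinx n d g G) i l"
proof -
 have A': "A (joinx n d g G) i l = A g i l" if "i < n" "l < d" for i l
  using that by (simp add: smoothed_a_def joinx_def)
 have "enorm d (A (joinx n d g G) i) = enorm d (A g i)" if "i < n" for i
  by (rule enorm_cong) (rule A'[OF that])
 then have "mag n d (A (joinx n d g G)) = mag n d (A g)" unfolding mag_def by simp
 then show ?thesis using assms A'[of i l]
  by (simp add: ext_constraints_def ex_def new_constraint_def joinx_def)
qed

lemma mx_join: "mx (joinx n d g G) = Max ((\<lambda>i. enorm d (A g i)) ` {..<n})"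
proof -
 have "A (joinx n d g G) i l = A g i l" if "i < n" "l < d" for i l
  using that by (simp add: smoothed_a_def joinx_def)
 then have "enorm d (A (joinx n d g G) i) = enorm d (A g i)" if "i < n" for i
  by (intro enorm_cong) (use that in auto)
 then show ?thesis unfolding mx_def by simp
qed

end

text \<open>The whole path lies in the plane. The zero vector lies in every cone and carries no
  information, but the path cannot vanish at both ends of an interval, because the initial objective
  is a nonzero multiple of a unit vector.\<close>

lemma pierced_in_shadow:
 assumes d: "1 < d" and U: "orth d U" and z0: "M \<noteq> 0" "z0 = (\<lambda>k. M * mat_app d U (simplex_center d) k)"
  and J: "J \<in> pierced_bases d c (\<lambda>_. 1) {..<m} (segment_path z0 z) {0..1}"
  and reg: "\<And>k. k \<in> J ==> regk d (pl1 d U) (pl2 d z U) c J k"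
 shows "J \<in> shadow_sets d (pl1 d U) (pl2 d z U) m c"
proof -
 let ?q = "segment_path z0 z" and ?w = "mat_app d U (simplex_center d)"
 obtain s u where f: "feasible_basis d c (\<lambda>_. 1) {..<m} J" and su: "s < u" "\<forall>t. s \<le> t \<and> t \<le> u \<longrightarrow> in_cone d c J (?q t)"
  using J unfolding pierced_bases_def by blast
 have fJ: "J \<subseteq> {..<m}" "finite J" "card J = d" "supp d c {..<m} J"
  using f unfolding feasible_basis_def supp_def by auto
 have "\<exists>t. s \<le> t \<and> t \<le> u \<and> (\<exists>l<d. ?q t l \<noteq> 0)"
 proof (rule ccontr)
  assume "\<not> ?thesis"
  then have z: "?q s l = 0" "?q u l = 0" if "l < d" for l using that su(1) by (meson less_imp_le order_refl)+
  have "z0 l = 0" if "l < d" for l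
  proof -
   have "(1 - s) * z0 l + s * z l = 0" "(1 - u) * z0 l + u * z l = 0" using z[OF that] by (auto simp: segment_path_def)
   then have "u * ((1 - s) * z0 l + s * z l) - s * ((1 - u) * z0 l + u * z l) = 0" by simp
   then have "(u - s) * z0 l = 0" by (simp add: algebra_simps)
   then show ?thesis using su(1) by simp
  qed
  then have "?w l = 0" if "l < d" for l using that z0 by simp
  then have "dot d ?w ?w = 0" unfolding dot_def by simp
  then show False using dot_mat_app[OF U, of "simplex_center d" "simplex_center d"] dot_center[of d] d by simp
 qed
 then obtain t l where t: "s \<le> t" "t \<le> u" "l < d" "?q t l \<noteq> 0" by blast
 then obtain x where x: "\<forall>i\<in>J. 0 \<le> x i" "\<forall>k<d. ?q t k = (\<Sum>i\<in>J. x i * c i k)"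
  using su(2) unfolding in_cone_def by blast
 have cx: "comb c J x k = ?q t k" if "k < d" for k using x(2) that by (simp add: comb_def)
 have "inW d (pl1 d U) (pl2 d z U) (comb c J x)"
  by (rule inW_lincomb[OF pl_inW(1)[OF U, of z] pl_inW(2)[OF U, of z], of _ "(1 - t) * M" t]) (simp add: cx segment_path_def z0)
 then have "\<exists>k\<in>J. edge d (pl1 d U) (pl2 d z U) c {..<m} 0 J k"
  using pierced_imp_edge[OF pl_orthonormal[OF d] fJ(2,3) _ fJ(4) reg x(1) _ t(3)] cx[OF t(3)] t(4) d by auto
 then show ?thesis unfolding shadow_sets_def using fJ by blast
qed

lemma attempt_steps_le:
 assumes d: "1 < d" and U: "orth d U"
  and reg: "\<And>I k. I \<subseteq> {..<n + d} ==> card I = d ==> k \<in> I ==> regk d (pl1 d U) (pl2 d z U) (ext_constraints c1 n d a U G) I k"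
 shows "attempt_steps c1 n d z a (U, G) \<le> nshadow d (pl1 d U) (pl2 d z U) (n + d) (ext_constraints c1 n d a U G)"
proof (cases "added_ok c1 n d a (U, G)")
 case True
 let ?c = "ext_constraints c1 n d a U G"
 have "attempt_steps c1 n d z a (U, G) = walk_steps d ?c (\<lambda>_. 1) {..<n + d} (segment_path (init_objective n d a U) z) {0..1} {n..<n + d}"
  using True by (simp add: attempt_steps_def)
 also have "\<dots> \<le> of_nat (card (pierced_bases d ?c (\<lambda>_. 1) {..<n + d} (segment_path (init_objective n d a U) z) {0..1}))"
  by (rule walk_steps_le_card) simp
 also have "\<dots> \<le> nshadow d (pl1 d U) (pl2 d z U) (n + d) ?c"
 proof (intro of_nat_mono card_mono)
  show "finite (shadow_sets d (pl1 d U) (pl2 d z U) (n + d) ?c)"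
   unfolding shadow_sets_def by (rule finite_subset[of _ "Pow {..<n + d}"]) auto
  show "pierced_bases d ?c (\<lambda>_. 1) {..<n + d} (segment_path (init_objective n d a U) z) {0..1} \<subseteq> shadow_sets d (pl1 d U) (pl2 d z U) (n + d) ?c"
  proof
   fix J assume J: "J \<in> pierced_bases d ?c (\<lambda>_. 1) {..<n + d} (segment_path (init_objective n d a U) z) {0..1}"
   then have "J \<subseteq> {..<n + d}" "card J = d" unfolding pierced_bases_def feasible_basis_def by auto
   then show "J \<in> shadow_sets d (pl1 d U) (pl2 d z U) (n + d) ?c"
    by (intro pierced_in_shadow[OF d U _ _ J, of "2 * mag n d a"] reg) (auto simp: mag_def init_objective_def[abs_def])
  qed
 qed
 finally show ?thesis .
qed (simp add: attempt_steps_def)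

section \<open>The expected number of pivots in one attempt\<close>

lemma measurable_mat_app:
 assumes "\<And>p. p \<in> {..<d} \<times> {..<d} ==> (\<lambda>x. U x p) \<in> borel_measurable M" "l < d"
 shows "(\<lambda>x. mat_app d (U x) v l) \<in> borel_measurable M"
 unfolding mat_app_def using assms by (intro borel_measurable_sum borel_measurable_times) auto

lemma sets_orth:
 assumes "\<And>p. p \<in> {..<d} \<times> {..<d} ==> (\<lambda>x. U x p) \<in> borel_measurable M"
 shows "{x \<in> space M. orth d (U x)} \<in> sets M"
proof -
 have m: "(\<lambda>x. \<Sum>l<d. U x (i, l) * U x (j, l)) \<in> borel_measurable M" if "i < d" "j < d" for i j
  using assms that by (intro borel_measurable_sum borel_measurable_times) auto
 have "{x \<in> space M. orth d (U x)} =
   {x \<in> space M. \<forall>i\<in>{..<d}. \<forall>j\<in>{..<d}. (\<Sum>l<d. U x (i, l) * U x (j, l)) = (if i = j then 1 else 0)}"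
  unfolding Defs.orthogonal_mat_def by auto
 also have "\<dots> \<in> sets M"
 proof (intro sets.sets_Collect_finite_All finite_lessThan)
  fix i j assume "i \<in> {..<d}" "j \<in> {..<d}"
  then have [measurable]: "(\<lambda>x. \<Sum>l<d. U x (i, l) * U x (j, l)) \<in> borel_measurable M" using m by simp
  show "{x \<in> space M. (\<Sum>l<d. U x (i, l) * U x (j, l)) = (if i = j then 1 else 0)} \<in> sets M" by measurable
 qed
 finally show ?thesis .
qed

lemma measurable_pl:
 assumes U: "\<And>p. p \<in> {..<d} \<times> {..<d} ==> (\<lambda>x. U x p) \<in> borel_measurable M" and l: "l < d"
 shows "(\<lambda>x. pl1 d (U x) l) \<in> borel_measurable M" "(\<lambda>x. pl2 d z (U x) l) \<in> borel_measurable M"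
proof -
 have o[measurable]: "Measurable.pred M (\<lambda>x. orth d (U x))" unfolding pred_def by (rule sets_orth[OF U])
 have ma: "(\<lambda>x. mat_app d (U x) v l) \<in> borel_measurable M" if "l < d" for v l by (rule measurable_mat_app[OF U that])
 have r: "(\<lambda>x. pl_res d z (U x) l) \<in> borel_measurable M" if "l < d" for l
  unfolding pl_res_def dot_def using ma that
  by (intro borel_measurable_diff borel_measurable_const borel_measurable_times borel_measurable_sum) auto
 have [measurable]: "(\<lambda>x. enorm d (pl_res d z (U x))) \<in> borel_measurable M" by (rule measurable_enorm[OF r])
 note [measurable] = ma[OF l] r[OF l]
 show "(\<lambda>x. pl1 d (U x) l) \<in> borel_measurable M" unfolding pl1_def by measurable
 show "(\<lambda>x. pl2 d z (U x) l) \<in> borel_measurable M" unfolding pl2_def by measurable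
qed

lemma measurable_mag:
 assumes "\<And>i l. i < n ==> l < d ==> (\<lambda>x. a x i l) \<in> borel_measurable M"
 shows "(\<lambda>x. mag n d (a x)) \<in> borel_measurable M"
proof -
 have [measurable]: "(\<lambda>x. Max ((\<lambda>i. enorm d (a x i)) ` {..<n})) \<in> borel_measurable M"
  by (rule borel_measurable_Max) (auto intro!: measurable_enorm assms)
 have "(\<lambda>x. \<lceil>ln (Max ((\<lambda>i. enorm d (a x i)) ` {..<n}))\<rceil>) \<in> M \<rightarrow>\<^sub>M count_space UNIV"
  by (rule measurable_compose[OF _ measurable_real_ceiling]) measurable
 from measurable_compose[OF this, of "\<lambda>k. exp (of_int k)"] show ?thesis unfolding mag_def by simp
qed

lemma measurable_ext:
 assumes a: "\<And>i l. i < n ==> l < d ==> (\<lambda>x. a x i l) \<in> borel_measurable M"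
  and U: "\<And>p. p \<in> {..<d} \<times> {..<d} ==> (\<lambda>x. U x p) \<in> borel_measurable M"
  and G: "\<And>p. p \<in> {..<d} \<times> {..<d} ==> (\<lambda>x. G x p) \<in> borel_measurable M"
  and il: "i < n + d" "l < d"
 shows "(\<lambda>x. ext_constraints c1 n d (a x) (U x) (G x) i l) \<in> borel_measurable M"
proof (cases "i < n")
 case False
 then have "i - n < d" using il by simp
 then show ?thesis unfolding ext_constraints_def new_constraint_def
  using False measurable_mag[OF a] measurable_mat_app[OF U il(2)] G[of "(i - n, l)"] il by simp
qed (use a il in \<open>simp add: ext_constraints_def\<close>)

text \<open>Puts the rotation outermost, so that estimates for a fixed orthogonal matrix apply to
  the joint law of the program and the noise.\<close>

lemma nn_integral_rotate:
 assumes "prob_space A" "prob_space B" "prob_space C" and F[measurable]: "F \<in> borel_measurable (A \<Otimes>\<^sub>M (B \<Otimes>\<^sub>M C))"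
 shows "(\<integral>\<^sup>+a. \<integral>\<^sup>+w. F (a, w) \<partial>(B \<Otimes>\<^sub>M C) \<partial>A) = (\<integral>\<^sup>+b. \<integral>\<^sup>+v. F (fst v, b, snd v) \<partial>(A \<Otimes>\<^sub>M C) \<partial>B)"
proof -
 interpret A: prob_space A by fact
 interpret B: prob_space B by fact
 interpret C: prob_space C by fact
 interpret AB: pair_sigma_finite A B ..
 have m: "(\<lambda>p. \<integral>\<^sup>+c. F (fst p, snd p, c) \<partial>C) \<in> borel_measurable (A \<Otimes>\<^sub>M B)"
  by (rule C.borel_measurable_nn_integral) measurable
 have "(\<integral>\<^sup>+a. \<integral>\<^sup>+w. F (a, w) \<partial>(B \<Otimes>\<^sub>M C) \<partial>A) = (\<integral>\<^sup>+a. \<integral>\<^sup>+b. \<integral>\<^sup>+c. F (a, b, c) \<partial>C \<partial>B \<partial>A)"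
 proof (rule nn_integral_cong)
  fix a assume [measurable]: "a \<in> space A"
  show "(\<integral>\<^sup>+w. F (a, w) \<partial>(B \<Otimes>\<^sub>M C)) = (\<integral>\<^sup>+b. \<integral>\<^sup>+c. F (a, b, c) \<partial>C \<partial>B)"
   by (rule C.nn_integral_fst[symmetric]) measurable
 qed
 also have "\<dots> = (\<integral>\<^sup>+b. \<integral>\<^sup>+a. \<integral>\<^sup>+c. F (a, b, c) \<partial>C \<partial>A \<partial>B)"
  using AB.Fubini[OF m] by simp
 also have "\<dots> = (\<integral>\<^sup>+b. \<integral>\<^sup>+v. F (fst v, b, snd v) \<partial>(A \<Otimes>\<^sub>M C) \<partial>B)"
 proof (rule nn_integral_cong)
  fix b assume [measurable]: "b \<in> space B"
  have "(\<integral>\<^sup>+a. \<integral>\<^sup>+c. F (fst (a, c), b, snd (a, c)) \<partial>C \<partial>A) = (\<integral>\<^sup>+v. F (fst v, b, snd v) \<partial>(A \<Otimes>\<^sub>M C))"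
   by (rule C.nn_integral_fst) measurable
  then show "(\<integral>\<^sup>+a. \<integral>\<^sup>+c. F (a, b, c) \<partial>C \<partial>A) = (\<integral>\<^sup>+v. F (fst v, b, snd v) \<partial>(A \<Otimes>\<^sub>M C))" by simp
 qed
 finally show ?thesis .
qed

section \<open>One round of phase I averaged over program, rotation and noise\<close>

locale solver = smoothed +
 fixes c1 :: real and \<H> :: "cvec measure"
 assumes c1: "0 < c1" "c1 \<le> 1" and haar: "haar_orthogonal d \<H>"
begin

abbreviation "GP \<equiv> gauss PP"
abbreviation "GD \<equiv> gauss ({..<d} \<times> {..<d})"
abbreviation "HD \<equiv> \<H> \<Otimes>\<^sub>M GD"

lemma prob_H: "prob_space \<H>" and AE_orth: "AE U in \<H>. orth d U"
 using haar unfolding haar_orthogonal_def by auto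

lemma measurable_H: "p \<in> {..<d} \<times> {..<d} ==> (\<lambda>U. U p) \<in> borel_measurable \<H>"
 using haar measurable_component_singleton[of p "{..<d} \<times> {..<d}" "\<lambda>_. borel"]
 unfolding haar_orthogonal_def by (metis measurable_cong_sets)

sublocale prH: prob_space \<H> by (rule prob_H)
sublocale prG: prob_space GD by (rule prob_space_gauss)
sublocale prP: prob_space GP by (rule prob_space_gauss)
sublocale prHG: pair_prob_space \<H> GD ..

lemma attempt_ax: "orth d U ==> attempt n d \<sigma> z a0 b0 R k0 c1 U"
 using c1 by unfold_locales auto

abbreviation "cE g w \<equiv> ext_constraints c1 n d (A g) (fst w) (snd w)"

definition Nf :: "cvec => cvec \<times> cvec => ennreal" where
 "Nf g w = nshadow d (pl1 d (fst w)) (pl2 d z (fst w)) (n + d) (cE g w)"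

definition regE :: "cvec => cvec \<times> cvec => bool" where
 "regE g w \<longleftrightarrow> orth d (fst w) \<and> (\<forall>I\<in>{I. I \<subseteq> {..<n + d} \<and> card I = d}. \<forall>k\<in>I. regk d (pl1 d (fst w)) (pl2 d z (fst w)) (cE g w) I k)"

definition mxA :: "cvec => real" where
 "mxA g = Max ((\<lambda>i. enorm d (A g i)) ` {..<n})"

lemma comp_GP: "p \<in> PP ==> (\<lambda>g. g p) \<in> borel_measurable GP"
 using measurable_component_singleton[of p PP "\<lambda>_. std_normal"] by simp

lemma comp_GD: "p \<in> {..<d} \<times> {..<d} ==> (\<lambda>g. g p) \<in> borel_measurable GD"
 using measurable_component_singleton[of p "{..<d} \<times> {..<d}" "\<lambda>_. std_normal"] by simp

lemma measurable_A_GP: "i < n ==> l < d ==> (\<lambda>g. A g i l) \<in> borel_measurable GP"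
 unfolding smoothed_a_def by (intro borel_measurable_add borel_measurable_times borel_measurable_const comp_GP) auto

lemma meas3:
 "\<And>i l. i < n ==> l < d ==> (\<lambda>x. A (fst x) i l) \<in> borel_measurable (GP \<Otimes>\<^sub>M HD)"
 "\<And>p. p \<in> {..<d} \<times> {..<d} ==> (\<lambda>x. fst (snd x) p) \<in> borel_measurable (GP \<Otimes>\<^sub>M HD)"
 "\<And>p. p \<in> {..<d} \<times> {..<d} ==> (\<lambda>x. snd (snd x) p) \<in> borel_measurable (GP \<Otimes>\<^sub>M HD)"
 using measurable_compose[OF measurable_fst measurable_A_GP]
  measurable_compose[OF measurable_compose[OF measurable_snd measurable_fst] measurable_H]
  measurable_compose[OF measurable_compose[OF measurable_snd measurable_snd] comp_GD] by blast+

lemma shadow_meas_ext: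
 "shadow_meas (GP \<Otimes>\<^sub>M HD) d (\<lambda>x. pl1 d (fst (snd x))) (\<lambda>x. pl2 d z (fst (snd x))) (\<lambda>x. cE (fst x) (snd x)) {..<n + d}"
 by (standard, simp, rule measurable_pl(1)[OF meas3(2)], assumption+, rule measurable_pl(2)[OF meas3(2)], assumption+,
  rule measurable_ext[OF meas3]) auto

lemma measurable_Nf: "(\<lambda>x. Nf (fst x) (snd x)) \<in> borel_measurable (GP \<Otimes>\<^sub>M HD)"
 unfolding Nf_def by (rule shadow_meas.measurable_card_shadow[OF shadow_meas_ext refl]) (use pl_orthonormal d3 in auto)

lemma sets_regE: "{x \<in> space (GP \<Otimes>\<^sub>M HD). regE (fst x) (snd x)} \<in> sets (GP \<Otimes>\<^sub>M HD)"
 unfolding regE_def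
proof (intro sets.sets_Collect_conj sets.sets_Collect_finite_All)
 show "{x \<in> space (GP \<Otimes>\<^sub>M HD). orth d (fst (snd x))} \<in> sets (GP \<Otimes>\<^sub>M HD)" by (rule sets_orth[OF meas3(2)])
 fix I k assume Ik: "I \<in> {I. I \<subseteq> {..<n + d} \<and> card I = d}" "k \<in> I"
 then have bi: "basis_index d I k" by (intro basis_index_lessThan[of I "n + d"]) auto
 have on: "orthonormal2 d (pl1 d U) (pl2 d z U)" for U using pl_orthonormal d3 by simp
 have [measurable]: "(\<lambda>x. dt (d + 1) (Bm d (pl1 d (fst (snd x))) (pl2 d z (fst (snd x))) (cE (fst x) (snd x)) I k)) \<in> borel_measurable (GP \<Otimes>\<^sub>M HD)"
  by (rule shadow_meas.measurable_slv_Bm(3)[OF shadow_meas_ext bi]) (use Ik in auto)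
 show "{x \<in> space (GP \<Otimes>\<^sub>M HD). regk d (pl1 d (fst (snd x))) (pl2 d z (fst (snd x))) (cE (fst x) (snd x)) I k} \<in> sets (GP \<Otimes>\<^sub>M HD)"
  unfolding basis_index.regk_iff_dt[OF bi on] by measurable
next
 show "finite {I. I \<subseteq> {..<n + d} \<and> card I = d}" by (rule finite_subset[of _ "Pow {..<n + d}"]) auto
 show "finite I" if "I \<in> {I. I \<subseteq> {..<n + d} \<and> card I = d}" for I using that finite_subset by auto
qed

text \<open>If all rows of the matrix vanished, the rows \<open>(a i, b i)\<close> would be confined
  to one axis, against their generic independence.\<close>

lemma AE_mx_pos: "AE g in GP. 0 < mxA g"
 using BB.AE_lin_indep_all
proof eventually_elim
 case (elim g)
 have I: "lin_indep (Suc d) (BB.cf g) {..<Suc d}" using elim dn by simp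
 have ge: "enorm d (A g i) \<le> mxA g" if "i < n" for i unfolding mxA_def using that by (intro Max_ge) auto
 show ?case
 proof (rule ccontr)
  assume "\<not> 0 < mxA g"
  then have "enorm d (A g i) = 0" if "i < n" for i using ge[OF that] enorm_nonneg[of d "A g i"] by linarith
  then have z: "A g i l = 0" if "i < n" "l < d" for i l using enorm_eq_0 that by blast
  have "dot (Suc d) (BB.cf g i) (\<lambda>l. if l = 0 then 1 else 0) = 0" if "i < Suc d" for i
  proof -
   have "dot (Suc d) (BB.cf g i) (\<lambda>l. if l = 0 then 1 else 0) = BB.cf g i 0" unfolding dot_def
    by (simp add: if_distrib sum.lessThan_Suc_shift cong: if_cong)
   then show ?thesis using z[of i 0] BB_cf[of i 0] that dn d3 by simp
  qed
  then show False using lin_indep_dual[OF _ _ I, of "\<lambda>l. if l = 0 then 1 else 0" 0] by force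
 qed
qed

lemma AE_join:
 assumes U: "orth d U"
 shows "AE v in GP \<Otimes>\<^sub>M GD. regE (fst v) (U, snd v)"
proof -
 interpret T: attempt n d \<sigma> z a0 b0 R k0 c1 U by (rule attempt_ax[OF U])
 have "AE x in distr (GP \<Otimes>\<^sub>M GD) (gauss T.PX) (\<lambda>x. joinx n d (fst x) (snd x)).
   \<forall>I. I \<subseteq> {..<n + d} \<longrightarrow> card I = d \<longrightarrow> (\<forall>k\<in>I. regk d (pl1 d U) (pl2 d z U) (T.ex x) I k)"
  unfolding distr_joinx by (rule T.AE_regk_ex)
 from AE_distrD[OF measurable_joinx this] show ?thesis
 proof eventually_elim
  case (elim v)
  show ?case unfolding regE_def fst_conv snd_conv
  proof (intro conjI ballI U)
   fix I k assume Ik: "I \<in> {I. I \<subseteq> {..<n + d} \<and> card I = d}" "k \<in> I"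
   have "regk d (pl1 d U) (pl2 d z U) (ext_constraints c1 n d (A (fst v)) U (snd v)) I k
     = regk d (pl1 d U) (pl2 d z U) (T.ex (joinx n d (fst v) (snd v))) I k"
    by (rule regk_cong, rule T.ext_eq_ex) (use Ik in auto)
   then show "regk d (pl1 d U) (pl2 d z U) (ext_constraints c1 n d (A (fst v)) U (snd v)) I k" using elim Ik by blast
  qed
 qed
qed

text \<open>Regularity is known for every fixed orthogonal rotation, jointly in program and noise.
  Exchanging the integrals gives it for almost every program, jointly in rotation and noise.\<close>

lemma AE_regE: "AE g in GP. AE w in HD. regE g w"
proof -
 let ?B = "{x \<in> space (GP \<Otimes>\<^sub>M HD). \<not> regE (fst x) (snd x)}"
 have B: "?B \<in> sets (GP \<Otimes>\<^sub>M HD)" using sets_regE by measurable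
 have "(\<integral>\<^sup>+g. \<integral>\<^sup>+w. indicator ?B (g, w) \<partial>HD \<partial>GP) = (\<integral>\<^sup>+U. \<integral>\<^sup>+v. indicator ?B (fst v, U, snd v) \<partial>(GP \<Otimes>\<^sub>M GD) \<partial>\<H>)"
  by (rule nn_integral_rotate[OF prob_space_gauss prob_H prob_space_gauss borel_measurable_indicator[OF B]])
 also have "\<dots> = (\<integral>\<^sup>+U. 0 \<partial>\<H>)"
 proof (rule nn_integral_cong_AE)
  show "AE U in \<H>. (\<integral>\<^sup>+v. indicator ?B (fst v, U, snd v) \<partial>(GP \<Otimes>\<^sub>M GD)) = 0"
   using AE_orth
  proof eventually_elim
   case (elim U)
   have "(\<integral>\<^sup>+v. indicator ?B (fst v, U, snd v) \<partial>(GP \<Otimes>\<^sub>M GD)) = (\<integral>\<^sup>+v. 0 \<partial>(GP \<Otimes>\<^sub>M GD))"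
    by (rule nn_integral_cong_AE) (use AE_join[OF elim] in eventually_elim, simp)
   then show ?case by simp
  qed
 qed
 finally have 0: "(\<integral>\<^sup>+g. \<integral>\<^sup>+w. indicator ?B (g, w) \<partial>HD \<partial>GP) = 0" by simp
 have "AE g in GP. (\<integral>\<^sup>+w. indicator ?B (g, w) \<partial>HD) = 0"
  using 0 by (subst (asm) nn_integral_0_iff_AE) (auto intro!: prHG.borel_measurable_nn_integral borel_measurable_indicator[OF B])
 then show ?thesis using AE_space
 proof eventually_elim
  case (elim g)
  have m: "(\<lambda>w. indicator ?B (g, w) :: ennreal) \<in> borel_measurable HD"
   by (rule measurable_compose[OF measurable_Pair1'[OF elim(2)] borel_measurable_indicator[OF B]])
  have "AE w in HD. (indicator ?B (g, w) :: ennreal) = 0" using elim(1) nn_integral_0_iff_AE[OF m] by blast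
  then show ?case using AE_space
   by eventually_elim (use elim(2) in \<open>auto simp: space_pair_measure indicator_def split: if_splits\<close>)
 qed
qed

lemma AE_attempt_steps_le: "AE g in GP. AE w in HD. attempt_steps c1 n d z (A g) w \<le> Nf g w"
 using AE_regE
proof eventually_elim
 case (elim g)
 then show ?case
 proof eventually_elim
  case (elim w)
  obtain U G where w: "w = (U, G)" by (cases w)
  show ?case using elim d3 unfolding w Nf_def regE_def fst_conv snd_conv
   by (intro attempt_steps_le) auto
 qed
qed

text \<open>\<open>KK\<close> written out; its value is the same for all rotations.\<close>

definition KA :: real where
 "KA = (17 * (1 / \<sigma> + 6 * sqrt (real d * ln (real n))))\<^sup>2 + 9 / (sdev1 c1 n d)\<^sup>2"

lemma integral_Nf_le: "(\<integral>\<^sup>+g. \<integral>\<^sup>+w. Nf g w \<partial>HD \<partial>GP) \<le> ennreal (18000000 * real d ^ 3 * KA\<^sup>2 + 1)"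
proof -
 let ?F = "\<lambda>x. indicator {g. 0 < mxA g} (fst x) * Nf (fst x) (snd x)"
 have [measurable]: "mxA \<in> borel_measurable GP"
  unfolding mxA_def[abs_def] by (rule borel_measurable_Max) (auto intro!: measurable_enorm measurable_A_GP)
 have "(\<lambda>x. if 0 < mxA (fst x) then Nf (fst x) (snd x) else 0) \<in> borel_measurable (GP \<Otimes>\<^sub>M HD)"
  by (rule measurable_If) (use measurable_Nf in measurable)
 moreover have "(\<lambda>x. if 0 < mxA (fst x) then Nf (fst x) (snd x) else 0) = ?F" by (auto simp: indicator_def)
 ultimately have F: "?F \<in> borel_measurable (GP \<Otimes>\<^sub>M HD)" by simp
 have "(\<integral>\<^sup>+g. \<integral>\<^sup>+w. Nf g w \<partial>HD \<partial>GP) = (\<integral>\<^sup>+g. \<integral>\<^sup>+w. ?F (g, w) \<partial>HD \<partial>GP)"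
  by (rule nn_integral_cong_AE) (use AE_mx_pos in eventually_elim, simp)
 also have "\<dots> = (\<integral>\<^sup>+U. \<integral>\<^sup>+v. ?F (fst v, U, snd v) \<partial>(GP \<Otimes>\<^sub>M GD) \<partial>\<H>)"
  by (rule nn_integral_rotate[OF prob_space_gauss prob_H prob_space_gauss F])
 also have "\<dots> \<le> (\<integral>\<^sup>+U. ennreal (18000000 * real d ^ 3 * KA\<^sup>2 + 1) \<partial>\<H>)"
 proof (rule nn_integral_mono_AE)
  show "AE U in \<H>. (\<integral>\<^sup>+v. ?F (fst v, U, snd v) \<partial>(GP \<Otimes>\<^sub>M GD)) \<le> ennreal (18000000 * real d ^ 3 * KA\<^sup>2 + 1)"
   using AE_orth
  proof eventually_elim
   case (elim U)
   interpret T: attempt n d \<sigma> z a0 b0 R k0 c1 U by (rule attempt_ax[OF elim])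
   let ?f = "\<lambda>x. indicator {x. 0 < T.mx x} x * nshadow d T.w1 T.w2 (n + d) (T.ex x) :: ennreal"
   have [measurable]: "T.mx \<in> borel_measurable (gauss T.PX)"
    using T.measurable_mx measurable_cong_sets[OF sets_gauss_leb refl] by blast
   have mE: "(\<lambda>x. T.ex x i l) \<in> borel_measurable (gauss T.PX)" if "i < n + d" "l < d" for i l
   proof -
    have A: "(\<lambda>x. A x i l) \<in> borel_measurable (gauss T.PX)" if "i < n" "l < d" for i l
     using T.measurable_A[OF that] measurable_cong_sets[OF sets_gauss_leb refl] by blast
    have "(\<lambda>x. x (i, l)) \<in> borel_measurable (gauss T.PX)"
     using measurable_component_singleton[of "(i, l)" T.PX "\<lambda>_. std_normal"] that by simp
    then show ?thesis unfolding T.ex_def using A that measurable_mag[OF A] by (cases "i < n") auto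
   qed
   have sm: "shadow_meas (gauss T.PX) d (\<lambda>_. T.w1) (\<lambda>_. T.w2) T.ex {..<n + d}"
    by standard (use mE in auto)
   have [measurable]: "(\<lambda>x. nshadow d T.w1 T.w2 (n + d) (T.ex x) :: ennreal) \<in> borel_measurable (gauss T.PX)"
    by (rule shadow_meas.measurable_card_shadow[OF sm refl]) (use pl_orthonormal d3 in auto)
   have "(\<lambda>x. if 0 < T.mx x then nshadow d T.w1 T.w2 (n + d) (T.ex x) else 0 :: ennreal) \<in> borel_measurable (gauss T.PX)"
    by measurable
   moreover have "(\<lambda>x. if 0 < T.mx x then nshadow d T.w1 T.w2 (n + d) (T.ex x) else 0 :: ennreal) = ?f"
    by (auto simp: indicator_def)
   ultimately have f: "?f \<in> borel_measurable (gauss T.PX)" by simp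
   have "?F (fst v, U, snd v) = ?f (joinx n d (fst v) (snd v))" for v
   proof -
    have "shadow_sets d T.w1 T.w2 (n + d) (ext_constraints c1 n d (A (fst v)) U (snd v))
     = shadow_sets d T.w1 T.w2 (n + d) (T.ex (joinx n d (fst v) (snd v)))"
     by (rule shadow_sets_cong) (rule T.ext_eq_ex)
    then show ?thesis unfolding Nf_def fst_conv snd_conv by (simp add: T.mx_join mxA_def indicator_def)
   qed
   then have "(\<integral>\<^sup>+v. ?F (fst v, U, snd v) \<partial>(GP \<Otimes>\<^sub>M GD)) = (\<integral>\<^sup>+v. ?f (joinx n d (fst v) (snd v)) \<partial>(GP \<Otimes>\<^sub>M GD))" by simp
   also have "\<dots> = (\<integral>\<^sup>+x. ?f x \<partial>distr (GP \<Otimes>\<^sub>M GD) (gauss T.PX) (\<lambda>x. joinx n d (fst x) (snd x)))"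
    by (rule nn_integral_distr[OF measurable_joinx, symmetric]) (use f in simp)
   also have "\<dots> \<le> ennreal (18000000 * real d ^ 3 * T.KK\<^sup>2 + 1)" unfolding distr_joinx by (rule T.all_levels)
   also have "T.KK = KA" unfolding T.KK_def KA_def T.Lx_def ..
   finally show ?case .
  qed
 qed
 also have "\<dots> = ennreal (18000000 * real d ^ 3 * KA\<^sup>2 + 1)" by (simp add: prH.emeasure_space_1)
 finally show ?thesis .
qed

end

section \<open>Correctness of an attempt\<close>

text \<open>The symmetric matrix with columns \<open>simplex_vertex d \<rho> j\<close>: it
  multiplies the mean by \<open>sqrt d\<close> and the deviation from the mean by
  \<open>\<rho> / sqrt (1 - 1 / d)\<close>. By symmetry it describes both combinations of the
  vertices and inner products with them.\<close>

definition sxop :: "nat => real => rvec => nat => real" where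
 "sxop d \<rho> x j = sqrt (real d) * ((\<Sum>k<d. x k) / real d) + \<rho> / sqrt (1 - 1 / real d) * (x j - (\<Sum>k<d. x k) / real d)"

lemma sum_vertex:
 assumes "k < d"
 shows "(\<Sum>j<d. l j * simplex_vertex d \<rho> j k) = sxop d \<rho> l k"
proof -
 have d: "sqrt (real d) * (s / real d) = s / sqrt (real d)" for s
  using assms real_sqrt_mult_self[of "real d"] by (simp add: field_simps)
 define q where "q = \<rho> / sqrt (1 - 1 / real d)"
 have v: "simplex_vertex d \<rho> j k = 1 / sqrt (real d) + q * ((if k = j then 1 else 0) - 1 / real d)" for j
  by (simp add: simplex_vertex_def simplex_center_def q_def)
 have "(\<Sum>j<d. l j * simplex_vertex d \<rho> j k) = (\<Sum>j<d. l j / sqrt (real d) + q * ((if k = j then l j else 0) - l j / real d))"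
  unfolding v by (intro sum.cong refl) (auto simp: algebra_simps)
 also have "\<dots> = (\<Sum>j<d. l j) / sqrt (real d) + q * (l k - (\<Sum>j<d. l j) / real d)"
  using assms by (simp add: sum.distrib sum_distrib_left[symmetric] sum_subtractf sum_divide_distrib)
 finally show ?thesis unfolding sxop_def d q_def .
qed

lemma dot_vertex: "j < d ==> dot d (simplex_vertex d \<rho> j) x = sxop d \<rho> x j"
 unfolding sum_vertex[of j d, symmetric] dot_def
 by (intro sum.cong refl) (auto simp: simplex_vertex_def simplex_center_def)

text \<open>Pythagoras for the mean and the deviation from it: both eigenvalues are at least
  \<open>\<rho>\<close>.\<close>

lemma enorm_sxop_ge:
 assumes d: "1 < d" and \<rho>: "0 \<le> \<rho>" "\<rho> \<le> 1"
 shows "\<rho> * enorm d x \<le> enorm d (sxop d \<rho> x)"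
proof -
 define m where "m = (\<Sum>k<d. x k) / real d"
 define r where "r = \<rho> / sqrt (1 - 1 / real d)"
 define q where "q = (\<Sum>j<d. (x j - m)\<^sup>2)"
 have s0: "(\<Sum>j<d. x j - m) = 0" using d by (simp add: sum_subtractf m_def)
 have q0: "0 \<le> q" unfolding q_def by (intro sum_nonneg) simp
 have x2: "(enorm d x)\<^sup>2 = real d * m\<^sup>2 + q"
 proof -
  have "(enorm d x)\<^sup>2 = (\<Sum>j<d. m\<^sup>2 + 2 * m * (x j - m) + (x j - m)\<^sup>2)"
   unfolding enorm_sq dot_def by (intro sum.cong refl) (simp add: power2_eq_square algebra_simps)
  then show ?thesis by (simp add: sum.distrib sum_distrib_left[symmetric] s0 q_def)
 qed
 have y2: "(enorm d (sxop d \<rho> x))\<^sup>2 = real d * (real d * m\<^sup>2) + r\<^sup>2 * q"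
 proof -
  have e: "(sxop d \<rho> x j)\<^sup>2 = real d * m\<^sup>2 + 2 * sqrt (real d) * m * r * (x j - m) + r\<^sup>2 * (x j - m)\<^sup>2" for j
  proof -
   have "(sqrt (real d) * m + r * (x j - m))\<^sup>2 = (sqrt (real d) * m)\<^sup>2 + 2 * (sqrt (real d) * m) * (r * (x j - m)) + (r * (x j - m))\<^sup>2"
    unfolding power2_sum by simp
   then show ?thesis unfolding sxop_def m_def[symmetric] r_def[symmetric] by (simp add: power_mult_distrib)
  qed
  have "(enorm d (sxop d \<rho> x))\<^sup>2 = (\<Sum>j<d. real d * m\<^sup>2 + 2 * sqrt (real d) * m * r * (x j - m) + r\<^sup>2 * (x j - m)\<^sup>2)"
   unfolding enorm_sq dot_def power2_eq_square[symmetric] e ..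
  then show ?thesis by (simp add: sum.distrib sum_distrib_left[symmetric] s0 q_def)
 qed
 have "\<rho> \<le> r"
 proof -
  have "0 < 1 - 1 / real d" "1 - 1 / real d \<le> 1" using d by auto
  then have "0 < sqrt (1 - 1 / real d)" "sqrt (1 - 1 / real d) \<le> 1" by auto
  then show ?thesis unfolding r_def using \<rho> by (simp add: le_divide_eq mult_left_le)
 qed
 then have r2: "\<rho>\<^sup>2 \<le> r\<^sup>2" using \<rho> by (intro power_mono)
 have "\<rho>\<^sup>2 \<le> 1" using \<rho> by (simp add: power_le_one)
 also have "1 \<le> real d" using d by simp
 finally have "\<rho>\<^sup>2 * (real d * m\<^sup>2) \<le> real d * (real d * m\<^sup>2)" by (intro mult_right_mono) auto
 moreover have "\<rho>\<^sup>2 * q \<le> r\<^sup>2 * q" using r2 q0 by (intro mult_right_mono)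
 ultimately have "(\<rho> * enorm d x)\<^sup>2 \<le> (enorm d (sxop d \<rho> x))\<^sup>2"
  unfolding power_mult_distrib x2 y2 distrib_left by linarith
 then show ?thesis by (rule power2_le_imp_le) simp
qed

lemma enorm_entries_le:
 assumes "\<And>j. j < d ==> \<bar>x j\<bar> \<le> b"
 shows "enorm d x \<le> real d * b"
proof -
 have "enorm d x \<le> (\<Sum>j<d. \<bar>x j\<bar>)" unfolding enorm_def by (rule L2_set_le_sum_abs)
 also have "\<dots> \<le> (\<Sum>j<d. b)" by (intro sum_mono assms) simp
 finally show ?thesis by simp
qed

lemma entry_le_enorm: "j < d ==> \<bar>x j\<bar> \<le> enorm d x"
 unfolding enorm_def using member_le_L2_set[of "{..<d}" j "\<lambda>j. \<bar>x j\<bar>"] by (simp add: L2_set_def)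

lemma mat_app_cong: "(\<And>l. l < d ==> x l = y l) ==> mat_app d U x k = mat_app d U y k"
 unfolding mat_app_def by (intro sum.cong) auto

lemma mat_app_sum: "mat_app d U (\<lambda>k. \<Sum>j<m. l j * x j k) i = (\<Sum>j<m. l j * mat_app d U (x j) i)"
 unfolding mat_app_def sum_distrib_left by (subst sum.swap) (simp add: mult_ac)

text \<open>The preimage is the transpose applied to \<open>y\<close>.\<close>

lemma orth_surj:
 assumes "orth d U"
 obtains x where "\<And>i. i < d ==> mat_app d U x i = y i"
proof
 fix i assume i: "i < d"
 have "mat_app d U (\<lambda>l. \<Sum>m<d. y m * U (m, l)) i = (\<Sum>m<d. y m * mat_app d U (\<lambda>l. U (m, l)) i)" by (rule mat_app_sum)
 also have "\<dots> = (\<Sum>m<d. if m = i then y m else 0)"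
  using assms i by (intro sum.cong refl) (auto simp: Defs.orthogonal_mat_def mat_app_def)
 finally show "mat_app d U (\<lambda>l. \<Sum>m<d. y m * U (m, l)) i = y i" using i by simp
qed

text \<open>Noise rows of norm at most \<open>\<rho> / (2 * real d)\<close> add up to a perturbation
  of operator norm at most \<open>\<rho> / 2\<close>, while the simplex matrix expands every vector
  by at least \<open>\<rho>\<close>; half of that expansion survives.\<close>

locale simplex_pert =
 fixes d :: nat and \<rho> :: real and U :: "cvec" and E :: rows
 assumes d1: "1 < d" and rho01: "0 < \<rho>" "\<rho> \<le> 1" and orthU: "orth d U"
  and E: "\<And>j. j < d ==> enorm d (E j) \<le> \<rho> / (2 * real d)"
begin

definition V :: rows where
 "V j k = mat_app d U (simplex_vertex d \<rho> j) k + E j k"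

lemma lower_comb: "\<rho> / 2 * enorm d l \<le> enorm d (\<lambda>k. \<Sum>j<d. l j * V j k)"
proof -
 let ?e = "\<lambda>k. \<Sum>j<d. l j * E j k"
 have "\<rho> * enorm d l \<le> enorm d (mat_app d U (sxop d \<rho> l))"
  unfolding enorm_mat_app[OF orthU] by (rule enorm_sxop_ge) (use d1 rho01 in auto)
 also have "\<dots> = enorm d (\<lambda>k. (\<Sum>j<d. l j * V j k) - ?e k)"
 proof (rule enorm_cong)
  fix k
  have "mat_app d U (sxop d \<rho> l) k = mat_app d U (\<lambda>k. \<Sum>j<d. l j * simplex_vertex d \<rho> j k) k"
   by (rule mat_app_cong) (rule sum_vertex[symmetric])
  then show "mat_app d U (sxop d \<rho> l) k = (\<Sum>j<d. l j * V j k) - ?e k"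
   unfolding mat_app_sum V_def by (simp add: distrib_left sum.distrib)
 qed
 also have "\<dots> \<le> enorm d (\<lambda>k. \<Sum>j<d. l j * V j k) + enorm d ?e" by (rule enorm_diff)
 also have "enorm d ?e \<le> (\<Sum>j<d. enorm d (\<lambda>k. l j * E j k))" by (rule enorm_sum_le) simp
 also have "\<dots> \<le> (\<Sum>j<d. enorm d l * (\<rho> / (2 * real d)))"
  unfolding enorm_scale using E entry_le_enorm[of _ d l] by (intro sum_mono mult_mono) auto
 also have "\<dots> = \<rho> / 2 * enorm d l" using d1 by simp
 finally show ?thesis by simp
qed

lemma lower_dot: "\<rho> / 2 * enorm d y \<le> enorm d (\<lambda>j. dot d (V j) y)"
proof -
 obtain x where x: "\<And>i. i < d ==> mat_app d U x i = y i" using orth_surj[OF orthU] by blast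
 have ny: "enorm d x = enorm d y" using enorm_mat_app[OF orthU, of x] enorm_cong[of d "mat_app d U x" y, OF x] by simp
 let ?e = "\<lambda>j. dot d (E j) y"
 have "\<rho> * enorm d y \<le> enorm d (sxop d \<rho> x)"
  unfolding ny[symmetric] by (rule enorm_sxop_ge) (use d1 rho01 in auto)
 also have "\<dots> = enorm d (\<lambda>j. dot d (V j) y - ?e j)"
 proof (rule enorm_cong)
  fix j assume j: "j < d"
  have "dot d (mat_app d U (simplex_vertex d \<rho> j)) y = dot d (mat_app d U (simplex_vertex d \<rho> j)) (mat_app d U x)"
   by (rule dot_cong) (use x in auto)
  then have "sxop d \<rho> x j = dot d (mat_app d U (simplex_vertex d \<rho> j)) y"
   unfolding dot_mat_app[OF orthU] dot_vertex[OF j] ..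
  then show "sxop d \<rho> x j = dot d (V j) y - ?e j" unfolding V_def dot_add by simp
 qed
 also have "\<dots> \<le> enorm d (\<lambda>j. dot d (V j) y) + enorm d ?e" by (rule enorm_diff)
 also have "enorm d ?e \<le> real d * (\<rho> / (2 * real d) * enorm d y)"
 proof (rule enorm_entries_le)
  fix j assume "j < d"
  then show "\<bar>dot d (E j) y\<bar> \<le> \<rho> / (2 * real d) * enorm d y"
   using abs_dot_le[of d "E j" y] mult_right_mono[OF E, of j "enorm d y"] by simp
 qed
 also have "\<dots> = \<rho> / 2 * enorm d y" using d1 by simp
 finally show ?thesis by simp
qed

lemma zero_if_lower:
 assumes "\<rho> / 2 * enorm d l \<le> enorm d f" "\<And>k. k < d ==> f k = 0" "j < d"
 shows "l j = 0"
proof -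
 have "enorm d f = 0" using assms(2) by (simp add: enorm_def L2_set_def)
 then have "\<rho> / 2 * enorm d l \<le> 0" using assms(1) by simp
 then have "enorm d l \<le> 0" using rho01(1) by (simp add: mult_le_0_iff)
 then have "enorm d l = 0" using enorm_nonneg[of d l] by linarith
 then show ?thesis using enorm_eq_0 assms(3) by blast
qed

lemma pert_indep: "\<forall>k<d. (\<Sum>j<d. l j * V j k) = 0 ==> j < d ==> l j = 0"
 by (rule zero_if_lower[OF lower_comb]) auto

text \<open>Without noise the centre has all weights \<open>1 / d\<close>. By
  \<open>lower_comb\<close> the deviation \<open>\<mu>\<close> from these weights has norm at most
  \<open>1 / d\<close>, so the weights stay nonnegative.\<close>

lemma pert_cone: "\<exists>l. (\<forall>j<d. 0 \<le> l j) \<and> (\<forall>k<d. mat_app d U (simplex_center d) k = (\<Sum>j<d. l j * V j k))"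
proof -
 have "dt d (\<lambda>r q. V q r) \<noteq> 0"
  unfolding dt_eq_0_iff using pert_indep by (auto simp: mult.commute)
 then obtain l where l: "\<forall>r<d. (\<Sum>q<d. V q r * l q) = mat_app d U (simplex_center d) r"
  using ex_solution[of d "\<lambda>r q. V q r"] by blast
 define \<mu> where "\<mu> j = l j - 1 / real d" for j
 have c: "(\<Sum>j<d. (1 / real d) * mat_app d U (simplex_vertex d \<rho> j) k) = mat_app d U (simplex_center d) k" for k
  unfolding mat_app_sum[symmetric]
 proof (rule mat_app_cong)
  fix k assume "k < d"
  have "sqrt (real d) * (1 / real d) = 1 / sqrt (real d)" using d1 real_sqrt_mult_self[of "real d"] by (simp add: field_simps)
  then show "(\<Sum>j<d. 1 / real d * simplex_vertex d \<rho> j k) = simplex_center d k"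
   unfolding sum_vertex[OF \<open>k < d\<close>] sxop_def simplex_center_def using d1 by simp
 qed
 have "\<rho> / 2 * enorm d \<mu> \<le> enorm d (\<lambda>k. \<Sum>j<d. \<mu> j * V j k)" by (rule lower_comb)
 also have "\<dots> = enorm d (\<lambda>k. \<Sum>j<d. - (1 / real d) * E j k)"
 proof (rule enorm_cong)
  fix k assume "k < d"
  then have "(\<Sum>j<d. l j * V j k) = mat_app d U (simplex_center d) k" using l by (simp add: mult.commute)
  moreover have "(\<Sum>j<d. \<mu> j * V j k) = (\<Sum>j<d. l j * V j k) - (\<Sum>j<d. (1 / real d) * mat_app d U (simplex_vertex d \<rho> j) k) - (\<Sum>j<d. (1 / real d) * E j k)"
   unfolding sum_subtractf[symmetric] by (intro sum.cong refl) (simp add: \<mu>_def V_def algebra_simps)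
  ultimately show "(\<Sum>j<d. \<mu> j * V j k) = (\<Sum>j<d. - (1 / real d) * E j k)" unfolding c by (simp add: sum_negf)
 qed
 also have "\<dots> \<le> (\<Sum>j<d. enorm d (\<lambda>k. - (1 / real d) * E j k))" by (rule enorm_sum_le) simp
 also have "\<dots> \<le> (\<Sum>j<d. 1 / real d * (\<rho> / (2 * real d)))"
  unfolding enorm_scale using E by (intro sum_mono mult_mono) auto
 also have "\<dots> = \<rho> / 2 * (1 / real d)" using d1 by simp
 finally have "\<rho> / 2 * enorm d \<mu> \<le> \<rho> / 2 * (1 / real d)" .
 then have "enorm d \<mu> \<le> 1 / real d" by (rule mult_left_le_imp_le) (use rho01 in simp)
 then have "0 \<le> l j" if "j < d" for j using entry_le_enorm[OF that, of \<mu>] by (simp add: \<mu>_def)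
 then show ?thesis using l by (intro exI[of _ l]) (auto simp: mult.commute)
qed

text \<open>Without noise the normal is the rotated centre, a unit vector, and the noise changes it
  by at most 1. The resulting 2 is compensated by the dilation with
  \<open>2 * mag n d a\<close>.\<close>

lemma pert_normal: "\<exists>h. (\<forall>j<d. dot d (V j) h = 1) \<and> enorm d h \<le> 2"
proof -
 let ?c = "mat_app d U (simplex_center d)"
 have "dt d V \<noteq> 0"
  unfolding dt_eq_0_iff
 proof
  assume "\<exists>x. (\<exists>q<d. x q \<noteq> 0) \<and> (\<forall>r<d. (\<Sum>q<d. V r q * x q) = 0)"
  then obtain x q where x: "q < d" "x q \<noteq> 0" "\<forall>r<d. (\<Sum>q<d. V r q * x q) = 0" by blast
  then show False using zero_if_lower[OF lower_dot, of x q] by (simp add: dot_def)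
 qed
 then obtain h where h: "\<forall>r<d. dot d (V r) h = 1" using ex_solution[of d V "\<lambda>_. 1"] unfolding dot_def by blast
 define k where "k i = h i + (- 1) * ?c i" for i
 have Vk: "dot d (V j) k = - dot d (E j) ?c" if j: "j < d" for j
 proof -
  have "dot d (V j) k = dot d k (V j)" by (rule dot_commute)
  also have "\<dots> = dot d h (V j) + (- 1) * dot d ?c (V j)" unfolding k_def[abs_def] by (simp only: dot_add dot_scale)
  also have "dot d h (V j) = 1" using h j by (subst dot_commute) simp
  also have "dot d ?c (V j) = dot d (V j) ?c" by (rule dot_commute)
  also have "dot d (V j) ?c = dot d (simplex_vertex d \<rho> j) (simplex_center d) + dot d (E j) ?c"
   unfolding V_def[abs_def] dot_add dot_mat_app[OF orthU] ..
  also have "dot d (simplex_vertex d \<rho> j) (simplex_center d) = 1"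
   unfolding dot_vertex[OF j] sxop_def simplex_center_def using d1 by simp
  finally show ?thesis by simp
 qed
 have "\<rho> / 2 * enorm d k \<le> enorm d (\<lambda>j. dot d (V j) k)" by (rule lower_dot)
 also have "\<dots> \<le> real d * (\<rho> / (2 * real d))"
 proof (rule enorm_entries_le)
  fix j assume j: "j < d"
  have "\<bar>dot d (E j) ?c\<bar> \<le> enorm d (E j) * enorm d ?c" by (rule abs_dot_le)
  also have "enorm d ?c = 1" unfolding enorm_mat_app[OF orthU] using norm_center d1 by simp
  finally show "\<bar>dot d (V j) k\<bar> \<le> \<rho> / (2 * real d)" using E[OF j] Vk[OF j] by simp
 qed
 also have "\<dots> = \<rho> / 2 * 1" using d1 by simp
 finally have "enorm d k \<le> 1" using rho01(1) by simp
 moreover have "enorm d h \<le> enorm d k + enorm d ?c" using enorm_add[of d k ?c] by (simp add: k_def)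
 moreover have "enorm d ?c = 1" unfolding enorm_mat_app[OF orthU] using norm_center d1 by simp
 ultimately show ?thesis using h by auto
qed

end

lemma sum_shift_added: "(\<Sum>i\<in>{n..<n + d}. f i) = (\<Sum>j<d. f (n + j))" for f :: rvec
 by (rule sum.reindex_bij_witness[of _ "\<lambda>j. n + j" "\<lambda>i. i - n"]) auto

lemma added_okI:
 assumes d: "1 < d" and \<rho>: "0 < size1 c1 d" "size1 c1 d \<le> 1" and U: "orth d U"
  and G: "\<And>j. j < d ==> enorm d (\<lambda>k. sdev1 c1 n d * G (j, k)) \<le> size1 c1 d / (2 * real d)"
 shows "added_ok c1 n d a (U, G)"
proof -
 interpret simplex_pert d "size1 c1 d" U "\<lambda>j k. sdev1 c1 n d * G (j, k)"
  by standard (use assms in auto)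
 define M where "M = mag n d a"
 have M0: "0 < M" by (simp add: M_def mag_def)
 let ?c = "ext_constraints c1 n d a U G"
 have c: "?c (n + j) k = 2 * M * V j k" for j k
  by (simp add: ext_constraints_def new_constraint_def V_def M_def)
 have sum: "(\<Sum>i\<in>{n..<n + d}. l i * ?c i k) = 2 * M * (\<Sum>j<d. l (n + j) * V j k)" for l k
  unfolding sum_shift_added c sum_distrib_left by (intro sum.cong) auto
 have 1: "lin_indep d ?c {n..<n + d}"
  unfolding lin_indep_def
 proof (intro allI impI ballI)
  fix l i assume l: "\<forall>k<d. (\<Sum>i\<in>{n..<n + d}. l i * ?c i k) = 0" and i: "i \<in> {n..<n + d}"
  then have "\<forall>k<d. (\<Sum>j<d. l (n + j) * V j k) = 0" unfolding sum using M0 by simp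
  moreover have "i - n < d" using i by auto
  ultimately show "l i = 0" using pert_indep[of "\<lambda>j. l (n + j)" "i - n"] i by simp
 qed
 obtain l where l: "\<forall>j<d. 0 \<le> l j" "\<forall>k<d. mat_app d U (simplex_center d) k = (\<Sum>j<d. l j * V j k)"
  using pert_cone by blast
 have 2: "in_cone d ?c {n..<n + d} (init_objective n d a U)"
  unfolding in_cone_def sum using l
  by (intro exI[of _ "\<lambda>i. l (i - n)"]) (auto simp: init_objective_def M_def)
 obtain h where h: "\<forall>j<d. dot d (V j) h = 1" "enorm d h \<le> 2" using pert_normal by blast
 have 3: "\<exists>h. (\<forall>i\<in>{n..<n + d}. dot d (?c i) h = 1) \<and> mag n d a * enorm d h \<le> 1"
 proof (intro exI conjI ballI)
  let ?h = "\<lambda>k. 1 / (2 * M) * h k"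
  fix i assume i: "i \<in> {n..<n + d}"
  then obtain j where j: "i = n + j" "j < d" using le_Suc_ex by auto
  have "dot d (?c i) ?h = dot d (\<lambda>k. 2 * M * V j k) ?h" unfolding j(1) by (rule dot_cong) (auto simp: c)
  also have "\<dots> = 2 * M * dot d ?h (V j)" by (subst dot_scale) (simp only: dot_commute[of d "V j"])
  also have "\<dots> = 2 * M * (1 / (2 * M) * dot d h (V j))" by (simp only: dot_scale)
  also have "\<dots> = dot d h (V j)" using M0 by simp
  also have "\<dots> = dot d (V j) h" by (rule dot_commute)
  finally show "dot d (?c i) ?h = 1" using h(1) j by simp
 next
  show "mag n d a * enorm d (\<lambda>k. 1 / (2 * M) * h k) \<le> 1"
   unfolding enorm_scale M_def[symmetric] using h(2) M0 by simp
 qed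
 show ?thesis unfolding added_ok_def using 1 2 3 by (simp add: Let_def)
qed

text \<open>The logarithm is rounded upwards; if all rows vanish it is meaningless, but
  \<open>mag\<close> is still positive.\<close>

lemma enorm_le_mag:
 assumes "i < n"
 shows "enorm d (a i) \<le> mag n d a"
proof -
 let ?m = "Max ((\<lambda>i. enorm d (a i)) ` {..<n})"
 have le: "enorm d (a i) \<le> ?m" using assms by (intro Max_ge) auto
 show ?thesis
 proof (cases "0 < ?m")
  case True
  have "?m = exp (ln ?m)" using True by simp
  also have "\<dots> \<le> mag n d a" unfolding mag_def by simp
  finally show ?thesis using le by simp
 next
  case False
  then show ?thesis using le enorm_nonneg[of d "a i"] exp_gt_zero[of "of_int \<lceil>ln ?m\<rceil> :: real"] unfolding mag_def by linarith
 qed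
qed

text \<open>
 \<open>y m\<close> is a maximizing sequence of the given unit program. If the added constraints have nonpositive
 values at infinitely many \<open>y m\<close>, then no optimal solution of the extended program uses an added constraint.
\<close>

lemma attempt_correctI:
 assumes dn: "d < n" and d: "0 < d"
  and gz: "\<And>I v. I \<subseteq> {..<n} ==> card I = d - 1 ==> \<not> (\<forall>l<d. z l = comb a I v l)"
  and ok: "added_ok c1 n d a (U, G)"
  and y: "\<And>m i. i < n ==> dot d (a i) (y m) \<le> 1"
  and opt: "\<And>x \<epsilon>. (\<And>i. i < n ==> dot d (a i) x \<le> 1) ==> 0 < \<epsilon> ==> \<exists>m0. \<forall>m\<ge>m0. dot d z x - \<epsilon> \<le> dot d z (y m)"
  and inf: "\<And>m0. \<exists>m\<ge>m0. \<forall>j<d. dot d (new_constraint c1 n d a U G j) (y m) \<le> 0"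
 shows "attempt_correct c1 n d z a (U, G)"
proof -
 let ?c = "ext_constraints c1 n d a U G" and ?I0 = "{n..<n + d}"
 obtain h where li: "lin_indep d ?c ?I0" and h: "\<forall>i\<in>?I0. dot d (?c i) h = 1" "mag n d a * enorm d h \<le> 1"
  using ok by (auto simp: added_ok_def Let_def)
 have cn: "?c i = a i" if "i < n" for i using that by (simp add: ext_constraints_def)
 have f0: "feasible_basis d ?c (\<lambda>_. 1) {..<n + d} ?I0"
  unfolding feasible_basis_def
 proof (intro conjI exI[of _ h] ballI)
  fix j assume j: "j \<in> {..<n + d}"
  show "dot d (?c j) h \<le> 1"
  proof (cases "j < n")
   case True
   have "dot d (a j) h \<le> enorm d (a j) * enorm d h" using abs_dot_le[of d "a j" h] by linarith
   also have "\<dots> \<le> mag n d a * enorm d h" by (intro mult_right_mono enorm_le_mag[OF True]) simp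
   finally show ?thesis using h(2) cn[OF True] by simp
  qed (use h(1) j in force)
 qed (use li h(1) in auto)
 obtain J where J: "walk_ends_at d ?c (\<lambda>_. 1) {..<n + d} (segment_path (init_objective n d a U) z) {0..1} ?I0 J"
  and "J = ?I0 \<or> J \<in> pierced_bases d ?c (\<lambda>_. 1) {..<n + d} (segment_path (init_objective n d a U) z) {0..1}"
  by (rule walk_terminates[of "{..<n + d}"]) auto
 then have "feasible_basis d ?c (\<lambda>_. 1) {..<n + d} J" using f0 unfolding pierced_bases_def by blast
 then obtain x where Js: "J \<subseteq> {..<n + d}" "finite J" "card J = d"
  and x: "\<forall>i\<in>J. dot d (?c i) x = 1" "\<forall>j\<in>{..<n + d}. dot d (?c j) x \<le> 1" unfolding feasible_basis_def by blast
 have ends: "attempt_ends_at c1 n d z a (U, G) J" unfolding attempt_ends_at_def using ok J by simp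
 show ?thesis
 proof (cases "in_cone d ?c J z")
  \<comment> \<open>A final facet not pierced by \<open>z\<close> is the answer "unbounded", which
    \<open>attempt_correct\<close> accepts.\<close>
  case False
  then show ?thesis unfolding attempt_correct_def attempt_unbounded_def using ends by auto
 next
  case True
  then obtain l where l: "\<forall>i\<in>J. 0 \<le> l i" "\<forall>k<d. z k = (\<Sum>i\<in>J. l i * ?c i k)" unfolding in_cone_def by blast
  have zd: "dot d z u = (\<Sum>i\<in>J. l i * dot d (?c i) u)" for u
  proof -
   have "dot d z u = dot d (comb ?c J l) u" by (rule dot_cong) (use l(2) in \<open>auto simp: comb_def\<close>)
   then show ?thesis using dot_comb[OF Js(2)] by simp
  qed
  have split: "(\<Sum>i\<in>J. f i) = (\<Sum>i\<in>J \<inter> {..<n}. f i) + (\<Sum>i\<in>J - {..<n}. f i)" for f :: rvec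
   using Js(2) sum.Int_Diff by blast
  \<comment> \<open>Weak duality along the maximizing sequence: at \<open>y m\<close> the added
    constraints contribute nothing positive to \<open>dot d z (y m)\<close>, so their multipliers
    account at most for the gap \<open>\<epsilon>\<close> between the values at \<open>x\<close> and
    \<open>y m\<close>.\<close>
  have small: "(\<Sum>i\<in>J - {..<n}. l i) \<le> \<epsilon>" if e: "0 < \<epsilon>" for \<epsilon>
  proof -
   have "dot d (a i) x \<le> 1" if "i < n" for i using bspec[OF x(2), of i] cn[OF that] that by simp
   from opt[OF this e] obtain m0 where m0: "\<forall>m\<ge>m0. dot d z x - \<epsilon> \<le> dot d z (y m)" by blast
   obtain m where m: "m \<ge> m0" "\<forall>j<d. dot d (new_constraint c1 n d a U G j) (y m) \<le> 0" using inf[of m0] by blast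
   have "(\<Sum>i\<in>J - {..<n}. l i * dot d (?c i) (y m)) \<le> 0"
   proof (intro sum_nonpos mult_nonneg_nonpos)
    fix i assume i: "i \<in> J - {..<n}"
    then have "i - n < d" "\<not> i < n" using Js(1) by force+
    then show "dot d (?c i) (y m) \<le> 0" using m(2) by (simp add: ext_constraints_def)
   qed (use l in auto)
   moreover have "(\<Sum>i\<in>J \<inter> {..<n}. l i * dot d (?c i) (y m)) \<le> (\<Sum>i\<in>J \<inter> {..<n}. l i * 1)"
    using l cn y by (intro sum_mono mult_left_mono) auto
   ultimately have "dot d z (y m) \<le> (\<Sum>i\<in>J \<inter> {..<n}. l i)" unfolding zd split by simp
   moreover have "dot d z x = (\<Sum>i\<in>J. l i)" unfolding zd by (rule sum.cong[OF refl]) (simp add: x(1))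
   moreover have "dot d z x - \<epsilon> \<le> dot d z (y m)" using m0 m(1) by blast
   ultimately show ?thesis using split[of l] by linarith
  qed
  have "(\<Sum>i\<in>J - {..<n}. l i) \<le> 0" by (rule field_le_epsilon) (use small in simp)
  moreover have "0 \<le> (\<Sum>i\<in>J - {..<n}. l i)" using l(1) by (intro sum_nonneg) auto
  ultimately have "(\<Sum>i\<in>J - {..<n}. l i) = 0" by linarith
  then have l0: "\<forall>i\<in>J - {..<n}. l i = 0" using l(1) Js(2) by (subst (asm) sum_nonneg_eq_0_iff) auto
  \<comment> \<open>Otherwise, the multipliers of added constraints being 0, \<open>z\<close> would
    be a combination of fewer than \<open>d\<close> given rows.\<close>
  have Jn: "J \<subseteq> {..<n}"
  proof (rule ccontr)
   assume "\<not> J \<subseteq> {..<n}"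
   then have "card (J \<inter> {..<n}) < d" unfolding Js(3)[symmetric] by (intro psubset_card_mono Js(2)) auto
   then have "card (J \<inter> {..<n}) \<le> d - 1" by simp
   then have "\<exists>I. J \<inter> {..<n} \<subseteq> I \<and> I \<subseteq> {..<n} \<and> card I = d - 1"
    by (rule exists_subset_between) (use dn in auto)
   then obtain I where I: "J \<inter> {..<n} \<subseteq> I" "I \<subseteq> {..<n}" "card I = d - 1" by blast
   have fI: "finite I" using I(2) finite_subset by blast
   have "z k = comb a I (\<lambda>i. if i \<in> J then l i else 0) k" if "k < d" for k
   proof -
    have "z k = (\<Sum>i\<in>J \<inter> {..<n}. l i * ?c i k)" using l(2) that split[of "\<lambda>i. l i * ?c i k"] l0 by simp
    also have "\<dots> = (\<Sum>i\<in>J \<inter> {..<n}. (if i \<in> J then l i else 0) * a i k)" using cn by (intro sum.cong) auto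
    also have "\<dots> = comb a I (\<lambda>i. if i \<in> J then l i else 0) k"
     unfolding comb_def by (rule sum.mono_neutral_left[OF fI I(1)]) (use I(2) in auto)
    finally show ?thesis .
   qed
   then show False using gz[OF I(2,3)] by blast
  qed
  have "in_cone d a J z"
   unfolding in_cone_def
  proof (intro exI[of _ l] conjI l(1) allI impI)
   fix k assume "k < d"
   then show "z k = (\<Sum>i\<in>J. l i * a i k)" using l(2) cn Jn by (auto intro!: sum.cong)
  qed
  then show ?thesis unfolding attempt_correct_def attempt_optimal_def using ends Jn by blast
 qed
qed

text \<open>One statement covers bounded and unbounded objectives; in the unbounded case the values
  along the sequence tend to infinity.\<close>

lemma maximizing_sequence:
 assumes "F \<noteq> {}"
 shows "\<exists>y :: nat => 'a. (\<forall>m. y m \<in> F) \<and> (\<forall>x\<in>F. \<forall>\<epsilon>>0. \<exists>m0. \<forall>m\<ge>m0. f x - \<epsilon> \<le> (f (y m) :: real))"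
proof (cases "bdd_above (f ` F)")
 case True
 define V where "V = Sup (f ` F)"
 have "\<exists>y\<in>F. V - 1 / real (Suc m) < f y" for m
  using less_cSup_iff[of "f ` F" "V - 1 / real (Suc m)"] True assms unfolding V_def by auto
 then obtain y where y: "\<And>m. y m \<in> F" "\<And>m. V - 1 / real (Suc m) < f (y m)" by metis
 have "\<exists>m0. \<forall>m\<ge>m0. f x - \<epsilon> \<le> f (y m)" if xF: "x \<in> F" and e: "0 < \<epsilon>" for x \<epsilon>
 proof -
  have xV: "f x \<le> V" unfolding V_def using True xF by (intro cSup_upper) auto
  obtain m0 where m0: "1 / real (Suc m0) < \<epsilon>" using nat_approx_posE[OF e] by blast
  have "1 / real (Suc m) \<le> 1 / real (Suc m0)" if "m \<ge> m0" for m using that by (intro divide_left_mono) auto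
  then show ?thesis using y(2) m0 xV by (intro exI[of _ m0]) (smt (verit))
 qed
 then show ?thesis using y(1) by blast
next
 case False
 then have "\<exists>y\<in>F. real m < f y" for m unfolding bdd_above_def by (metis imageE not_le)
 then obtain y where y: "\<And>m. y m \<in> F" "\<And>m. real m < f (y m)" by metis
 have "\<exists>m0. \<forall>m\<ge>m0. f x - \<epsilon> \<le> f (y m)" if "0 < \<epsilon>" for x \<epsilon>
 proof -
  obtain m0 where "f x < real m0" using reals_Archimedean2 by blast
  then show ?thesis using y(2) that by (intro exI[of _ m0]) (smt (verit) of_nat_le_iff)
 qed
 then show ?thesis using y(1) by blast
qed

section \<open>The probability of a correct attempt\<close>

lemma distr_gauss_component: "i \<in> I ==> distr (gauss I) borel (\<lambda>g. g i) = std_normal"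
proof -
 assume i: "i \<in> I"
 have "distr (gauss I) borel (\<lambda>g. g i) = distr (gauss I) std_normal (\<lambda>g. g i)" by (rule distr_cong) auto
 also have "\<dots> = std_normal" by (rule distr_PiM_component) (use prob_space_std_normal i in auto)
 finally show ?thesis .
qed

lemma distributed_dot_gauss:
 assumes u: "dot d u u = 1"
 shows "distributed (gauss {..<d}) lborel (\<lambda>g. dot d u g) std_normal_density"
proof -
 interpret prob_space "gauss {..<d}" by (rule prob_space_gauss)
 \<comment> \<open>Coordinates with coefficient 0 are left out because the rule for sums of
   independent normal variables asks for positive deviations.\<close>
 define I where "I = {i. i < d \<and> u i \<noteq> 0}"
 have comp: "(\<lambda>g. g i) \<in> borel_measurable (gauss {..<d})" if "i < d" for i
  using measurable_component_singleton[of i "{..<d}" "\<lambda>_. std_normal"] that by simp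
 have I: "finite I" "I \<subseteq> {..<d}" unfolding I_def by auto
 have Ine: "I \<noteq> {}"
 proof
  assume "I = {}"
  then have "dot d u u = 0" unfolding dot_def I_def by (intro sum.neutral) auto
  then show False using u by simp
 qed
 have "indep_vars (\<lambda>_. borel) (\<lambda>i g. g i) {..<d}"
 proof (subst indep_vars_iff_distr_eq_PiM')
  show "{..<d} \<noteq> {}" using I Ine by auto
  show "random_variable borel (\<lambda>g. g i)" if "i \<in> {..<d}" for i using comp that by simp
  have "distr (gauss {..<d}) (Pi\<^sub>M {..<d} (\<lambda>_. borel)) (\<lambda>x. \<lambda>i\<in>{..<d}. x i) = distr (gauss {..<d}) (gauss {..<d}) (\<lambda>x. x)"
   by (rule distr_cong) (auto simp: space_PiM PiE_restrict intro!: sets_PiM_cong)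
  also have "\<dots> = gauss {..<d}" by (rule distr_id2) simp
  also have "\<dots> = (\<Pi>\<^sub>M i\<in>{..<d}. distr (gauss {..<d}) borel (\<lambda>g. g i))"
   by (rule PiM_cong) (auto simp: distr_gauss_component)
  finally show "distr (gauss {..<d}) (Pi\<^sub>M {..<d} (\<lambda>_. borel)) (\<lambda>x. \<lambda>i\<in>{..<d}. x i) = \<dots>" .
 qed
 then have "indep_vars (\<lambda>_. borel) (\<lambda>i g. g i) I" by (rule indep_vars_subset[OF _ I(2)])
 then have ind: "indep_vars (\<lambda>_. borel) (\<lambda>i g. 0 + u i * g i) I"
  by (rule indep_vars_compose2[where Y = "\<lambda>i x. 0 + u i * x"]) simp
 have "distributed (gauss {..<d}) lborel (\<lambda>g. \<Sum>i\<in>I. 0 + u i * g i) (normal_density (\<Sum>i\<in>I. 0) (sqrt (\<Sum>i\<in>I. (\<bar>u i\<bar>)\<^sup>2)))"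
 proof (rule sum_indep_normal[OF I(1) Ine ind])
  fix i assume i: "i \<in> I"
  then have id: "i < d" "u i \<noteq> 0" unfolding I_def by auto
  then show "0 < \<bar>u i\<bar>" by simp
  have "distr (gauss {..<d}) lborel (\<lambda>g. g i) = std_normal"
   using distr_gauss_component[of i "{..<d}"] id by (subst distr_cong[OF refl sets_lborel refl]) auto
  then have "distributed (gauss {..<d}) lborel (\<lambda>g. g i) (normal_density 0 1)"
   using comp[OF id(1)] unfolding distributed_def by simp
  from normal_density_affine[OF this _ id(2), of 0]
  show "distributed (gauss {..<d}) lborel (\<lambda>g. 0 + u i * g i) (normal_density 0 \<bar>u i\<bar>)" by simp
 qed
 moreover have "(\<Sum>i\<in>I. 0 + u i * g i) = dot d u g" for g
  unfolding dot_def I_def by (simp, intro sum.mono_neutral_left) auto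
 moreover have "(\<Sum>i\<in>I. (\<bar>u i\<bar>)\<^sup>2) = dot d u u"
 proof -
  have "(\<Sum>i\<in>I. u i * u i) = dot d u u" unfolding dot_def I_def by (intro sum.mono_neutral_left) auto
  then show ?thesis by (simp add: power2_eq_square)
 qed
 ultimately show ?thesis using u by simp
qed

lemma measure_dot_gauss:
 assumes u: "dot d u u = 1" and S: "S \<in> sets borel"
 shows "measure (gauss {..<d}) {g \<in> space (gauss {..<d}). dot d u g \<in> S} = measure std_normal S"
proof -
 have D: "distr (gauss {..<d}) lborel (\<lambda>g. dot d u g) = std_normal" and m: "(\<lambda>g. dot d u g) \<in> gauss {..<d} \<rightarrow>\<^sub>M lborel"
  using distributed_dot_gauss[OF u] unfolding distributed_def by auto
 have "measure (distr (gauss {..<d}) lborel (\<lambda>g. dot d u g)) S = measure (gauss {..<d}) ((\<lambda>g. dot d u g) -` S \<inter> space (gauss {..<d}))"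
  by (rule measure_distr[OF m]) (use S in simp)
 then show ?thesis unfolding D by (simp add: vimage_def Int_def conj_commute)
qed

lemma std_normal_tail: "0 \<le> r ==> measure std_normal {x. r < \<bar>x\<bar>} \<le> sqrt 2 * exp (- r\<^sup>2 / 4)"
proof -
 assume r: "0 \<le> r"
 interpret prob_space std_normal by (rule prob_space_std_normal)
 have m: "{x. r < \<bar>x\<bar>} \<in> sets std_normal" by simp
 have "emeasure std_normal {x. r < \<bar>x\<bar>} = (\<integral>\<^sup>+x. indicator {x. r < \<bar>x\<bar>} x \<partial>std_normal)"
  by (rule nn_integral_indicator[OF m, symmetric])
 also have "\<dots> \<le> (\<integral>\<^sup>+x. ennreal (exp (- r\<^sup>2 / 4)) * ennreal (exp (x\<^sup>2 / 4)) \<partial>std_normal)"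
 proof (rule nn_integral_mono)
  fix x :: real
  show "indicator {x. r < \<bar>x\<bar>} x \<le> ennreal (exp (- r\<^sup>2 / 4)) * ennreal (exp (x\<^sup>2 / 4))"
  proof (cases "r < \<bar>x\<bar>")
   case True
   then have "r\<^sup>2 \<le> x\<^sup>2" using r by (metis abs_of_nonneg less_imp_le power2_le_iff_abs_le power2_abs abs_ge_zero)
   then have "1 \<le> exp (- r\<^sup>2 / 4) * exp (x\<^sup>2 / 4)" by (simp add: exp_add[symmetric])
   then show ?thesis using True by (simp add: ennreal_mult[symmetric])
  qed simp
 qed
 also have "\<dots> = ennreal (exp (- r\<^sup>2 / 4)) * ennreal (sqrt 2)"
  by (subst nn_integral_cmult) (auto simp: nn_integral_exp_sq)
 also have "\<dots> = ennreal (sqrt 2 * exp (- r\<^sup>2 / 4))" by (simp add: ennreal_mult[symmetric] mult.commute)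
 finally show ?thesis unfolding emeasure_eq_measure by simp
qed

lemma std_normal_interval_pos: "a < b ==> 0 < measure std_normal {a..b}"
proof (rule ccontr)
 assume ab: "a < b" and n: "\<not> 0 < measure std_normal {a..b}"
 interpret prob_space std_normal by (rule prob_space_std_normal)
 have "measure std_normal {a..b} = 0" using n measure_nonneg[of std_normal "{a..b}"] by linarith
 then have "{a..b} \<in> null_sets std_normal" by (simp add: emeasure_eq_measure null_sets_def)
 then have "AE x in lborel. x \<in> {a..b} \<longrightarrow> ennreal (std_normal_density x) = 0"
  by (subst (asm) null_sets_density_iff) auto
 then have "AE x in lborel. x \<notin> {a..b}"
 proof eventually_elim
  case (elim x)
  have "0 < std_normal_density x" by (rule normal_density_pos) simp
  then have "ennreal (std_normal_density x) \<noteq> 0" by (simp add: ennreal_eq_0_iff)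
  then show ?case using elim by blast
 qed
 then have "{a..b} \<in> null_sets lborel" by (subst AE_iff_null_sets) auto
 then have "emeasure lborel {a..b} = 0" by (rule null_setsD1)
 then show False using ab by simp
qed

text \<open>
 The centre \<open>U c\<close> of the simplex has inner product at most \<open>-1\<close> with a Gaussian vector with constant
 probability, and the deviations of all vertices are of smaller order.
\<close>

lemma gauss_simplex_behind:
 obtains c1 \<alpha> :: real where "0 < c1" "c1 \<le> 1" "0 < \<alpha>"
  "\<And>d U. 3 < d ==> orth d U ==> \<alpha> \<le> measure (gauss {..<d}) {g \<in> space (gauss {..<d}). 0 < enorm d g \<and>
    (\<forall>j<d. dot d (mat_app d U (simplex_vertex d (size1 c1 d) j)) g \<le> - (size1 c1 d / (2 * real d)) * enorm d g)}"
proof -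
 define \<alpha>\<^sub>0 where "\<alpha>\<^sub>0 = measure std_normal {-2..-1::real}"
 have a0: "0 < \<alpha>\<^sub>0" unfolding \<alpha>\<^sub>0_def by (rule std_normal_interval_pos) simp
 \<comment> \<open>With this \<open>s\<close> the two exceptional events, each of probability at
   most \<open>6 * exp (- s)\<close>, use up at most half of
   \<open>\<alpha>\<^sub>0\<close>.\<close>
 define s where "s = max 1 (24 / \<alpha>\<^sub>0)"
 define t where "t = 2 * sqrt s"
 have s1: "1 \<le> s" "24 / \<alpha>\<^sub>0 \<le> s" unfolding s_def by auto
 have t2: "t\<^sup>2 = 4 * s" "2 \<le> t" unfolding t_def using s1 by (auto simp: power_mult_distrib)
 have small: "6 * exp (- s) \<le> \<alpha>\<^sub>0 / 4"
 proof -
  have "24 / \<alpha>\<^sub>0 \<le> exp s" using s1 exp_ge_add_one_self[of s] by linarith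
  then have "24 \<le> exp s * \<alpha>\<^sub>0" using a0 by (simp add: divide_le_eq)
  then show ?thesis by (simp add: exp_minus field_simps)
 qed
 \<comment> \<open>The vertices deviate from the centre by at most
   \<open>size1 c1 d * t * sqrt (ln (real d)) = c1 * t = 1 / 2\<close> in inner product, half of
   what the centre guarantees.\<close>
 define c1 where "c1 = 1 / (2 * t)"
 have c1: "0 < c1" "c1 \<le> 1" "c1 * t = 1 / 2" unfolding c1_def using t2 by auto
 show ?thesis
 proof (rule that[of c1 "\<alpha>\<^sub>0 / 2"])
  show "0 < c1" "c1 \<le> 1" "0 < \<alpha>\<^sub>0 / 2" using c1 a0 by auto
  fix d :: nat and U assume d: "3 < d" and U: "orth d U"
  interpret prob_space "gauss {..<d}" by (rule prob_space_gauss)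
  let ?G = "gauss {..<d}" and ?\<rho> = "size1 c1 d"
  have lnd: "1 \<le> ln (real d)"
  proof -
   have "exp 1 \<le> real d" using d by (intro order_trans[OF exp_le]) auto
   then show ?thesis using d by (subst ln_ge_iff) auto
  qed
  have comp: "(\<lambda>g. g i) \<in> borel_measurable ?G" if "i < d" for i
   using measurable_component_singleton[of i "{..<d}" "\<lambda>_. std_normal"] that by simp
  have md: "(\<lambda>g. dot d u g) \<in> borel_measurable ?G" for u
   unfolding dot_def using comp by (intro borel_measurable_sum borel_measurable_times) auto
  have me[measurable]: "(\<lambda>g. enorm d g) \<in> borel_measurable ?G" by (rule measurable_enorm[OF comp])
  let ?w = "mat_app d U (simplex_center d)" and ?e = "\<lambda>j. mat_app d U (simplex_dir d j)"
  have w1: "dot d ?w ?w = 1" using dot_mat_app[OF U] dot_center[of d] d by simp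
  have e1: "dot d (?e j) (?e j) = 1" if "j < d" for j
   using dot_mat_app[OF U] norm_dir[of d j] enorm_sq[of d "simplex_dir d j"] that d by simp
  let ?X = "{g \<in> space ?G. dot d ?w g \<in> {-2..-1}}"
  let ?B = "\<lambda>j. {g \<in> space ?G. dot d (?e j) g \<in> {x. t * sqrt (ln (real d)) < \<bar>x\<bar>}}"
  let ?B2 = "{g \<in> space ?G. t\<^sup>2 * real d < (\<Sum>p\<in>{..<d}. (g p)\<^sup>2)}"
  let ?E = "{g \<in> space ?G. 0 < enorm d g \<and> (\<forall>j<d. dot d (mat_app d U (simplex_vertex d ?\<rho> j)) g \<le> - (?\<rho> / (2 * real d)) * enorm d g)}"
  have X: "measure ?G ?X = \<alpha>\<^sub>0" unfolding \<alpha>\<^sub>0_def by (rule measure_dot_gauss[OF w1]) simp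
  have sB: "?B j \<in> events" for j using md[of "?e j"] by measurable
  have sX: "?X \<in> events" using md[of ?w] by measurable
  have sB2: "?B2 \<in> events"
  proof -
   have [measurable]: "(\<lambda>g. \<Sum>p\<in>{..<d}. (g p)\<^sup>2) \<in> borel_measurable ?G"
    using comp by (intro borel_measurable_sum borel_measurable_power) auto
   show ?thesis by measurable
  qed
  have sE: "?E \<in> events"
  proof -
   have "{g \<in> space ?G. dot d (mat_app d U (simplex_vertex d ?\<rho> j)) g \<le> - (?\<rho> / (2 * real d)) * enorm d g} \<in> events" for j
    using md[of "mat_app d U (simplex_vertex d ?\<rho> j)"] by measurable
   then have "{g \<in> space ?G. 0 < enorm d g \<and> (\<forall>j\<in>{..<d}. dot d (mat_app d U (simplex_vertex d ?\<rho> j)) g \<le> - (?\<rho> / (2 * real d)) * enorm d g)} \<in> events"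
    by (intro sets.sets_Collect_conj sets.sets_Collect_finite_All) (measurable, auto)
   moreover have "{g \<in> space ?G. 0 < enorm d g \<and> (\<forall>j\<in>{..<d}. dot d (mat_app d U (simplex_vertex d ?\<rho> j)) g \<le> - (?\<rho> / (2 * real d)) * enorm d g)} = ?E"
    by (simp only: Ball_def lessThan_iff)
   ultimately show ?thesis by (simp only:)
  qed
  have "prob (\<Union>j\<in>{..<d}. ?B j) \<le> (\<Sum>j\<in>{..<d}. prob (?B j))"
   by (rule finite_measure_subadditive_finite) (use sB in auto)
  also have "\<dots> \<le> (\<Sum>j\<in>{..<d}. sqrt 2 * exp (- (t * sqrt (ln (real d)))\<^sup>2 / 4))"
  proof (rule sum_mono)
   fix j assume "j \<in> {..<d}"
   then have "prob (?B j) = measure std_normal {x. t * sqrt (ln (real d)) < \<bar>x\<bar>}" by (intro measure_dot_gauss e1) auto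
   also have "\<dots> \<le> sqrt 2 * exp (- (t * sqrt (ln (real d)))\<^sup>2 / 4)" using t2 lnd by (intro std_normal_tail) auto
   finally show "prob (?B j) \<le> sqrt 2 * exp (- (t * sqrt (ln (real d)))\<^sup>2 / 4)" .
  qed
  also have "\<dots> = sqrt 2 * (real d * exp (- (s * ln (real d))))" using lnd by (simp add: power_mult_distrib t2)
  also have "real d * exp (- (s * ln (real d))) = exp ((1 - s) * ln (real d))"
   using d by (simp add: left_diff_distrib exp_diff exp_minus field_simps)
  also have "sqrt 2 * exp ((1 - s) * ln (real d)) \<le> 2 * exp ((1 - s) * 1)"
  proof (intro mult_mono)
   have "(1 - s) * ln (real d) \<le> (1 - s) * 1" using s1 lnd by (intro mult_left_mono_neg) auto
   then show "exp ((1 - s) * ln (real d)) \<le> exp ((1 - s) * 1)" by simp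
  qed (use sqrt2_less_2 in auto)
  also have "\<dots> = 2 * exp 1 * exp (- s)" by (simp add: exp_add[symmetric])
  also have "\<dots> \<le> 6 * exp (- s)" using exp_le by simp
  finally have P1: "prob (\<Union>j\<in>{..<d}. ?B j) \<le> \<alpha>\<^sub>0 / 4" using small by linarith
  have "emeasure ?G ?B2 \<le> ennreal (sqrt 2 ^ card {..<d} * exp (- (t\<^sup>2 * real d) / 4))"
   by (rule gauss_tail) auto
  then have "prob ?B2 \<le> sqrt 2 ^ d * exp (- (t\<^sup>2 * real d) / 4)" unfolding emeasure_eq_measure by simp
  also have "\<dots> \<le> exp 1 ^ d * exp (- (t\<^sup>2 * real d) / 4)"
  proof (intro mult_right_mono power_mono)
   show "sqrt 2 \<le> exp (1::real)" using sqrt2_less_2 exp_ge_add_one_self[of "1::real"] by linarith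
  qed auto
  also have "\<dots> = exp ((1 - s) * real d)" by (simp add: t2 exp_of_nat_mult[symmetric] exp_add[symmetric] algebra_simps)
  also have "\<dots> \<le> exp ((1 - s) * 1)"
  proof -
   have "(1 - s) * real d \<le> (1 - s) * 1" using s1 d by (intro mult_left_mono_neg) auto
   then show ?thesis by simp
  qed
  also have "\<dots> = exp 1 * exp (- s)" by (simp add: exp_add[symmetric])
  also have "\<dots> \<le> 6 * exp (- s)" using exp_le by (intro mult_right_mono) auto
  finally have P2: "prob ?B2 \<le> \<alpha>\<^sub>0 / 4" using small by linarith
  have sub: "?X \<subseteq> ?E \<union> ((\<Union>j\<in>{..<d}. ?B j) \<union> ?B2)"
  proof
   fix g assume g: "g \<in> ?X"
   show "g \<in> ?E \<union> ((\<Union>j\<in>{..<d}. ?B j) \<union> ?B2)"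
   proof (rule ccontr)
    assume n: "g \<notin> ?E \<union> ((\<Union>j\<in>{..<d}. ?B j) \<union> ?B2)"
    have sp: "g \<in> space ?G" and gw: "dot d ?w g \<le> -1" using g by auto
    have nB: "\<bar>dot d (?e j) g\<bar> \<le> t * sqrt (ln (real d))" if "j < d" for j using n sp that by (auto simp: not_less)
    have "(\<Sum>p\<in>{..<d}. (g p)\<^sup>2) \<le> t\<^sup>2 * real d" using n sp by (auto simp: not_less)
    then have "(enorm d g)\<^sup>2 \<le> (t * real d)\<^sup>2"
    proof -
     assume "(\<Sum>p\<in>{..<d}. (g p)\<^sup>2) \<le> t\<^sup>2 * real d"
     also have "\<dots> \<le> t\<^sup>2 * (real d)\<^sup>2" using d by (intro mult_left_mono) (auto simp: power2_eq_square)
     finally show ?thesis unfolding enorm_sq dot_def power_mult_distrib by (simp add: power2_eq_square)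
    qed
    then have ng: "enorm d g \<le> t * real d" by (rule power2_le_imp_le) (use t2 in simp)
    have pos: "0 < enorm d g"
    proof (rule ccontr)
     assume "\<not> 0 < enorm d g"
     then have "enorm d g = 0" using enorm_nonneg[of d g] by linarith
     then show False using abs_dot_le[of d ?w g] gw by simp
    qed
    have rho: "0 \<le> ?\<rho>" "?\<rho> * sqrt (ln (real d)) = c1" "?\<rho> \<le> c1"
    proof -
     have "1 \<le> sqrt (ln (real d))" using lnd by simp
     then show "0 \<le> ?\<rho>" "?\<rho> * sqrt (ln (real d)) = c1" "?\<rho> \<le> c1" unfolding size1_def using c1
      by (auto simp: divide_le_eq)
    qed
    have "dot d (mat_app d U (simplex_vertex d ?\<rho> j)) g \<le> - (?\<rho> / (2 * real d)) * enorm d g" if j: "j < d" for j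
    proof -
     have "dot d (mat_app d U (simplex_vertex d ?\<rho> j)) g = dot d (\<lambda>k. ?w k + ?\<rho> * ?e j k) g"
      by (rule dot_cong) (auto simp: simplex_vertex_eq mat_app_add mat_app_scale)
     also have "\<dots> = dot d ?w g + ?\<rho> * dot d (?e j) g" by (simp only: dot_add dot_scale)
     also have "\<dots> \<le> -1 + ?\<rho> * (t * sqrt (ln (real d)))"
      using gw nB[OF j] rho(1) by (intro add_mono mult_left_mono) auto
     also have "\<dots> = -1 + (?\<rho> * sqrt (ln (real d))) * t" by simp
     also have "\<dots> = - (1 / 2)" unfolding rho(2) c1(3) by simp
     finally have 1: "dot d (mat_app d U (simplex_vertex d ?\<rho> j)) g \<le> - (1 / 2)" .
     have "?\<rho> / (2 * real d) * enorm d g \<le> c1 / (2 * real d) * (t * real d)"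
      using rho ng d c1(1) by (intro mult_mono divide_right_mono) auto
     also have "\<dots> = c1 * t / 2" using d by simp
     finally have "?\<rho> / (2 * real d) * enorm d g \<le> 1 / 4" unfolding c1(3) by simp
     moreover have "- (?\<rho> / (2 * real d)) * enorm d g = - (?\<rho> / (2 * real d) * enorm d g)" by simp
     ultimately show ?thesis using 1 by linarith
    qed
    then have "g \<in> ?E" by (intro CollectI conjI sp pos allI impI)
    then show False by (rule notE[OF n UnI1])
   qed
  qed
  have sUB: "(\<Union>j\<in>{..<d}. ?B j) \<in> events" by (rule sets.finite_UN[OF finite_lessThan sB])
  have "\<alpha>\<^sub>0 \<le> prob (?E \<union> ((\<Union>j\<in>{..<d}. ?B j) \<union> ?B2))"
   unfolding X[symmetric] by (rule finite_measure_mono[OF sub sets.Un[OF sE sets.Un[OF sUB sB2]]])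
  also have "\<dots> \<le> prob ?E + prob ((\<Union>j\<in>{..<d}. ?B j) \<union> ?B2)"
   by (rule measure_Un_le[OF sE sets.Un[OF sUB sB2]])
  also have "prob ((\<Union>j\<in>{..<d}. ?B j) \<union> ?B2) \<le> prob (\<Union>j\<in>{..<d}. ?B j) + prob ?B2"
   by (rule measure_Un_le[OF sUB sB2])
  finally show "\<alpha>\<^sub>0 / 2 \<le> prob ?E" using P1 P2 by linarith
 qed
qed

text \<open>The reflection in the hyperplane orthogonal to \<open>x - y\<close> is symmetric and
  exchanges \<open>x\<close> and \<open>y\<close>.\<close>

lemma householder:
 assumes eq: "enorm d x = enorm d y" and ne: "\<exists>i<d. x i \<noteq> y i"
 obtains V where "orth d V" "\<And>u. dot d (mat_app d V u) x = dot d u y"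
proof -
 define w where "w i = x i - y i" for i
 define W where "W = dot d w w"
 have "W \<noteq> 0"
 proof
  assume "W = 0"
  then have "enorm d w = 0" using enorm_sq[of d w] by (simp add: W_def)
  then show False using ne enorm_eq_0[of d w] by (auto simp: w_def)
 qed
 define V where "V p = (if fst p = snd p then 1 else 0) - 2 * w (fst p) * w (snd p) / W" for p
 have ww: "(\<Sum>l<d. w l * w l) = W" by (simp add: W_def dot_def)
 have "orth d V"
  unfolding Defs.orthogonal_mat_def
 proof (intro allI impI)
  fix i j assume ij: "i < d" "j < d"
  define K where "K = 4 * w i * w j / (W * W)"
  have "(\<Sum>l<d. V (i, l) * V (j, l)) = (\<Sum>l<d. (if l = i then (if i = j then 1 else 0) else 0) - (if l = j then 2 * w i * w j / W else 0)
    - (if l = i then 2 * w i * w j / W else 0) + K * (w l * w l))"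
   by (intro sum.cong refl) (auto simp: V_def K_def algebra_simps)
  also have "\<dots> = (if i = j then 1 else 0) - 2 * w i * w j / W - 2 * w i * w j / W + K * W"
   using ij by (simp add: sum.distrib sum_subtractf sum_distrib_left[symmetric] ww)
  also have "\<dots> = (if i = j then 1 else 0)" unfolding K_def using \<open>W \<noteq> 0\<close> by simp
  finally show "(\<Sum>l<d. V (i, l) * V (j, l)) = (if i = j then 1 else 0)" .
 qed
 moreover have "dot d (mat_app d V u) x = dot d u y" for u
 proof -
  have m: "mat_app d V u i = u i + (- 2 * dot d w u / W) * w i" if "i < d" for i
  proof -
   define K where "K = - 2 * w i / W"
   have "mat_app d V u i = (\<Sum>l<d. (if l = i then u l else 0) + K * (w l * u l))"
    unfolding mat_app_def by (intro sum.cong refl) (auto simp: V_def K_def algebra_simps)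
   also have "\<dots> = u i + K * dot d w u" using that by (simp add: sum.distrib sum_distrib_left[symmetric] dot_def)
   finally show ?thesis by (simp add: K_def)
  qed
  have "dot d x x = dot d y y" using eq enorm_sq[of d x] enorm_sq[of d y] by simp
  moreover have "W = dot d x x - 2 * dot d x y + dot d y y"
   unfolding W_def dot_def w_def sum_distrib_left sum_subtractf[symmetric] sum.distrib[symmetric]
   by (intro sum.cong refl) (simp add: algebra_simps)
  moreover have "dot d w x = dot d x x - dot d x y"
   unfolding dot_def w_def sum_subtractf[symmetric] by (intro sum.cong refl) (simp add: algebra_simps)
  ultimately have W2: "W = 2 * dot d w x" by simp
  have "dot d (mat_app d V u) x = dot d (\<lambda>i. u i + (- 2 * dot d w u / W) * w i) x"
   by (rule dot_cong) (use m in auto)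
  also have "\<dots> = dot d u x + (- 2 * dot d w u / W) * dot d w x" by (simp only: dot_add dot_scale)
  also have "(- 2 * dot d w u / W) * dot d w x = - dot d w u" using \<open>W \<noteq> 0\<close> unfolding W2 by simp
  also have "dot d u x + - dot d w u = dot d u y"
   unfolding dot_def w_def sum_subtractf[symmetric] diff_conv_add_uminus[symmetric] by (intro sum.cong refl) (simp add: algebra_simps)
  finally show ?thesis .
 qed
 ultimately show ?thesis by (rule that)
qed

text \<open>
 By left invariance the probability below does not depend on \<open>\<theta>\<close>, so \<open>\<theta>\<close> may be replaced by a Gaussian vector.
\<close>

lemma haar_half_spaces:
 assumes H: "haar_orthogonal d H" and \<theta>: "0 < enorm d \<theta>"
  and \<alpha>: "\<And>U. orth d U ==> \<alpha> \<le> measure (gauss {..<d}) {g \<in> space (gauss {..<d}). 0 < enorm d g \<and>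
    (\<forall>j<d. dot d (mat_app d U (v j)) g \<le> - \<kappa> * enorm d g)}"
 shows "ennreal \<alpha> \<le> emeasure H {U \<in> space H. \<forall>j<d. dot d (mat_app d U (v j)) \<theta> \<le> - \<kappa> * enorm d \<theta>}"
proof -
 let ?D = "{..<d} \<times> {..<d}" and ?G = "gauss {..<d}"
 define Q where "Q U g \<longleftrightarrow> (\<forall>j\<in>{..<d}. dot d (mat_app d U (v j)) g \<le> - \<kappa> * enorm d g)" for U g
 have Hs: "prob_space H" "sets H = sets (\<Pi>\<^sub>M p\<in>?D. borel)" "AE U in H. orth d U"
  "\<And>V. orth d V ==> distr H H (mat_mult_ext d V) = H" using H unfolding haar_orthogonal_def by auto
 interpret HP: prob_space H by (rule Hs)
 interpret GP: prob_space ?G by (rule prob_space_gauss)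
 interpret HG: pair_sigma_finite H ?G ..
 have compH: "(\<lambda>U. U p) \<in> borel_measurable H" if "p \<in> ?D" for p
  using measurable_component_singleton[OF that, of "\<lambda>_. borel"] measurable_cong_sets[OF Hs(2) refl] by blast
 have compG: "(\<lambda>g. g i) \<in> borel_measurable ?G" if "i < d" for i
  using measurable_component_singleton[of i "{..<d}" "\<lambda>_. std_normal"] that by simp
 have Qm: "{x \<in> space N. Q (u x) (g x)} \<in> sets N"
  if u: "\<And>p. p \<in> ?D ==> (\<lambda>x. u x p) \<in> borel_measurable N" and g: "\<And>i. i < d ==> (\<lambda>x. g x i) \<in> borel_measurable N"
  for N :: "'c measure" and u g
  unfolding Q_def
 proof (rule sets.sets_Collect_finite_All)
  fix j
  have [measurable]: "(\<lambda>x. dot d (mat_app d (u x) (v j)) (g x)) \<in> borel_measurable N"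
   unfolding dot_def using measurable_mat_app[OF u] g by (intro borel_measurable_sum borel_measurable_times) auto
  have [measurable]: "(\<lambda>x. enorm d (g x)) \<in> borel_measurable N" by (rule measurable_enorm[OF g])
  show "{x \<in> space N. dot d (mat_app d (u x) (v j)) (g x) \<le> - \<kappa> * enorm d (g x)} \<in> sets N" by measurable
 qed simp
 let ?f = "\<lambda>g. emeasure H {U \<in> space H. Q U g}"
 have scale: "Q U (\<lambda>i. r * g i) \<longleftrightarrow> Q U g" if r: "0 < r" for U g r
 proof -
  have "dot d x (\<lambda>i. r * g i) = r * dot d x g" for x
   by (subst dot_commute) (simp only: dot_scale dot_commute[of d g])
  moreover have "r * a \<le> - \<kappa> * (\<bar>r\<bar> * e) \<longleftrightarrow> a \<le> - \<kappa> * e" for a e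
  proof -
   have "- \<kappa> * (\<bar>r\<bar> * e) = r * (- \<kappa> * e)" using r by simp
   then show ?thesis by (simp only: mult_le_cancel_left_pos[OF r])
  qed
  ultimately show ?thesis unfolding Q_def enorm_scale by simp
 qed
 \<comment> \<open>Left multiplication by the reflection turns the condition at \<open>x\<close>
   into the condition at \<open>y\<close>. Together with \<open>scale\<close> the probability is the
   same for all nonzero vectors.\<close>
 have inv: "?f x = ?f y" if eq: "enorm d x = enorm d y" for x y
 proof (cases "\<exists>i<d. x i \<noteq> y i")
  case True
  obtain V where V: "orth d V" "\<And>u. dot d (mat_app d V u) x = dot d u y" using householder[OF eq True] by blast
  have mV: "mat_mult_ext d V \<in> H \<rightarrow>\<^sub>M H"
  proof -
   have "mat_mult_ext d V \<in> H \<rightarrow>\<^sub>M (\<Pi>\<^sub>M p\<in>?D. borel)"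
    unfolding mat_mult_ext_def
   proof (rule measurable_restrict)
    fix p assume p: "p \<in> ?D"
    obtain i k where "p = (i, k)" "i < d" "k < d" using p by auto
    then show "(\<lambda>U. case p of (i, k) => \<Sum>l<d. V (i, l) * U (l, k)) \<in> borel_measurable H"
     using compH by (auto intro!: borel_measurable_sum borel_measurable_times)
   qed
   then show ?thesis using measurable_cong_sets[OF refl Hs(2)] by blast
  qed
  have app: "mat_app d (mat_mult_ext d V U) u i = mat_app d V (mat_app d U u) i" if "i < d" for U u i
  proof -
   have "mat_app d (mat_mult_ext d V U) u i = (\<Sum>k<d. \<Sum>l<d. V (i, l) * U (l, k) * u k)"
    unfolding mat_app_def using that by (intro sum.cong refl) (simp add: mat_mult_ext_def sum_distrib_right)
   also have "\<dots> = (\<Sum>l<d. \<Sum>k<d. V (i, l) * U (l, k) * u k)" by (rule sum.swap)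
   finally show ?thesis unfolding mat_app_def by (simp add: sum_distrib_left mult.assoc)
  qed
  have QV: "Q (mat_mult_ext d V U) x \<longleftrightarrow> Q U y" for U
  proof -
   have "dot d (mat_app d (mat_mult_ext d V U) u) x = dot d (mat_app d U u) y" for u
    unfolding V(2)[symmetric] by (rule dot_cong) (use app in auto)
   then show ?thesis unfolding Q_def eq by simp
  qed
  have "?f x = emeasure (distr H H (mat_mult_ext d V)) {U \<in> space H. Q U x}" unfolding Hs(4)[OF V(1)] ..
  also have "\<dots> = emeasure H (mat_mult_ext d V -` {U \<in> space H. Q U x} \<inter> space H)"
   by (rule emeasure_distr[OF mV]) (use Qm[of "\<lambda>U. U" H "\<lambda>_. x"] compH in simp)
  also have "mat_mult_ext d V -` {U \<in> space H. Q U x} \<inter> space H = {U \<in> space H. Q U y}"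
   using measurable_space[OF mV] QV by auto
  finally show ?thesis .
 next
  case False
  then have "dot d u x = dot d u y" for u by (intro dot_cong) auto
  then show ?thesis unfolding Q_def eq by simp
 qed
 have const: "?f g = ?f \<theta>" if g: "0 < enorm d g" for g
 proof -
  let ?r = "enorm d g / enorm d \<theta>"
  have r: "0 < ?r" using g \<theta> by simp
  have "?f g = ?f (\<lambda>i. ?r * \<theta> i)" by (rule inv, unfold enorm_scale) (use \<theta> g in simp)
  then show ?thesis unfolding scale[OF r] .
 qed
 let ?S = "{x \<in> space (H \<Otimes>\<^sub>M ?G). 0 < enorm d (snd x) \<and> Q (fst x) (snd x)}"
 have S: "?S \<in> sets (H \<Otimes>\<^sub>M ?G)"
 proof (rule sets.sets_Collect_conj)
  have c2: "(\<lambda>x. snd x i) \<in> borel_measurable (H \<Otimes>\<^sub>M ?G)" if "i < d" for i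
   by (rule measurable_compose[OF measurable_snd compG[OF that]])
  have c1: "(\<lambda>x. fst x p) \<in> borel_measurable (H \<Otimes>\<^sub>M ?G)" if "p \<in> ?D" for p
   by (rule measurable_compose[OF measurable_fst compH[OF that]])
  have [measurable]: "(\<lambda>x. enorm d (snd x)) \<in> borel_measurable (H \<Otimes>\<^sub>M ?G)" by (rule measurable_enorm[OF c2])
  show "{x \<in> space (H \<Otimes>\<^sub>M ?G). 0 < enorm d (snd x)} \<in> sets (H \<Otimes>\<^sub>M ?G)" by measurable
  show "{x \<in> space (H \<Otimes>\<^sub>M ?G). Q (fst x) (snd x)} \<in> sets (H \<Otimes>\<^sub>M ?G)" by (rule Qm[OF c1 c2])
 qed
 have "ennreal \<alpha> = (\<integral>\<^sup>+U. ennreal \<alpha> \<partial>H)" by (simp add: HP.emeasure_space_1)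
 also have "\<dots> \<le> (\<integral>\<^sup>+U. \<integral>\<^sup>+g. indicator ?S (U, g) \<partial>?G \<partial>H)"
 proof (rule nn_integral_mono_AE)
  show "AE U in H. ennreal \<alpha> \<le> (\<integral>\<^sup>+g. indicator ?S (U, g) \<partial>?G)"
   using Hs(3) AE_space
  proof eventually_elim
   case (elim U)
   let ?A = "{g \<in> space ?G. 0 < enorm d g \<and> Q U g}"
   have A: "?A \<in> sets ?G"
   proof (rule sets.sets_Collect_conj)
    have [measurable]: "(\<lambda>g. enorm d g) \<in> borel_measurable ?G" by (rule measurable_enorm[OF compG])
    show "{g \<in> space ?G. 0 < enorm d g} \<in> sets ?G" by measurable
    show "{g \<in> space ?G. Q U g} \<in> sets ?G" by (rule Qm[of "\<lambda>_. U" ?G "\<lambda>g. g"]) (use compG in auto)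
   qed
   have "\<alpha> \<le> measure ?G ?A" using \<alpha>[OF elim(1)] unfolding Q_def Ball_def lessThan_iff .
   then have "ennreal \<alpha> \<le> emeasure ?G ?A" unfolding GP.emeasure_eq_measure by (rule ennreal_leI)
   also have "\<dots> = (\<integral>\<^sup>+g. indicator ?A g \<partial>?G)" by (rule nn_integral_indicator[OF A, symmetric])
   also have "\<dots> = (\<integral>\<^sup>+g. indicator ?S (U, g) \<partial>?G)"
    by (rule nn_integral_cong) (use elim(2) in \<open>auto simp: space_pair_measure indicator_def\<close>)
   finally show ?case .
  qed
 qed
 also have "\<dots> = (\<integral>\<^sup>+g. \<integral>\<^sup>+U. indicator ?S (U, g) \<partial>H \<partial>?G)"
  by (rule HG.Fubini[OF borel_measurable_indicator[OF S], symmetric])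
 also have "\<dots> \<le> (\<integral>\<^sup>+g. ?f \<theta> \<partial>?G)"
 proof (rule nn_integral_mono)
  fix g assume "g \<in> space ?G"
  show "(\<integral>\<^sup>+U. indicator ?S (U, g) \<partial>H) \<le> ?f \<theta>"
  proof (cases "0 < enorm d g")
   case True
   have "(\<integral>\<^sup>+U. indicator ?S (U, g) \<partial>H) \<le> (\<integral>\<^sup>+U. indicator {U \<in> space H. Q U g} U \<partial>H)"
    by (rule nn_integral_mono) (auto simp: space_pair_measure indicator_def)
   also have "\<dots> = ?f g" by (rule nn_integral_indicator) (rule Qm[of "\<lambda>U. U" H "\<lambda>_. g"], use compH in auto)
   finally show ?thesis using const[OF True] by simp
  next
   case False
   then have "(\<integral>\<^sup>+U. indicator ?S (U, g) \<partial>H) = (\<integral>\<^sup>+U. 0 \<partial>H)" by (intro nn_integral_cong) (auto simp: indicator_def)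
   then show ?thesis by simp
  qed
 qed
 also have "\<dots> = ?f \<theta>" by (simp add: GP.emeasure_space_1)
 finally show ?thesis unfolding Q_def Ball_def lessThan_iff .
qed

text \<open>The bound has to be uniform in \<open>d\<close>. Up to a fixed threshold a box of small
  entries has probability bounded below; beyond it \<open>ln (real d) \<ge> 64\<close>, so the tail
  \<open>exp (- (real d * ln (real d) / 16))\<close> outweighs the factor
  \<open>real d * sqrt 2 ^ d\<close>.\<close>

lemma gauss_small_rows:
 obtains p :: real where "0 < p"
  "\<And>d. 3 < d ==> p \<le> measure (gauss ({..<d} \<times> {..<d})) {G \<in> space (gauss ({..<d} \<times> {..<d})).
    \<forall>j<d. enorm d (\<lambda>k. G (j, k)) \<le> sqrt (real d * ln (real d)) / 2}"
proof -
 define q where "q = measure std_normal {-1/2..1/2::real}"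
 have q0: "0 < q" unfolding q_def by (rule std_normal_interval_pos) simp
 have q1: "q \<le> 1" unfolding q_def by (rule prob_space.prob_le_1[OF prob_space_std_normal])
 define d0 where "d0 = nat \<lceil>exp (64::real)\<rceil>"
 show ?thesis
 proof (rule that[of "min (1 / 2) (q ^ (d0 * d0))"])
  show "0 < min (1 / 2) (q ^ (d0 * d0))" using q0 by simp
  fix d :: nat assume d: "3 < d"
  let ?D = "{..<d} \<times> {..<d}"
  interpret prob_space "gauss ?D" by (rule prob_space_gauss)
  let ?A = "{G \<in> space (gauss ?D). \<forall>j<d. enorm d (\<lambda>k. G (j, k)) \<le> sqrt (real d * ln (real d)) / 2}"
  have lnd: "1 \<le> ln (real d)"
  proof -
   have "exp 1 \<le> real d" using d by (intro order_trans[OF exp_le]) auto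
   then show ?thesis using d by (subst ln_ge_iff) auto
  qed
  have mr: "(\<lambda>G. enorm d (\<lambda>k. G (j, k))) \<in> borel_measurable (gauss ?D)" if "j < d" for j
   by (rule measurable_enorm) (use measurable_component_singleton[of "(j, _)" ?D "\<lambda>_. std_normal"] that in simp)
  have A: "?A \<in> events"
  proof -
   have "{G \<in> space (gauss ?D). \<forall>j\<in>{..<d}. enorm d (\<lambda>k. G (j, k)) \<le> sqrt (real d * ln (real d)) / 2} \<in> events"
   proof (rule sets.sets_Collect_finite_All)
    fix j assume "j \<in> {..<d}"
    then have [measurable]: "(\<lambda>G. enorm d (\<lambda>k. G (j, k))) \<in> borel_measurable (gauss ?D)" using mr by simp
    show "{G \<in> space (gauss ?D). enorm d (\<lambda>k. G (j, k)) \<le> sqrt (real d * ln (real d)) / 2} \<in> events" by measurable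
   qed simp
   then show ?thesis unfolding Ball_def lessThan_iff .
  qed
  show "min (1 / 2) (q ^ (d0 * d0)) \<le> prob ?A"
  proof (cases "d \<le> d0")
   case True
   interpret S: product_sigma_finite "\<lambda>_::nat \<times> nat. std_normal"
    by (intro product_sigma_finite.intro prob_space_imp_sigma_finite prob_space_std_normal)
   let ?Bx = "Pi\<^sub>E ?D (\<lambda>_. {-1/2..1/2::real})"
   have "emeasure (gauss ?D) ?Bx = (\<Prod>p\<in>?D. emeasure std_normal {-1/2..1/2})"
    by (rule S.emeasure_PiM) auto
   also have "emeasure std_normal {-1/2..1/2} = ennreal q"
    unfolding q_def by (rule finite_measure.emeasure_eq_measure) (rule prob_space.finite_measure[OF prob_space_std_normal])
   finally have "ennreal (prob ?Bx) = ennreal (q ^ (d * d))"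
    using q0 unfolding emeasure_eq_measure by (simp add: prod_constant card_cartesian_product ennreal_power)
   then have "prob ?Bx = q ^ (d * d)" using q0 by simp
   moreover have "prob ?Bx \<le> prob ?A"
   proof (rule finite_measure_mono[OF _ A], rule subsetI)
    fix G assume G: "G \<in> ?Bx"
    have "enorm d (\<lambda>k. G (j, k)) \<le> sqrt (real d * ln (real d)) / 2" if j: "j < d" for j
    proof (rule power2_le_imp_le)
     have "(enorm d (\<lambda>k. G (j, k)))\<^sup>2 = (\<Sum>k<d. (G (j, k))\<^sup>2)" unfolding enorm_sq dot_def by (simp add: power2_eq_square)
     also have "\<dots> \<le> (\<Sum>k<d. 1 / 4)"
     proof (rule sum_mono)
      fix k assume "k \<in> {..<d}"
      then have "G (j, k) \<in> {-1/2..1/2}" using G j by (auto simp: PiE_iff)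
      then have "\<bar>G (j, k)\<bar> \<le> 1 / 2" by auto
      then have "(\<bar>G (j, k)\<bar>)\<^sup>2 \<le> (1 / 2)\<^sup>2" by (intro power_mono) auto
      then show "(G (j, k))\<^sup>2 \<le> 1 / 4" by (simp add: power2_eq_square)
     qed
     also have "\<dots> \<le> real d * ln (real d) / 4" using mult_left_mono[OF lnd, of "real d"] by simp
     also have "\<dots> = (sqrt (real d * ln (real d)) / 2)\<^sup>2" using lnd by (simp add: power_divide)
     finally show "(enorm d (\<lambda>k. G (j, k)))\<^sup>2 \<le> (sqrt (real d * ln (real d)) / 2)\<^sup>2" .
    qed (use lnd in simp)
    then show "G \<in> ?A" using G by (auto simp: space_PiM PiE_iff)
   qed
   moreover have "q ^ (d0 * d0) \<le> q ^ (d * d)" using True q0 q1 by (intro power_decreasing mult_le_mono) auto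
   ultimately show ?thesis by simp
  next
   case False
   have "exp 64 \<le> real d" using False unfolding d0_def by linarith
   then have l64: "64 \<le> ln (real d)" using d by (subst ln_ge_iff) auto
   let ?L = "sqrt (real d * ln (real d)) / 2"
   let ?C = "{G \<in> space (gauss ?D). \<exists>j<d. ?L < enorm d (\<lambda>k. G (j, k))}"
   have L2: "- ?L\<^sup>2 / 4 = - (real d * ln (real d) / 16)" using lnd by (simp add: power_divide)
   have "emeasure (gauss ?D) ?C \<le> ennreal (real d * sqrt 2 ^ d * exp (- ?L\<^sup>2 / 4))"
    by (rule gauss_row_tail) (use lnd in auto)
   then have "prob ?C \<le> real d * sqrt 2 ^ d * exp (- ?L\<^sup>2 / 4)" unfolding emeasure_eq_measure by simp
   also have "\<dots> \<le> exp (real d) * exp 1 ^ d * exp (- (real d * 4))"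
    unfolding L2
   proof (intro mult_mono power_mono)
    show "real d \<le> exp (real d)" using exp_ge_add_one_self[of "real d"] by linarith
    show "sqrt 2 \<le> exp (1::real)" using sqrt2_less_2 exp_ge_add_one_self[of "1::real"] by linarith
    have "real d * 64 \<le> real d * ln (real d)" using l64 by (intro mult_left_mono) auto
    then show "exp (- (real d * ln (real d) / 16)) \<le> exp (- (real d * 4))" by simp
   qed auto
   also have "\<dots> = exp (- (2 * real d))" by (simp add: exp_of_nat_mult[symmetric] exp_add[symmetric])
   also have "\<dots> = 1 / exp (2 * real d)" by (simp add: exp_minus inverse_eq_divide)
   also have "2 \<le> exp (2 * real d)" using exp_ge_add_one_self[of "2 * real d"] d by linarith
   then have "1 / exp (2 * real d) \<le> 1 / 2" by (intro divide_left_mono) auto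
   finally have pC: "prob ?C \<le> 1 / 2" .
   have "?A = space (gauss ?D) - ?C" by (auto simp: not_less)
   then have "?C = space (gauss ?D) - ?A" by auto
   then have "prob ?C = 1 - prob ?A" using prob_compl[OF A] by simp
   then show ?thesis using pC by simp
  qed
 qed
qed

text \<open>With probability at least \<open>min \<alpha> 1\<close> the rotation puts the simplex
  behind infinitely many \<open>y m\<close>, and independently the noise is too small to undo this.
  \<open>E\<close> is a measurable certificate inside the event of success.\<close>

lemma correct_attempt_probability:
 obtains c1 p :: real where "0 < c1" "c1 \<le> 1" "0 < p"
  "\<And>n d H z a. 3 < d ==> d < n ==> haar_orthogonal d H ==>
    (\<And>I v. I \<subseteq> {..<n} ==> card I = d - 1 ==> \<not> (\<forall>l<d. z l = comb a I v l)) ==>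
    \<exists>E\<in>sets (H \<Otimes>\<^sub>M gauss ({..<d} \<times> {..<d})). (\<forall>w\<in>E. attempt_correct c1 n d z a w) \<and>
     ennreal p \<le> emeasure (H \<Otimes>\<^sub>M gauss ({..<d} \<times> {..<d})) E"
proof -
 obtain c1 \<alpha> :: real where c1: "0 < c1" "c1 \<le> 1" and \<alpha>: "0 < \<alpha>"
  "\<And>d U. 3 < d ==> orth d U ==> \<alpha> \<le> measure (gauss {..<d}) {g \<in> space (gauss {..<d}). 0 < enorm d g \<and>
    (\<forall>j<d. dot d (mat_app d U (simplex_vertex d (size1 c1 d) j)) g \<le> - (size1 c1 d / (2 * real d)) * enorm d g)}"
  by (rule gauss_simplex_behind) blast
 obtain p where p: "0 < p"
  "\<And>d. 3 < d ==> p \<le> measure (gauss ({..<d} \<times> {..<d})) {G \<in> space (gauss ({..<d} \<times> {..<d})).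
    \<forall>j<d. enorm d (\<lambda>k. G (j, k)) \<le> sqrt (real d * ln (real d)) / 2}"
  by (rule gauss_small_rows) blast
 show ?thesis
 proof (rule that[of c1 "min \<alpha> 1 * p"])
  show "0 < c1" "c1 \<le> 1" "0 < min \<alpha> 1 * p" using c1 \<alpha> p by auto
  fix n d :: nat and H z a assume d: "3 < d" and dn: "d < n" and H: "haar_orthogonal d H"
   and gz: "\<And>I v. I \<subseteq> {..<n} ==> card I = d - 1 ==> \<not> (\<forall>l<d. z l = comb a I v l)"
  let ?D = "{..<d} \<times> {..<d}" and ?\<rho> = "size1 c1 d" and ?sg = "sdev1 c1 n d"
  have Hs: "prob_space H" "sets H = sets (\<Pi>\<^sub>M p\<in>?D. borel)" "AE U in H. orth d U"
   using H unfolding haar_orthogonal_def by auto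
  interpret HP: prob_space H by (rule Hs)
  interpret GD: prob_space "gauss ?D" by (rule prob_space_gauss)
  have compH: "(\<lambda>U. U p) \<in> borel_measurable H" if "p \<in> ?D" for p
   using measurable_component_singleton[OF that, of "\<lambda>_. borel"] measurable_cong_sets[OF Hs(2) refl] by blast
  have lnd: "1 \<le> ln (real d)"
  proof -
   have "exp 1 \<le> real d" using d by (intro order_trans[OF exp_le]) auto
   then show ?thesis using d by (subst ln_ge_iff) auto
  qed
  have rho: "0 < ?\<rho>" "?\<rho> \<le> 1"
  proof -
   have s1: "1 \<le> sqrt (ln (real d))" using lnd by simp
   show "0 < ?\<rho>" unfolding size1_def using c1 s1 by (intro divide_pos_pos) auto
   have "c1 / sqrt (ln (real d)) \<le> 1 / 1" using c1 s1 by (intro frac_le) auto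
   then show "?\<rho> \<le> 1" unfolding size1_def by simp
  qed
  have sg0: "0 \<le> ?sg" unfolding sdev1_def using c1 lnd dn by (simp add: divide_nonneg_nonneg)
  let ?F = "{x. \<forall>i<n. dot d (a i) x \<le> 1}"
  have "?F \<noteq> {}" by (rule ex_in_conv[THEN iffD1], rule exI[of _ "\<lambda>_. 0"]) (simp add: dot_def)
  from maximizing_sequence[OF this, of "dot d z"] obtain y :: rows where y: "\<forall>m. y m \<in> ?F"
   "\<forall>x\<in>?F. \<forall>\<epsilon>>0. \<exists>m0. \<forall>m\<ge>m0. dot d z x - \<epsilon> \<le> dot d z (y m)" by blast
  define C where "C m = {U \<in> space H. \<forall>j<d. dot d (mat_app d U (simplex_vertex d ?\<rho> j)) (y m) \<le> - (?\<rho> / (2 * real d)) * enorm d (y m)}" for m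
  have Cm: "C m \<in> sets H" for m
  proof -
   have "{U \<in> space H. \<forall>j\<in>{..<d}. dot d (mat_app d U (simplex_vertex d ?\<rho> j)) (y m) \<le> - (?\<rho> / (2 * real d)) * enorm d (y m)} \<in> sets H"
   proof (rule sets.sets_Collect_finite_All)
    fix j
    have [measurable]: "(\<lambda>U. dot d (mat_app d U (simplex_vertex d ?\<rho> j)) (y m)) \<in> borel_measurable H"
     unfolding dot_def using measurable_mat_app[OF compH] by (intro borel_measurable_sum borel_measurable_times) auto
    show "{U \<in> space H. dot d (mat_app d U (simplex_vertex d ?\<rho> j)) (y m) \<le> - (?\<rho> / (2 * real d)) * enorm d (y m)} \<in> sets H"
     by measurable
   qed simp
   then show ?thesis unfolding C_def Ball_def lessThan_iff .
  qed
  \<comment> \<open>If \<open>y m\<close> has norm 0 the condition is void and the event has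
    probability 1, hence the minimum with 1.\<close>
  have C\<alpha>: "ennreal (min \<alpha> 1) \<le> emeasure H (C m)" for m
  proof (cases "0 < enorm d (y m)")
   case True
   have "ennreal (min \<alpha> 1) \<le> ennreal \<alpha>" by (rule ennreal_leI) simp
   also have "\<dots> \<le> emeasure H (C m)" unfolding C_def by (rule haar_half_spaces[OF H True \<alpha>(2)[OF d]])
   finally show ?thesis .
  next
   case False
   then have e: "enorm d (y m) = 0" using enorm_nonneg[of d "y m"] by linarith
   have "dot d x (y m) = 0" for x using abs_dot_le[of d x "y m"] e by simp
   then have "C m = space H" unfolding C_def e by simp
   moreover have "ennreal (min \<alpha> 1) \<le> ennreal 1" by (rule ennreal_leI) simp
   ultimately show ?thesis by (simp add: HP.emeasure_space_1)
  qed
  \<comment> \<open>The limit superior of the events \<open>C m\<close>: a single rotation has to be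
    good for infinitely many \<open>m\<close>. Continuity from above preserves the common lower
    bound of the probabilities.\<close>
  define CI where "CI = (\<Inter>k. \<Union>m\<in>{k..}. C m)"
  have tail: "(\<Union>m\<in>{k..}. C m) \<in> sets H" for k using Cm by (intro sets.countable_UN'') auto
  have CI\<alpha>: "ennreal (min \<alpha> 1) \<le> emeasure H CI"
  proof -
   have "emeasure H CI = (INF k. emeasure H (\<Union>m\<in>{k..}. C m))"
    unfolding CI_def
   proof (rule INF_emeasure_decseq[symmetric])
    show "decseq (\<lambda>k. \<Union>m\<in>{k..}. C m)" unfolding decseq_def by (intro allI impI UN_mono) auto
   qed (use tail in \<open>auto simp: HP.emeasure_eq_measure\<close>)
   moreover have "ennreal (min \<alpha> 1) \<le> emeasure H (\<Union>m\<in>{k..}. C m)" for k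
    using C\<alpha>[of k] by (rule order_trans) (rule emeasure_mono[OF _ tail], auto)
   ultimately show ?thesis by (simp add: le_INF_iff)
  qed
  have CIm: "CI \<in> sets H" unfolding CI_def by (rule sets.countable_INT) (use tail in auto)
  let ?O = "{U \<in> space H. orth d U}"
  have Om: "?O \<in> sets H" by (rule sets_orth[OF compH])
  let ?A = "{G \<in> space (gauss ?D). \<forall>j<d. enorm d (\<lambda>k. G (j, k)) \<le> sqrt (real d * ln (real d)) / 2}"
  \<comment> \<open>A set outside the sigma-algebra would have \<open>measure\<close> 0, against the
    lower bound \<open>p\<close>.\<close>
  have Am: "?A \<in> sets (gauss ?D)"
  proof (rule ccontr)
   assume "?A \<notin> sets (gauss ?D)"
   then have "measure (gauss ?D) ?A = 0" by (rule measure_notin_sets)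
   then show False using p(1) p(2)[OF d] by linarith
  qed
  have CIO: "emeasure H (CI \<inter> ?O) = emeasure H CI"
   by (rule emeasure_eq_AE) (use Hs(3) CIm Om in \<open>auto elim!: eventually_mono intro: sets.Int simp: AE_iff_null_sets\<close>)
  let ?E = "(CI \<inter> ?O) \<times> ?A"
  show "\<exists>E\<in>sets (H \<Otimes>\<^sub>M gauss ?D). (\<forall>w\<in>E. attempt_correct c1 n d z a w) \<and> ennreal (min \<alpha> 1 * p) \<le> emeasure (H \<Otimes>\<^sub>M gauss ?D) E"
  proof (intro bexI[of _ ?E] conjI ballI)
   show "?E \<in> sets (H \<Otimes>\<^sub>M gauss ?D)" by (intro pair_measureI sets.Int CIm Om Am)
   have "ennreal (min \<alpha> 1 * p) = ennreal (min \<alpha> 1) * ennreal p" using \<alpha> p by (intro ennreal_mult) auto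
   also have "\<dots> \<le> emeasure H (CI \<inter> ?O) * emeasure (gauss ?D) ?A"
    unfolding CIO GD.emeasure_eq_measure by (intro mult_mono CI\<alpha> ennreal_leI p(2)[OF d]) auto
   also have "\<dots> = emeasure (H \<Otimes>\<^sub>M gauss ?D) ?E" by (rule GD.emeasure_pair_measure_Times[symmetric]) (intro sets.Int CIm Om, rule Am)
   finally show "ennreal (min \<alpha> 1 * p) \<le> emeasure (H \<Otimes>\<^sub>M gauss ?D) ?E" .
   fix w assume w: "w \<in> ?E"
   obtain U G where wUG: "w = (U, G)" by (cases w)
   have U: "orth d U" "U \<in> CI" and G: "\<And>j. j < d ==> enorm d (\<lambda>k. G (j, k)) \<le> sqrt (real d * ln (real d)) / 2"
    using w unfolding wUG by blast+
   have sgG: "enorm d (\<lambda>k. ?sg * G (j, k)) \<le> ?\<rho> / (2 * real d)" if j: "j < d" for j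
   proof -
    have "enorm d (\<lambda>k. ?sg * G (j, k)) = ?sg * enorm d (\<lambda>k. G (j, k))" unfolding enorm_scale using sg0 by simp
    \<comment> \<open>The second bound in \<open>sdev1\<close> is matched to the row bound
      \<open>sqrt (real d * ln (real d)) / 2\<close>, so that the noise has at most the norm allowed
      in \<open>simplex_pert\<close>.\<close>
    also have "\<dots> \<le> c1 / (real d powr (3/2) * ln (real d)) * (sqrt (real d * ln (real d)) / 2)"
     using G[OF j] sg0 c1 lnd by (intro mult_mono) (auto simp: sdev1_def)
    also have "\<dots> = ?\<rho> / (2 * real d)"
    proof -
     have p32: "real d powr (3/2) = real d * sqrt (real d)"
      using d by (simp add: powr_half_sqrt[symmetric] powr_add[symmetric] powr_mult_base)
     define r where "r = sqrt (real d)"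
     define l where "l = sqrt (ln (real d))"
     have "0 < r" "0 < l" "ln (real d) = l * l" unfolding r_def l_def using lnd d by auto
     then show ?thesis unfolding p32 size1_def real_sqrt_mult r_def[symmetric] l_def[symmetric] by simp
    qed
    finally show ?thesis .
   qed
   show "attempt_correct c1 n d z a w"
    unfolding wUG
   proof (rule attempt_correctI[OF dn _ gz])
    show "0 < d" using d by simp
    show "added_ok c1 n d a (U, G)" by (rule added_okI) (use d rho U sgG in auto)
    show "dot d (a i) (y m) \<le> 1" if "i < n" for m i using spec[OF y(1), of m] that by blast
    show "\<exists>m0. \<forall>m\<ge>m0. dot d z x - \<epsilon> \<le> dot d z (y m)" if "\<And>i. i < n ==> dot d (a i) x \<le> 1" "0 < \<epsilon>" for x \<epsilon>
     using bspec[OF y(2), of x] that by blast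
    show "\<exists>m\<ge>m0. \<forall>j<d. dot d (new_constraint c1 n d a U G j) (y m) \<le> 0" for m0
    proof -
     obtain m where m: "m \<ge> m0" "U \<in> C m" using U(2) unfolding CI_def by blast
     have "dot d (new_constraint c1 n d a U G j) (y m) \<le> 0" if j: "j < d" for j
     proof -
      let ?v = "mat_app d U (simplex_vertex d ?\<rho> j)" and ?e = "\<lambda>k. ?sg * G (j, k)"
      have "dot d (new_constraint c1 n d a U G j) (y m) = dot d (\<lambda>k. 2 * mag n d a * (?v k + ?e k)) (y m)"
       by (rule dot_cong) (auto simp: new_constraint_def)
      also have "\<dots> = 2 * mag n d a * (dot d ?v (y m) + dot d ?e (y m))" by (simp only: dot_scale dot_add)
      finally have eq: "dot d (new_constraint c1 n d a U G j) (y m) = 2 * mag n d a * (dot d ?v (y m) + dot d ?e (y m))" .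
      have "dot d ?v (y m) \<le> - (?\<rho> / (2 * real d)) * enorm d (y m)" using m(2) j unfolding C_def by blast
      moreover have "dot d ?e (y m) \<le> enorm d ?e * enorm d (y m)" using abs_dot_le[of d ?e "y m"] by linarith
      moreover have "enorm d ?e * enorm d (y m) \<le> ?\<rho> / (2 * real d) * enorm d (y m)"
       by (intro mult_right_mono sgG[OF j]) simp
      ultimately have "dot d ?v (y m) + dot d ?e (y m) \<le> 0" by linarith
      then show ?thesis unfolding eq by (intro mult_nonneg_nonpos) (auto simp: mag_def)
     qed
     then show ?thesis using m(1) by blast
    qed
   qed
  qed
 qed
qed

section \<open>Repeated attempts and the final bound\<close>

text \<open>No measurability is needed here: the upper integral of the left-hand side is a supremum of simple functions below \<open>f\<close>.\<close>

lemma nn_integral_pair_le: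
 assumes "sigma_finite_measure B"
 shows "(\<integral>\<^sup>+x. f x \<partial>(A \<Otimes>\<^sub>M B)) \<le> (\<integral>\<^sup>+a. \<integral>\<^sup>+b. f (a, b) \<partial>B \<partial>A)"
proof -
 interpret sigma_finite_measure B by fact
 show ?thesis
  unfolding nn_integral_def[of "A \<Otimes>\<^sub>M B"]
 proof (rule SUP_least)
  fix g assume "g \<in> {g. simple_function (A \<Otimes>\<^sub>M B) g \<and> g \<le> f}"
  then have g: "simple_function (A \<Otimes>\<^sub>M B) g" "\<And>x. g x \<le> f x" by (auto simp: le_fun_def)
  have "integral\<^sup>S (A \<Otimes>\<^sub>M B) g = (\<integral>\<^sup>+x. g x \<partial>(A \<Otimes>\<^sub>M B))" by (rule nn_integral_eq_simple_integral[OF g(1), symmetric])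
  also have "\<dots> = (\<integral>\<^sup>+a. \<integral>\<^sup>+b. g (a, b) \<partial>B \<partial>A)"
   by (rule nn_integral_fst[symmetric]) (rule borel_measurable_simple_function[OF g(1)])
  also have "\<dots> \<le> (\<integral>\<^sup>+a. \<integral>\<^sup>+b. f (a, b) \<partial>B \<partial>A)" by (intro nn_integral_mono g(2))
  finally show "integral\<^sup>S (A \<Otimes>\<^sub>M B) g \<le> (\<integral>\<^sup>+a. \<integral>\<^sup>+b. f (a, b) \<partial>B \<partial>A)" .
 qed
qed

text \<open>Round \<open>m\<close> is independent of the misses before it, which have probability
  \<open>r ^ m\<close> with \<open>r \<le> 1 - p\<close>; the geometric series gives
  \<open>1 / p\<close>.\<close>

lemma nn_integral_until_success:
 assumes N: "prob_space N" and E: "E \<in> sets N" and p: "0 < p" "ennreal p \<le> emeasure N E"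
  and X: "X \<in> borel_measurable N"
 shows "(\<integral>\<^sup>+\<omega>. (\<Sum>m. (\<Prod>j<m. indicator (space N - E) (\<omega> j)) * X (\<omega> m)) \<partial>(\<Pi>\<^sub>M m\<in>(UNIV :: nat set). N))
  \<le> ennreal (1 / p) * (\<integral>\<^sup>+w. X w \<partial>N)"
proof -
 interpret N: prob_space N by fact
 interpret P: product_prob_space "\<lambda>_::nat. N" UNIV ..
 let ?\<Omega> = "\<Pi>\<^sub>M m\<in>(UNIV :: nat set). N"
 define r where "r = measure N (space N - E)"
 have r: "0 \<le> r" "r \<le> 1 - p"
 proof -
  have "p \<le> measure N E" using p unfolding N.emeasure_eq_measure by simp
  then show "r \<le> 1 - p" unfolding r_def using N.prob_compl[OF E] by simp
 qed (simp add: r_def)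
 have comp: "(\<lambda>\<omega>. h (\<omega> m)) \<in> borel_measurable ?\<Omega>" if "h \<in> borel_measurable N" for h :: "'a => ennreal" and m
  by (rule measurable_compose[OF measurable_component_singleton[of m UNIV "\<lambda>_. N"] that]) simp
 have ind: "(indicator (space N - E) :: 'a => ennreal) \<in> borel_measurable N" using E by (intro borel_measurable_indicator) auto
 have each: "(\<integral>\<^sup>+\<omega>. (\<Prod>j<m. indicator (space N - E) (\<omega> j)) * X (\<omega> m) \<partial>?\<Omega>) = ennreal (r ^ m) * (\<integral>\<^sup>+w. X w \<partial>N)" for m
 proof -
  define f where "f i = (if i < m then indicator (space N - E) else X)" for i
  have f: "f i \<in> borel_measurable N" for i unfolding f_def using ind X by simp
  have pr: "(\<Prod>i\<in>{..m}. h i) = (\<Prod>i<m. h i) * h m" for h :: "nat => ennreal" by (simp add: lessThan_Suc_atMost[symmetric])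
  have "(\<integral>\<^sup>+\<omega>. (\<Prod>j<m. indicator (space N - E) (\<omega> j)) * X (\<omega> m) \<partial>?\<Omega>) = (\<integral>\<^sup>+\<omega>. (\<Prod>i\<in>{..m}. f i (restrict \<omega> {..m} i)) \<partial>?\<Omega>)"
   unfolding pr by (simp add: f_def)
  also have "\<dots> = (\<integral>\<^sup>+x. (\<Prod>i\<in>{..m}. f i (x i)) \<partial>distr ?\<Omega> (\<Pi>\<^sub>M i\<in>{..m}. N) (\<lambda>x. restrict x {..m}))"
  proof (rule nn_integral_distr[symmetric])
   show "(\<lambda>x. restrict x {..m}) \<in> ?\<Omega> \<rightarrow>\<^sub>M (\<Pi>\<^sub>M i\<in>{..m}. N)" by (rule measurable_restrict_subset) simp
   show "(\<lambda>x. \<Prod>i\<in>{..m}. f i (x i)) \<in> borel_measurable (distr ?\<Omega> (\<Pi>\<^sub>M i\<in>{..m}. N) (\<lambda>x. restrict x {..m}))"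
    unfolding measurable_distr_eq1
    by (rule borel_measurable_prod_ennreal) (rule measurable_compose[OF measurable_component_singleton[of _ "{..m}" "\<lambda>_. N"] f], simp)
  qed
  also have "\<dots> = (\<integral>\<^sup>+x. (\<Prod>i\<in>{..m}. f i (x i)) \<partial>(\<Pi>\<^sub>M i\<in>{..m}. N))"
   by (subst P.distr_PiM_restrict_finite) auto
  also have "\<dots> = (\<Prod>i\<in>{..m}. integral\<^sup>N N (f i))" by (rule P.product_nn_integral_prod) (use f in auto)
  also have "\<dots> = emeasure N (space N - E) ^ m * integral\<^sup>N N X"
   unfolding pr using E by (simp add: f_def nn_integral_indicator sets.compl_sets)
  also have "emeasure N (space N - E) ^ m = ennreal (r ^ m)"
   unfolding N.emeasure_eq_measure r_def[symmetric] by (rule ennreal_power[OF r(1)])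
  finally show ?thesis .
 qed
 have geo: "(\<Sum>m. ennreal (r ^ m)) \<le> ennreal (1 / p)"
 proof -
  have r1: "norm r < 1" using r p by simp
  have "(\<Sum>m. ennreal (r ^ m)) = ennreal (1 / (1 - r))"
   by (rule suminf_ennreal_eq[OF _ geometric_sums[OF r1]]) (use r in simp)
  also have "\<dots> \<le> ennreal (1 / p)" using r p by (intro ennreal_leI divide_left_mono) auto
  finally show ?thesis .
 qed
 have "(\<integral>\<^sup>+\<omega>. (\<Sum>m. (\<Prod>j<m. indicator (space N - E) (\<omega> j)) * X (\<omega> m)) \<partial>?\<Omega>)
   = (\<Sum>m. \<integral>\<^sup>+\<omega>. (\<Prod>j<m. indicator (space N - E) (\<omega> j)) * X (\<omega> m) \<partial>?\<Omega>)"
  by (rule nn_integral_suminf) (intro borel_measurable_times_ennreal borel_measurable_prod_ennreal comp ind X)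
 also have "\<dots> = (\<Sum>m. ennreal (r ^ m)) * (\<integral>\<^sup>+w. X w \<partial>N)" unfolding each by simp
 also have "\<dots> \<le> ennreal (1 / p) * (\<integral>\<^sup>+w. X w \<partial>N)" using geo by (rule mult_right_mono) simp
 finally show ?thesis .
qed

text \<open>If the walk never leaves the added facet, no round finds a solution among the given
  constraints, so phase II is void. This covers zero objectives, which span no plane with the
  coordinate \<open>t\<close>, and zero rows, which occur when the noise vanishes.\<close>

lemma simplex_steps_zero:
 assumes d: "0 < d" and np: "\<And>U G J. added_ok c1 n d a (U, G) ==> \<not> shadow_pivot d (ext_constraints c1 n d a U G) (\<lambda>_. 1) {..<n + d}
   (segment_path (init_objective n d a U) z) {0..1} {n..<n + d} J"
 shows "simplex_steps c1 n d z a b \<omega> = 0"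
proof -
 have st: "attempt_steps c1 n d z a w = 0" for w
  using walk_ends_at_start(1) np by (cases w) (auto simp: attempt_steps_def)
 have "J = {n..<n + d}" if "attempt_ends_at c1 n d z a w J" for w J
  using that walk_ends_at_start(2) np by (cases w) (auto simp: attempt_ends_at_def)
 moreover have "n \<in> {n..<n + d}" "n \<notin> {..<n}" using d by auto
 ultimately have "\<not> attempt_optimal c1 n d z a w J" for w J unfolding attempt_optimal_def by blast
 then have "\<not> (\<exists>J. unit_solution c1 n d z a \<omega> J)" unfolding unit_solution_def by blast
 moreover have "unit_steps c1 n d z a \<omega> = 0" unfolding unit_steps_def st by simp
 ultimately show ?thesis unfolding simplex_steps_def by (simp only: if_False add_0)
qed

text \<open>The path shrinks the initial objective to 0 within the cone of the added facet, so there
  is no last parameter below 1 at which this facet is pierced.\<close>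

lemma simplex_steps_zero_objective:
 assumes d: "0 < d" and z: "\<And>k. k < d ==> z k = 0"
 shows "simplex_steps c1 n d z a b \<omega> = 0"
proof (rule simplex_steps_zero[OF d])
 fix U G J assume ok: "added_ok c1 n d a (U, G)"
 let ?c = "ext_constraints c1 n d a U G" and ?q = "segment_path (init_objective n d a U) z" and ?I = "{n..<n + d}"
 obtain l where l: "\<forall>i\<in>?I. 0 \<le> l i" "\<forall>k<d. init_objective n d a U k = (\<Sum>i\<in>?I. l i * ?c i k)"
  using ok unfolding added_ok_def in_cone_def by (auto simp: Let_def)
 have all: "in_cone d ?c ?I (?q t)" if t: "t \<in> {0..1}" for t
  unfolding in_cone_def
 proof (intro exI[of _ "\<lambda>i. (1 - t) * l i"] conjI ballI allI impI)
  show "0 \<le> (1 - t) * l i" if "i \<in> ?I" for i using l(1) that t by simp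
  show "?q t k = (\<Sum>i\<in>?I. (1 - t) * l i * ?c i k)" if "k < d" for k
   using l(2) that z[OF that] by (simp add: segment_path_def sum_distrib_left mult.assoc)
 qed
 then show "\<not> shadow_pivot d ?c (\<lambda>_. 1) {..<n + d} ?q {0..1} ?I J" unfolding shadow_pivot_def by blast
qed

text \<open>Zero rows never belong to an independent set, so the added facet is the only possible
  basis.\<close>

lemma simplex_steps_zero_rows:
 assumes d: "0 < d" and a: "\<And>i k. i < n ==> k < d ==> a i k = 0"
 shows "simplex_steps c1 n d z a b \<omega> = 0"
proof (rule simplex_steps_zero[OF d])
 fix U G J
 let ?c = "ext_constraints c1 n d a U G"
 have "J = {n..<n + d}" if f: "feasible_basis d ?c (\<lambda>_. 1) {..<n + d} J"
 proof -
  have J: "J \<subseteq> {..<n + d}" "finite J" "card J = d" "lin_indep d ?c J" using f unfolding feasible_basis_def by auto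
  have "\<not> i < n" if i: "i \<in> J" for i
  proof
   assume n: "i < n"
   have "(\<Sum>j\<in>J. (if j = i then 1 else 0) * ?c j k) = 0" if "k < d" for k
    using J(2) i n a that by (intro sum.neutral) (auto simp: ext_constraints_def)
   moreover have "(\<forall>k<d. (\<Sum>j\<in>J. (if j = i then 1 else 0) * ?c j k) = 0) \<longrightarrow> (\<forall>j\<in>J. (if j = i then 1 else 0) = (0::real))"
    using J(4) unfolding lin_indep_def by (rule spec)
   ultimately have "(if i = i then 1 else 0) = (0::real)" using i by blast
   then show False by simp
  qed
  then have "J \<subseteq> {n..<n + d}" using J(1) by (auto simp: not_less)
  then show ?thesis using J(3) by (intro card_subset_eq) auto
 qed
 then show "\<not> shadow_pivot d ?c (\<lambda>_. 1) {..<n + d} (segment_path (init_objective n d a U) z) {0..1} {n..<n + d} J"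
  unfolding shadow_pivot_def by blast
qed

section \<open>Combining the rounds of phase I with phase II\<close>

context solver
begin

abbreviation "\<Omega> \<equiv> \<Pi>\<^sub>M m\<in>(UNIV :: nat set). HD"
abbreviation "Ni g \<equiv> nshadow (Suc d) v1 v2 n (H.cf g) :: ennreal"

text \<open>A round is made only if all earlier ones failed and hence missed \<open>E\<close>; this
  replaces failure by a larger measurable event. The bound on phase II holds for every starting
  basis, so the dependence of the basis found in phase I on the program causes no
  difficulty.\<close>

lemma expected_steps_fixed_program:
 assumes p: "0 < p"
  and E: "\<And>a. (\<And>I v. I \<subseteq> {..<n} ==> card I = d - 1 ==> \<not> (\<forall>l<d. z l = comb a I v l)) ==>
    \<exists>E\<in>sets HD. (\<forall>w\<in>E. attempt_correct c1 n d z a w) \<and> ennreal p \<le> emeasure HD E"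
 shows "AE g in GP. (\<integral>\<^sup>+\<omega>. simplex_steps c1 n d z (A g) (B g) \<omega> \<partial>\<Omega>) \<le> ennreal (1 / p) * (\<integral>\<^sup>+w. Nf g w \<partial>HD) + (Ni g + 2)"
 using AE_genz AE_attempt_steps_le AE_int_steps_le AE_space
proof eventually_elim
 case (elim g)
 have gz: "\<not> (\<forall>l<d. z l = comb (A g) I v l)" if "I \<subseteq> {..<n}" "card I = d - 1" for I v
  using elim(1) that unfolding interp.genz_def[OF interp_ax] by blast
 obtain E where Em: "E \<in> sets HD" and Ec: "\<And>w. w \<in> E ==> attempt_correct c1 n d z (A g) w" and Ep: "ennreal p \<le> emeasure HD E"
  using E[OF gz] by blast
 have Nm: "Nf g \<in> borel_measurable HD"
  using measurable_compose[OF measurable_Pair1'[OF elim(4)] measurable_Nf] by simp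
 let ?S = "\<lambda>\<omega>. \<Sum>m. (\<Prod>j<m. indicator (space HD - E) (\<omega> j)) * Nf g (\<omega> m)"
 have pHD: "prob_space HD" by (rule prHG.prob_space_axioms)
 interpret O: prob_space \<Omega> by (rule prob_space_PiM) (rule pHD)
 have "AE \<omega> in \<Omega>. \<forall>m. attempt_steps c1 n d z (A g) (\<omega> m) \<le> Nf g (\<omega> m)"
  unfolding AE_all_countable by (intro allI AE_PiM_component pHD UNIV_I elim(2))
 then have "AE \<omega> in \<Omega>. simplex_steps c1 n d z (A g) (B g) \<omega> \<le> ?S \<omega> + (Ni g + 2)"
  using AE_space
 proof eventually_elim
  case (elim \<omega>)
  have sp: "\<omega> j \<in> space HD" for j using elim(2) by (auto simp: space_PiM)
  have "unit_steps c1 n d z (A g) \<omega> \<le> ?S \<omega>"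
   unfolding unit_steps_def
  proof (rule suminf_le[OF _ summableI summableI])
   fix m
   show "(if \<forall>j<m. \<not> attempt_correct c1 n d z (A g) (\<omega> j) then attempt_steps c1 n d z (A g) (\<omega> m) else 0)
     \<le> (\<Prod>j<m. indicator (space HD - E) (\<omega> j)) * Nf g (\<omega> m)"
   proof (cases "\<forall>j<m. \<not> attempt_correct c1 n d z (A g) (\<omega> j)")
    case True
    then have "\<omega> j \<in> space HD - E" if "j < m" for j using Ec[of "\<omega> j"] sp[of j] that by blast
    then have "(\<Prod>j<m. indicator (space HD - E) (\<omega> j)) = (\<Prod>j<m. 1 :: ennreal)" by (intro prod.cong refl) simp
    then show ?thesis using elim(1) by simp
   qed auto
  qed
  moreover have "(if \<exists>J. unit_solution c1 n d z (A g) \<omega> J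
    then int_steps n d z (A g) (B g) (THE J. unit_solution c1 n d z (A g) \<omega> J) else 0) \<le> Ni g + 2"
   using \<open>\<forall>J. int_steps n d z (A g) (B g) J \<le> Ni g + 2\<close> by simp
  ultimately show ?case unfolding simplex_steps_def by (rule add_mono)
 qed
 then have "(\<integral>\<^sup>+\<omega>. simplex_steps c1 n d z (A g) (B g) \<omega> \<partial>\<Omega>) \<le> (\<integral>\<^sup>+\<omega>. ?S \<omega> + (Ni g + 2) \<partial>\<Omega>)" by (rule nn_integral_mono_AE)
 also have "\<dots> = (\<integral>\<^sup>+\<omega>. ?S \<omega> \<partial>\<Omega>) + (\<integral>\<^sup>+\<omega>. Ni g + 2 \<partial>\<Omega>)"
 proof (rule nn_integral_add)
  have comp: "(\<lambda>\<omega>. h (\<omega> m)) \<in> borel_measurable \<Omega>" if "h \<in> borel_measurable HD" for h :: "_ => ennreal" and m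
   by (rule measurable_compose[OF measurable_component_singleton[of m UNIV "\<lambda>_. HD"] that]) simp
  have "(indicator (space HD - E) :: _ => ennreal) \<in> borel_measurable HD" by (intro borel_measurable_indicator sets.compl_sets Em)
  then show "?S \<in> borel_measurable \<Omega>"
   using Nm by (intro borel_measurable_suminf_order borel_measurable_times_ennreal borel_measurable_prod_ennreal comp) auto
 qed simp
 also have "(\<integral>\<^sup>+\<omega>. ?S \<omega> \<partial>\<Omega>) \<le> ennreal (1 / p) * (\<integral>\<^sup>+w. Nf g w \<partial>HD)"
  by (rule nn_integral_until_success[OF pHD Em p Ep Nm])
 also have "(\<integral>\<^sup>+\<omega>. Ni g + 2 \<partial>\<Omega>) = Ni g + 2" by (simp add: O.emeasure_space_1)
 finally show ?case by (simp add: add_right_mono)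
qed

lemma expected_steps_le:
 assumes p: "0 < p"
  and E: "\<And>a. (\<And>I v. I \<subseteq> {..<n} ==> card I = d - 1 ==> \<not> (\<forall>l<d. z l = comb a I v l)) ==>
    \<exists>E\<in>sets HD. (\<forall>w\<in>E. attempt_correct c1 n d z a w) \<and> ennreal p \<le> emeasure HD E"
 shows "expected_pivot_steps c1 \<H> n d \<sigma> z a0 b0
  \<le> ennreal (1 / p * (18000000 * real d ^ 3 * KA\<^sup>2 + 1) + (6000000 * real (Suc d) ^ 3 * ((2 / \<sigma> + LL)\<^sup>2)\<^sup>2 + 3))"
proof -
 have pHD: "prob_space HD" by (rule prHG.prob_space_axioms)
 have pO: "prob_space \<Omega>" by (rule prob_space_PiM) (rule pHD)
 have "expected_pivot_steps c1 \<H> n d \<sigma> z a0 b0 = (\<integral>\<^sup>+x. (case x of (g, \<omega>) => simplex_steps c1 n d z (A g) (B g) \<omega>) \<partial>(GP \<Otimes>\<^sub>M \<Omega>))"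
  unfolding expected_pivot_steps_def std_gauss_def R_def[symmetric] Let_def ..
 also have "\<dots> \<le> (\<integral>\<^sup>+g. \<integral>\<^sup>+\<omega>. (case (g, \<omega>) of (g, \<omega>) => simplex_steps c1 n d z (A g) (B g) \<omega>) \<partial>\<Omega> \<partial>GP)"
  by (rule nn_integral_pair_le) (rule prob_space_imp_sigma_finite[OF pO])
 also have "\<dots> = (\<integral>\<^sup>+g. \<integral>\<^sup>+\<omega>. simplex_steps c1 n d z (A g) (B g) \<omega> \<partial>\<Omega> \<partial>GP)" by simp
 also have "\<dots> \<le> (\<integral>\<^sup>+g. ennreal (1 / p) * (\<integral>\<^sup>+w. Nf g w \<partial>HD) + (Ni g + 2) \<partial>GP)"
  by (rule nn_integral_mono_AE) (rule expected_steps_fixed_program[OF p E])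
 also have "\<dots> = ennreal (1 / p) * (\<integral>\<^sup>+g. \<integral>\<^sup>+w. Nf g w \<partial>HD \<partial>GP) + ((\<integral>\<^sup>+g. Ni g \<partial>GP) + 2)"
 proof -
  have m1: "(\<lambda>g. \<integral>\<^sup>+w. Nf g w \<partial>HD) \<in> borel_measurable GP"
   by (rule prHG.borel_measurable_nn_integral) (use measurable_Nf in \<open>simp add: case_prod_beta'\<close>)
  have m2: "Ni \<in> borel_measurable GP" by (rule H.measurable_shadow)
  have "(\<integral>\<^sup>+g. ennreal (1 / p) * (\<integral>\<^sup>+w. Nf g w \<partial>HD) + (Ni g + 2) \<partial>GP)
    = (\<integral>\<^sup>+g. ennreal (1 / p) * (\<integral>\<^sup>+w. Nf g w \<partial>HD) \<partial>GP) + (\<integral>\<^sup>+g. Ni g + 2 \<partial>GP)"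
   by (rule nn_integral_add) (use m1 m2 in auto)
  also have "(\<integral>\<^sup>+g. ennreal (1 / p) * (\<integral>\<^sup>+w. Nf g w \<partial>HD) \<partial>GP) = ennreal (1 / p) * (\<integral>\<^sup>+g. \<integral>\<^sup>+w. Nf g w \<partial>HD \<partial>GP)"
   by (rule nn_integral_cmult[OF m1])
  also have "(\<integral>\<^sup>+g. Ni g + 2 \<partial>GP) = (\<integral>\<^sup>+g. Ni g \<partial>GP) + (\<integral>\<^sup>+g. 2 \<partial>GP)"
   by (rule nn_integral_add) (use m2 in auto)
  also have "(\<integral>\<^sup>+g. 2 \<partial>GP) = (2 :: ennreal)" by (simp add: prP.emeasure_space_1)
  finally show ?thesis .
 qed
 also have "\<dots> \<le> ennreal (1 / p) * ennreal (18000000 * real d ^ 3 * KA\<^sup>2 + 1)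
   + (ennreal (6000000 * real (Suc d) ^ 3 * ((2 / \<sigma> + LL)\<^sup>2)\<^sup>2 + 1) + ennreal 2)"
  by (intro add_mono mult_left_mono integral_Nf_le expected_interp_shadow) auto
 also have "\<dots> = ennreal (1 / p * (18000000 * real d ^ 3 * KA\<^sup>2 + 1) + (6000000 * real (Suc d) ^ 3 * ((2 / \<sigma> + LL)\<^sup>2)\<^sup>2 + 3))"
 proof -
  have "ennreal (1 / p) * ennreal (18000000 * real d ^ 3 * KA\<^sup>2 + 1) = ennreal (1 / p * (18000000 * real d ^ 3 * KA\<^sup>2 + 1))"
   using p by (intro ennreal_mult[symmetric]) auto
  moreover have "ennreal (6000000 * real (Suc d) ^ 3 * ((2 / \<sigma> + LL)\<^sup>2)\<^sup>2 + 1) + ennreal 2 = ennreal (6000000 * real (Suc d) ^ 3 * ((2 / \<sigma> + LL)\<^sup>2)\<^sup>2 + 3)"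
   by (subst ennreal_plus[symmetric]) (auto simp del: of_nat_Suc)
  ultimately show ?thesis using p by (simp only:) (rule ennreal_plus[symmetric], auto simp del: of_nat_Suc)
 qed
 finally show ?thesis .
qed

text \<open>The square of a sum is at most twice the sum of the squares, whence 578 = 2 * 289 and
  20808 = 36 * 578. The summands 324, contained in 21132, and \<open>9 / c1\<^sup>2\<close> come
  from the two cases of the minimum in \<open>sdev1\<close>.\<close>

lemma KA_le: "KA \<le> 578 * (1 / \<sigma>)\<^sup>2 + (21132 + 9 / c1\<^sup>2) * (real d ^ 3 * ln (real n) ^ 2)"
proof -
 define S L D where "S = 1 / \<sigma>" and "L = ln (real n)" and "D = real d"
 have L1: "1 \<le> L" unfolding L_def by (rule ln_n_ge)
 have D1: "1 \<le> D" unfolding D_def using d3 by simp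
 have DL: "D * L \<le> D ^ 3 * L\<^sup>2" using L1 D1 by (intro mult_mono self_le_power) auto
 have sq: "(sqrt (D * L))\<^sup>2 = D * L" using L1 D1 by simp
 have "(17 * (x + 6 * y))\<^sup>2 \<le> 578 * x\<^sup>2 + 20808 * y\<^sup>2" for x y :: real
 proof -
  have "0 \<le> 289 * (x - 6 * y)\<^sup>2" by simp
  then show ?thesis by (simp add: power2_eq_square algebra_simps)
 qed
 then have "(17 * (S + 6 * sqrt (D * L)))\<^sup>2 \<le> 578 * S\<^sup>2 + 20808 * (sqrt (D * L))\<^sup>2" .
 also have "\<dots> \<le> 578 * S\<^sup>2 + 20808 * (D ^ 3 * L\<^sup>2)" using DL unfolding sq by simp
 finally have 1: "(17 * (S + 6 * sqrt (D * L)))\<^sup>2 \<le> 578 * S\<^sup>2 + 20808 * (D ^ 3 * L\<^sup>2)" .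
 have lnd: "0 < ln D" "ln D \<le> L" unfolding D_def L_def using d3 dn by auto
 have p32: "(D powr (3/2))\<^sup>2 = D ^ 3"
 proof -
  have "(D powr (3/2))\<^sup>2 = D powr (3/2 + 3/2)" unfolding power2_eq_square by (rule powr_add[symmetric])
  also have "\<dots> = D powr (real 3)" by simp
  also have "\<dots> = D ^ 3" by (rule powr_realpow) (use D1 in simp)
  finally show ?thesis .
 qed
 have "9 / (sdev1 c1 n d)\<^sup>2 \<le> (324 + 9 / c1\<^sup>2) * (D ^ 3 * L\<^sup>2)"
 proof (cases "1 / (6 * sqrt (D * L)) \<le> c1 / (D powr (3/2) * ln D)")
  case True
  then have "9 / (sdev1 c1 n d)\<^sup>2 = 324 * (sqrt (D * L))\<^sup>2" unfolding sdev1_def D_def L_def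
   by (simp add: power_divide power_mult_distrib)
  also have "\<dots> \<le> 324 * (D ^ 3 * L\<^sup>2)" using DL unfolding sq by simp
  also have "\<dots> \<le> (324 + 9 / c1\<^sup>2) * (D ^ 3 * L\<^sup>2)" using L1 D1 by (intro mult_right_mono) auto
  finally show ?thesis .
 next
  case False
  then have "9 / (sdev1 c1 n d)\<^sup>2 = 9 / c1\<^sup>2 * ((D powr (3/2))\<^sup>2 * (ln D)\<^sup>2)" unfolding sdev1_def D_def L_def
   by (simp add: power_divide power_mult_distrib)
  also have "\<dots> \<le> 9 / c1\<^sup>2 * (D ^ 3 * L\<^sup>2)" unfolding p32 using lnd D1 by (intro mult_left_mono power_mono) auto
  also have "\<dots> \<le> (324 + 9 / c1\<^sup>2) * (D ^ 3 * L\<^sup>2)" using L1 D1 by (intro mult_right_mono) auto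
  finally show ?thesis .
 qed
 then show ?thesis unfolding KA_def using 1 unfolding S_def L_def D_def by (simp add: distrib_right)
qed

text \<open>With \<open>S = 1 / \<sigma>\<close> the order of \<open>KA\<close> is S^2 + D^3 L^2, so
  D^3 times its square has order D^3 S^4 + D^9 L^4. Phase II leads to D^3 S^4 + D^5 L^2, and powers
  of \<open>D\<close> and \<open>L\<close> may be raised because both are at least 1.\<close>

lemma final_arith:
 assumes p: "0 < p"
 shows "1 / p * (18000000 * real d ^ 3 * KA\<^sup>2 + 1) + (6000000 * real (Suc d) ^ 3 * ((2 / \<sigma> + LL)\<^sup>2)\<^sup>2 + 3)
  \<le> ((18000000 * (668168 + 2 * (21132 + 9 / c1\<^sup>2)\<^sup>2) + 1) / p + 500000000000) * ln (real n) ^ 7 * (real d ^ 9 + real d ^ 3 * (1 / \<sigma>) ^ 4)"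
proof -
 define S L D k where "S = 1 / \<sigma>" and "L = ln (real n)" and "D = real d" and "k = 21132 + 9 / c1\<^sup>2"
 define T where "T = L ^ 7 * (D ^ 9 + D ^ 3 * S ^ 4)"
 have L1: "1 \<le> L" unfolding L_def by (rule ln_n_ge)
 have D1: "1 \<le> D" unfolding D_def using d3 by simp
 have S0: "0 < S" unfolding S_def using \<sigma> by simp
 have k0: "0 \<le> k" unfolding k_def by simp
 have L7: "1 \<le> L ^ 7" using L1 by simp
 have T1: "L ^ 7 * D ^ 9 \<le> T" "L ^ 7 * (D ^ 3 * S ^ 4) \<le> T" unfolding T_def using L1 D1 S0 by (auto simp: distrib_left)
 have "1 * (D ^ 3 * S ^ 4) \<le> L ^ 7 * (D ^ 3 * S ^ 4)" by (rule mult_right_mono[OF L7]) (use D1 in simp)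
 then have TS: "D ^ 3 * S ^ 4 \<le> T" using T1(2) by linarith
 have T0: "1 \<le> T" using mult_mono[OF L7 one_le_power[OF D1, of 9]] T1(1) L7 L1 by simp
 have D9: "D ^ i * L ^ j \<le> T" if "i \<le> 9" "j \<le> 7" for i j
 proof -
  have "D ^ i * L ^ j \<le> D ^ 9 * L ^ 7" using that L1 D1 by (intro mult_mono power_increasing) auto
  then show ?thesis using T1(1) by (simp add: mult.commute)
 qed
 have sq2: "(x + y)\<^sup>2 \<le> 2 * x\<^sup>2 + 2 * y\<^sup>2" for x y :: real
 proof -
  have "0 \<le> (x - y)\<^sup>2" by simp
  then show ?thesis by (simp add: power2_eq_square algebra_simps)
 qed
 have KA0: "0 \<le> KA" unfolding KA_def by simp
 have "KA\<^sup>2 \<le> (578 * S\<^sup>2 + k * (D ^ 3 * L\<^sup>2))\<^sup>2" using KA_le KA0 unfolding S_def L_def D_def k_def by (intro power_mono) auto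
 also have "\<dots> \<le> 2 * (578 * S\<^sup>2)\<^sup>2 + 2 * (k * (D ^ 3 * L\<^sup>2))\<^sup>2" by (rule sq2)
 also have "\<dots> = 668168 * S ^ 4 + 2 * k\<^sup>2 * (D ^ 6 * L ^ 4)" by (simp add: power_mult_distrib power_mult[symmetric])
 finally have "D ^ 3 * KA\<^sup>2 \<le> D ^ 3 * (668168 * S ^ 4 + 2 * k\<^sup>2 * (D ^ 6 * L ^ 4))" using D1 by (intro mult_left_mono) auto
 also have "\<dots> = 668168 * (D ^ 3 * S ^ 4) + 2 * k\<^sup>2 * (D ^ 9 * L ^ 4)" by (simp add: algebra_simps power_add[symmetric])
 also have "\<dots> \<le> 668168 * T + 2 * k\<^sup>2 * T" using TS D9[of 9 4] by (intro add_mono mult_left_mono) auto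
 finally have A: "18000000 * (D ^ 3 * KA\<^sup>2) + 1 \<le> (18000000 * (668168 + 2 * k\<^sup>2) + 1) * T" using T0 by (simp add: algebra_simps)
 have LL2: "LL\<^sup>2 \<le> 32 * (D * L)"
 proof -
  have "real (Suc d) \<le> 2 * D" unfolding D_def using d3 by simp
  then have "16 * real (Suc d) * L \<le> 16 * (2 * D) * L" using L1 by (intro mult_right_mono mult_left_mono) auto
  then show ?thesis unfolding LL_sq L_def by simp
 qed
 have "((2 / \<sigma> + LL)\<^sup>2)\<^sup>2 \<le> (8 * S\<^sup>2 + 64 * (D * L))\<^sup>2"
 proof (rule power_mono)
  have "(2 * S + LL)\<^sup>2 \<le> 2 * (2 * S)\<^sup>2 + 2 * LL\<^sup>2" by (rule sq2)
  also have "\<dots> \<le> 8 * S\<^sup>2 + 64 * (D * L)" using LL2 by (simp add: power_mult_distrib)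
  finally show "(2 / \<sigma> + LL)\<^sup>2 \<le> 8 * S\<^sup>2 + 64 * (D * L)" unfolding S_def by simp
 qed simp
 also have "\<dots> \<le> 2 * (8 * S\<^sup>2)\<^sup>2 + 2 * (64 * (D * L))\<^sup>2" by (rule sq2)
 also have "\<dots> = 128 * S ^ 4 + 8192 * (D\<^sup>2 * L\<^sup>2)" by (simp add: power_mult_distrib power_mult[symmetric])
 finally have i1: "((2 / \<sigma> + LL)\<^sup>2)\<^sup>2 \<le> 128 * S ^ 4 + 8192 * (D\<^sup>2 * L\<^sup>2)" .
 have "real (Suc d) ^ 3 * ((2 / \<sigma> + LL)\<^sup>2)\<^sup>2 \<le> (2 * D) ^ 3 * (128 * S ^ 4 + 8192 * (D\<^sup>2 * L\<^sup>2))"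
  by (rule mult_mono[OF power_mono i1]) (use d3 in \<open>auto simp: D_def\<close>)
 also have "\<dots> = 1024 * (D ^ 3 * S ^ 4) + 65536 * (D ^ 5 * L\<^sup>2)" by (simp add: power_mult_distrib algebra_simps power_add[symmetric])
 also have "\<dots> \<le> 1024 * T + 65536 * T" using TS D9[of 5 2] by (intro add_mono mult_left_mono) auto
 finally have B: "6000000 * (real (Suc d) ^ 3 * ((2 / \<sigma> + LL)\<^sup>2)\<^sup>2) + 3 \<le> 500000000000 * T" using T0 by linarith
 have "1 / p * (18000000 * (D ^ 3 * KA\<^sup>2) + 1) \<le> 1 / p * ((18000000 * (668168 + 2 * k\<^sup>2) + 1) * T)"
  using A p by (intro mult_left_mono) auto
 then have "1 / p * (18000000 * (D ^ 3 * KA\<^sup>2) + 1) + (6000000 * (real (Suc d) ^ 3 * ((2 / \<sigma> + LL)\<^sup>2)\<^sup>2) + 3)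
   \<le> 1 / p * ((18000000 * (668168 + 2 * k\<^sup>2) + 1) * T) + 500000000000 * T" using B by (rule add_mono)
 also have "\<dots> = ((18000000 * (668168 + 2 * k\<^sup>2) + 1) / p + 500000000000) * T" by (simp add: distrib_right)
 finally show ?thesis unfolding T_def D_def L_def S_def k_def by (simp only: mult.assoc)
qed

end

theorem theorem1p2:
  shows "\<exists>c\<^sub>1 > 0. \<exists>C > 0.
    \<forall>(n::nat) (d::nat) (\<sigma>::real) (z :: nat \<Rightarrow> real) (a\<^sub>0 :: nat \<Rightarrow> nat \<Rightarrow> real) (b\<^sub>0 :: nat \<Rightarrow> real) H.
      3 < d \<longrightarrow> d < n \<longrightarrow> 0 < \<sigma> \<longrightarrow> haar_orthogonal d H \<longrightarrow>
      expected_pivot_steps c\<^sub>1 H n d \<sigma> z a\<^sub>0 b\<^sub>0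
        \<le> ennreal (C * ln (real n) ^ 7 * (real d ^ 9 + real d ^ 3 * (1 / \<sigma>) ^ 4))"
proof -
  obtain c\<^sub>1 p :: real where c1: "0 < c\<^sub>1" "c\<^sub>1 \<le> 1" and p: "0 < p"
    and cor: "\<And>n d H z a. 3 < d \<Longrightarrow> d < n \<Longrightarrow> haar_orthogonal d H \<Longrightarrow>
       (\<And>I v. I \<subseteq> {..<n} \<Longrightarrow> card I = d - 1 \<Longrightarrow> \<not> (\<forall>l<d. z l = comb a I v l)) \<Longrightarrow>
       \<exists>E\<in>sets (H \<Otimes>\<^sub>M gauss ({..<d} \<times> {..<d})). (\<forall>w\<in>E. attempt_correct c\<^sub>1 n d z a w) \<and>
         ennreal p \<le> emeasure (H \<Otimes>\<^sub>M gauss ({..<d} \<times> {..<d})) E"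
    by (rule correct_attempt_probability) blast
  define C where "C = (18000000 * (668168 + 2 * (21132 + 9 / c\<^sub>1\<^sup>2)\<^sup>2) + 1) / p + 500000000000"
  have C0: "0 < C" unfolding C_def using p by (intro add_nonneg_pos divide_nonneg_pos) auto
  have main: "expected_pivot_steps c\<^sub>1 H n d \<sigma> z a\<^sub>0 b\<^sub>0 \<le> ennreal (C * ln (real n) ^ 7 * (real d ^ 9 + real d ^ 3 * (1 / \<sigma>) ^ 4))"
    if d: "3 < d" and dn: "d < n" and \<sigma>: "0 < \<sigma>" and H: "haar_orthogonal d H"
    for n d :: nat and \<sigma> :: real and z :: "nat \<Rightarrow> real" and a\<^sub>0 :: "nat \<Rightarrow> nat \<Rightarrow> real" and b\<^sub>0 :: "nat \<Rightarrow> real" and H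
  proof -
    define R where "R = max_row_norm n d a\<^sub>0 b\<^sub>0"
    have rn: "sqrt ((enorm d (a\<^sub>0 i))\<^sup>2 + (b\<^sub>0 i)\<^sup>2) \<le> R" if "i < n" for i unfolding R_def by (rule max_row_norm_ge[OF that])
    have zero: "expected_pivot_steps c\<^sub>1 H n d \<sigma> z a\<^sub>0 b\<^sub>0 \<le> X"
      if "\<And>g \<omega>. simplex_steps c\<^sub>1 n d z (smoothed_a (\<sigma> * R) a\<^sub>0 g) (smoothed_b d (\<sigma> * R) b\<^sub>0 g) \<omega> = 0" for X
      unfolding expected_pivot_steps_def R_def[symmetric] Let_def that by (simp add: split_def)
    \<comment> \<open>The general argument asks for a nonzero objective and, as the deviation is
      \<open>\<sigma> * R\<close>, for a nonzero row among the centers.\<close>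
    consider "\<forall>k<d. z k = 0" | "R \<le> 0" | k where "k < d" "z k \<noteq> 0" "0 < R" by force
    then show ?thesis
    proof cases
      case 1
      show ?thesis by (rule zero, rule simplex_steps_zero_objective) (use d 1 in auto)
    next
      case 2
      have "0 \<le> sqrt ((enorm d (a\<^sub>0 0))\<^sup>2 + (b\<^sub>0 0)\<^sup>2)" by simp
      then have R0: "R = 0" using rn[of 0] dn 2 by linarith
      have "a\<^sub>0 i l = 0" if "i < n" "l < d" for i l
      proof -
        have "sqrt ((enorm d (a\<^sub>0 i))\<^sup>2 + (b\<^sub>0 i)\<^sup>2) \<le> 0" using rn[OF that(1)] R0 by simp
        then have "(enorm d (a\<^sub>0 i))\<^sup>2 + (b\<^sub>0 i)\<^sup>2 \<le> 0" by simp
        then have "enorm d (a\<^sub>0 i) = 0" by (simp add: sum_power2_le_zero_iff)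
        then show ?thesis using enorm_eq_0 that(2) by blast
      qed
      then show ?thesis by (intro zero simplex_steps_zero_rows) (use d R0 in \<open>auto simp: smoothed_a_def\<close>)
    next
      case 3
      interpret solver n d \<sigma> z a\<^sub>0 b\<^sub>0 R k c\<^sub>1 H by standard (use d dn \<sigma> 3 H c1 R_def in auto)
      have "expected_pivot_steps c\<^sub>1 H n d \<sigma> z a\<^sub>0 b\<^sub>0
          \<le> ennreal (1 / p * (18000000 * real d ^ 3 * KA\<^sup>2 + 1) + (6000000 * real (Suc d) ^ 3 * ((2 / \<sigma> + LL)\<^sup>2)\<^sup>2 + 3))"
        by (rule expected_steps_le[OF p]) (rule cor[OF d dn H])
      also have "\<dots> \<le> ennreal (C * ln (real n) ^ 7 * (real d ^ 9 + real d ^ 3 * (1 / \<sigma>) ^ 4))"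
        unfolding C_def by (rule ennreal_leI) (rule final_arith[OF p])
      finally show ?thesis .
    qed
  qed
  show ?thesis
    by (intro exI[of _ c\<^sub>1] conjI c1 exI[of _ C] C0 allI impI main)
qed

end
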